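(* There is a $\tfrac32$-approximation algorithm for the preemptive variant running in time $\mathcal{O}(n\log n)$; i.e. for every instance it computes a feasible preemptive schedule with makespan at most $\tfrac32\,\mathrm{OPT}_{\mathrm{pmtn}}$ in that time.
   Context: An instance consists of $m\in\mathbb{N}$ identical parallel machines, a set $J$ of $n$ jobs, a partition $J=C_1\,\dot\cup\,\dots\,\dot\cup\, C_c$ into $c$ nonempty classes, processing times $t_j\in\mathbb{N}$ and setup times $s_i\in\mathbb{N}$ ($i\in[c]$). On each machine at most one item is processed at a time; a setup of class $i$ of length $s_i$ must be processed whenever the machine starts processing load of class $i$ and whenever it switches from another class to class $i$; setups are not preempted. In the preemptive variant jobs may be preempted and split into pieces processed on arbitrary machines, but no two pieces of the same job may be processed at overlapping times. $\mathrm{OPT}_{\mathrm{pmtn}}$ is the minimum makespan. *)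

theory Defs
  imports Complex_Main "HOL-Library.Landau_Symbols"
begin

section \<open>Scheduling with batch setup times, preemptive variant\<close>

text \<open>
  The \<open>n\<close> jobs are \<open>0, ..., n - 1\<close> and the \<open>c\<close> classes are \<open>0, ..., c - 1\<close>; the partition
  of the jobs is the map \<open>job_class\<close> from jobs to classes.
\<close>

record batch_instance =
  num_machines :: nat
  setup_times :: "nat list"
  job_times :: "nat list"
  job_class :: "nat list"

definition num_jobs :: "batch_instance \<Rightarrow> nat" where
  "num_jobs I = length (job_times I)"

definition num_classes :: "batch_instance \<Rightarrow> nat" where
  "num_classes I = length (setup_times I)"

text \<open>All numbers are positive integers; the last conjunct says that every class is nonempty.\<close>

definition valid_instance :: "batch_instance \<Rightarrow> bool" where
  "valid_instance I \<longleftrightarrow>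
     num_machines I > 0 \<and>
     (\<forall>i < num_classes I. setup_times I ! i > 0) \<and>
     (\<forall>j < num_jobs I. job_times I ! j > 0) \<and>
     length (job_class I) = num_jobs I \<and>
     set (job_class I) = {..<num_classes I}"

datatype item = Setup nat | Piece nat  \<comment> \<open>a setup of a class, a piece of a job\<close>

record entry =
  item_of :: item
  machine_of :: nat
  start_of :: real
  finish_of :: real

type_synonym schedule = "entry list"

fun item_class :: "batch_instance \<Rightarrow> item \<Rightarrow> nat" where
  "item_class I (Setup i) = i"
| "item_class I (Piece j) = job_class I ! j"

fun well_timed :: "batch_instance \<Rightarrow> entry \<Rightarrow> bool" where
  "well_timed I e \<longleftrightarrow>
     machine_of e < num_machines I \<and> 0 \<le> start_of e \<and>
     (case item_of e of
        Setup i \<Rightarrow> i < num_classes I \<and> finish_of e = start_of e + real (setup_times I ! i)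
      | Piece j \<Rightarrow> j < num_jobs I \<and> start_of e < finish_of e)"

definition separated :: "entry \<Rightarrow> entry \<Rightarrow> bool" where
  "separated e e' \<longleftrightarrow> finish_of e \<le> start_of e' \<or> finish_of e' \<le> start_of e"

text \<open>
  The machine is set up for \<open>e\<close>: an earlier setup of the class of \<open>e\<close> is followed, until \<open>e\<close>
  starts, only by items of that class. Idle time does not invalidate a setup.
\<close>

definition set_up :: "batch_instance \<Rightarrow> schedule \<Rightarrow> entry \<Rightarrow> bool" where
  "set_up I S e \<longleftrightarrow>
     (\<exists>s \<in> set S. item_of s = Setup (item_class I (item_of e)) \<and>
        machine_of s = machine_of e \<and> finish_of s \<le> start_of e \<and>
        (\<forall>g \<in> set S. machine_of g = machine_of e \<and>
             finish_of s \<le> start_of g \<and> finish_of g \<le> start_of e \<longrightarrow>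
           item_class I (item_of g) = item_class I (item_of e)))"

definition feasible_pmtn :: "batch_instance \<Rightarrow> schedule \<Rightarrow> bool" where
  "feasible_pmtn I S \<longleftrightarrow>
     (\<forall>e \<in> set S. well_timed I e) \<and>
     (\<forall>a < length S. \<forall>b < length S.
        a \<noteq> b \<and> machine_of (S ! a) = machine_of (S ! b) \<longrightarrow> separated (S ! a) (S ! b)) \<and>
     (\<forall>a < length S. \<forall>b < length S. \<forall>j.
        a \<noteq> b \<and> item_of (S ! a) = Piece j \<and> item_of (S ! b) = Piece j \<longrightarrow>
          separated (S ! a) (S ! b)) \<and>
     (\<forall>e \<in> set S. \<forall>j. item_of e = Piece j \<longrightarrow> set_up I S e) \<and>
     (\<forall>j < num_jobs I.
        (\<Sum>e \<leftarrow> filter (\<lambda>e. item_of e = Piece j) S. finish_of e - start_of e)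
          = real (job_times I ! j))"

definition makespan :: "schedule \<Rightarrow> real" where
  "makespan S = Max (insert 0 (finish_of ` set S))"

definition OPT_pmtn :: "batch_instance \<Rightarrow> real" where
  "OPT_pmtn I = Inf (makespan ` {S. feasible_pmtn I S})"


section \<open>A word RAM with structured control flow\<close>

text \<open>
  Memory consists of integer arrays; a program accesses finitely many of them. Scalar variables
  are cells with index 0. Every operation, memory access and constant costs one time unit.
  Machine words hold the integers of absolute value at most \<open>W\<close>, and a run in which any
  intermediate value falls outside this range has no derivation in the semantics below.
\<close>

type_synonym memory = "string \<Rightarrow> int \<Rightarrow> int"

datatype aexp =
  Num int
| Read string aexp
| Add aexp aexp
| Sub aexp aexp
| Mul aexp aexp
| Quot aexp aexp

datatype bexp =
  Less aexp aexp
| Neg bexp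
| Conj bexp bexp

datatype com =
  Skip
| Write string aexp aexp  \<comment> \<open>array, index, value\<close>
| Seq com com
| Cond bexp com com
| Loop bexp com

fun aval :: "aexp \<Rightarrow> memory \<Rightarrow> int" where
  "aval (Num k) M = k"
| "aval (Read x a) M = M x (aval a M)"
| "aval (Add a b) M = aval a M + aval b M"
| "aval (Sub a b) M = aval a M - aval b M"
| "aval (Mul a b) M = aval a M * aval b M"
| "aval (Quot a b) M = aval a M div aval b M"

fun bval :: "bexp \<Rightarrow> memory \<Rightarrow> bool" where
  "bval (Less a b) M \<longleftrightarrow> aval a M < aval b M"
| "bval (Neg b) M \<longleftrightarrow> \<not> bval b M"
| "bval (Conj a b) M \<longleftrightarrow> bval a M \<and> bval b M"

fun acost :: "aexp \<Rightarrow> nat" where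
  "acost (Num k) = 1"
| "acost (Read x a) = 1 + acost a"
| "acost (Add a b) = 1 + acost a + acost b"
| "acost (Sub a b) = 1 + acost a + acost b"
| "acost (Mul a b) = 1 + acost a + acost b"
| "acost (Quot a b) = 1 + acost a + acost b"

fun bcost :: "bexp \<Rightarrow> nat" where
  "bcost (Less a b) = 1 + acost a + acost b"
| "bcost (Neg b) = 1 + bcost b"
| "bcost (Conj a b) = 1 + bcost a + bcost b"

fun asubs :: "aexp \<Rightarrow> aexp set" where
  "asubs (Num k) = {Num k}"
| "asubs (Read x a) = insert (Read x a) (asubs a)"
| "asubs (Add a b) = insert (Add a b) (asubs a \<union> asubs b)"
| "asubs (Sub a b) = insert (Sub a b) (asubs a \<union> asubs b)"
| "asubs (Mul a b) = insert (Mul a b) (asubs a \<union> asubs b)"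
| "asubs (Quot a b) = insert (Quot a b) (asubs a \<union> asubs b)"

definition afits :: "int \<Rightarrow> aexp \<Rightarrow> memory \<Rightarrow> bool" where
  "afits W a M \<longleftrightarrow> (\<forall>a' \<in> asubs a. \<bar>aval a' M\<bar> \<le> W)"

fun bfits :: "int \<Rightarrow> bexp \<Rightarrow> memory \<Rightarrow> bool" where
  "bfits W (Less a b) M \<longleftrightarrow> afits W a M \<and> afits W b M"
| "bfits W (Neg b) M \<longleftrightarrow> bfits W b M"
| "bfits W (Conj a b) M \<longleftrightarrow> bfits W a M \<and> bfits W b M"

text \<open>\<open>exec W p M t M'\<close>: on memory \<open>M\<close>, \<open>p\<close> halts after \<open>t\<close> time units with memory \<open>M'\<close>.\<close>

inductive exec :: "int \<Rightarrow> com \<Rightarrow> memory \<Rightarrow> nat \<Rightarrow> memory \<Rightarrow> bool" for W :: int where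
  exec_Skip: "exec W Skip M 1 M"
| exec_Write: "\<lbrakk>afits W a M; afits W b M\<rbrakk> \<Longrightarrow>
    exec W (Write x a b) M (1 + acost a + acost b) (M(x := (M x)(aval a M := aval b M)))"
| exec_Seq: "\<lbrakk>exec W p M t M'; exec W q M' t' M''\<rbrakk> \<Longrightarrow> exec W (Seq p q) M (t + t') M''"
| exec_CondTrue: "\<lbrakk>bfits W b M; bval b M; exec W p M t M'\<rbrakk> \<Longrightarrow>
    exec W (Cond b p q) M (1 + bcost b + t) M'"
| exec_CondFalse: "\<lbrakk>bfits W b M; \<not> bval b M; exec W q M t M'\<rbrakk> \<Longrightarrow>
    exec W (Cond b p q) M (1 + bcost b + t) M'"
| exec_LoopFalse: "\<lbrakk>bfits W b M; \<not> bval b M\<rbrakk> \<Longrightarrow>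
    exec W (Loop b p) M (1 + bcost b) M"
| exec_LoopTrue: "\<lbrakk>bfits W b M; bval b M; exec W p M t M'; exec W (Loop b p) M' t' M''\<rbrakk> \<Longrightarrow>
    exec W (Loop b p) M (1 + bcost b + t + t') M''"


section \<open>Input and output of scheduling algorithms\<close>

definition list_array :: "nat list \<Rightarrow> int \<Rightarrow> int" where
  "list_array xs k = (if 0 \<le> k \<and> k < int (length xs) then int (xs ! nat k) else 0)"

definition scalar_array :: "nat \<Rightarrow> int \<Rightarrow> int" where
  "scalar_array x = list_array [x]"

definition input_memory :: "batch_instance \<Rightarrow> memory" where
  "input_memory I = (\<lambda>_ _. 0)
     (''m'' := scalar_array (num_machines I),
      ''n'' := scalar_array (num_jobs I),
      ''c'' := scalar_array (num_classes I),
      ''setup_times'' := list_array (setup_times I),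
      ''job_times'' := list_array (job_times I),
      ''job_class'' := list_array (job_class I))"

text \<open>
  A bound on all numbers in the input. With word bound a fixed power of it, the bit length of a
  word is a constant multiple of the bit length of this number.
\<close>

definition magnitude :: "batch_instance \<Rightarrow> nat" where
  "magnitude I = 2 + num_machines I + num_jobs I + num_classes I
     + sum_list (setup_times I) + sum_list (job_times I)"

text \<open>
  Entry \<open>k\<close> of the computed schedule is found at index \<open>k\<close> of the output arrays. An item is a
  flag (0 for a setup, 1 for a piece) with the number of its class or job; times are fractions,
  not necessarily reduced and possibly with different denominators.
\<close>

definition output_item :: "memory \<Rightarrow> int \<Rightarrow> item \<Rightarrow> bool" where
  "output_item M k x \<longleftrightarrow>
     (case x of
        Setup i \<Rightarrow> M ''out_kind'' k = 0 \<and> M ''out_index'' k = int i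
      | Piece j \<Rightarrow> M ''out_kind'' k = 1 \<and> M ''out_index'' k = int j)"

definition output_time :: "memory \<Rightarrow> string \<Rightarrow> string \<Rightarrow> int \<Rightarrow> real \<Rightarrow> bool" where
  "output_time M num den k r \<longleftrightarrow>
     M den k > 0 \<and> r = real_of_int (M num k) / real_of_int (M den k)"

definition outputs :: "memory \<Rightarrow> schedule \<Rightarrow> bool" where
  "outputs M S \<longleftrightarrow>
     M ''out_length'' 0 = int (length S) \<and>
     (\<forall>k < length S.
        output_item M (int k) (item_of (S ! k)) \<and>
        M ''out_machine'' (int k) = int (machine_of (S ! k)) \<and>
        output_time M ''out_start_num'' ''out_start_den'' (int k) (start_of (S ! k)) \<and>
        output_time M ''out_finish_num'' ''out_finish_den'' (int k) (finish_of (S ! k)))"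

end

theory Submission
  imports Defs
begin

text \<open>
  The makespan \<open>T\<close> is tested by linear conditions. Call a class expensive if \<open>2 * s i > T\<close>. No
  machine hosts two expensive classes, so an expensive class needs a number of machines of its own.
  All other classes share what remains. A job with \<open>2 * (s i + t j) > T\<close> that is processed on the
  machines of expensive classes leaves at most \<open>T / 2 - s i\<close> of its load there. Counting loads gives
  three inequalities \<open>0 <= FA q T + FB q T * T\<close>, necessary for a schedule of makespan \<open>T\<close>. Conversely, if
  they hold, a schedule of makespan \<open>3 / 2 * T\<close> is obtained with two cursors that fill gaps
  in a wrap-around fashion, one in the lower halves of machines whose upper part carries an
  expensive class, one on all other machine space; the split of a job between the two cursors
  keeps its pieces disjoint in time. \<open>FA\<close> and \<open>FB\<close> are constant between consecutive elements of a set of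
  \<open>O(n)\<close> breakpoints, so sorting, binary search and solving three linear equations find a
  \<open>T\<close> that passes the test and does not exceed the optimum.

  The word length is handled separately from correctness: programs are verified in an unbounded
  semantics, and a syntactic degree check bounds every cell by a power of the magnitude
  times the running time.
\<close>

text \<open>The factor \<open>3 / 2\<close> comes from one exchange. An expensive class of load
  above \<open>3 / 4 * T\<close> that is set up once leaves less than \<open>T / 4\<close> on its
  machine. With \<open>3 / 2 * T\<close> available, the class is pushed to the top and the
  \<open>T / 2\<close> below it becomes a slot; the surplus pays for the setups that greedy filling
  repeats in every slot. The obstacle is that total volume alone is too weak a test: some load
  cannot go into the slots, and load that does go there drags setups along. The first inequality
  bounds what must lie outside the slots, the second bounds the total volume, the third counts
  outside volume twice and inside volume once, because a cheap class with \<open>T / 8 < s i\<close>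
  and a long job spends at least half of its inside volume on setups. Which of them completes the
  construction depends on whether the slots run out, and at which type of class. A rejected
  \<open>T\<close> lies below every makespan, by necessity of the test. Hence any adjacent pair of a
  rejected and an accepted breakpoint encloses a usable value, and monotonicity of the test is never
  at issue.\<close>

lemma separated_sum_le:
  assumes "finite A" "lo \<le> hi"
    and "\<And>a. a \<in> A ==> lo \<le> f a \<and> f a < g a \<and> g a \<le> (hi::real)"
    and "\<And>a b. a \<in> A ==> b \<in> A ==> a \<noteq> b ==> g a \<le> f b \<or> g b \<le> f a"
  shows "(\<Sum>a\<in>A. g a - f a) \<le> hi - lo"
  using assms
proof (induction "card A" arbitrary: A hi)
  case 0 then show ?case by auto
next
  case (Suc k)
  then have ne: "A \<noteq> {}" by auto
  obtain x where x: "x \<in> A" "\<And>y. y \<in> A ==> f y \<le> f x"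
    using Max_in[of "f ` A"] Max_ge[of "f ` A"] ne Suc.prems(1) by (metis (no_types, lifting) finite_imageI image_iff image_is_empty)
  \<comment> \<open>\<open>x\<close> starts last, so every interval separated from it must end
    before it starts.\<close>
  have *: "g y \<le> f x" if "y \<in> A - {x}" for y
    using Suc.prems(4)[of y x] Suc.prems(3)[OF x(1)] Suc.prems(3)[of y] x(2)[of y] that x(1) by force
  have "(\<Sum>a\<in>A - {x}. g a - f a) \<le> f x - lo"
  proof (rule Suc.hyps(1))
    show "k = card (A - {x})" using Suc.hyps(2) x(1) Suc.prems(1) by simp
  qed (use Suc.prems x(1) * in \<open>auto\<close>)
  moreover have "(\<Sum>a\<in>A. g a - f a) = (g x - f x) + (\<Sum>a\<in>A - {x}. g a - f a)"
    using x(1) Suc.prems(1) by (rule sum.remove[rotated])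
  ultimately show ?case using Suc.prems(3)[OF x(1)] by linarith
qed

section \<open>Loads, class types and the linear test\<close>

locale inst =
  fixes I :: batch_instance
  assumes valid: "valid_instance I"
begin

abbreviation "m \<equiv> num_machines I"
abbreviation "n \<equiv> num_jobs I"
abbreviation "c \<equiv> num_classes I"

definition s :: "nat \<Rightarrow> real" where "s i = real (setup_times I ! i)"
definition t :: "nat \<Rightarrow> real" where "t j = real (job_times I ! j)"
definition cl :: "nat \<Rightarrow> nat" where "cl j = job_class I ! j"
definition J :: "nat \<Rightarrow> nat set" where "J i = {j. j < n \<and> cl j = i}"
definition P :: "nat \<Rightarrow> real" where "P i = (\<Sum>j\<in>J i. t j)"
definition L :: "nat \<Rightarrow> real" where "L i = s i + P i"

text \<open>Long jobs are those that do not fit together with their setup into a time of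
  \<open>T / 2\<close>. Only their number and the total length \<open>sm\<close> of the other jobs
  enter the test, which makes \<open>D\<close> affine in \<open>T\<close> between
  breakpoints.\<close>

definition bg :: "real \<Rightarrow> nat \<Rightarrow> nat" where
  "bg T i = card {j \<in> J i. T < 2 * (s i + t j)}"
definition sm :: "real \<Rightarrow> nat \<Rightarrow> real" where
  "sm T i = (\<Sum>j\<in>{j \<in> J i. \<not> T < 2 * (s i + t j)}. t j)"
text \<open>The largest integer strictly below the quotient. In a schedule of makespan
  \<open>T\<close> an expensive class of load above \<open>T\<close> needs more than
  \<open>al\<close> machines, while \<open>al\<close> machines suffice for makespan
  \<open>3 / 2 * T\<close>: the remainder is put on top of a full machine.\<close>

definition al :: "real \<Rightarrow> nat \<Rightarrow> int" where
  "al T i = \<lceil>P i / (T - s i)\<rceil> - 1"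

text \<open>Types 0 to 2 are the expensive classes by load, 3 to 6 the cheap ones. The space beside
  an expensive class of load above \<open>3 / 4 * T\<close> is shorter than \<open>T / 4\<close>: a
  setup above \<open>T / 4\<close> cannot go there, and one above \<open>T / 8\<close> fills more
  than half of it. The numbering is the order of processing: type 0 takes the first machines and
  type 1 the next, so that the slots form a contiguous range, and types 3 and 4 reach the slots
  before type 5.\<close>

definition ty :: "real \<Rightarrow> nat \<Rightarrow> nat" where
  "ty T i = (if T < 2 * s i then (if T < L i then 0 else if 3 * T < 4 * L i then 1 else 2)
     else if T < 4 * s i then 6 else if bg T i = 0 then 3 else if T < 8 * s i then 5 else 4)"

definition mc :: "real \<Rightarrow> nat \<Rightarrow> int" where
  "mc T i = (if ty T i = 0 then al T i else if ty T i \<le> 2 then 1 else 0)"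

text \<open>\<open>fa q T i + fb q T i * T\<close> is twice the contribution of class
  \<open>i\<close> to inequality \<open>q\<close>; the doubling clears the \<open>T / 2\<close> in
  \<open>D\<close>. The three list entries belong to the volume outside the slots, to the total
  volume, and to outside volume twice plus inside volume once.\<close>

definition fa :: "nat \<Rightarrow> real \<Rightarrow> nat \<Rightarrow> real" where
  "fa q T i = (let l = 2 * L i; d = 2 * (sm T i - real (bg T i) * s i) in
     (if ty T i = 0 then [0, 0, 0] else if ty T i = 1 then [0, - l, - l]
      else if ty T i = 2 then [- l, - l, - 2 * l] else if ty T i = 3 then [0, - l, - l]
      else if ty T i = 4 then [d - l, - l, d - 2 * l] else if ty T i = 5 then [d - l, - l, - 2 * l]
      else [- l, - l, - 2 * l]) ! q)"

definition fb :: "nat \<Rightarrow> real \<Rightarrow> nat \<Rightarrow> real" where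
  "fb q T i = (let k = real (bg T i); a = real_of_int (al T i) in
     (if ty T i = 0 then [- 2 * a, - 2 * a, - 4 * a] else if ty T i = 1 then [- 2, 0, - 2]
      else if ty T i = 4 then [k, 0, k] else if ty T i = 5 then [k, 0, 0] else [0, 0, 0]) ! q)"

definition FA :: "nat \<Rightarrow> real \<Rightarrow> real" where "FA q T = (\<Sum>i<c. fa q T i)"
definition FB :: "nat \<Rightarrow> real \<Rightarrow> real" where
  "FB q T = (if q = 2 then 4 else 2) * real m + (\<Sum>i<c. fb q T i)"

definition ok0 :: "real \<Rightarrow> bool" where
  "ok0 T \<longleftrightarrow> (\<forall>j<n. s (cl j) + t j \<le> T) \<and> (\<Sum>i<c. mc T i) \<le> int m"

definition acc :: "real \<Rightarrow> bool" where
  "acc T \<longleftrightarrow> ok0 T \<and> (\<forall>q<3. 0 \<le> FA q T + FB q T * T)"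

text \<open>The most load of a class that can lie in slots: of each job at most \<open>T / 2\<close>
  minus the setup, both in an arbitrary schedule of makespan \<open>T\<close> and in the
  construction.\<close>

definition D :: "real \<Rightarrow> nat \<Rightarrow> real" where
  "D T i = (\<Sum>j\<in>J i. min (t j) (T / 2 - s i))"

lemma m_pos: "m > 0" using valid by (simp add: valid_instance_def)
lemma s_pos: "i < c ==> s i > 0" using valid by (simp add: valid_instance_def s_def)
lemma t_pos: "j < n ==> t j > 0" using valid by (simp add: valid_instance_def t_def)
lemma cl_less: "j < n ==> cl j < c"
  using valid unfolding valid_instance_def cl_def by (metis lessThan_iff nth_mem)
lemma J_ne: "i < c ==> J i \<noteq> {}"
proof -
  assume "i < c"
  then have "i \<in> set (job_class I)" using valid by (simp add: valid_instance_def)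
  then obtain j where "j < length (job_class I)" "job_class I ! j = i" by (auto simp: in_set_conv_nth)
  then show ?thesis using valid by (auto simp: J_def cl_def valid_instance_def)
qed
lemma fin_J[simp]: "finite (J i)" by (simp add: J_def)
lemma P_pos: "i < c ==> P i > 0"
  unfolding P_def using J_ne[of i] by (intro sum_pos) (auto simp: t_pos J_def)

lemma D_eq: fixes T :: real shows "2 * D T i = 2 * (sm T i - real (bg T i) * s i) + bg T i * T"
proof -
  have "D T i = (\<Sum>j\<in>{j \<in> J i. T < 2 * (s i + t j)}. min (t j) (T / 2 - s i))
     + (\<Sum>j\<in>{j \<in> J i. \<not> T < 2 * (s i + t j)}. min (t j) (T / 2 - s i))"
    unfolding D_def by (subst sum.union_disjoint[symmetric]) (auto intro!: sum.cong)
  also have "(\<Sum>j\<in>{j \<in> J i. T < 2 * (s i + t j)}. min (t j) (T / 2 - s i))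
    = (\<Sum>j\<in>{j \<in> J i. T < 2 * (s i + t j)}. T / 2 - s i)"
    by (intro sum.cong) auto
  also have "(\<Sum>j\<in>{j \<in> J i. \<not> T < 2 * (s i + t j)}. min (t j) (T / 2 - s i)) = sm T i"
    unfolding sm_def by (intro sum.cong) auto
  finally show ?thesis by (simp add: bg_def algebra_simps)
qed

lemma bg0_D: fixes T :: real assumes "bg T i = 0" shows "D T i = P i"
proof -
  have "\<forall>j\<in>J i. \<not> T < 2 * (s i + t j)" using assms unfolding bg_def by (auto simp: card_eq_0_iff)
  then show ?thesis unfolding D_def P_def by (intro sum.cong) auto
qed

lemma FF_eq: fixes T :: real shows "FA q T + FB q T * T = (if q = 2 then 4 else 2) * real m * T
    + (\<Sum>i<c. fa q T i + fb q T i * T)"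
  unfolding FA_def FB_def by (simp add: sum.distrib sum_distrib_right ring_distribs)

lemma ty_cheap: fixes T :: real shows "ty T i \<ge> 3 \<longleftrightarrow> 2 * s i \<le> T" by (auto simp: ty_def)
lemma ty_le6: fixes T :: real shows "ty T i \<le> 6" by (auto simp: ty_def)

lemma al_bounds:
  fixes T :: real assumes "s i < T"
  shows "al T i * (T - s i) < P i" "P i \<le> (al T i + 1) * (T - s i)"
proof -
  have pos: "0 < T - s i" using assms by simp
  have "al T i < P i / (T - s i)" "P i / (T - s i) \<le> al T i + 1"
    unfolding al_def by linarith+
  then show "al T i * (T - s i) < P i" "P i \<le> (al T i + 1) * (T - s i)"
    using pos by (auto simp: field_simps)
qed

lemma al_ge1: fixes T :: real assumes "s i < T" "T < L i" shows "al T i \<ge> 1"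
proof -
  have "1 < P i / (T - s i)" using assms by (simp add: field_simps L_def)
  then show ?thesis unfolding al_def by linarith
qed

end

section \<open>Necessary conditions\<close>

locale sched = inst +
  fixes S :: schedule and T :: real
  assumes feas: "feasible_pmtn I S" and fin: "\<And>e. e \<in> set S ==> finish_of e \<le> T"
begin

abbreviation "it a \<equiv> item_of (S ! a)"
abbreviation "mach a \<equiv> machine_of (S ! a)"
abbreviation "st a \<equiv> start_of (S ! a)"
abbreviation "fi a \<equiv> finish_of (S ! a)"
definition ic :: "nat \<Rightarrow> nat" where "ic a = item_class I (it a)"
definition vol :: "nat set \<Rightarrow> real" where "vol A = (\<Sum>a\<in>A. fi a - st a)"
text \<open>Positions in the list instead of entries, so that a sum over a set of positions agrees
  with the list sum in the feasibility condition.\<close>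

definition ent :: "nat set" where "ent = {..<length S}"
definition ST :: "nat \<Rightarrow> nat set" where "ST i = {a \<in> ent. it a = Setup i}"
definition PC :: "nat \<Rightarrow> nat set" where "PC i = {a \<in> ent. \<exists>j. it a = Piece j \<and> cl j = i}"
definition PJ :: "nat \<Rightarrow> nat set" where "PJ j = {a \<in> ent. it a = Piece j}"
definition NN :: "nat \<Rightarrow> nat set" where "NN i = mach ` ST i"
definition On :: "nat set \<Rightarrow> nat set" where "On U = {a \<in> ent. mach a \<in> U}"

lemma fin_ent[simp]: "finite ent" by (simp add: ent_def)
lemma fin_sets[simp]: "finite (ST i)" "finite (PC i)" "finite (PJ j)" "finite (On U)" "finite (NN i)"
  by (simp_all add: ST_def PC_def PJ_def On_def NN_def)

lemma entD:
  assumes "a \<in> ent"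
  shows "mach a < m" "0 \<le> st a" "st a < fi a" "fi a \<le> T" "ic a < c"
    "it a = Setup i ==> fi a - st a = s i \<and> i < c" "it a = Piece j ==> j < n"
proof -
  have mem: "S ! a \<in> set S" using assms by (simp add: ent_def)
  then have w: "well_timed I (S ! a)" using feas by (simp add: feasible_pmtn_def)
  show "fi a \<le> T" using fin mem by blast
  show "mach a < m" "0 \<le> st a" using w by auto
  show "it a = Setup i ==> fi a - st a = s i \<and> i < c" using w by (simp add: s_def)
  show "it a = Piece j ==> j < n" using w by simp
  show "ic a < c" using w by (cases "it a") (auto simp: ic_def cl_less[unfolded cl_def])
  show "st a < fi a" using w s_pos by (cases "it a") (auto simp: s_def)
qed

lemma sep_mach: "a \<in> ent ==> b \<in> ent ==> a \<noteq> b ==> mach a = mach b ==> fi a \<le> st b \<or> fi b \<le> st a"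
  using feas unfolding feasible_pmtn_def separated_def ent_def by auto

lemma sep_job: "a \<in> PJ j ==> b \<in> PJ j ==> a \<noteq> b ==> fi a \<le> st b \<or> fi b \<le> st a"
  using feas unfolding feasible_pmtn_def separated_def ent_def PJ_def by auto

lemma set_up_ent:
  assumes "a \<in> PC i"
  obtains b where "b \<in> ST i" "mach b = mach a" "fi b \<le> st a"
    "\<And>g. g \<in> ent ==> mach g = mach a ==> fi b \<le> st g ==> fi g \<le> st a ==> ic g = i"
proof -
  obtain j where j: "it a = Piece j" "cl j = i" "a \<in> ent" using assms by (auto simp: PC_def)
  have "set_up I S (S ! a)" using feas j by (auto simp: feasible_pmtn_def ent_def)
  then obtain e where e: "e \<in> set S" "item_of e = Setup i" "machine_of e = mach a" "finish_of e \<le> st a"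
    "\<forall>g \<in> set S. machine_of g = mach a \<and> finish_of e \<le> start_of g \<and> finish_of g \<le> st a \<longrightarrow>
           item_class I (item_of g) = i"
    unfolding set_up_def using j by (auto simp: cl_def)
  then obtain b where "b < length S" "S ! b = e" by (auto simp: in_set_conv_nth)
  then show ?thesis using e that[of b] by (auto simp: ST_def ent_def ic_def)
qed

lemma vol_PJ: "j < n ==> vol (PJ j) = t j"
proof -
  assume j: "j < n"
  have "(\<Sum>e \<leftarrow> filter (\<lambda>e. item_of e = Piece j) S. finish_of e - start_of e) = real (job_times I ! j)"
    using feas j by (simp add: feasible_pmtn_def)
  also have "(\<Sum>e \<leftarrow> filter (\<lambda>e. item_of e = Piece j) S. finish_of e - start_of e)
    = (\<Sum>a<length S. if it a = Piece j then fi a - st a else 0)"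
    by (subst sum_list_map_filter') (simp add: sum_list_sum_nth atLeast0LessThan)
  also have "\<dots> = vol (PJ j)"
    unfolding vol_def PJ_def ent_def by (rule sum.mono_neutral_cong_right) auto
  finally show ?thesis by (simp add: t_def)
qed

lemma vol_mono: "A \<subseteq> B ==> B \<subseteq> ent ==> vol A \<le> vol B"
  unfolding vol_def
proof (rule sum_mono2)
  assume "A \<subseteq> B" and B: "B \<subseteq> ent"
  show "finite B" using B by (rule finite_subset) simp
  show "A \<subseteq> B" by fact
  show "0 \<le> fi b - st b" if "b \<in> B - A" for b using entD(3)[of b] that B by auto
qed
lemma vol_nonneg: "A \<subseteq> ent ==> 0 \<le> vol A"
  using vol_mono[of "{}" A] by (simp add: vol_def)
lemma vol_Un: "A \<inter> B = {} ==> finite A ==> finite B ==> vol (A \<union> B) = vol A + vol B"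
  unfolding vol_def by (rule sum.union_disjoint)

lemma vol_interval:
  assumes "A \<subseteq> ent" "\<And>a b. a \<in> A ==> b \<in> A ==> a \<noteq> b ==> fi a \<le> st b \<or> fi b \<le> st a"
    "\<And>a. a \<in> A ==> lo \<le> st a \<and> fi a \<le> hi" "lo \<le> hi"
  shows "vol A \<le> hi - lo"
  unfolding vol_def using assms finite_subset[OF assms(1)]
  by (intro separated_sum_le) (auto dest: entD(3))

lemma T_nonneg: "n > 0 ==> T \<ge> 0"
proof -
  assume "n > 0"
  then have "vol (PJ 0) > 0" using vol_PJ[of 0] t_pos[of 0] by simp
  then have "PJ 0 \<noteq> {}" by (auto simp: vol_def)
  then show ?thesis using entD(2,3,4) by (fastforce simp: PJ_def)
qed

lemma vol_mach: "T \<ge> 0 ==> vol (On {u}) \<le> T"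
  using vol_interval[of "On {u}" 0 T] sep_mach entD by (fastforce simp: On_def)

lemma vol_On:
  assumes "T \<ge> 0" "finite U" shows "vol (On U) \<le> card U * T"
proof -
  have "vol (On U) = (\<Sum>u\<in>U. vol (On {u}))"
    using assms(2)
  proof (induction U)
    case empty then show ?case by (simp add: vol_def On_def)
  next
    case (insert u U)
    have "On (insert u U) = On {u} \<union> On U" by (auto simp: On_def)
    moreover have "On {u} \<inter> On U = {}" using insert by (auto simp: On_def)
    ultimately show ?case using insert by (simp add: vol_Un)
  qed
  also have "\<dots> \<le> (\<Sum>u\<in>U. T)" by (rule sum_mono) (use vol_mach assms in auto)
  finally show ?thesis by simp
qed

lemma vol_ST: "A \<subseteq> ST i ==> vol A = card A * s i"
proof -
  assume A: "A \<subseteq> ST i"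
  have "vol A = (\<Sum>a\<in>A. s i)"
    unfolding vol_def by (rule sum.cong) (use A entD(6) in \<open>auto simp: ST_def\<close>)
  then show ?thesis by simp
qed

lemma PC_Un: "PC i \<inter> A = (\<Union>j\<in>J i. PJ j \<inter> A)"
  using entD(7) by (auto simp: PC_def PJ_def J_def)

lemma vol_PC_Int: "vol (PC i \<inter> A) = (\<Sum>j\<in>J i. vol (PJ j \<inter> A))"
  unfolding vol_def PC_Un by (rule sum.UNION_disjoint) (auto simp: PJ_def)

lemma vol_PC: "vol (PC i) = P i"
proof -
  have "vol (PC i) = (\<Sum>j\<in>J i. vol (PJ j))" using vol_PC_Int[of i UNIV] by simp
  then show ?thesis by (simp add: P_def vol_PJ J_def)
qed

lemma ic_sets: "{a \<in> ent. ic a = i} = ST i \<union> PC i" "ST i \<inter> PC i = {}"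
proof -
  show "{a \<in> ent. ic a = i} = ST i \<union> PC i"
    unfolding ST_def PC_def ic_def cl_def
    apply (auto)
    subgoal for x by (cases "it x") auto
    done
qed (auto simp: ST_def PC_def)

lemma setup_start: "a \<in> PC i ==> s i \<le> st a"
proof (erule set_up_ent)
  fix b assume "b \<in> ST i" "fi b \<le> st a"
  then show "s i \<le> st a" using entD(2)[of b] entD(6)[of b i] by (auto simp: ST_def)
qed

text \<open>The pieces of a job are disjoint in time across all machines, and none of them starts
  before a setup of its class has been completed.\<close>

lemma job_le: "j < n ==> s (cl j) + t j \<le> T"
proof -
  assume j: "j < n"
  have sub: "PJ j \<subseteq> PC (cl j)" by (auto simp: PJ_def PC_def)
  have "vol (PJ j) > 0" using vol_PJ[OF j] t_pos[OF j] by simp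
  then obtain a where a: "a \<in> PJ j" by (fastforce simp: vol_def)
  have "s (cl j) \<le> st a" "a \<in> ent" using a sub setup_start by (auto simp: PJ_def)
  then have "s (cl j) \<le> T" using entD(3,4)[of a] by simp
  then have "vol (PJ j) \<le> T - s (cl j)"
    using sub setup_start sep_job entD(4) by (intro vol_interval) (auto simp: PJ_def)
  then show ?thesis using vol_PJ[OF j] by linarith
qed

lemma ST_ne: "i < c ==> ST i \<noteq> {}"
proof -
  assume "i < c"
  then have "vol (PC i) > 0" using vol_PC P_pos by simp
  then have "PC i \<noteq> {}" by (auto simp: vol_def)
  then show ?thesis using set_up_ent by blast
qed

lemma s_less_T: "i < c ==> s i < T"
proof -
  assume "i < c"
  then obtain j where "j \<in> J i" using J_ne by blast
  then show ?thesis using job_le[of j] t_pos[of j] by (auto simp: J_def)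
qed

abbreviation "Exp i \<equiv> T < 2 * s i"

text \<open>Two setups longer than \<open>T / 2\<close> do not fit on one machine. For expensive
  classes this identifies setups with machines.\<close>

lemma exp_unique:
  assumes "a \<in> ST i" "b \<in> ST i'" "Exp i" "Exp i'" "mach a = mach b" shows "a = b"
proof (rule ccontr)
  assume "a \<noteq> b"
  then show False
    using sep_mach[of a b] entD(2,4)[of a] entD(2,4)[of b] entD(6)[of a i] entD(6)[of b i'] assms
    unfolding ST_def by fastforce
qed

lemma card_NN: "Exp i ==> card (NN i) = card (ST i)"
  unfolding NN_def by (rule card_image) (auto intro: inj_onI exp_unique)

lemma NN_disj: "Exp i ==> Exp i' ==> i \<noteq> i' ==> NN i \<inter> NN i' = {}"
  unfolding NN_def using exp_unique by (auto simp: ST_def) (metis (no_types, lifting) ST_def exp_unique item.inject(1) mem_Collect_eq)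

lemma mach_PC: "a \<in> PC i ==> mach a \<in> NN i"
  by (erule set_up_ent) (metis NN_def image_eqI)

lemma NN_sub: "NN i \<subseteq> {..<m}" using entD(1) by (auto simp: NN_def ST_def)

end

section \<open>Volume on and off the machines of nearly full expensive classes\<close>

context sched
begin

text \<open>A class of type 1 with a single setup lies entirely on one machine and fills it beyond
  \<open>3 / 4 * T\<close>; \<open>U\<close> collects these machines, the counterpart of the slots.
  A class of type 1 with two setups has volume above \<open>T\<close> from setups alone, so it can
  be charged \<open>T\<close> without owning a machine.\<close>

definition E1 :: "nat set" where "E1 = {i. i < c \<and> ty T i = 1 \<and> card (ST i) = 1}"
definition U :: "nat set" where "U = (\<Union>i\<in>E1. NN i)"
definition CE :: "nat \<Rightarrow> nat set" where "CE i = {a \<in> ent. ic a = i}"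

lemma ty_exp: "ty T i \<le> 2 \<longleftrightarrow> Exp i" by (auto simp: ty_def)
lemma fin_E1[simp]: "finite E1" by (simp add: E1_def)
lemma fin_U[simp]: "finite U" by (simp add: U_def)
lemma CE_sub: "CE i \<subseteq> ent" by (auto simp: CE_def)
lemma fin_CE[simp]: "finite (CE i)" by (simp add: CE_def)
lemma CE_split: "CE i \<inter> A = (ST i \<inter> A) \<union> (PC i \<inter> A)" using ic_sets(1) by (auto simp: CE_def)
lemma vol_CE_split: "vol (CE i \<inter> A) = vol (ST i \<inter> A) + vol (PC i \<inter> A)"
  unfolding CE_split by (rule vol_Un) (use ic_sets(2) in auto)

lemma U_sub: "U \<subseteq> {..<m}" using NN_sub by (auto simp: U_def)

lemma E1_D: assumes "i \<in> E1"
  obtains b where "ST i = {b}" "NN i = {mach b}" "b \<in> ent" "Exp i" "i < c" "L i \<le> T" "3 * T < 4 * L i"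
proof -
  have i: "i < c" "ty T i = 1" "card (ST i) = 1" using assms by (auto simp: E1_def)
  then obtain b where "ST i = {b}" by (auto simp: card_1_singleton_iff)
  then show ?thesis using that[of b] i by (auto simp: NN_def ST_def ty_def split: if_splits)
qed

lemma NN_E1_eq: "i \<in> E1 ==> j \<in> E1 ==> u \<in> NN i ==> u \<in> NN j ==> i = j"
  using NN_disj[of i j] by (metis E1_D IntI empty_iff)

lemma vol_interval_mach:
  assumes "A \<subseteq> On {u}" "\<And>a. a \<in> A ==> lo \<le> st a \<and> fi a \<le> hi" "lo \<le> hi"
  shows "vol A \<le> hi - lo"
proof (rule vol_interval)
  show "A \<subseteq> ent" using assms(1) by (auto simp: On_def)
  show "fi a \<le> st b \<or> fi b \<le> st a" if "a \<in> A" "b \<in> A" "a \<noteq> b" for a b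
    using sep_mach[of a b] that assms(1) by (auto simp: On_def)
qed (use assms in auto)

lemma vol_interval_job:
  assumes "A \<subseteq> PJ j" "\<And>a. a \<in> A ==> lo \<le> st a \<and> fi a \<le> hi" "lo \<le> hi"
  shows "vol A \<le> hi - lo"
proof (rule vol_interval)
  show "A \<subseteq> ent" using assms(1) by (auto simp: PJ_def)
  show "fi a \<le> st b \<or> fi b \<le> st a" if "a \<in> A" "b \<in> A" "a \<noteq> b" for a b
    using sep_job[of a j b] that assms(1) by auto
qed (use assms in auto)

lemma card_U: "card U = card E1"
proof -
  have "card U = (\<Sum>i\<in>E1. card (NN i))"
    unfolding U_def by (rule card_UN_disjoint) (use NN_E1_eq in auto)
  also have "\<dots> = (\<Sum>i\<in>E1. 1)" by (rule sum.cong) (auto elim: E1_D)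
  finally show ?thesis by simp
qed

lemma T_pos: "i < c ==> 0 < T" using s_less_T[of i] s_pos[of i] by simp

lemma exp_mach: "i < c ==> a \<in> CE i ==> mach a \<in> NN i"
proof -
  assume a: "a \<in> CE i" and i: "i < c"
  then have "a \<in> ST i \<or> a \<in> PC i" using ic_sets(1)[of i] by (auto simp: CE_def)
  then show ?thesis by (auto simp: NN_def mach_PC[unfolded NN_def])
qed

lemma exp_out: "i < c ==> Exp i ==> i \<notin> E1 ==> CE i \<subseteq> On ({..<m} - U)"
proof
  fix a assume *: "i < c" "Exp i" "i \<notin> E1" "a \<in> CE i"
  have "mach a \<notin> U"
  proof
    assume "mach a \<in> U"
    then obtain i' where i': "i' \<in> E1" "mach a \<in> NN i'" by (auto simp: U_def)
    have "Exp i'" using i'(1) by (auto elim: E1_D)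
    then show False using NN_disj[of i i'] * i' exp_mach[of i a] by auto
  qed
  then show "a \<in> On ({..<m} - U)" using * entD(1)[of a] by (auto simp: On_def CE_def)
qed

definition ov :: "nat \<Rightarrow> real" where "ov i = vol (CE i \<inter> On ({..<m} - U))"
definition iv :: "nat \<Rightarrow> real" where "iv i = vol (CE i \<inter> On U)"

lemma vol_classes:
  assumes "A \<subseteq> ent" shows "vol A = (\<Sum>i<c. vol (CE i \<inter> A))"
proof -
  have "A = (\<Union>i<c. CE i \<inter> A)" using assms entD(5) by (auto simp: CE_def)
  then have "vol A = vol (\<Union>i<c. CE i \<inter> A)" by simp
  also have "\<dots> = (\<Sum>i<c. vol (CE i \<inter> A))"
    unfolding vol_def by (rule sum.UNION_disjoint) (auto simp: CE_def)
  finally show ?thesis .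
qed

lemma ov_iv: "ov i + iv i = card (ST i) * s i + P i"
proof -
  have "CE i \<inter> On ({..<m} - U) \<union> CE i \<inter> On U = CE i" using entD(1) by (auto simp: CE_def On_def)
  moreover have "vol (CE i \<inter> On ({..<m} - U) \<union> CE i \<inter> On U) = ov i + iv i"
    unfolding ov_def iv_def by (rule vol_Un) (auto simp: On_def)
  ultimately have "ov i + iv i = vol (CE i \<inter> UNIV)" by simp
  also have "\<dots> = card (ST i) * s i + P i" unfolding vol_CE_split using vol_ST[of "ST i" i] vol_PC by simp
  finally show ?thesis .
qed

lemma On_sub: "On X \<subseteq> ent" by (auto simp: On_def)
lemma ov_nonneg: "0 \<le> ov i" and iv_nonneg: "0 \<le> iv i"
  unfolding ov_def iv_def using CE_sub by (auto intro!: vol_nonneg)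

lemma ST_card_ge: "i < c ==> card (ST i) \<ge> 1"
  using ST_ne[of i] by (simp add: Suc_le_eq card_gt_0_iff)

text \<open>The charge for an expensive class. For type 1 it is the whole \<open>T\<close>, so a
  machine holding such a class counts as used up; what it leaves free, \<open>T - L i\<close>,
  returns as capacity in \<open>inside\<close>.\<close>

definition eo :: "nat \<Rightarrow> real" where
  "eo i = (if ty T i = 0 then al T i * T else if ty T i = 1 then T else L i)"

lemma ov_sum: "(\<Sum>i<c. ov i) \<le> (real m - card U) * T" if "T \<ge> 0"
proof -
  have "(\<Sum>i<c. ov i) = vol (On ({..<m} - U))"
    unfolding ov_def by (rule vol_classes[symmetric, OF On_sub])
  also have "\<dots> \<le> card ({..<m} - U) * T" by (rule vol_On[OF that]) simp
  finally show ?thesis using U_sub card_mono[OF _ U_sub] by (simp add: card_Diff_subset of_nat_diff)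
qed

lemma exp_ov:
  assumes "i < c" "Exp i" "i \<notin> E1" shows "eo i \<le> ov i"
proof -
  have "CE i \<inter> On U = {}" using exp_out[OF assms] by (auto simp: On_def)
  then have "ov i = card (ST i) * s i + P i" using ov_iv[of i] by (simp add: iv_def vol_def)
  moreover have "eo i \<le> card (ST i) * s i + P i"
  proof (cases "ty T i = 0")
    case True
    then have TL: "T < L i" by (auto simp: ty_def split: if_splits)
    have alb: "al T i * (T - s i) < P i" using al_bounds[OF s_less_T[OF assms(1)]] by simp
    \<comment> \<open>Each machine carries one setup of the class and therefore at most
      \<open>T - s i\<close> of its load.\<close>
    have "real_of_int (al T i) \<le> card (ST i)"
    proof -
      have "P i = (\<Sum>u\<in>NN i. vol (PC i \<inter> On {u}))"
      proof -
        have "PC i = (\<Union>u\<in>NN i. PC i \<inter> On {u})" using mach_PC by (auto simp: On_def PC_def)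
        then have "vol (PC i) = vol (\<Union>u\<in>NN i. PC i \<inter> On {u})" by simp
        also have "\<dots> = (\<Sum>u\<in>NN i. vol (PC i \<inter> On {u}))"
          unfolding vol_def by (rule sum.UNION_disjoint) (auto simp: On_def)
        finally show ?thesis using vol_PC by simp
      qed
      also have "\<dots> \<le> (\<Sum>u\<in>NN i. T - s i)"
      proof (rule sum_mono)
        fix u assume "u \<in> NN i"
        show "vol (PC i \<inter> On {u}) \<le> T - s i"
          using entD(4) setup_start s_less_T[OF assms(1)]
          by (intro vol_interval_mach[of _ u]) (auto simp: On_def PC_def)
      qed
      also have "\<dots> = card (ST i) * (T - s i)" using card_NN[OF assms(2)] by simp
      finally have "al T i * (T - s i) \<le> card (ST i) * (T - s i)" using alb by linarith
      then show ?thesis using s_less_T[OF assms(1)] by simp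
    qed
    then have "al T i * s i \<le> card (ST i) * s i" using s_pos[OF assms(1)] by (simp add: mult_right_mono)
    moreover have "eo i = al T i * (T - s i) + al T i * s i" using True by (simp add: eo_def algebra_simps)
    ultimately show ?thesis using alb by linarith
  next
    case False
    have t12: "ty T i = 1 \<or> ty T i = 2" using False ty_exp[of i] assms(2) by auto
    show ?thesis
    proof (cases "ty T i = 1")
      case True
      then have "card (ST i) \<ge> 2" using assms(1,3) ST_card_ge[of i] by (auto simp: E1_def)
      \<comment> \<open>Two expensive setups together are longer than \<open>T\<close>, the charge
        for this type.\<close>
      then have "2 * s i \<le> card (ST i) * s i" using s_pos[OF assms(1)] by (intro mult_right_mono) auto
      then show ?thesis using True assms(2) P_pos[OF assms(1)] by (simp add: eo_def)
    next
      case False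
      have "1 * s i \<le> card (ST i) * s i"
        using s_pos[OF assms(1)] ST_card_ge[OF assms(1)] by (intro mult_right_mono) auto
      then show ?thesis using False t12 by (simp add: eo_def L_def)
    qed
  qed
  ultimately show ?thesis by simp
qed

text \<open>\<open>ov_sum\<close> allows \<open>T\<close> for each machine outside \<open>U\<close>.
  Adding \<open>T\<close> for every class of \<open>E1\<close> to both sides yields
  \<open>m * T\<close>, since \<open>U\<close> has exactly one machine per class of
  \<open>E1\<close>.\<close>

lemma outside: 
  assumes "0 \<le> T" shows "(\<Sum>i\<in>{i. i < c \<and> \<not> Exp i}. ov i) + (\<Sum>i\<in>{i. i < c \<and> Exp i}. eo i) \<le> m * T"
proof -
  have *: "(\<Sum>i<c. ov i) = (\<Sum>i\<in>{i. i < c \<and> \<not> Exp i}. ov i) + (\<Sum>i\<in>{i. i < c \<and> Exp i}. ov i)"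
    by (subst sum.union_disjoint[symmetric]) (auto intro!: sum.cong)
  have "(\<Sum>i\<in>{i. i < c \<and> Exp i}. eo i) \<le> (\<Sum>i\<in>{i. i < c \<and> Exp i}. ov i + (if i \<in> E1 then T else 0))"
  proof (rule sum_mono)
    fix i assume i: "i \<in> {i. i < c \<and> Exp i}"
    show "eo i \<le> ov i + (if i \<in> E1 then T else 0)"
    proof (cases "i \<in> E1")
      case True
      then have "ty T i = 1" by (simp add: E1_def)
      then show ?thesis using True ov_nonneg[of i] by (simp add: eo_def)
    qed (use i exp_ov in auto)
  qed
  also have "\<dots> = (\<Sum>i\<in>{i. i < c \<and> Exp i}. ov i) + (\<Sum>i\<in>E1. T)"
  proof -
    have "(\<Sum>i\<in>{i. i < c \<and> Exp i}. (if i \<in> E1 then T else 0)) = (\<Sum>i\<in>E1. T)"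
      by (rule sum.mono_neutral_cong_right) (auto elim: E1_D)
    then show ?thesis by (simp add: sum.distrib)
  qed
  finally show ?thesis using ov_sum[OF assms] card_U * by (simp add: algebra_simps)
qed

lemma E1_iv: "i \<in> E1 ==> vol (CE i \<inter> On (NN i)) = L i"
proof -
  assume i: "i \<in> E1"
  then obtain b where b: "ST i = {b}" "i < c" using E1_D by metis
  have "CE i \<inter> On (NN i) = CE i" using exp_mach[OF b(2)] by (auto simp: On_def CE_def)
  moreover have "vol (CE i \<inter> UNIV) = L i"
    unfolding vol_CE_split using b vol_ST[of "ST i" i] vol_PC[of i] by (simp add: L_def)
  ultimately show ?thesis by simp
qed

definition CH :: "nat set" where "CH = {a \<in> ent. \<not> Exp (ic a)}"

lemma cheap_slot: "i \<in> E1 ==> vol (CH \<inter> On (NN i)) \<le> T - L i"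
proof -
  assume i: "i \<in> E1"
  then obtain b where b: "NN i = {mach b}" "Exp i" "i < c" using E1_D by metis
  have "vol (CH \<inter> On (NN i)) + vol (CE i \<inter> On (NN i)) \<le> vol (On (NN i))"
  proof -
    have "CH \<inter> On (NN i) \<inter> (CE i \<inter> On (NN i)) = {}" using b by (auto simp: CH_def CE_def)
    from vol_Un[OF this]
    show ?thesis using vol_mono[of "CH \<inter> On (NN i) \<union> CE i \<inter> On (NN i)" "On (NN i)"]
      by (simp add: On_def CH_def)
  qed
  also have "\<dots> \<le> T" unfolding b(1) using T_pos[OF b(3)] by (intro vol_mach) simp
  finally show ?thesis using E1_iv[OF i] by simp
qed

lemma inside: "(\<Sum>i\<in>{i. i < c \<and> \<not> Exp i}. iv i) \<le> (\<Sum>i\<in>{i. i < c \<and> ty T i = 1}. T - L i)"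
proof -
  have "(\<Sum>i\<in>{i. i < c \<and> \<not> Exp i}. iv i) = vol (\<Union>i\<in>{i. i < c \<and> \<not> Exp i}. CE i \<inter> On U)"
    unfolding iv_def vol_def by (rule sum.UNION_disjoint[symmetric]) (auto simp: CE_def)
  also have "(\<Union>i\<in>{i. i < c \<and> \<not> Exp i}. CE i \<inter> On U) = (\<Union>i\<in>E1. CH \<inter> On (NN i))"
    using entD(5) by (auto simp: CE_def CH_def On_def U_def)
  also have "vol \<dots> = (\<Sum>i\<in>E1. vol (CH \<inter> On (NN i)))"
    unfolding vol_def
  proof (rule sum.UNION_disjoint)
    show "\<forall>i\<in>E1. \<forall>j\<in>E1. i \<noteq> j \<longrightarrow> CH \<inter> On (NN i) \<inter> (CH \<inter> On (NN j)) = {}"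
      using NN_E1_eq by (auto simp: On_def)
  qed (auto simp: On_def)
  also have "\<dots> \<le> (\<Sum>i\<in>E1. T - L i)" by (rule sum_mono) (rule cheap_slot)
  \<comment> \<open>The added terms belong to classes of type 1 with several setups and are
    nonnegative, since \<open>L i\<close> is at most \<open>T\<close> there.\<close>
  also have "\<dots> \<le> (\<Sum>i\<in>{i. i < c \<and> ty T i = 1}. T - L i)"
    by (rule sum_mono2) (auto simp: E1_def ty_def split: if_splits)
  finally show ?thesis .
qed

text \<open>On a machine whose expensive class fills more than \<open>3 / 4 * T\<close>, that class occupies the whole
  interval from \<open>T / 4\<close> to \<open>3 / 4 * T\<close>, since nothing can come between its setup and its pieces.\<close>

lemma cheap_piece_time:
  assumes "a \<in> PC i'" "\<not> Exp i'" "mach a \<in> U"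
  shows "fi a \<le> T / 4 \<or> 3 / 4 * T \<le> st a"
proof -
  obtain i where i: "i \<in> E1" "mach a \<in> NN i" using assms(3) by (auto simp: U_def)
  obtain b where b: "ST i = {b}" "NN i = {mach b}" "b \<in> ent" "Exp i" "i < c" "3 * T < 4 * L i"
    using E1_D[OF i(1)] by metis
  have itb: "it b = Setup i" using b(1) by (auto simp: ST_def)
  obtain j where "a \<in> ent" "it a = Piece j" "cl j = i'" using assms(1) by (auto simp: PC_def)
  then have ab: "mach a = mach b" "a \<noteq> b" "a \<in> ent" "ic a = i'" "i' \<noteq> i"
    using i(2) b(2,4) itb assms(2) by (auto simp: ic_def cl_def)
  have CEm: "\<And>g. g \<in> CE i ==> mach g = mach b" using exp_mach b(2,5) by auto
  have pieces: "fi b \<le> st g \<and> (\<forall>h \<in> ent. mach h = mach g \<and> fi b \<le> st h \<and> fi h \<le> st g \<longrightarrow> ic h = i)"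
    if "g \<in> PC i" for g using set_up_ent[OF that] b(1) by (metis singletonD)
  have CE: "CE i = {b} \<union> PC i" using ic_sets(1)[of i] b(1) by (simp add: CE_def)
  have vL: "vol (CE i) = L i"
  proof -
    have "CE i \<inter> On (NN i) = CE i" using exp_mach[OF b(5)] by (auto simp: On_def CE_def)
    then show ?thesis using E1_iv[OF i(1)] by simp
  qed
  have sepE: "fi x \<le> st y \<or> fi y \<le> st x" if "x \<in> CE i" "y \<in> CE i" "x \<noteq> y" for x y
    using that CEm sep_mach by (auto simp: CE_def)
  have "fi a \<le> st b \<or> fi b \<le> st a" using sep_mach[of a b] ab b(3) by blast
  then show ?thesis
  proof
    assume *: "fi a \<le> st b"
    have "vol (CE i) \<le> T - fi a"
    proof (rule vol_interval[OF CE_sub sepE])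
      fix g assume g: "g \<in> CE i"
      then have "fi a \<le> st g" using * pieces[of g] entD(3)[OF b(3)] unfolding CE by auto
      then show "fi a \<le> st g \<and> fi g \<le> T" using entD(4) g by (auto simp: CE_def)
    qed (use entD(4)[OF ab(3)] in auto)
    then show ?thesis using b(6) vL by simp
  next
    assume *: "fi b \<le> st a"
    have "vol (CE i) \<le> st a - 0"
    proof (rule vol_interval[OF CE_sub sepE])
      fix g assume g: "g \<in> CE i"
      have "fi g \<le> st a"
      proof (cases "g = b")
        case False
        then have gP: "g \<in> PC i" using g unfolding CE by auto
        have "g \<noteq> a" using g ab by (auto simp: CE_def)
        have "\<not> fi a \<le> st g" using pieces[OF gP] ab * CEm[OF g] by auto
        then show ?thesis using sep_mach[of a g] ab \<open>g \<noteq> a\<close> CEm[OF g] g by (auto simp: CE_def)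
      qed (use * in simp)
      then show "0 \<le> st g \<and> fi g \<le> st a" using entD(2) g by (auto simp: CE_def)
    qed (use entD(2)[OF ab(3)] in auto)
    then show ?thesis using b(6) vL by simp
  qed
qed

definition yp :: "nat \<Rightarrow> real" where "yp i = vol (PC i \<inter> On U)"

text \<open>Pieces of one job do not overlap even on different machines of \<open>U\<close>, and by
  \<open>cheap_piece_time\<close> all of them lie between \<open>s\<close> and \<open>T / 4\<close>
  or between \<open>3 / 4 * T\<close> and \<open>T\<close>. The two windows have total length
  \<open>T / 2 - s\<close>.\<close>

lemma big_inside:
  assumes "j < n" "\<not> Exp (cl j)" "4 * s (cl j) \<le> T"
  shows "vol (PJ j \<inter> On U) \<le> T / 2 - s (cl j)"
proof -
  have sub: "PJ j \<subseteq> PC (cl j)" by (auto simp: PJ_def PC_def)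
  define A where "A = {a \<in> PJ j \<inter> On U. fi a \<le> T / 4}"
  define B where "B = {a \<in> PJ j \<inter> On U. \<not> fi a \<le> T / 4}"
  have B: "3 / 4 * T \<le> st a" if "a \<in> B" for a
    using that cheap_piece_time[of a "cl j"] sub assms(2) by (auto simp: B_def On_def)
  have AB: "A \<subseteq> ent" "B \<subseteq> ent" by (auto simp: A_def B_def PJ_def)
  have "vol A \<le> T / 4 - s (cl j)"
    using AB assms(3) setup_start sub by (intro vol_interval_job[of _ j]) (auto simp: A_def)
  moreover have "vol B \<le> T - 3 / 4 * T"
    using B entD(4) AB(2) T_pos[OF cl_less[OF assms(1)]] by (intro vol_interval_job[of _ j]) (auto simp: B_def)
  moreover have "PJ j \<inter> On U = A \<union> B" "A \<inter> B = {}" by (auto simp: A_def B_def)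
  ultimately show ?thesis using vol_Un[of A B] finite_subset[OF AB(1)] finite_subset[OF AB(2)] by simp
qed

lemma yp_le_D: assumes "i < c" "\<not> Exp i" "4 * s i \<le> T" shows "yp i \<le> D T i"
proof -
  have "yp i = (\<Sum>j\<in>J i. vol (PJ j \<inter> On U))" unfolding yp_def by (rule vol_PC_Int)
  also have "\<dots> \<le> (\<Sum>j\<in>J i. min (t j) (T / 2 - s i))"
  proof (rule sum_mono)
    fix j assume j: "j \<in> J i"
    then have jd: "j < n" "cl j = i" by (auto simp: J_def)
    have "vol (PJ j \<inter> On U) \<le> vol (PJ j)" by (rule vol_mono) (auto simp: PJ_def)
    then show "vol (PJ j \<inter> On U) \<le> min (t j) (T / 2 - s i)"
      using big_inside[of j] vol_PJ[of j] jd assms by auto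
  qed
  finally show ?thesis by (simp add: D_def)
qed

lemma iv_split: "iv i = vol (ST i \<inter> On U) + yp i" unfolding iv_def yp_def vol_CE_split ..
lemma yp_le_iv: "yp i \<le> iv i"
  unfolding iv_split using vol_nonneg[of "ST i \<inter> On U"] by (auto simp: ST_def)

text \<open>The expensive class leaves less than \<open>T / 4\<close> on its machine, and a cheap
  class needs its setup there in addition to its pieces.\<close>

lemma mach_U_cheap:
  assumes "a \<in> CE i" "i < c" "\<not> Exp i" "mach a \<in> U"
  obtains b where "b \<in> ST i" "mach b = mach a"
    "s i + vol (PC i \<inter> On {mach a}) < T / 4"
proof -
  obtain b where b: "b \<in> ST i" "mach b = mach a" using exp_mach[OF assms(2,1)] by (auto simp: NN_def)
  obtain i' where i': "i' \<in> E1" "mach a \<in> NN i'" using assms(4) by (auto simp: U_def)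
  obtain b' where b': "NN i' = {mach b'}" "3 * T < 4 * L i'" using E1_D[OF i'(1)] by metis
  have "{b} \<inter> (PC i \<inter> On {mach a}) = {}" using b(1) ic_sets(2)[of i] by auto
  from vol_Un[OF this] have "vol ({b} \<union> (PC i \<inter> On {mach a})) = s i + vol (PC i \<inter> On {mach a})"
    using vol_ST[of "{b}" i] b(1) by simp
  moreover have "vol ({b} \<union> (PC i \<inter> On {mach a})) \<le> vol (CH \<inter> On (NN i'))"
    using b assms i' b' by (intro vol_mono) (auto simp: CH_def On_def ST_def PC_def ic_def cl_def)
  ultimately show ?thesis using cheap_slot[OF i'(1)] b'(2) that[OF b] by linarith
qed

lemma out_setup:
  assumes "i < c" "a \<in> PC i" "mach a \<notin> U" shows "s i + (P i - yp i) \<le> ov i"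
proof -
  obtain b where b: "b \<in> ST i" "mach b = mach a" using mach_PC[OF assms(2)] by (auto simp: NN_def)
  let ?O = "On ({..<m} - U)"
  have "mach b \<in> {..<m} - U" using b assms entD(1)[of b] by (auto simp: ST_def)
  then have "{b} \<subseteq> ST i \<inter> ?O" using b(1) by (auto simp: On_def ST_def)
  then have "vol {b} \<le> vol (ST i \<inter> ?O)" by (rule vol_mono) (auto simp: ST_def)
  then have 1: "s i \<le> vol (ST i \<inter> ?O)" using vol_ST[of "{b}" i] b(1) by simp
  have "PC i \<inter> ?O \<union> PC i \<inter> On U = PC i" using entD(1) by (auto simp: PC_def On_def)
  moreover have "vol (PC i \<inter> ?O \<union> PC i \<inter> On U) = vol (PC i \<inter> ?O) + yp i"
    unfolding yp_def by (rule vol_Un) (auto simp: On_def)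
  ultimately have "P i = vol (PC i \<inter> ?O) + yp i" using vol_PC by simp
  then show ?thesis using 1 unfolding ov_def vol_CE_split by linarith
qed

lemma L_le_ov_iv: "i < c ==> L i \<le> ov i + iv i"
proof -
  assume i: "i < c"
  have "1 * s i \<le> card (ST i) * s i" using ST_card_ge[OF i] s_pos[OF i] by (intro mult_right_mono) auto
  then show ?thesis using ov_iv[of i] by (simp add: L_def)
qed

lemma class6: assumes "i < c" "ty T i = 6" shows "L i \<le> ov i" "iv i = 0"
proof -
  have "\<not> Exp i" "T < 4 * s i" using assms(2) by (auto simp: ty_def split: if_splits)
  have "CE i \<inter> On U = {}"
  proof (rule ccontr)
    assume "CE i \<inter> On U \<noteq> {}"
    then obtain a where a: "a \<in> CE i" "mach a \<in> U" by (auto simp: On_def)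
    from mach_U_cheap[OF a(1) assms(1) \<open>\<not> Exp i\<close> a(2)] obtain b where
      "s i + vol (PC i \<inter> On {mach a}) < T / 4" by metis
    moreover have "0 \<le> vol (PC i \<inter> On {mach a})" by (rule vol_nonneg) (auto simp: On_def)
    ultimately show False using \<open>T < 4 * s i\<close> by simp
  qed
  then show "iv i = 0" by (simp add: iv_def vol_def)
  then show "L i \<le> ov i" using L_le_ov_iv[OF assms(1)] by simp
qed

text \<open>A long job does not fit inside \<open>U\<close>, so one of its pieces lies outside and
  brings a setup of the class with it.\<close>

lemma class45: assumes "i < c" "ty T i = 4 \<or> ty T i = 5"
  shows "L i - yp i \<le> ov i" "yp i \<le> D T i"
proof -
  have ty: "\<not> Exp i" "4 * s i \<le> T" "bg T i \<noteq> 0" using assms(2) by (auto simp: ty_def split: if_splits)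
  then obtain j where j: "j < n" "cl j = i" "T < 2 * (s i + t j)"
    unfolding bg_def by (auto simp: J_def)
  have "vol (PJ j \<inter> On U) < vol (PJ j)" using big_inside[of j] vol_PJ[OF j(1)] j ty by auto
  then have "PJ j \<inter> On U \<noteq> PJ j" by auto
  then obtain a where a: "a \<in> PJ j" "a \<notin> On U" by auto
  then have "a \<in> PC i" "mach a \<notin> U" using j by (auto simp: PJ_def PC_def On_def)
  from out_setup[OF assms(1) this] show "L i - yp i \<le> ov i" by (simp add: L_def)
  show "yp i \<le> D T i" by (rule yp_le_D) (use assms ty in auto)
qed

text \<open>On each machine of \<open>U\<close> that carries pieces, setup and pieces together stay
  below \<open>T / 4\<close> while the setup exceeds \<open>T / 8\<close>; hence the pieces take
  less than the setup.\<close>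

lemma class5: assumes "i < c" "ty T i = 5" shows "2 * yp i \<le> iv i"
proof -
  have ty: "\<not> Exp i" "T < 8 * s i" using assms(2) by (auto simp: ty_def split: if_splits)
  have un: "vol (X \<inter> On U) = (\<Sum>u\<in>U. vol (X \<inter> On {u}))" if "X \<subseteq> ent" for X
  proof -
    have "X \<inter> On U = (\<Union>u\<in>U. X \<inter> On {u})" by (auto simp: On_def)
    then have "vol (X \<inter> On U) = vol (\<Union>u\<in>U. X \<inter> On {u})" by simp
    also have "\<dots> = (\<Sum>u\<in>U. vol (X \<inter> On {u}))"
      unfolding vol_def by (rule sum.UNION_disjoint) (auto simp: On_def)
    finally show ?thesis .
  qed
  have "yp i \<le> vol (ST i \<inter> On U)"
    unfolding yp_def
  proof (subst (1 2) un)
    show "PC i \<subseteq> ent" "ST i \<subseteq> ent" by (auto simp: PC_def ST_def)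
    show "(\<Sum>u\<in>U. vol (PC i \<inter> On {u})) \<le> (\<Sum>u\<in>U. vol (ST i \<inter> On {u}))"
    proof (rule sum_mono)
      fix u assume u: "u \<in> U"
      show "vol (PC i \<inter> On {u}) \<le> vol (ST i \<inter> On {u})"
      proof (cases "PC i \<inter> On {u} = {}")
        case True
        then show ?thesis using vol_nonneg[of "ST i \<inter> On {u}"] by (auto simp: vol_def[of "{}"] ST_def)
      next
        case False
        then obtain a where a: "a \<in> PC i" "mach a = u" by (auto simp: On_def)
        have "a \<in> CE i" using a ic_sets(1)[of i] by (auto simp: CE_def)
        from mach_U_cheap[OF this assms(1) ty(1)] a(2) u obtain b where
          b: "b \<in> ST i" "mach b = u" "s i + vol (PC i \<inter> On {u}) < T / 4" by metis
        have "vol {b} \<le> vol (ST i \<inter> On {u})" by (rule vol_mono) (use b in \<open>auto simp: ST_def On_def\<close>)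
        moreover have "vol {b} = s i" using vol_ST[of "{b}" i] b(1) by simp
        ultimately show ?thesis using b(3) ty(2) by linarith
      qed
    qed
  qed
  then show ?thesis using iv_split[of i] by linarith
qed

lemma mc_sum: "(\<Sum>i<c. mc T i) \<le> int m"
proof -
  have "(\<Sum>i<c. mc T i) \<le> (\<Sum>i\<in>{i. i < c \<and> Exp i}. int (card (NN i)))"
  proof (rule order_trans[OF eq_refl sum_mono])
    show "(\<Sum>i<c. mc T i) = (\<Sum>i\<in>{i. i < c \<and> Exp i}. mc T i)"
      by (rule sum.mono_neutral_right) (auto simp: mc_def, use ty_exp in fastforce, use ty_exp in fastforce)
    fix i assume i: "i \<in> {i. i < c \<and> Exp i}"
    have c1: "1 \<le> card (ST i)" using ST_card_ge i by auto
    show "mc T i \<le> int (card (NN i))"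
    proof (cases "ty T i = 0")
      case True
      have s: "s i < T" using s_less_T i by auto
      have "P i \<le> card (ST i) * (T - s i)"
      proof -
        have "PC i = (\<Union>u\<in>NN i. PC i \<inter> On {u})" using mach_PC by (auto simp: On_def PC_def)
        then have "vol (PC i) = vol (\<Union>u\<in>NN i. PC i \<inter> On {u})" by simp
        also have "\<dots> = (\<Sum>u\<in>NN i. vol (PC i \<inter> On {u}))"
          unfolding vol_def by (rule sum.UNION_disjoint) (auto simp: On_def)
        also have "\<dots> \<le> (\<Sum>u\<in>NN i. T - s i)"
          using entD(4) setup_start s
          by (intro sum_mono vol_interval_mach) (auto simp: On_def PC_def)
        finally show ?thesis using card_NN[of i] i vol_PC by simp
      qed
      with al_bounds(1)[OF s] have "al T i * (T - s i) < card (ST i) * (T - s i)" by linarith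
      then have "al T i < card (ST i)" using s by simp
      then show ?thesis using True i card_NN[of i] by (simp add: mc_def)
    qed (use c1 i card_NN[of i] in \<open>auto simp: mc_def\<close>)
  qed
  also have "\<dots> = int (card (\<Union>i\<in>{i. i < c \<and> Exp i}. NN i))"
    by (subst card_UN_disjoint) (use NN_disj in auto)
  also have "\<dots> \<le> int (card {..<m})" using NN_sub by (intro of_nat_mono card_mono) auto
  finally show ?thesis by simp
qed

text \<open>With the class estimates \<open>class6\<close>, \<open>class45\<close> and
  \<open>class5\<close>, inequality 0 is \<open>outside\<close>, inequality 1 is
  \<open>outside\<close> plus \<open>inside\<close>, and inequality 2 is twice
  \<open>outside\<close> plus \<open>inside\<close>, each multiplied by two.\<close>

theorem lower_bound: assumes "n > 0" shows "acc T"
proof -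
  have T0: "0 \<le> T" using T_nonneg[OF assms] .
  let ?E = "{i. i < c \<and> Exp i}" and ?C = "{i. i < c \<and> \<not> Exp i}"
  have split: "(\<Sum>i<c. f i) = (\<Sum>i\<in>?C. f i) + (\<Sum>i\<in>?E. f i)" for f :: "nat \<Rightarrow> real"
    by (subst sum.union_disjoint[symmetric]) (auto intro!: sum.cong)
  define w where "w i = (if ty T i = 1 then T - L i else 0)" for i
  have O: "(\<Sum>i\<in>?C. ov i) + (\<Sum>i\<in>?E. eo i) \<le> m * T" by (rule outside[OF T0])
  have In: "(\<Sum>i\<in>?C. iv i) \<le> (\<Sum>i\<in>?E. w i)"
  proof -
    have "(\<Sum>i\<in>{i. i < c \<and> ty T i = 1}. T - L i) = (\<Sum>i\<in>?E. w i)"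
      unfolding w_def by (rule sum.mono_neutral_cong_left) (auto simp: ty_exp[symmetric])
    then show ?thesis using inside by simp
  qed
  have lower: "(\<Sum>i\<in>?C. g i) \<le> (\<Sum>i\<in>?C. k i)" if "\<And>i. i < c ==> \<not> Exp i ==> g i \<le> k i" for g k :: "nat \<Rightarrow> real"
    by (rule sum_mono) (use that in auto)
  let ?F = "\<lambda>q i. fa q T i + fb q T i * T"
  have E: "?F 0 i = - 2 * eo i" "?F 1 i = - 2 * eo i + 2 * w i" "?F 2 i = - 4 * eo i + 2 * w i"
    if "i \<in> ?E" for i
    using that ty_exp[of i] by (auto simp: fa_def fb_def eo_def w_def Let_def le_Suc_eq numeral_2_eq_2)
  have Deq: "2 * D T i = 2 * (sm T i - real (bg T i) * s i) + bg T i * T" for i by (rule D_eq)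
  have ch: "ty T i = 3 \<or> ty T i = 4 \<or> ty T i = 5 \<or> ty T i = 6" if "\<not> Exp i" for i
    using that by (auto simp: ty_def)
  have F0: "- 2 * ov i \<le> ?F 0 i" and F1: "- 2 * (ov i + iv i) \<le> ?F 1 i"
    and F2: "- 2 * (2 * ov i + iv i) \<le> ?F 2 i" if i: "i < c" "\<not> Exp i" for i
    using ch[OF i(2)] class6[OF i(1)] class45[OF i(1)] class5[OF i(1)] L_le_ov_iv[OF i(1)]
      ov_nonneg[of i] iv_nonneg[of i] yp_le_iv[of i] Deq[of i]
    by (auto simp: fa_def fb_def Let_def numeral_2_eq_2)
  have l: "(\<Sum>i\<in>?C. - 2 * ov i) \<le> (\<Sum>i\<in>?C. ?F 0 i)"
    "(\<Sum>i\<in>?C. - 2 * (ov i + iv i)) \<le> (\<Sum>i\<in>?C. ?F 1 i)"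
    "(\<Sum>i\<in>?C. - 2 * (2 * ov i + iv i)) \<le> (\<Sum>i\<in>?C. ?F 2 i)"
    by (intro lower F0 F1 F2; assumption)+
  have "0 \<le> FA q T + FB q T * T" if "q < 3" for q
  proof -
    have "q = 0 \<or> q = 1 \<or> q = 2" using that by auto
    then show ?thesis
    proof (elim disjE)
      assume q: "q = 0"
      have "(\<Sum>i\<in>?E. ?F 0 i) = - 2 * (\<Sum>i\<in>?E. eo i)" using E(1) by (simp add: sum_distrib_left)
      then show ?thesis using l(1) O by (simp add: FF_eq q split sum_distrib_left[symmetric] sum_negf)
    next
      assume q: "q = 1"
      have "(\<Sum>i\<in>?E. ?F 1 i) = - 2 * (\<Sum>i\<in>?E. eo i) + 2 * (\<Sum>i\<in>?E. w i)"
        using E(2) by (simp add: sum_distrib_left sum_subtractf sum_negf)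
      then show ?thesis using l(2) O In
        by (simp add: FF_eq q split sum_distrib_left[symmetric] sum_negf sum.distrib sum_subtractf)
    next
      assume q: "q = 2"
      have "(\<Sum>i\<in>?E. ?F 2 i) = - 4 * (\<Sum>i\<in>?E. eo i) + 2 * (\<Sum>i\<in>?E. w i)"
        using E(3) by (simp add: sum_distrib_left sum_subtractf sum_negf)
      then show ?thesis using l(3) O In
        by (simp add: FF_eq q split sum_distrib_left[symmetric] sum_negf sum.distrib sum_subtractf)
    qed
  qed
  then show ?thesis unfolding acc_def ok0_def using mc_sum job_le by blast
qed

end

section \<open>Wrapping around the gaps\<close>

text \<open>Current machine, current time, end of the usable time on that machine, and the class
  currently set up, with \<open>- 1\<close> for none.\<close>

type_synonym cursor = "int \<times> real \<times> real \<times> int"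

definition mk :: "item \<Rightarrow> int \<Rightarrow> real \<Rightarrow> real \<Rightarrow> entry" where
  "mk x k a b = \<lparr>item_of = x, machine_of = nat k, start_of = a, finish_of = b\<rparr>"

lemma mk_sel[simp]: "item_of (mk x k a b) = x" "machine_of (mk x k a b) = nat k"
  "start_of (mk x k a b) = a" "finish_of (mk x k a b) = b"
  by (simp_all add: mk_def)

text \<open>\<open>lm\<close> is the end of the track, \<open>p\<close> the time at which a fresh
  machine begins to be used and \<open>b0\<close> the end of its usable time. With no machine left
  the cursor moves on without writing, so that a machine number of at least \<open>lm\<close> marks
  exhaustion.\<close>

definition opn :: "int \<Rightarrow> real \<Rightarrow> real \<Rightarrow> real \<Rightarrow> nat \<Rightarrow> cursor \<Rightarrow> cursor \<times> schedule" where
  "opn lm s p b0 i = (\<lambda>(k, x, b, r). if r = int i then ((k, x, b, r), [])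
     else if k < lm \<and> x + s \<le> b then ((k, x + s, b, int i), [mk (Setup i) k x (x + s)])
     else ((k + 1, p + s, b0, int i), if k + 1 < lm then [mk (Setup i) (k + 1) p (p + s)] else []))"

text \<open>The last result is the amount actually placed. It falls short of \<open>a\<close> only
  at the end of the track, and the other cursor then receives the difference.\<close>

definition pce :: "int \<Rightarrow> real \<Rightarrow> real \<Rightarrow> real \<Rightarrow> nat \<Rightarrow> nat \<Rightarrow> real \<Rightarrow> cursor \<Rightarrow> cursor \<times> schedule \<times> real" where
  "pce lm s p b0 i j a = (\<lambda>(k, x, b, r). if lm \<le> k then ((k, x, b, r), [], 0)
     else if x + a \<le> b then ((k, x + a, b, r), [mk (Piece j) k x (x + a)], a)
     else if k + 1 < lm then ((k + 1, p + s + (a - (b - x)), b0, r),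
       (if x < b then [mk (Piece j) k x b] else []) @
         [mk (Setup i) (k + 1) p (p + s), mk (Piece j) (k + 1) (p + s) (p + s + (a - (b - x)))], a)
     else ((k + 1, p + s, b0, r), if x < b then [mk (Piece j) k x b] else [], b - x))"

text \<open>\<open>b0\<close> limits a machine opened by a new class and \<open>b1\<close> one
  opened by wrapping. They differ only for type 0, where the first machine takes the remainder as
  well.\<close>

definition put :: "int \<Rightarrow> real \<Rightarrow> real \<Rightarrow> real \<Rightarrow> real \<Rightarrow> nat \<Rightarrow> nat \<Rightarrow> real \<Rightarrow> cursor \<Rightarrow> cursor \<times> schedule \<times> real" where
  "put lm s p b0 b1 i j a c0 = (if 0 < a then
     let (c1, E1) = opn lm s p b0 i c0; (c2, E2, d) = pce lm s p b1 i j a c1 in (c2, E1 @ E2, d)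
     else (c0, [], 0))"

definition tot :: "schedule \<Rightarrow> nat \<Rightarrow> real" where
  "tot S j = (\<Sum>e \<leftarrow> filter (\<lambda>e. item_of e = Piece j) S. finish_of e - start_of e)"

lemma tot_simps[simp]: "tot [] j = 0" "tot (S @ S') j = tot S j + tot S' j"
  "tot (e # S) j = (if item_of e = Piece j then finish_of e - start_of e else 0) + tot S j"
  by (simp_all add: tot_def)

section \<open>Invariants of two cursors on separate tracks\<close>

locale tracks = inst +
  fixes T :: real and A l :: int
  assumes Tpos: "0 < T" and Al: "0 \<le> A" "0 \<le> l" "A + l \<le> int m"
begin

text \<open>The entries below \<open>T / 2\<close> on the machines \<open>A, ..., A + l - 1\<close> form one track, all others a
  second one; each track is written by its own cursor.\<close>

definition se :: "entry \<Rightarrow> bool" where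
  "se e \<longleftrightarrow> A \<le> int (machine_of e) \<and> int (machine_of e) < A + l \<and> finish_of e \<le> T / 2"

text \<open>Strengthens \<open>set_up\<close> by requiring the setup to lie in the track of the
  entry. Whatever the other cursor adds on that machine is then on the other side of
  \<open>T / 2\<close> and cannot fall between the two.\<close>

definition su :: "schedule \<Rightarrow> entry \<Rightarrow> bool" where
  "su S e \<longleftrightarrow> (\<exists>q\<in>set S. se q = se e \<and> item_of q = Setup (item_class I (item_of e)) \<and>
     machine_of q = machine_of e \<and> finish_of q \<le> start_of e \<and>
     (\<forall>g\<in>set S. machine_of g = machine_of e \<and> finish_of q \<le> start_of g \<and> finish_of g \<le> start_of e \<longrightarrow>
        item_class I (item_of g) = item_class I (item_of e)))"

text \<open>Feasibility of a partial schedule: everything except completeness of the jobs, together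
  with the separation of the tracks at \<open>T / 2\<close> and the final bound on the
  makespan.\<close>

definition fz :: "schedule \<Rightarrow> bool" where
  "fz S \<longleftrightarrow> (\<forall>e\<in>set S. well_timed I e \<and> start_of e < finish_of e) \<and>
     sorted_wrt (\<lambda>e e'. machine_of e = machine_of e' \<longrightarrow> separated e e') S \<and>
     sorted_wrt (\<lambda>e e'. \<forall>j. item_of e = Piece j \<and> item_of e' = Piece j \<longrightarrow> separated e e') S \<and>
     (\<forall>e\<in>set S. \<forall>j. item_of e = Piece j \<longrightarrow> su S e) \<and>
     (\<forall>e\<in>set S. A \<le> int (machine_of e) \<and> int (machine_of e) < A + l \<and> \<not> se e \<longrightarrow> T / 2 \<le> start_of e) \<and>
     (\<forall>e\<in>set S. finish_of e \<le> 3 / 2 * T)"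

text \<open>The cursor is past everything written in its track, and the setup of its current class
  is still in force, so that a further piece of that class is legal at once.\<close>

definition cin :: "bool \<Rightarrow> schedule \<Rightarrow> int \<Rightarrow> real \<Rightarrow> int \<Rightarrow> int \<Rightarrow> bool" where
  "cin d S k x r lm \<longleftrightarrow>
     (\<forall>e\<in>set S. se e = d \<longrightarrow> int (machine_of e) \<le> k \<and> (int (machine_of e) = k \<longrightarrow> finish_of e \<le> x)) \<and>
     (0 \<le> r \<and> k < lm \<longrightarrow> (\<exists>q\<in>set S. se q = d \<and> item_of q = Setup (nat r) \<and> int (machine_of q) = k \<and>
        finish_of q \<le> x \<and> (\<forall>g\<in>set S. se g = d \<and> machine_of g = machine_of q \<and> finish_of q \<le> start_of g \<longrightarrow>
          item_class I (item_of g) = nat r)))"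

lemma fz_feasible:
  assumes "fz S" "\<And>j. j < n ==> tot S j = t j" shows "feasible_pmtn I S"
proof -
  have pw: "R (S ! a) (S ! b)" if "sorted_wrt R S" "a < length S" "b < length S" "a \<noteq> b" "\<And>x y. R x y ==> R y x" for R a b
    using that sorted_wrt_nth_less[OF that(1), of a b] sorted_wrt_nth_less[OF that(1), of b a] by (cases a b rule: linorder_cases) auto
  have 1: "machine_of (S ! a) = machine_of (S ! b) \<longrightarrow> separated (S ! a) (S ! b)"
    if "a < length S" "b < length S" "a \<noteq> b" for a b
    by (rule pw[of "\<lambda>e e'. machine_of e = machine_of e' \<longrightarrow> separated e e'"])
      (use assms(1) that in \<open>auto simp: fz_def separated_def\<close>)
  have 2: "\<forall>j. item_of (S ! a) = Piece j \<and> item_of (S ! b) = Piece j \<longrightarrow> separated (S ! a) (S ! b)"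
    if "a < length S" "b < length S" "a \<noteq> b" for a b
    by (rule pw[of "\<lambda>e e'. \<forall>j. item_of e = Piece j \<and> item_of e' = Piece j \<longrightarrow> separated e e'"])
      (use assms(1) that in \<open>auto simp: fz_def separated_def\<close>)
  have "su S e ==> set_up I S e" for e unfolding su_def set_up_def by blast
  then have 3: "\<forall>e\<in>set S. \<forall>j. item_of e = Piece j \<longrightarrow> set_up I S e" using assms(1) by (auto simp: fz_def)
  have 4: "\<forall>e\<in>set S. well_timed I e" using assms(1) by (auto simp: fz_def)
  have 5: "\<forall>j<num_jobs I. (\<Sum>e\<leftarrow>filter (\<lambda>e. item_of e = Piece j) S. finish_of e - start_of e) = real (job_times I ! j)"
    using assms(2) by (simp add: tot_def t_def)
  show ?thesis unfolding feasible_pmtn_def using 1 2 3 4 5 by blast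
qed

text \<open>Only entries of the same track have to be compared with the new one in machine order,
  because on a common machine the two tracks meet at \<open>T / 2\<close>.\<close>

lemma fz_snoc:
  assumes fz: "fz S" and wt: "well_timed I e" "start_of e < finish_of e"
    and M0: "\<not> se e ==> A \<le> int (machine_of e) ==> int (machine_of e) < A + l ==> T / 2 \<le> start_of e"
    and after: "\<And>g. g \<in> set S ==> se g = se e ==> machine_of g = machine_of e ==> finish_of g \<le> start_of e"
    and job: "\<And>g j. g \<in> set S ==> item_of e = Piece j ==> item_of g = Piece j ==> separated g e"
    and fin: "finish_of e \<le> 3 / 2 * T"
    and sue: "\<And>j. item_of e = Piece j ==> su (S @ [e]) e"
  shows "fz (S @ [e])"
proof -
  have len: "start_of g < finish_of g" if "g \<in> set S" for g using fz that by (auto simp: fz_def)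
  have M0S: "T / 2 \<le> start_of g" if "g \<in> set S" "\<not> se g" "A \<le> int (machine_of g)" "int (machine_of g) < A + l" for g
    using fz that by (auto simp: fz_def)
  have sep: "separated g e" if g: "g \<in> set S" "machine_of g = machine_of e" for g
  proof (cases "se g = se e")
    case True then show ?thesis using after g by (auto simp: separated_def)
  next
    case False
    then consider "se e" "\<not> se g" | "\<not> se e" "se g" by blast
    then show ?thesis
    proof cases
      case 1
      then have "T / 2 \<le> start_of g" "finish_of e \<le> T / 2" using M0S[OF g(1)] g(2) by (auto simp: se_def)
      then show ?thesis by (simp add: separated_def)
    next
      case 2
      then have "T / 2 \<le> start_of e" "finish_of g \<le> T / 2" using M0 g(2) by (auto simp: se_def)
      then show ?thesis by (simp add: separated_def)
    qed
  qed
  have "su (S @ [e]) g" if g: "g \<in> set S" "item_of g = Piece j" for g j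
  proof -
    have "su S g" using fz g by (auto simp: fz_def)
    then obtain q where q: "q \<in> set S" "se q = se g" "item_of q = Setup (item_class I (item_of g))"
      "machine_of q = machine_of g" "finish_of q \<le> start_of g"
      "\<And>h. h \<in> set S ==> machine_of h = machine_of g ==> finish_of q \<le> start_of h ==> finish_of h \<le> start_of g ==>
        item_class I (item_of h) = item_class I (item_of g)"
      unfolding su_def by blast
    have "\<not> (machine_of e = machine_of g \<and> finish_of q \<le> start_of e \<and> finish_of e \<le> start_of g)"
    proof (rule notI, elim conjE)
      assume *: "machine_of e = machine_of g" "finish_of q \<le> start_of e" "finish_of e \<le> start_of g"
      show False
      proof (cases "se g = se e")
        case True then show False using after[OF g(1)] * len[OF g(1)] wt(2) by auto
      next
        case False
        show False
        proof (cases "se e")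
          case True
          then have "\<not> se q" "A \<le> int (machine_of q)" "int (machine_of q) < A + l" "finish_of e \<le> T / 2"
            using False q * by (auto simp: se_def)
          then show False using M0S[OF q(1)] len[OF q(1)] * wt(2) by linarith
        next
          case 2: False
          then have "se g" using False by simp
          then show False using M0[OF 2] * wt(2) len[OF g(1)] by (auto simp: se_def)
        qed
      qed
    qed
    then show ?thesis unfolding su_def using q by (intro bexI[of _ q]) auto
  qed
  then show ?thesis using fz wt M0 sep job sue fin unfolding fz_def
    by (simp add: sorted_wrt_append) (metis Un_iff list.set_intros(1))
qed

definition place :: "bool \<Rightarrow> int \<Rightarrow> real \<Rightarrow> real \<Rightarrow> bool" where
  "place d k a b \<longleftrightarrow> 0 \<le> k \<and> k < int m \<and> 0 \<le> a \<and> a < b \<and>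
     (if d then A \<le> k \<and> k < A + l \<and> b \<le> T / 2 else b \<le> 3 / 2 * T \<and> (A \<le> k \<and> k < A + l \<longrightarrow> T / 2 \<le> a))"

lemma place_se: "place d k a b ==> se (mk x k a b) = d"
  by (auto simp: place_def se_def split: if_splits)

lemma add_setup:
  assumes "fz S" "cin d S k x r lm" "cin (\<not> d) S k2 x2 r2 lm2" "i < c" "place d k' a (a + s i)"
    "k' > k \<or> k' = k \<and> x \<le> a"
  shows "fz (S @ [mk (Setup i) k' a (a + s i)])" "cin d (S @ [mk (Setup i) k' a (a + s i)]) k' (a + s i) (int i) lm"
    "cin (\<not> d) (S @ [mk (Setup i) k' a (a + s i)]) k2 x2 r2 lm2"
proof -
  let ?e = "mk (Setup i) k' a (a + s i)"
  have pl: "0 \<le> k'" "k' < int m" "0 \<le> a" "0 < s i" using assms(4,5) s_pos by (auto simp: place_def)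
  have se: "se ?e = d" by (rule place_se[OF assms(5)])
  have wt: "well_timed I ?e" using pl assms(4) by (auto simp: s_def)
  have c1: "int (machine_of g) \<le> k" "int (machine_of g) = k ==> finish_of g \<le> x" if "g \<in> set S" "se g = d" for g
    using assms(2) that unfolding cin_def by blast+
  have aft: "finish_of g \<le> a" if "g \<in> set S" "se g = d" "machine_of g = nat k'" for g
    using c1[OF that(1,2)] assms(6) that(3) pl(1) by auto
  show "fz (S @ [?e])"
    by (rule fz_snoc[OF assms(1) wt]) (use pl aft se assms(5) Tpos in \<open>auto simp: place_def split: if_splits\<close>)
  have len: "start_of g < finish_of g" if "g \<in> set S" for g using assms(1) that by (auto simp: fz_def)
  show "cin d (S @ [?e]) k' (a + s i) (int i) lm"
    unfolding cin_def
  proof (intro conjI impI ballI)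
    fix g assume g: "g \<in> set (S @ [?e])" "se g = d"
    show "int (machine_of g) \<le> k'"
      using g c1[of g] assms(6) pl by (cases "g = ?e") auto
    assume "int (machine_of g) = k'"
    then show "finish_of g \<le> a + s i" using g aft[of g] pl by (cases "g = ?e") auto
  next
    show "\<exists>q\<in>set (S @ [?e]). se q = d \<and> item_of q = Setup (nat (int i)) \<and> int (machine_of q) = k' \<and>
       finish_of q \<le> a + s i \<and> (\<forall>g\<in>set (S @ [?e]). se g = d \<and> machine_of g = machine_of q \<and>
         finish_of q \<le> start_of g \<longrightarrow> item_class I (item_of g) = nat (int i))"
      by (intro bexI[of _ ?e]) (use se pl aft len in \<open>fastforce\<close>)+
  qed
  show "cin (\<not> d) (S @ [?e]) k2 x2 r2 lm2" using assms(3) se unfolding cin_def by auto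
qed

lemma add_piece:
  assumes "fz S" "cin d S k x (int i) lm" "cin (\<not> d) S k2 x2 r2 lm2" "j < n" "cl j = i" "place d k a b"
    "k < lm" "x \<le> a" "\<And>g. g \<in> set S ==> item_of g = Piece j ==> finish_of g \<le> a \<or> b \<le> start_of g"
  shows "fz (S @ [mk (Piece j) k a b])" "cin d (S @ [mk (Piece j) k a b]) k b (int i) lm"
    "cin (\<not> d) (S @ [mk (Piece j) k a b]) k2 x2 r2 lm2"
proof -
  let ?e = "mk (Piece j) k a b"
  have pl: "0 \<le> k" "k < int m" "0 \<le> a" "a < b" using assms(6) by (auto simp: place_def)
  have se: "se ?e = d" by (rule place_se[OF assms(6)])
  have wt: "well_timed I ?e" using pl assms(4) by auto
  have c1: "int (machine_of g) \<le> k" "int (machine_of g) = k ==> finish_of g \<le> x" if "g \<in> set S" "se g = d" for g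
    using assms(2) that unfolding cin_def by blast+
  have aft: "finish_of g \<le> a" if "g \<in> set S" "se g = d" "machine_of g = nat k" for g
    using c1[OF that(1,2)] assms(8) that(3) pl(1) by auto
  have len: "start_of g < finish_of g" if "g \<in> set S" for g using assms(1) that by (auto simp: fz_def)
  have M0S: "T / 2 \<le> start_of g" if "g \<in> set S" "\<not> se g" "A \<le> int (machine_of g)" "int (machine_of g) < A + l" for g
    using assms(1) that by (auto simp: fz_def)
  have ic: "item_class I (Piece j) = i" using assms(5) by (simp add: cl_def)
  obtain q where q: "q \<in> set S" "se q = d" "item_of q = Setup i" "int (machine_of q) = k" "finish_of q \<le> x"
    "\<And>g. g \<in> set S ==> se g = d ==> machine_of g = machine_of q ==> finish_of q \<le> start_of g ==> item_class I (item_of g) = i"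
    using assms(2,7) unfolding cin_def by auto
  have "su (S @ [?e]) ?e"
    unfolding su_def
  proof (intro bexI[of _ q] conjI ballI impI)
    fix g assume g: "g \<in> set (S @ [?e])" "machine_of g = machine_of ?e \<and> finish_of q \<le> start_of g \<and> finish_of g \<le> start_of ?e"
    show "item_class I (item_of g) = item_class I (item_of ?e)"
    proof (cases "g = ?e")
      case False
      then have gS: "g \<in> set S" using g by auto
      have mg: "int (machine_of g) = k" "machine_of g = machine_of q" using g pl q(4) by auto
      \<comment> \<open>An entry of the other track lies on the other side of \<open>T / 2\<close>
        and hence not between the setup and the new piece.\<close>
      have "se g = d"
      proof (rule ccontr)
        assume sg: "se g \<noteq> d"
        show False
        proof (cases d)
          case True
          then have "A \<le> k" "k < A + l" "b \<le> T / 2" using assms(6) by (auto simp: place_def)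
          then show False using M0S[OF gS] sg True g mg(1) pl len[OF gS] by auto
        next
          case False
          then have "finish_of g \<le> T / 2" "A \<le> k" "k < A + l" using sg mg by (auto simp: se_def)
          then show False using M0S[OF q(1)] q(2,4) False g len[OF gS] len[OF q(1)] by auto
        qed
      qed
      then show ?thesis using q(6)[OF gS _ mg(2)] g ic by simp
    qed simp
  qed (use q se pl ic assms(8) in auto)
  then show "fz (S @ [?e])"
    by (intro fz_snoc[OF assms(1) wt]) (use pl aft se assms(6,9) Tpos in \<open>auto simp: place_def separated_def split: if_splits\<close>)
  show "cin d (S @ [?e]) k b (int i) lm"
    unfolding cin_def
  proof (intro conjI impI ballI)
    fix g assume g: "g \<in> set (S @ [?e])" "se g = d"
    show "int (machine_of g) \<le> k" using g c1[of g] pl by (cases "g = ?e") auto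
    assume "int (machine_of g) = k"
    then show "finish_of g \<le> b" using g aft[of g] pl by (cases "g = ?e") auto
  next
    show "\<exists>q\<in>set (S @ [?e]). se q = d \<and> item_of q = Setup (nat (int i)) \<and> int (machine_of q) = k \<and>
       finish_of q \<le> b \<and> (\<forall>g\<in>set (S @ [?e]). se g = d \<and> machine_of g = machine_of q \<and>
         finish_of q \<le> start_of g \<longrightarrow> item_class I (item_of g) = nat (int i))"
      by (intro bexI[of _ q]) (use q ic pl assms(8) in \<open>auto\<close>)
  qed
  show "cin (\<not> d) (S @ [?e]) k2 x2 r2 lm2" using assms(3) se unfolding cin_def by auto
qed

end

context tracks begin

lemma cin_skip: "cin d S k x r lm ==> lm \<le> k' ==> k < k' ==> cin d S k' x' r' lm"
proof -
  assume "cin d S k x r lm" and k: "lm \<le> k'" "k < k'"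
  then have "\<forall>e\<in>set S. se e = d \<longrightarrow> int (machine_of e) \<le> k" unfolding cin_def by blast
  then have "\<forall>e\<in>set S. se e = d \<longrightarrow> int (machine_of e) \<le> k' \<and> (int (machine_of e) = k' \<longrightarrow> finish_of e \<le> x')"
    using k(2) by fastforce
  then show ?thesis unfolding cin_def using k(1) by simp
qed

lemma opn_inv:
  assumes "fz S" "cin d S k x r lm" "cin (\<not> d) S k2 x2 r2 lm2" "i < c"
    and op: "opn lm (s i) p b0 i (k, x, b, r) = ((k1, x1, b1, r1), E)"
    and O1: "r \<noteq> int i ==> k < lm ==> x + s i \<le> b ==> place d k x (x + s i)"
    and O2: "r \<noteq> int i ==> \<not> (k < lm \<and> x + s i \<le> b) ==> k + 1 < lm ==> place d (k + 1) p (p + s i)"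
  shows "fz (S @ E)" "cin d (S @ E) k1 x1 (int i) lm" "cin (\<not> d) (S @ E) k2 x2 r2 lm2" "r1 = int i"
    "\<forall>e\<in>set E. \<forall>j. item_of e \<noteq> Piece j"
proof -
  consider "r = int i" | "r \<noteq> int i" "k < lm" "x + s i \<le> b"
    | "r \<noteq> int i" "\<not> (k < lm \<and> x + s i \<le> b)" "k + 1 < lm"
    | "r \<noteq> int i" "\<not> (k < lm \<and> x + s i \<le> b)" "\<not> k + 1 < lm" by blast
  then have "fz (S @ E) \<and> cin d (S @ E) k1 x1 (int i) lm \<and> cin (\<not> d) (S @ E) k2 x2 r2 lm2 \<and> r1 = int i \<and>
    (\<forall>e\<in>set E. \<forall>j. item_of e \<noteq> Piece j)"
  proof cases
    case 1 then show ?thesis using assms by (auto simp: opn_def)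
  next
    case 2
    then have "E = [mk (Setup i) k x (x + s i)]" "k1 = k" "x1 = x + s i" "r1 = int i" using op by (auto simp: opn_def)
    then show ?thesis using add_setup[OF assms(1-4) O1[OF 2]] by simp
  next
    case 3
    then have "E = [mk (Setup i) (k + 1) p (p + s i)]" "k1 = k + 1" "x1 = p + s i" "r1 = int i" using op by (auto simp: opn_def)
    then show ?thesis using add_setup[OF assms(1-4) O2[OF 3]] by simp
  next
    case 4
    then have "E = []" "k1 = k + 1" "r1 = int i" using op by (auto simp: opn_def)
    then show ?thesis using assms(1,3) cin_skip[OF assms(2)] 4 by auto
  qed
  then show "fz (S @ E)" "cin d (S @ E) k1 x1 (int i) lm" "cin (\<not> d) (S @ E) k2 x2 r2 lm2" "r1 = int i"
    "\<forall>e\<in>set E. \<forall>j. item_of e \<noteq> Piece j" by auto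
qed

text \<open>\<open>z\<close> bounds the end of what the other cursor has written of this job. The
  last condition of \<open>P4\<close> makes the wrapped part on the next machine end before the
  first part starts, so that all pieces of the job are disjoint in time.\<close>

lemma pce_inv:
  assumes "fz S" "cin d S k x (int i) lm" "cin (\<not> d) S k2 x2 r2 lm2" "j < n" "cl j = i" "0 < a"
    and pc: "pce lm (s i) p b1 i j a (k, x, b, int i) = ((k', x', b', r'), E, dd)"
    and Z: "\<And>g. g \<in> set S ==> item_of g = Piece j ==> finish_of g \<le> z"
    and P1: "k < lm ==> z \<le> x"
    and P2: "k < lm ==> x + a \<le> b ==> place d k x (x + a)"
    and P3: "k < lm ==> \<not> x + a \<le> b ==> x \<le> b \<and> (x < b \<longrightarrow> place d k x b)"
    and P4: "k + 1 < lm ==> \<not> x + a \<le> b ==> place d (k + 1) p (p + s i) \<and> z \<le> p + s i \<and>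
       place d (k + 1) (p + s i) (p + s i + (a - (b - x))) \<and> p + s i + (a - (b - x)) \<le> x"
  shows "fz (S @ E)" "cin d (S @ E) k' x' (int i) lm" "cin (\<not> d) (S @ E) k2 x2 r2 lm2" "r' = int i"
    "tot E j = dd" "\<forall>e\<in>set E. \<forall>j'. item_of e = Piece j' \<longrightarrow> j' = j"
proof -
  have ic: "i < c" using cl_less assms(4,5) by blast
  let ?E1 = "if x < b then [mk (Piece j) k x b] else []"
  let ?A = "mk (Setup i) (k + 1) p (p + s i)"
  let ?B = "mk (Piece j) (k + 1) (p + s i) (p + s i + (a - (b - x)))"
  have first: "fz (S @ ?E1) \<and> cin d (S @ ?E1) k b (int i) lm \<and> cin (\<not> d) (S @ ?E1) k2 x2 r2 lm2"
    if kk: "k < lm" "\<not> x + a \<le> b"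
  proof (cases "x < b")
    case True
    then have pl: "place d k x b" using P3[OF kk] by simp
    have "finish_of g \<le> x \<or> b \<le> start_of g" if "g \<in> set S" "item_of g = Piece j" for g
      using Z[OF that] P1[OF kk(1)] by linarith
    from add_piece[OF assms(1-5) pl kk(1) order_refl this] True show ?thesis by auto
  next
    case False
    then have "x = b" using P3[OF kk] by simp
    then show ?thesis using assms(1-3) False by simp
  qed
  consider "lm \<le> k" | "k < lm" "x + a \<le> b" | "k + 1 < lm" "\<not> x + a \<le> b"
    | "k < lm" "\<not> k + 1 < lm" "\<not> x + a \<le> b" by linarith
  then have "fz (S @ E) \<and> cin d (S @ E) k' x' (int i) lm \<and> cin (\<not> d) (S @ E) k2 x2 r2 lm2 \<and> r' = int i \<and>
    tot E j = dd \<and> (\<forall>e\<in>set E. \<forall>j'. item_of e = Piece j' \<longrightarrow> j' = j)"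
  proof cases
    case 1
    then have "E = []" "k' = k" "x' = x" "r' = int i" "dd = 0" using pc by (auto simp: pce_def)
    then show ?thesis using assms by simp
  next
    case 2
    then have E: "E = [mk (Piece j) k x (x + a)]" "k' = k" "x' = x + a" "r' = int i" "dd = a" using pc by (auto simp: pce_def)
    have "finish_of g \<le> x \<or> x + a \<le> start_of g" if "g \<in> set S" "item_of g = Piece j" for g
      using Z[OF that] P1[OF 2(1)] by linarith
    from add_piece[OF assms(1-5) P2[OF 2] 2(1) order_refl this] E show ?thesis by auto
  next
    case 3
    then have E: "E = ?E1 @ [?A, ?B]" "k' = k + 1" "x' = p + s i + (a - (b - x))" "r' = int i" "dd = a"
      using pc by (auto simp: pce_def)
    have kl: "k < lm" using 3 by simp
    note f = first[OF kl 3(2)] and p4 = P4[OF 3]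
    have s2: "fz ((S @ ?E1) @ [?A])" "cin d ((S @ ?E1) @ [?A]) (k + 1) (p + s i) (int i) lm"
      "cin (\<not> d) ((S @ ?E1) @ [?A]) k2 x2 r2 lm2"
      using add_setup[OF f[THEN conjunct1] f[THEN conjunct2, THEN conjunct1] f[THEN conjunct2, THEN conjunct2]
          ic p4[THEN conjunct1]] by auto
    have jb: "finish_of g \<le> p + s i \<or> p + s i + (a - (b - x)) \<le> start_of g"
      if g: "g \<in> set ((S @ ?E1) @ [?A])" "item_of g = Piece j" for g
    proof (cases "g \<in> set S")
      case True then show ?thesis using Z[OF True g(2)] p4 by linarith
    next
      case False then show ?thesis using g p4 by (auto split: if_splits)
    qed
    have plB: "place d (k + 1) (p + s i) (p + s i + (a - (b - x)))" using p4 by blast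
    note s3 = add_piece[OF s2 assms(4,5) plB 3(1) order_refl jb]
    have SE: "S @ E = ((S @ ?E1) @ [?A]) @ [?B]" unfolding E(1) by (simp only: append_assoc append.simps)
    have "fz (S @ E) \<and> cin d (S @ E) k' x' (int i) lm \<and> cin (\<not> d) (S @ E) k2 x2 r2 lm2"
      unfolding SE E(2,3) using s3 by blast
    moreover have "x \<le> b" using P3[OF kl 3(2)] by simp
    then have "tot E j = a" unfolding E(1) by (cases "x < b") simp_all
    moreover have "\<forall>e\<in>set E. \<forall>j'. item_of e = Piece j' \<longrightarrow> j' = j" unfolding E(1) by simp
    ultimately show ?thesis using E(4,5) by blast
  next
    case 4
    then have E: "E = ?E1" "k' = k + 1" "r' = int i" "dd = b - x" using pc by (auto simp: pce_def)
    have "lm \<le> k + 1" using 4 by simp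
    then have "cin d (S @ ?E1) (k + 1) x' (int i) lm" using first[OF 4(1,3)] cin_skip[of d "S @ ?E1" k b "int i" lm "k + 1"] by auto
    moreover have "tot ?E1 j = b - x" using P3[OF 4(1,3)] by (cases "x < b") simp_all
    ultimately show ?thesis unfolding E using first[OF 4(1,3)] by simp
  qed
  then show "fz (S @ E)" "cin d (S @ E) k' x' (int i) lm" "cin (\<not> d) (S @ E) k2 x2 r2 lm2" "r' = int i"
    "tot E j = dd" "\<forall>e\<in>set E. \<forall>j'. item_of e = Piece j' \<longrightarrow> j' = j" by auto
qed

end

section \<open>The schedule as a fold over the jobs\<close>

context inst begin

definition AA :: "real \<Rightarrow> int" where "AA T = (\<Sum>i\<in>{i. i < c \<and> ty T i = 0}. al T i)"
definition ll :: "real \<Rightarrow> int" where "ll T = int (card {i. i < c \<and> ty T i = 1})"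

text \<open>The part of a job offered to the slots; the bound \<open>T / 2 - s i\<close> is what one
  slot holds beside the setup.\<close>

definition am :: "real \<Rightarrow> nat \<Rightarrow> real" where
  "am T j = (let i = cl j in if 3 \<le> ty T i \<and> ty T i \<le> 5 then min (t j) (T / 2 - s i) else 0)"
text \<open>Type 1 is pushed against \<open>3 / 2 * T\<close>, which frees the lower half of its
  machine. A cheap class ends its setup at \<open>T / 2\<close> on a fresh machine, so that its main
  pieces start no earlier than \<open>T / 2\<close> and avoid the slot pieces of the same
  job.\<close>

definition p0 :: "real \<Rightarrow> nat \<Rightarrow> real" where
  "p0 T i = (if ty T i = 1 then 3 / 2 * T - L i else if ty T i \<le> 2 then 0 else T / 2 - s i)"
text \<open>For type 0 the first machine takes the load that \<open>al T i - 1\<close> further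
  machines, each filled exactly to \<open>T\<close>, leave over. By \<open>al_bounds\<close> it ends
  between \<open>T\<close> and \<open>2 * T - s i\<close>, which is below \<open>3 / 2 * T\<close>
  for an expensive class.\<close>

definition bo :: "real \<Rightarrow> nat \<Rightarrow> real" where
  "bo T i = (if ty T i = 0 then L i - (al T i - 1) * (T - s i) else 3 / 2 * T)"
definition bc :: "real \<Rightarrow> nat \<Rightarrow> real" where
  "bc T i = (if ty T i = 0 then T else 3 / 2 * T)"

definition sl :: "real \<Rightarrow> cursor \<Rightarrow> nat \<Rightarrow> cursor \<times> schedule \<times> real" where
  "sl T c0 j = put (AA T + ll T) (s (cl j)) 0 (T / 2) (T / 2) (cl j) j (am T j) c0"
definition mp :: "real \<Rightarrow> cursor \<Rightarrow> nat \<Rightarrow> real \<Rightarrow> cursor \<times> schedule \<times> real" where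
  "mp T c0 j r = put (int m) (s (cl j)) (p0 T (cl j)) (bo T (cl j)) (bc T (cl j)) (cl j) j r c0"

definition step :: "real \<Rightarrow> cursor \<times> cursor \<times> schedule \<Rightarrow> nat \<Rightarrow> cursor \<times> cursor \<times> schedule" where
  "step T = (\<lambda>(cs, cm, S) j. let (cs', E1, d) = sl T cs j; (cm', E2, _) = mp T cm j (t j - d)
     in (cs', cm', S @ E1 @ E2))"

text \<open>The slots start after the \<open>AA T\<close> machines of type 0. The main cursor starts
  on a virtual full machine \<open>- 1\<close>, so that its first setup opens machine 0.\<close>

definition cs0 :: "real \<Rightarrow> cursor" where "cs0 T = (AA T, 0, T / 2, - 1)"
definition cm0 :: "real \<Rightarrow> cursor" where "cm0 T = (- 1, 3 / 2 * T, 3 / 2 * T, - 1)"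

text \<open>The obligations of the main cursor at one job. They are kept apart from the invariant
  because they follow from global volume counting, whereas the invariant is preserved
  locally.\<close>

definition okm :: "real \<Rightarrow> cursor \<Rightarrow> nat \<Rightarrow> real \<Rightarrow> bool" where
  "okm T c0 j a \<longleftrightarrow> (0 < a \<longrightarrow> (let i = cl j; p = p0 T i; (k, x, b, r) = c0;
     ((k1, x1, b1, r1), E) = opn (int m) (s i) p (bo T i) i c0;
     gd = (\<lambda>k. 0 \<le> k \<and> k < int m \<and> (AA T \<le> k \<and> k < AA T + ll T \<longrightarrow> T / 2 \<le> p)) in
     (r \<noteq> int i \<longrightarrow> (if k < int m \<and> x + s i \<le> b then 0 \<le> k \<and> T / 2 \<le> x else gd (k + 1))) \<and>
     0 \<le> k1 \<and> k1 < int m \<and> T / 2 \<le> x1 \<and> x1 \<le> b1 \<and> b1 \<le> 3 / 2 * T \<and>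
     (x1 + a \<le> b1 \<or> gd (k1 + 1) \<and> T / 2 \<le> p + s i \<and> p + s i + a \<le> b1)))"

end

locale constr = inst +
  fixes T :: real
  assumes acc: "acc T" and npos: "0 < n"
begin

lemma job_le: "j < n ==> s (cl j) + t j \<le> T" using acc by (simp add: acc_def ok0_def)
lemma s_less: "i < c ==> s i < T"
proof -
  assume "i < c"
  then obtain j where "j < n" "cl j = i" using J_ne[of i] by (auto simp: J_def)
  then show ?thesis using job_le[of j] t_pos[of j] by simp
qed
lemma T_pos: "0 < T" using s_less[OF cl_less[OF npos]] s_pos[OF cl_less[OF npos]] by linarith
lemma al1: "i < c ==> ty T i = 0 ==> 1 \<le> al T i"
  using s_less[of i] by (intro al_ge1) (auto simp: ty_def split: if_splits)

lemma mc_nonneg: "i < c ==> 0 \<le> mc T i" using al1[of i] by (auto simp: mc_def)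

lemma mc_split: "(\<Sum>i<c. mc T i) = AA T + ll T + int (card {i. i < c \<and> ty T i = 2})"
proof -
  have "(\<Sum>i<c. mc T i) = (\<Sum>i<c. (if ty T i = 0 then al T i else 0) + (if ty T i = 1 then 1 else 0)
      + (if ty T i = 2 then 1 else 0))"
    by (rule sum.cong) (auto simp: mc_def le_Suc_eq numeral_2_eq_2)
  also have "\<dots> = AA T + ll T + int (card {i. i < c \<and> ty T i = 2})"
    by (simp add: sum.distrib AA_def ll_def sum.If_cases) (simp add: lessThan_def Collect_conj_eq)
  finally show ?thesis .
qed

lemma mc_le: "AA T + ll T + int (card {i. i < c \<and> ty T i = 2}) \<le> int m"
  using acc mc_split by (simp add: acc_def ok0_def)

lemma AA_nonneg: "0 \<le> AA T" unfolding AA_def using al1 by (intro sum_nonneg) force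

sublocale tracks I T "AA T" "ll T"
  by unfold_locales (use T_pos AA_nonneg mc_le in \<open>auto simp: ll_def\<close>)

lemma p0_nonneg: "i < c ==> 0 \<le> p0 T i"
  using T_pos by (auto simp: p0_def ty_def split: if_splits)

lemma am_slot:
  assumes "0 < am T j"
  shows "am T j \<le> T / 2 - s (cl j)" "am T j \<le> t j" "4 * s (cl j) \<le> T"
  using assms by (auto simp: am_def Let_def ty_def split: if_splits)

definition inv :: "cursor \<times> cursor \<times> schedule \<Rightarrow> nat set \<Rightarrow> bool" where
  "inv st X \<longleftrightarrow> (case st of ((k, x, b, r), (k2, x2, b2, r2), S) \<Rightarrow>
     fz S \<and> cin True S k x r (AA T + ll T) \<and> cin False S k2 x2 r2 (int m) \<and>
     AA T \<le> k \<and> 0 \<le> x \<and> b = T / 2 \<and> x \<le> T / 2 \<and>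
     (\<forall>j\<in>X. tot S j = t j) \<and> (\<forall>e\<in>set S. \<forall>j. item_of e = Piece j \<longrightarrow> j \<in> X))"

lemma inv_init: "inv (cs0 T, cm0 T, []) {}"
  using T_pos by (auto simp: inv_def cs0_def cm0_def fz_def cin_def)

lemma tot_0: "(\<forall>e\<in>set S. \<forall>j. item_of e = Piece j \<longrightarrow> j \<in> X) ==> j \<notin> X ==> tot S j = 0"
  by (induction S) auto

lemma slot_put:
  assumes inv: "inv ((k, x, b, r), (k2, x2, b2, r2), S) X" and j: "j < n" "j \<notin> X"
    and sl: "sl T (k, x, b, r) j = ((k', x', b', r'), E, d)"
  shows "fz (S @ E)" "cin True (S @ E) k' x' r' (AA T + ll T)" "cin False (S @ E) k2 x2 r2 (int m)"
    "AA T \<le> k'" "0 \<le> x'" "b' = T / 2" "x' \<le> T / 2" "tot E j = d" "\<forall>e\<in>set E. \<forall>j'. item_of e = Piece j' \<longrightarrow> j' = j"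
    "\<forall>g\<in>set (S @ E). item_of g = Piece j \<longrightarrow> finish_of g \<le> T / 2" "d \<le> am T j" "0 \<le> d"
proof -
  let ?l = "AA T + ll T" and ?i = "cl j"
  have I: "fz S" "cin True S k x r ?l" "cin (\<not> True) S k2 x2 r2 (int m)" "AA T \<le> k" "0 \<le> x" "b = T / 2" "x \<le> T / 2"
    "\<forall>e\<in>set S. \<forall>j. item_of e = Piece j \<longrightarrow> j \<in> X" using inv by (auto simp: inv_def)
  have ic: "?i < c" using cl_less j by blast
  have A0: "0 \<le> AA T" "?l \<le> int m" using Al by auto
  have "fz (S @ E) \<and> cin True (S @ E) k' x' r' ?l \<and> cin False (S @ E) k2 x2 r2 (int m) \<and>
    AA T \<le> k' \<and> 0 \<le> x' \<and> b' = T / 2 \<and> x' \<le> T / 2 \<and> tot E j = d \<and>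
    (\<forall>e\<in>set E. \<forall>j'. item_of e = Piece j' \<longrightarrow> j' = j) \<and>
    (\<forall>g\<in>set E. item_of g = Piece j \<longrightarrow> finish_of g \<le> T / 2) \<and> d \<le> am T j \<and> 0 \<le> d"
  proof (cases "0 < am T j")
    case False
    then have "am T j = 0" using t_pos[OF j(1)] by (auto simp: am_def Let_def ty_def split: if_splits)
    then show ?thesis using sl I by (auto simp: sl_def put_def)
  next
    case True
    note ams = am_slot[OF True]
    have spos: "0 < s ?i" by (rule s_pos[OF ic])
    obtain k1 x1 b1 r1 E1 where op: "opn ?l (s ?i) 0 (T / 2) ?i (k, x, b, r) = ((k1, x1, b1, r1), E1)"
      by (metis prod_cases4 surj_pair)
    obtain E2 where pc: "pce ?l (s ?i) 0 (T / 2) ?i j (am T j) (k1, x1, b1, r1) = ((k', x', b', r'), E2, d)" "E = E1 @ E2"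
      using sl True op by (auto simp: sl_def put_def split: prod.splits)
    note oi = opn_inv[OF I(1-3) ic op]
    have o: "fz (S @ E1)" "cin True (S @ E1) k1 x1 (int ?i) ?l" "cin (\<not> True) (S @ E1) k2 x2 r2 (int m)" "r1 = int ?i"
      "\<forall>e\<in>set E1. \<forall>j. item_of e \<noteq> Piece j"
      by (rule oi; use I A0 ams spos T_pos in \<open>auto simp: place_def\<close>)+
    have c1: "AA T \<le> k1" "0 \<le> x1" "b1 = T / 2" "x1 \<le> T / 2"
      using op I spos ams T_pos by (auto simp: opn_def split: if_splits)
    have noj: "g \<in> set (S @ E1) ==> item_of g = Piece j ==> finish_of g \<le> 0" for g using I(8) j(2) o(5) by auto
    note pi = pce_inv[OF o(1-3) j(1) refl True pc(1)[unfolded o(4)] noj]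
    have q: "fz ((S @ E1) @ E2)" "cin True ((S @ E1) @ E2) k' x' (int ?i) ?l"
      "cin (\<not> True) ((S @ E1) @ E2) k2 x2 r2 (int m)" "r' = int ?i" "tot E2 j = d"
      "\<forall>e\<in>set E2. \<forall>j'. item_of e = Piece j' \<longrightarrow> j' = j"
      by (rule pi; use c1 A0 ams spos T_pos True in \<open>auto simp: place_def\<close>)+
    have "tot E1 j = 0" using o(5) by (intro tot_0[of _ "{}"]) auto
    moreover have "AA T \<le> k' \<and> 0 \<le> x' \<and> b' = T / 2 \<and> x' \<le> T / 2 \<and> d \<le> am T j \<and> 0 \<le> d"
      using pc(1) c1 spos ams T_pos True by (auto simp: pce_def split: if_splits)
    moreover have "\<forall>g\<in>set E2. item_of g = Piece j \<longrightarrow> finish_of g \<le> T / 2"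
      using pc(1) c1 spos ams T_pos True by (auto simp: pce_def split: if_splits)
    ultimately show ?thesis using q o(5) pc(2) by auto
  qed
  moreover have "\<forall>g\<in>set S. item_of g \<noteq> Piece j" using I(8) j(2) by auto
  ultimately show "fz (S @ E)" "cin True (S @ E) k' x' r' (AA T + ll T)" "cin False (S @ E) k2 x2 r2 (int m)"
    "AA T \<le> k'" "0 \<le> x'" "b' = T / 2" "x' \<le> T / 2" "tot E j = d" "\<forall>e\<in>set E. \<forall>j'. item_of e = Piece j' \<longrightarrow> j' = j"
    "\<forall>g\<in>set (S @ E). item_of g = Piece j \<longrightarrow> finish_of g \<le> T / 2" "d \<le> am T j" "0 \<le> d" by auto
qed

text \<open>Slot pieces of the job end by \<open>T / 2\<close>, and \<open>okm\<close> makes main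
  pieces start at \<open>T / 2\<close> or later; this is \<open>pce_inv\<close> with
  \<open>z = T / 2\<close>.\<close>

lemma main_put:
  assumes I: "fz S" "cin False S k x r (int m)" "cin (\<not> False) S k2 x2 r2 lm2"
    and j: "j < n" and Z: "\<And>g. g \<in> set S ==> item_of g = Piece j ==> finish_of g \<le> T / 2"
    and a: "0 \<le> a" and ok: "okm T (k, x, b, r) j a"
    and mp: "mp T (k, x, b, r) j a = ((k', x', b', r'), E, d)"
  shows "fz (S @ E)" "cin False (S @ E) k' x' r' (int m)" "cin (\<not> False) (S @ E) k2 x2 r2 lm2"
    "tot E j = a" "\<forall>e\<in>set E. \<forall>j'. item_of e = Piece j' \<longrightarrow> j' = j"
proof -
  let ?i = "cl j"
  have ic: "?i < c" using cl_less j by blast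
  have "fz (S @ E) \<and> cin False (S @ E) k' x' r' (int m) \<and> cin (\<not> False) (S @ E) k2 x2 r2 lm2 \<and>
    tot E j = a \<and> (\<forall>e\<in>set E. \<forall>j'. item_of e = Piece j' \<longrightarrow> j' = j)"
  proof (cases "0 < a")
    case False
    then show ?thesis using mp I a by (auto simp: mp_def put_def)
  next
    case True
    let ?p = "p0 T ?i"
    have spos: "0 < s ?i" by (rule s_pos[OF ic])
    have pp: "0 \<le> ?p" by (rule p0_nonneg[OF ic])
    obtain k1 x1 b1 r1 E1 where op: "opn (int m) (s ?i) ?p (bo T ?i) ?i (k, x, b, r) = ((k1, x1, b1, r1), E1)"
      by (metis prod_cases4 surj_pair)
    obtain E2 where pc: "pce (int m) (s ?i) ?p (bc T ?i) ?i j a (k1, x1, b1, r1) = ((k', x', b', r'), E2, d)" "E = E1 @ E2"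
      using mp True op by (auto simp: mp_def put_def split: prod.splits)
    let ?gd = "\<lambda>k. 0 \<le> k \<and> k < int m \<and> (AA T \<le> k \<and> k < AA T + ll T \<longrightarrow> T / 2 \<le> ?p)"
    have ok': "(r \<noteq> int ?i \<longrightarrow> (if k < int m \<and> x + s ?i \<le> b then 0 \<le> k \<and> T / 2 \<le> x else ?gd (k + 1))) \<and>
     0 \<le> k1 \<and> k1 < int m \<and> T / 2 \<le> x1 \<and> x1 \<le> b1 \<and> b1 \<le> 3 / 2 * T \<and>
     (x1 + a \<le> b1 \<or> ?gd (k1 + 1) \<and> T / 2 \<le> ?p + s ?i \<and> ?p + s ?i + a \<le> b1)"
      using ok True op by (auto simp: okm_def Let_def)
    have new: "k1 = k + 1 \<and> x1 = ?p + s ?i" if "r \<noteq> int ?i" "\<not> (k < int m \<and> x + s ?i \<le> b)"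
      using that op by (auto simp: opn_def)
    have old: "k1 = k \<and> x1 = x + s ?i" if "r \<noteq> int ?i" "k < int m" "x + s ?i \<le> b"
      using that op by (auto simp: opn_def)
    have O1: "place False k x (x + s ?i)" if "r \<noteq> int ?i" "k < int m" "x + s ?i \<le> b"
      using that ok' spos old[OF that] T_pos by (auto simp: place_def)
    have O2: "place False (k + 1) ?p (?p + s ?i)" if "r \<noteq> int ?i" "\<not> (k < int m \<and> x + s ?i \<le> b)"
      using that ok' spos new[OF that] pp by (auto simp: place_def simp del: not_less de_Morgan_conj)
    have o: "fz (S @ E1)" "cin False (S @ E1) k1 x1 (int ?i) (int m)" "cin (\<not> False) (S @ E1) k2 x2 r2 lm2" "r1 = int ?i"
      "\<forall>e\<in>set E1. \<forall>j. item_of e \<noteq> Piece j"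
      by (rule opn_inv[OF I ic op]; use O1 O2 in blast)+
    have Z': "g \<in> set (S @ E1) ==> item_of g = Piece j ==> finish_of g \<le> T / 2" for g using Z o(5) by auto
    note pi = pce_inv[OF o(1-3) j refl True pc(1)[unfolded o(4)] Z']
    have P2: "x1 + a \<le> b1 ==> place False k1 x1 (x1 + a)" and
      P3: "\<not> x1 + a \<le> b1 ==> x1 \<le> b1 \<and> (x1 < b1 \<longrightarrow> place False k1 x1 b1)"
      using ok' True T_pos by (auto simp: place_def)
    have P4: "place False (k1 + 1) ?p (?p + s ?i) \<and> T / 2 \<le> ?p + s ?i \<and>
       place False (k1 + 1) (?p + s ?i) (?p + s ?i + (a - (b1 - x1))) \<and> ?p + s ?i + (a - (b1 - x1)) \<le> x1"
      if "\<not> x1 + a \<le> b1"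
      using that ok' True T_pos spos pp by (auto simp: place_def)
    have q: "fz ((S @ E1) @ E2)" "cin False ((S @ E1) @ E2) k' x' (int ?i) (int m)"
      "cin (\<not> False) ((S @ E1) @ E2) k2 x2 r2 lm2" "r' = int ?i" "tot E2 j = d"
      "\<forall>e\<in>set E2. \<forall>j'. item_of e = Piece j' \<longrightarrow> j' = j"
      by (rule pi; use P2 P3 P4 ok' in blast)+
    have "tot E1 j = 0" using o(5) by (intro tot_0[of _ "{}"]) auto
    moreover have "d = a" using pc(1) ok' by (auto simp: pce_def split: if_splits)
    ultimately show ?thesis using q o(5) pc(2) by auto
  qed
  then show "fz (S @ E)" "cin False (S @ E) k' x' r' (int m)" "cin (\<not> False) (S @ E) k2 x2 r2 lm2"
    "tot E j = a" "\<forall>e\<in>set E. \<forall>j'. item_of e = Piece j' \<longrightarrow> j' = j" by auto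
qed

definition gs :: "nat list \<Rightarrow> cursor" where "gs js = foldl (\<lambda>c j. fst (sl T c j)) (cs0 T) js"
definition pl :: "cursor \<Rightarrow> nat \<Rightarrow> real" where "pl c0 j = snd (snd (sl T c0 j))"

lemma am_le: "j < n ==> am T j \<le> t j"
  using am_slot(2)[of j] t_pos[of j] by (cases "0 < am T j") auto

lemma run_inv:
  assumes "distinct js" "set js \<subseteq> {..<n}"
    "\<And>pre j post st. js = pre @ j # post ==> st = foldl (step T) (cs0 T, cm0 T, []) pre ==>
       okm T (fst (snd st)) j (t j - pl (fst st) j)"
  shows "inv (foldl (step T) (cs0 T, cm0 T, []) js) (set js)"
  using assms
proof (induction js rule: rev_induct)
  case Nil then show ?case using inv_init by simp
next
  case (snoc j js)
  obtain k x b r k2 x2 b2 r2 S where st: "foldl (step T) (cs0 T, cm0 T, []) js = ((k, x, b, r), (k2, x2, b2, r2), S)"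
    by (metis prod_cases4 surj_pair)
  have "inv (foldl (step T) (cs0 T, cm0 T, []) js) (set js)"
    by (rule snoc.IH) (use snoc.prems in \<open>auto simp del: foldl_append\<close>)
  then have inv: "inv ((k, x, b, r), (k2, x2, b2, r2), S) (set js)" unfolding st .
  have j: "j < n" "j \<notin> set js" using snoc.prems by auto
  obtain k' x' b' r' E d where sl: "sl T (k, x, b, r) j = ((k', x', b', r'), E, d)" by (metis prod_cases4 surj_pair)
  obtain k3 x3 b3 r3 E2 d2 where mp: "mp T (k2, x2, b2, r2) j (t j - d) = ((k3, x3, b3, r3), E2, d2)" by (metis prod_cases4 surj_pair)
  note sp = slot_put[OF inv j sl]
  have I2: "cin False S k2 x2 r2 (int m)" using inv by (simp add: inv_def)
  have ok: "okm T (k2, x2, b2, r2) j (t j - d)" using snoc.prems(3)[of js j "[]"] st sl by (simp add: pl_def)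
  have td: "0 \<le> t j - d" using am_le[OF j(1)] sp(11) by simp
  have sp2: "cin (\<not> False) (S @ E) k' x' r' (AA T + ll T)" using sp(2) by simp
  note mq = main_put[OF sp(1,3) sp2 j(1) sp(10)[rule_format] td ok mp]
  have new: "foldl (step T) (cs0 T, cm0 T, []) (js @ [j]) = ((k', x', b', r'), (k3, x3, b3, r3), S @ E @ E2)"
    using st sl mp by (simp add: step_def)
  have SX: "\<forall>e\<in>set S. \<forall>j. item_of e = Piece j \<longrightarrow> j \<in> set js" "\<forall>i\<in>set js. tot S i = t i" using inv by (auto simp: inv_def)
  have T1: "tot (S @ E @ E2) i = t i" if "i \<in> set (js @ [j])" for i
  proof (cases "i = j")
    case True
    then show ?thesis using tot_0[OF SX(1) j(2)] sp(8) mq(4) by simp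
  next
    case False
    then have "tot E i = 0" "tot E2 i = 0" using sp(9) mq(5) by (auto intro!: tot_0[of _ "{j}"])
    then show ?thesis using SX(2) that False by simp
  qed
  moreover have "\<forall>e\<in>set (S @ E @ E2). \<forall>i. item_of e = Piece i \<longrightarrow> i \<in> set (js @ [j])"
    using SX(1) sp(9) mq(5) by auto
  ultimately show ?case unfolding new inv_def using mq(1-3) sp(4-7) by (simp del: tot_simps set_append)
qed

end

text \<open>During a class the slot cursor advances by \<open>d\<close> machines, \<open>q\<close>
  of them by wrapping. A slot has length \<open>T / 2\<close> but costs only \<open>T / 4\<close> of
  the credit \<open>v\<close>, an upper bound on what the test counts for it; this leaves room for
  the setup repeated at every wrap. The credit suffices in three ways: the opening setup is credited
  too, or \<open>8 * s \<le> T\<close> makes \<open>g\<close> at least \<open>3 / 8 * T\<close>, or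
  the load is credited twice. If the setup does not fit into the current slot, then \<open>x\<close>
  exceeds \<open>T / 4\<close> and that slot is already paid for.\<close>

lemma potential_step:
  fixes T s x x' g Y v d :: real and q :: int
  assumes T: "0 < T" "0 < s" "4 * s \<le> T" and x: "0 \<le> x" "x \<le> T / 2" and x': "s \<le> x'" "x' \<le> T / 2"
    and g: "g = T / 2 - s" and q: "0 \<le> q" and Y0: "0 \<le> Y"
    and Y: "x + s \<le> T / 2 ==> Y = q * g + (x' - (x + s)) \<and> d = q"
      "\<not> x + s \<le> T / 2 ==> Y = q * g + (x' - s) \<and> d = q + 1"
    and v: "v = s + Y \<or> 8 * s \<le> T \<and> g \<le> Y \<and> v = Y \<or> g \<le> Y \<and> v = 2 * Y"
  shows "d * (T / 4) + min x' (T / 4) \<le> min x (T / 4) + v"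
proof -
  have gT: "T / 4 \<le> g" "8 * s \<le> T ==> 3 / 8 * T \<le> g" using T g by auto
  define u where "u = q * T"
  define Q where "Q = q * g"
  define dd where "dd = d * (T / 4)"
  have Y1: "Y = Q + (x' - (x + s))" "dd = u / 4" if "x + s \<le> T / 2"
    using Y(1)[OF that] by (auto simp: u_def Q_def dd_def)
  have Y2: "Y = Q + (x' - s)" "dd = u / 4 + T / 4" if "\<not> x + s \<le> T / 2"
    using Y(2)[OF that] by (auto simp: u_def Q_def dd_def algebra_simps)
  \<comment> \<open>Replacing the products by \<open>u\<close> and \<open>Q\<close>, with linear
    bounds for zero, one and at least two wraps, leaves linear arithmetic only.\<close>
  have fin: "dd + min x' (T / 4) \<le> min x (T / 4) + v"
    if Qu: "u = 0 \<and> Q = 0 \<or> u = T \<and> Q = g \<or> 2 * T \<le> u \<and> 2 * g + (u - 2 * T) / 4 \<le> Q \<and>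
      (8 * s \<le> T \<longrightarrow> 2 * g + (u - 2 * T) * 3 / 8 \<le> Q)"
  proof -
    define mx where "mx = min x (T / 4)"
    define mx' where "mx' = min x' (T / 4)"
    have mx: "mx = x \<and> x \<le> T / 4 \<or> mx = T / 4 \<and> T / 4 \<le> x" and mx': "mx' \<le> x'" "mx' \<le> T / 4"
      by (auto simp: mx_def mx'_def min_def)
    have YY: "x + s \<le> T / 2 \<and> Y = Q + (x' - (x + s)) \<and> dd = u / 4 \<or>
      T / 2 < x + s \<and> Y = Q + (x' - s) \<and> dd = u / 4 + T / 4" using Y1 Y2 by (cases "x + s \<le> T / 2") auto
    have Q1: "u = 0 \<and> Q = 0 \<or> u = T \<and> Q = g \<or> 2 * T \<le> u \<and> 2 * g + (u - 2 * T) / 4 \<le> Q" using Qu by blast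
    from v have "dd + mx' \<le> mx + v"
    proof (elim disjE conjE)
      assume "v = s + Y"
      then show ?thesis using YY mx mx' T x x' gT(1) g Y0 Q1 by (elim disjE conjE; argo)
    next
      assume "8 * s \<le> T" "g \<le> Y" "v = Y"
      moreover from this Qu have "u = 0 \<and> Q = 0 \<or> u = T \<and> Q = g \<or> 2 * T \<le> u \<and> 2 * g + (u - 2 * T) * 3 / 8 \<le> Q" by blast
      ultimately show ?thesis using YY mx mx' T x x' gT(2)[OF \<open>8 * s \<le> T\<close>] g by (elim disjE conjE; argo)
    next
      assume "g \<le> Y" "v = 2 * Y"
      then show ?thesis using YY mx mx' T x x' gT(1) g Y0 Q1 by (elim disjE conjE; argo)
    qed
    then show ?thesis by (simp add: mx_def mx'_def)
  qed
  consider "q = 0" | "q = 1" | "2 \<le> q" using q by linarith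
  then show ?thesis unfolding dd_def[symmetric]
  proof cases
    case 3
    have uT: "2 * T \<le> u" unfolding u_def using 3 T by (intro mult_right_mono) auto
    have "(real_of_int q - 2) * (T / 4) \<le> (real_of_int q - 2) * g" using 3 gT by (intro mult_left_mono) auto
    then have Q1: "2 * g + (u - 2 * T) / 4 \<le> Q" by (simp add: u_def Q_def algebra_simps)
    have "(real_of_int q - 2) * (3 / 8 * T) \<le> (real_of_int q - 2) * g" if "8 * s \<le> T"
      using 3 gT(2)[OF that] by (intro mult_left_mono) auto
    then have Q2: "8 * s \<le> T ==> 2 * g + (u - 2 * T) * 3 / 8 \<le> Q" by (simp add: u_def Q_def algebra_simps)
    show "dd + min x' (T / 4) \<le> min x (T / 4) + v" by (rule fin) (use uT Q1 Q2 in blast)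
  qed (rule fin; simp add: u_def Q_def)+
qed

text \<open>When the track ends inside a class, all its remaining slots are full, and each holds
  load of at least \<open>T / 2 - s\<close>, hence of at least its price \<open>T / 4\<close>. The
  load alone pays, even though the class is not completely placed.\<close>

lemma potential_exhausted:
  fixes T s x g Y d :: real and q :: int
  assumes T: "0 < T" "0 < s" "4 * s \<le> T" and x: "0 \<le> x" "x \<le> T / 2"
    and g: "g = T / 2 - s" and q: "0 \<le> q"
    and Y: "x + s \<le> T / 2 ==> 1 \<le> q \<and> Y = q * g - x \<and> d = q"
      "\<not> x + s \<le> T / 2 ==> Y = q * g \<and> d = q + 1"
  shows "d * (T / 4) \<le> min x (T / 4) + Y" "0 \<le> Y"
proof -
  have gT: "T / 4 \<le> g" using T g by auto
  have 0: "0 \<le> q * g" "q * (T / 4) \<le> q * g"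
    using q gT T by (simp, intro mult_left_mono) auto
  have 1: "g + (q * T - T) / 4 \<le> q * g" if "1 \<le> q"
  proof -
    have "(real_of_int q - 1) * (T / 4) \<le> (real_of_int q - 1) * g" using that gT by (intro mult_left_mono) auto
    then show ?thesis by (simp add: algebra_simps)
  qed
  have 2: "g \<le> q * g" if "1 \<le> q" using mult_right_mono[of 1 "real_of_int q" g] that gT T by simp
  define Q where "Q = q * g"
  define u where "u = q * T"
  show "0 \<le> Y"
  proof (cases "x + s \<le> T / 2")
    case True
    then show ?thesis using Y(1)[OF True] 2 g by linarith
  qed (use Y(2) 0 in auto)
  show "d * (T / 4) \<le> min x (T / 4) + Y"
  proof (cases "x + s \<le> T / 2")
    case True
    have *: "1 \<le> q" "Y = Q - x" "d * (T / 4) = u / 4" using Y(1)[OF True] by (auto simp: Q_def u_def)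
    have "g + (u - T) / 4 \<le> Q" using 1[OF *(1)] by (simp add: Q_def u_def)
    moreover have "min x (T / 4) = x \<or> min x (T / 4) = T / 4 \<and> T / 4 \<le> x" by (auto simp: min_def)
    ultimately show ?thesis using *(2,3) True gT g by (elim disjE conjE; argo)
  next
    case False
    have *: "Y = Q" "d * (T / 4) = u / 4 + T / 4" using Y(2)[OF False] by (auto simp: algebra_simps Q_def u_def)
    have "u / 4 \<le> Q" "0 \<le> Q" using 0 by (auto simp: Q_def u_def)
    moreover have "min x (T / 4) = T / 4" using False T by simp
    ultimately show ?thesis using * by linarith
  qed
qed

section \<open>Load absorbed by the slots\<close>

context constr
begin

abbreviation "lm \<equiv> AA T + ll T"

definition nx :: "cursor \<Rightarrow> nat \<Rightarrow> cursor" where "nx c0 j = fst (sl T c0 j)"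
fun ps :: "cursor \<Rightarrow> nat list \<Rightarrow> real list" where
  "ps c0 [] = []"
| "ps c0 (j # js) = pl c0 j # ps (nx c0 j) js"

lemma sl_0: "am T j = 0 ==> nx c0 j = c0 \<and> pl c0 j = 0"
  by (simp add: nx_def pl_def sl_def put_def)

lemma slots_0: "(\<And>j. j \<in> set js ==> am T j = 0) ==> foldl nx c0 js = c0 \<and> sum_list (ps c0 js) = 0"
  by (induction js arbitrary: c0) (auto simp: sl_0)

lemma sl_full: "lm \<le> k ==> \<exists>k' x' b' r'. nx (k, x, b, r) j = (k', x', b', r') \<and> k \<le> k' \<and> pl (k, x, b, r) j = 0"
  by (auto simp: nx_def pl_def sl_def put_def opn_def pce_def intro: exI[of _ "T / 2"])

lemma slots_full: "lm \<le> k ==> \<exists>k' x' b' r'. foldl nx (k, x, b, r) js = (k', x', b', r') \<and> k \<le> k' \<and>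
    sum_list (ps (k, x, b, r) js) = 0"
proof (induction js arbitrary: k x b r)
  case (Cons j js)
  obtain k' x' b' r' where *: "nx (k, x, b, r) j = (k', x', b', r')" "k \<le> k'" "pl (k, x, b, r) j = 0"
    using sl_full[OF Cons.prems] by blast
  show ?case using Cons.IH[of k' x' b' r'] Cons.prems * by auto
qed auto

lemma am_pos: "j < n ==> 3 \<le> ty T (cl j) ==> ty T (cl j) \<le> 5 ==> 0 < am T j"
  using T_pos t_pos[of j] by (auto simp: am_def Let_def ty_def split: if_splits)

lemma sl_in:
  assumes k: "k < lm" and j: "j < n" "cl j = i" "3 \<le> ty T i" "ty T i \<le> 5" and x: "s i \<le> x" "x \<le> T / 2"
    and ev: "nx (k, x, T / 2, int i) j = (k', x', b', r')"
  shows "b' = T / 2" "r' = int i" "k \<le> k'" "k' \<le> lm" "s i \<le> x'" "x' \<le> T / 2" "k' = lm ==> x' = s i"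
    "pl (k, x, T / 2, int i) j = real_of_int (k' - k) * (T / 2 - s i) + (x' - x)"
    "k' < lm ==> pl (k, x, T / 2, int i) j = am T j"
proof -
  have a: "0 < am T j" using am_pos j by auto
  note am_slot[OF a]
  then have "b' = T / 2 \<and> r' = int i \<and> k \<le> k' \<and> k' \<le> lm \<and> s i \<le> x' \<and> x' \<le> T / 2 \<and> (k' = lm \<longrightarrow> x' = s i) \<and>
    pl (k, x, T / 2, int i) j = real_of_int (k' - k) * (T / 2 - s i) + (x' - x) \<and> (k' < lm \<longrightarrow> pl (k, x, T / 2, int i) j = am T j)"
    using ev a x k j(2) T_pos unfolding nx_def pl_def sl_def put_def opn_def pce_def
    by (auto split: if_splits)
  then show "b' = T / 2" "r' = int i" "k \<le> k'" "k' \<le> lm" "s i \<le> x'" "x' \<le> T / 2" "k' = lm ==> x' = s i"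
    "pl (k, x, T / 2, int i) j = real_of_int (k' - k) * (T / 2 - s i) + (x' - x)"
    "k' < lm ==> pl (k, x, T / 2, int i) j = am T j" by auto
qed

lemma slots_in:
  assumes "k \<le> lm" "\<forall>j\<in>set js. j < n \<and> cl j = i" "3 \<le> ty T i" "ty T i \<le> 5" "s i \<le> x" "x \<le> T / 2"
    "k = lm \<longrightarrow> x = s i"
  shows "\<exists>k' x' r' b'. foldl nx (k, x, T / 2, int i) js = (k', x', b', r') \<and> k \<le> k' \<and>
    (k' < lm \<longrightarrow> b' = T / 2 \<and> r' = int i \<and> s i \<le> x' \<and> x' \<le> T / 2 \<and>
       ps (k, x, T / 2, int i) js = map (am T) js \<and>
       sum_list (ps (k, x, T / 2, int i) js) = real_of_int (k' - k) * (T / 2 - s i) + (x' - x)) \<and>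
    (lm \<le> k' \<longrightarrow> sum_list (ps (k, x, T / 2, int i) js) = real_of_int (lm - k) * (T / 2 - s i) + (s i - x))"
  using assms
proof (induction js arbitrary: k x)
  case Nil
  then show ?case by (intro exI[of _ k] exI[of _ x] exI[of _ "int i"] exI[of _ "T / 2"]) simp
next
  case (Cons j js)
  show ?case
  proof (cases "k = lm")
    case True
    then show ?thesis using slots_full[of k x "T / 2" "int i" "j # js"] Cons.prems(7) by auto
  next
    case False
    then have kl: "k < lm" using Cons.prems(1) by simp
    obtain k1 x1 b1 r1 where ev: "nx (k, x, T / 2, int i) j = (k1, x1, b1, r1)" by (metis prod_cases4)
    have j: "j < n" "cl j = i" using Cons.prems(2) by auto
    note e = sl_in[OF kl j Cons.prems(3-6) ev]
    have "\<exists>k' x' r' b'. foldl nx (k1, x1, T / 2, int i) js = (k', x', b', r') \<and> k1 \<le> k' \<and>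
      (k' < lm \<longrightarrow> b' = T / 2 \<and> r' = int i \<and> s i \<le> x' \<and> x' \<le> T / 2 \<and>
         ps (k1, x1, T / 2, int i) js = map (am T) js \<and>
         sum_list (ps (k1, x1, T / 2, int i) js) = real_of_int (k' - k1) * (T / 2 - s i) + (x' - x1)) \<and>
      (lm \<le> k' \<longrightarrow> sum_list (ps (k1, x1, T / 2, int i) js) = real_of_int (lm - k1) * (T / 2 - s i) + (s i - x1))"
      by (rule Cons.IH) (use e Cons.prems in auto)
    then obtain k' x' r' b' where f: "foldl nx (k1, x1, T / 2, int i) js = (k', x', b', r')" "k1 \<le> k'"
      "k' < lm \<longrightarrow> b' = T / 2 \<and> r' = int i \<and> s i \<le> x' \<and> x' \<le> T / 2 \<and>
         ps (k1, x1, T / 2, int i) js = map (am T) js \<and>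
         sum_list (ps (k1, x1, T / 2, int i) js) = real_of_int (k' - k1) * (T / 2 - s i) + (x' - x1)"
      "lm \<le> k' \<longrightarrow> sum_list (ps (k1, x1, T / 2, int i) js) = real_of_int (lm - k1) * (T / 2 - s i) + (s i - x1)"
      by (elim exE conjE)
    have ev': "nx (k, x, T / 2, int i) j = (k1, x1, T / 2, int i)" using ev e(1,2) by simp
    define gg where "gg = T / 2 - s i"
    note f' = f[folded gg_def] and e' = e(8)[folded gg_def]
    have am: "am T j = real_of_int (k1 - k) * gg + (x1 - x)" if "k' < lm" using e(9) e' that f(2) by simp
    have smm: "sum_list (map (am T) js) = real_of_int (k' - k1) * gg + (x' - x1)" if "k' < lm"
      using f'(3) that by (metis (no_types, lifting))
    show ?thesis unfolding gg_def[symmetric]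
      by (rule exI[of _ k'], rule exI[of _ x'], rule exI[of _ r'], rule exI[of _ b'], intro conjI)
        (use f' e(3-7) e' am smm in \<open>simp_all add: ev' left_diff_distrib\<close>)
  qed
qed

text \<open>Performing the opening setup in advance does not change what the cursor does. After it
  all jobs of the class are alike, as the induction in \<open>slots_in\<close> requires.\<close>

lemma slots_block:
  assumes k: "k < lm" and js: "js \<noteq> []" "\<And>j. j \<in> set js ==> j < n \<and> cl j = i" and i: "3 \<le> ty T i" "ty T i \<le> 5"
    and x: "0 \<le> x" "x \<le> T / 2" and r: "r \<noteq> int i"
    and c1: "c1 = (if x + s i \<le> T / 2 then (k, x + s i, T / 2, int i) else (k + 1, s i, T / 2, int i))"
  shows "foldl nx (k, x, T / 2, r) js = foldl nx c1 js" "ps (k, x, T / 2, r) js = ps c1 js"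
proof -
  obtain j js' where jj: "js = j # js'" using js(1) by (cases js) auto
  have a: "0 < am T j" "cl j = i" using am_pos js(2)[of j] i jj by auto
  have *: "sl T (k, x, T / 2, r) j = (fst (sl T c1 j), snd (opn lm (s i) 0 (T / 2) i (k, x, T / 2, r)) @ fst (snd (sl T c1 j)), snd (snd (sl T c1 j)))"
    using a r k unfolding sl_def put_def c1 by (auto simp: opn_def split: prod.splits)
  show "foldl nx (k, x, T / 2, r) js = foldl nx c1 js" "ps (k, x, T / 2, r) js = ps c1 js"
    unfolding jj by (simp_all add: nx_def pl_def *)
qed

lemma sl_bounds:
  assumes "AA T \<le> k" "0 \<le> x" "x \<le> T / 2" "j < n"
  shows "\<exists>k' x' r'. nx (k, x, T / 2, r) j = (k', x', T / 2, r') \<and> AA T \<le> k' \<and> 0 \<le> x' \<and> x' \<le> T / 2 \<and>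
    0 \<le> pl (k, x, T / 2, r) j \<and> pl (k, x, T / 2, r) j \<le> am T j"
proof (cases "0 < am T j")
  case True
  note am_slot[OF True]
  moreover have "0 < s (cl j)" using s_pos cl_less assms(4) by blast
  ultimately show ?thesis using True assms T_pos unfolding nx_def pl_def sl_def put_def opn_def pce_def
    by (auto split: if_splits)
next
  case False
  then have "am T j = 0" using t_pos[OF assms(4)] by (auto simp: am_def Let_def ty_def split: if_splits)
  then show ?thesis using sl_0 assms by auto
qed

end

locale ordered = constr +
  fixes blk :: "nat \<Rightarrow> nat list" and cls :: "nat list"
  assumes blk: "\<And>i. i < c ==> distinct (blk i) \<and> set (blk i) = J i"
    and cls: "distinct cls" "set cls = {..<c}" "sorted (map (ty T) cls)"
begin

definition bef :: "nat \<Rightarrow> cursor" where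
  "bef i = foldl nx (cs0 T) (concat (map blk (takeWhile (\<lambda>k. k \<noteq> i) cls)))"
definition y :: "nat \<Rightarrow> real" where "y i = sum_list (ps (bef i) (blk i))"
text \<open>The credit of a class for its load in the slots, matched to what it saves elsewhere. A
  class of type 3 that is placed completely also saves its setup on the main track. Load of type 5
  counts twice because the inequality used for it counts outside volume twice and grants this type
  no other discount.\<close>

definition val :: "nat \<Rightarrow> real" where
  "val i = (if ty T i = 3 then (if y i = P i then L i else y i) else if ty T i = 4 then y i
     else if ty T i = 5 then 2 * y i else 0)"

lemma bef_eq: "cls = pre @ i # post ==> bef i = foldl nx (cs0 T) (concat (map blk pre))"
proof -
  assume e: "cls = pre @ i # post"
  then have "i \<notin> set pre" using cls(1) by simp
  then have "takeWhile (\<lambda>k. k \<noteq> i) (pre @ i # post) = pre" by (induction pre) auto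
  then show ?thesis unfolding bef_def e[symmetric] by simp
qed

lemma am_D: assumes "i < c" "3 \<le> ty T i" "ty T i \<le> 5" shows "sum_list (map (am T) (blk i)) = D T i"
proof -
  have "sum_list (map (am T) (blk i)) = (\<Sum>j\<in>J i. am T j)" using blk[OF assms(1)] by (simp add: sum_list_distinct_conv_sum_set)
  also have "\<dots> = D T i" unfolding D_def using assms by (intro sum.cong) (auto simp: am_def J_def)
  finally show ?thesis .
qed

lemma D_big: assumes "i < c" "ty T i = 4 \<or> ty T i = 5" shows "T / 2 - s i \<le> D T i" "D T i < P i"
proof -
  have "bg T i \<noteq> 0" and s4: "4 * s i \<le> T" using assms by (auto simp: ty_def split: if_splits)
  then obtain j where j: "j \<in> J i" "T < 2 * (s i + t j)" unfolding bg_def by auto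
  have pos: "0 \<le> min (t k) (T / 2 - s i)" if "k \<in> J i" for k using that t_pos[of k] s4 T_pos by (auto simp: J_def)
  have "min (t j) (T / 2 - s i) \<le> D T i" unfolding D_def by (rule member_le_sum) (use j pos in auto)
  then show "T / 2 - s i \<le> D T i" using j by simp
  show "D T i < P i" unfolding D_def P_def
    by (rule sum_strict_mono_ex1) (use j in \<open>auto intro!: bexI[of _ j]\<close>)
qed

lemma D_3: "i < c ==> ty T i = 3 ==> D T i = P i" by (rule bg0_D) (auto simp: ty_def split: if_splits)

lemma blk_ne: "i < c ==> blk i \<noteq> []" using blk[of i] J_ne[of i] by auto

text \<open>While slots remain, every class has placed its full share, and progress is paid for at
  \<open>T / 4\<close> per slot. After exhaustion only the total credit and a dichotomy survive: by
  the order of types, the slots run out either before type 5 has received anything or after types 3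
  and 4 are complete.\<close>

definition sinv :: "nat list \<Rightarrow> bool" where
  "sinv pre \<longleftrightarrow> (case foldl nx (cs0 T) (concat (map blk pre)) of (k, x, b, r) \<Rightarrow>
    (if k < lm then AA T \<le> k \<and> 0 \<le> x \<and> x \<le> T / 2 \<and> b = T / 2 \<and> (r = - 1 \<or> r \<in> int ` set pre) \<and>
       (\<forall>i\<in>set pre. 3 \<le> ty T i \<and> ty T i \<le> 5 \<longrightarrow> y i = D T i) \<and>
       (k - AA T) * (T / 4) + min x (T / 4) \<le> (\<Sum>i\<in>set pre. val i)
     else ll T * (T / 4) \<le> (\<Sum>i\<in>set pre. val i) \<and>
       ((\<forall>i\<in>set pre. ty T i = 5 \<longrightarrow> y i = 0) \<or> (\<forall>i\<in>set cls. ty T i = 3 \<or> ty T i = 4 \<longrightarrow> y i = D T i))) \<and>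
    (\<forall>i\<in>set pre. 0 \<le> y i \<and> (ty T i \<le> 2 \<or> ty T i = 6 \<longrightarrow> y i = 0)))"

lemma sinv_all: "cls = pre @ post ==> sinv pre"
proof (induction pre arbitrary: post rule: rev_induct)
  case Nil
  show ?case using T_pos Al by (simp add: sinv_def cs0_def)
next
  case (snoc i pre)
  have cl: "cls = pre @ i # post" using snoc.prems by simp
  have IH: "sinv pre" using snoc.IH[of "i # post"] cl by simp
  have ic: "i < c" "i \<notin> set pre" using cls cl by auto
  obtain k x b r where st: "foldl nx (cs0 T) (concat (map blk pre)) = (k, x, b, r)" by (metis prod_cases4)
  have bi: "bef i = (k, x, b, r)" using bef_eq[OF cl] st by simp
  have new: "foldl nx (cs0 T) (concat (map blk (pre @ [i]))) = foldl nx (k, x, b, r) (blk i)" using st by simp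
  have yi: "y i = sum_list (ps (k, x, b, r) (blk i))" by (simp add: y_def bi)
  have sum: "(\<Sum>i\<in>set (pre @ [i]). val i) = (\<Sum>i\<in>set pre. val i) + val i" using ic by simp
  have bj: "j < n \<and> cl j = i" if "j \<in> set (blk i)" for j using that blk[OF ic(1)] by (auto simp: J_def)
  consider "ty T i \<le> 2 \<or> ty T i = 6" | "lm \<le> k" "3 \<le> ty T i" "ty T i \<le> 5" | "k < lm" "3 \<le> ty T i" "ty T i \<le> 5"
    using ty_le6[of T i] by linarith
  then show ?case
  proof cases
    case 1
    have "foldl nx (k, x, b, r) (blk i) = (k, x, b, r) \<and> sum_list (ps (k, x, b, r) (blk i)) = 0"
      by (rule slots_0) (use bj 1 in \<open>auto simp: am_def\<close>)
    then have *: "foldl nx (k, x, b, r) (blk i) = (k, x, b, r)" "y i = 0" using yi by auto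
    have "val i = 0" using 1 by (auto simp: val_def)
    then show ?thesis using IH 1 * unfolding sinv_def new st sum by (auto split: if_splits)
  next
    case 2
    obtain k' x' b' r' where *: "foldl nx (k, x, b, r) (blk i) = (k', x', b', r')" "k \<le> k'" "y i = 0"
      using slots_full[OF 2(1), of x b r "blk i"] yi by auto
    have "val i = 0" using * P_pos[OF ic(1)] 2 by (auto simp: val_def)
    then show ?thesis using IH 2 * unfolding sinv_def new st sum by (auto split: if_splits)
  next
    case 3
    have I: "AA T \<le> k" "0 \<le> x" "x \<le> T / 2" "b = T / 2" "r = - 1 \<or> r \<in> int ` set pre"
      "\<And>i. i \<in> set pre ==> 3 \<le> ty T i ==> ty T i \<le> 5 ==> y i = D T i"
      "(k - AA T) * (T / 4) + min x (T / 4) \<le> (\<Sum>i\<in>set pre. val i)"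
      "\<forall>i\<in>set pre. 0 \<le> y i \<and> (ty T i \<le> 2 \<or> ty T i = 6 \<longrightarrow> y i = 0)"
      using IH 3(1) unfolding sinv_def st by auto
    have ri: "r \<noteq> int i" using I(5) ic by auto
    have s4: "4 * s i \<le> T" "0 < s i" using 3 s_pos[OF ic(1)] by (auto simp: ty_def split: if_splits)
    define k0 where "k0 = (if x + s i \<le> T / 2 then k else k + 1)"
    define x0 where "x0 = (if x + s i \<le> T / 2 then x + s i else s i)"
    have c1: "(k0, x0, T / 2, int i) = (if x + s i \<le> T / 2 then (k, x + s i, T / 2, int i) else (k + 1, s i, T / 2, int i))"
      by (simp add: k0_def x0_def)
    note B = slots_block[OF 3(1) blk_ne[OF ic(1)] bj 3(2,3) I(2,3) ri c1]
    define g where "g = T / 2 - s i"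
    have "k0 \<le> lm" "s i \<le> x0" "x0 \<le> T / 2" "k0 = lm \<longrightarrow> x0 = s i"
      using 3(1) I s4 T_pos by (auto simp: k0_def x0_def split: if_splits)
    note SI = slots_in[where js = "blk i" and i = i, OF this(1) _ 3(2,3) this(2-4)]
    have "\<forall>j\<in>set (blk i). j < n \<and> cl j = i" using bj by blast
    from SI[OF this] obtain k' x' r' b' where e0: "foldl nx (k0, x0, T / 2, int i) (blk i) = (k', x', b', r')" "k0 \<le> k'"
      "k' < lm \<longrightarrow> b' = T / 2 \<and> r' = int i \<and> s i \<le> x' \<and> x' \<le> T / 2 \<and>
         ps (k0, x0, T / 2, int i) (blk i) = map (am T) (blk i) \<and>
         sum_list (ps (k0, x0, T / 2, int i) (blk i)) = real_of_int (k' - k0) * (T / 2 - s i) + (x' - x0)"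
      "lm \<le> k' \<longrightarrow> sum_list (ps (k0, x0, T / 2, int i) (blk i)) = real_of_int (lm - k0) * (T / 2 - s i) + (s i - x0)"
      by (elim exE conjE)
    have psi: "ps (k, x, b, r) (blk i) = ps (k0, x0, T / 2, int i) (blk i)" unfolding I(4) by (rule B(2))
    have e: "foldl nx (k, x, b, r) (blk i) = (k', x', b', r')" "k0 \<le> k'"
      "k' < lm ==> b' = T / 2 \<and> r' = int i \<and> s i \<le> x' \<and> x' \<le> T / 2 \<and> ps (k, x, b, r) (blk i) = map (am T) (blk i) \<and>
         y i = real_of_int (k' - k0) * g + (x' - x0)"
      "lm \<le> k' ==> y i = real_of_int (lm - k0) * g + (s i - x0)"
    proof -
      show "foldl nx (k, x, b, r) (blk i) = (k', x', b', r')" unfolding I(4) by (rule trans[OF B(1) e0(1)])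
      show "k' < lm ==> b' = T / 2 \<and> r' = int i \<and> s i \<le> x' \<and> x' \<le> T / 2 \<and> ps (k, x, b, r) (blk i) = map (am T) (blk i) \<and>
         y i = real_of_int (k' - k0) * g + (x' - x0)" using e0(3) unfolding psi g_def yi by blast
      show "lm \<le> k' ==> y i = real_of_int (lm - k0) * g + (s i - x0)" using e0(4) unfolding psi g_def yi by blast
    qed (rule e0(2))
    show ?thesis
    proof (cases "k' < lm")
      case True
      have e': "b' = T / 2" "r' = int i" "s i \<le> x'" "x' \<le> T / 2" "y i = real_of_int (k' - k0) * g + (x' - x0)" using e(3)[OF True] by blast+
      have yD: "y i = D T i" using e(3)[OF True] am_D[OF ic(1) 3(2,3)] yi by simp
      have v: "val i = s i + y i \<or> 8 * s i \<le> T \<and> g \<le> y i \<and> val i = y i \<or> g \<le> y i \<and> val i = 2 * y i"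
        using yD D_3[OF ic(1)] D_big(1)[OF ic(1)] 3(2,3) unfolding val_def g_def L_def
        by (auto simp: ty_def split: if_splits)
      have y0: "0 \<le> y i" unfolding yD D_def using s4 t_pos T_pos
        by (intro sum_nonneg) (auto simp: J_def min_def intro: less_imp_le)
      have "(k' - k) * (T / 4) + min x' (T / 4) \<le> min x (T / 4) + val i"
        by (rule potential_step[OF T_pos s4(2,1) I(2,3) e'(3,4) g_def _ y0, of "k' - k0"])
          (use e(2) e'(5) v in \<open>auto simp: k0_def x0_def\<close>)
      moreover have "AA T \<le> k'" using e(2) I(1) by (auto simp: k0_def split: if_splits)
      moreover have "(k' - AA T) * (T / 4) = (k' - k) * (T / 4) + (k - AA T) * (T / 4)" by (simp add: left_diff_distrib distrib_right add_divide_distrib diff_divide_distrib)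
      ultimately have key: "(k' - AA T) * (T / 4) + min x' (T / 4) \<le> (\<Sum>i\<in>set pre. val i) + val i"
        using I(7) by linarith
      have k'A: "AA T \<le> k'" using e(2) I(1) by (auto simp: k0_def split: if_splits)
      have x0': "0 \<le> x'" using e'(3) s4 by linarith
      have r': "r' = - 1 \<or> r' \<in> int ` set (pre @ [i])" using e'(2) by simp
      have all: "\<forall>a\<in>set (pre @ [i]). 3 \<le> ty T a \<and> ty T a \<le> 5 \<longrightarrow> y a = D T a" using I(6) yD by auto
      have all2: "\<forall>a\<in>set (pre @ [i]). 0 \<le> y a \<and> (ty T a \<le> 2 \<or> ty T a = 6 \<longrightarrow> y a = 0)" using I(8) y0 3 by auto
      show ?thesis unfolding sinv_def new e(1) sum
        using key k'A x0' r' all all2 e'(1,4) True by simp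
    next
      case False
      have ye: "y i = real_of_int (lm - k0) * g + (s i - x0)" using e(4) False by simp
      have pe: "(lm - k) * (T / 4) \<le> min x (T / 4) + y i" "0 \<le> y i"
        by (rule potential_exhausted[OF T_pos s4(2,1) I(2,3) g_def, of "lm - k0"];
          use 3(1) ye in \<open>auto simp: k0_def x0_def\<close>)+
      have vy: "y i \<le> val i" using 3 pe(2) s4 by (auto simp: val_def L_def)
      have "ll T * (T / 4) = (lm - k) * (T / 4) + (k - AA T) * (T / 4)" by (simp add: left_diff_distrib distrib_right add_divide_distrib diff_divide_distrib)
      then have tot: "ll T * (T / 4) \<le> (\<Sum>i\<in>set (pre @ [i]). val i)" using pe vy I(7) unfolding sum by linarith
      have srt: "ty T a \<le> ty T i" if "a \<in> set pre" for a using cls(3) that unfolding cl by (auto simp: sorted_append)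
      have srt2: "ty T i \<le> ty T a" if "a \<in> set post" for a using cls(3) that unfolding cl by (auto simp: sorted_append)
      \<comment> \<open>If the slots run out at a class of type 5, all classes of types 3 and 4 have
        come earlier; otherwise no class of type 5 has come yet.\<close>
      have "(\<forall>a\<in>set (pre @ [i]). ty T a = 5 \<longrightarrow> y a = 0) \<or> (\<forall>a\<in>set cls. ty T a = 3 \<or> ty T a = 4 \<longrightarrow> y a = D T a)"
      proof (cases "ty T i = 5")
        case True
        have "y a = D T a" if "a \<in> set cls" "ty T a = 3 \<or> ty T a = 4" for a
        proof -
          have "a \<in> set pre" using that True srt2[of a] unfolding cl by auto
          then show ?thesis using I(6)[of a] that by auto
        qed
        then show ?thesis by blast
      next
        case F: False
        then have "ty T a \<noteq> 5" if "a \<in> set (pre @ [i])" for a using srt[of a] 3(3) that by auto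
        then show ?thesis by blast
      qed
      then show ?thesis using tot pe(2) I(8) False 3 unfolding sinv_def new e(1) by auto
    qed
  qed
qed

text \<open>Demand of a class on the main track; a class that went into the slots completely needs
  no setup there.\<close>

definition ovol :: "nat \<Rightarrow> real" where "ovol i = (if y i = P i then 0 else s i + (P i - y i))"
definition eo :: "nat \<Rightarrow> real" where
  "eo i = (if ty T i = 0 then al T i * T else if ty T i = 1 then T else L i)"
definition RR :: real where "RR = real m * T - (\<Sum>i\<in>{i. i < c \<and> ty T i \<le> 2}. eo i)"

lemma y_bounds: "i < c ==> 0 \<le> y i" "i < c ==> ty T i \<le> 2 \<or> ty T i = 6 ==> y i = 0"
  using sinv_all[of cls "[]"] cls(2) by (auto simp: sinv_def split: prod.splits)

text \<open>The three inequalities cover the three outcomes of the slot filling. If slots are left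
  over, every share is placed and inequality 0 applies. If they run out before type 5, the credit is
  a saving in total volume, as in inequality 1. If they run out after types 3 and 4 are complete,
  the saving is measured by inequality 2.\<close>

lemma ovol_le: "(\<Sum>i\<in>{i. i < c \<and> 3 \<le> ty T i}. ovol i) \<le> RR"
proof -
  let ?E = "{i. i < c \<and> ty T i \<le> 2}" and ?C = "{i. i < c \<and> 3 \<le> ty T i}"
  have split: "(\<Sum>i<c. f i) = (\<Sum>i\<in>?C. f i) + (\<Sum>i\<in>?E. f i)" for f :: "nat \<Rightarrow> real"
    by (subst sum.union_disjoint[symmetric]) (auto intro!: sum.cong)
  define w where "w i = (if ty T i = 1 then T - L i else 0)" for i
  define v where "v i = (if ty T i = 3 then L i else if ty T i = 4 then D T i else 0)" for i
  let ?F = "\<lambda>q i. fa q T i + fb q T i * T"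
  have E: "?F 0 i = - 2 * eo i" "?F 1 i = - 2 * eo i + 2 * w i" "?F 2 i = - 4 * eo i + 2 * w i"
    if "i \<in> ?E" for i
    using that by (auto simp: fa_def fb_def eo_def w_def Let_def le_Suc_eq numeral_2_eq_2)
  have DD: "2 * D T i = 2 * (sm T i - real (bg T i) * s i) + real (bg T i) * T" for i using D_eq .
  have C: "?F 1 i = - 2 * L i" "?F 2 i = - 4 * L i + 2 * v i" if "i \<in> ?C" for i
    using that ty_le6[of T i] DD[of i] by (auto simp: fa_def fb_def v_def Let_def numeral_2_eq_2)
  have C0: "?F 0 i = - 2 * (if ty T i = 3 then 0 else if ty T i \<le> 5 then L i - D T i else L i)" if "i \<in> ?C" for i
    using that ty_le6[of T i] DD[of i] by (auto simp: fa_def fb_def Let_def numeral_2_eq_2)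
  have acc3: "0 \<le> FA q T + FB q T * T" if "q < 3" for q using acc that by (simp add: acc_def)
  have A0: "(\<Sum>i\<in>?C. if ty T i = 3 then 0 else if ty T i \<le> 5 then L i - D T i else L i) \<le> RR"
  proof -
    have "(\<Sum>i\<in>?E. ?F 0 i) = - 2 * (\<Sum>i\<in>?E. eo i)" using E(1) by (simp add: sum_distrib_left sum_negf)
    moreover have "(\<Sum>i\<in>?C. ?F 0 i) = - 2 * (\<Sum>i\<in>?C. if ty T i = 3 then 0 else if ty T i \<le> 5 then L i - D T i else L i)"
      unfolding sum_distrib_left by (rule sum.cong[OF refl C0])
    ultimately show ?thesis using acc3[of 0] unfolding FF_eq split RR_def by simp
  qed
  have A1: "(\<Sum>i\<in>?C. L i) \<le> RR + (\<Sum>i\<in>?E. w i)"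
  proof -
    have "(\<Sum>i\<in>?E. ?F 1 i) = - 2 * (\<Sum>i\<in>?E. eo i) + 2 * (\<Sum>i\<in>?E. w i)"
      using E(2) by (simp add: sum_distrib_left sum_subtractf sum_negf)
    moreover have "(\<Sum>i\<in>?C. ?F 1 i) = - 2 * (\<Sum>i\<in>?C. L i)"
      unfolding sum_distrib_left by (rule sum.cong[OF refl C(1)])
    ultimately show ?thesis using acc3[of 1] unfolding FF_eq split RR_def by simp
  qed
  have A2: "2 * (\<Sum>i\<in>?C. L i) \<le> 2 * RR + (\<Sum>i\<in>?E. w i) + (\<Sum>i\<in>?C. v i)"
  proof -
    have "(\<Sum>i\<in>?E. ?F 2 i) = - 4 * (\<Sum>i\<in>?E. eo i) + 2 * (\<Sum>i\<in>?E. w i)"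
      using E(3) by (simp add: sum_distrib_left sum_subtractf sum_negf)
    moreover have "(\<Sum>i\<in>?C. ?F 2 i) = - 4 * (\<Sum>i\<in>?C. L i) + 2 * (\<Sum>i\<in>?C. v i)"
      unfolding sum_distrib_left sum.distrib[symmetric] by (rule sum.cong[OF refl C(2)])
    ultimately show ?thesis using acc3[of 2] unfolding FF_eq split RR_def by simp
  qed
  \<comment> \<open>The test counts a slot only as the \<open>T - L i\<close> available at makespan
    \<open>T\<close>, which is below \<open>T / 4\<close> for type 1.\<close>
  have V: "(\<Sum>i\<in>?E. w i) \<le> ll T * (T / 4)"
  proof -
    have "(\<Sum>i\<in>?E. w i) = (\<Sum>i\<in>{i. i < c \<and> ty T i = 1}. w i)"
      by (rule sum.mono_neutral_right) (auto simp: w_def)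
    also have "\<dots> \<le> (\<Sum>i\<in>{i. i < c \<and> ty T i = 1}. T / 4)"
      by (rule sum_mono) (auto simp: w_def ty_def split: if_splits)
    finally show ?thesis by (simp add: ll_def)
  qed
  have valC: "(\<Sum>i\<in>set cls. val i) = (\<Sum>i\<in>?C. val i)"
    unfolding cls(2) by (rule sum.mono_neutral_right) (auto simp: val_def)
  obtain k x b r where st: "foldl nx (cs0 T) (concat (map blk cls)) = (k, x, b, r)" by (metis prod_cases4)
  note inv = sinv_all[of cls "[]", simplified, unfolded sinv_def st, simplified]
  have Pp: "0 < P i" "0 < s i" if "i \<in> ?C" for i using that P_pos s_pos by auto
  show ?thesis
  proof (cases "k < lm")
    case True
    have yD: "y i = D T i" if "i \<in> ?C" "ty T i \<le> 5" for i using inv True that cls(2) by auto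
    have "(\<Sum>i\<in>?C. ovol i) \<le> (\<Sum>i\<in>?C. if ty T i = 3 then 0 else if ty T i \<le> 5 then L i - D T i else L i)"
    proof (rule sum_mono)
      fix i assume i: "i \<in> ?C"
      show "ovol i \<le> (if ty T i = 3 then 0 else if ty T i \<le> 5 then L i - D T i else L i)"
        using yD[OF i] D_3[of i] y_bounds(2)[of i] i ty_le6[of T i] Pp[OF i] by (auto simp: ovol_def L_def)
    qed
    then show ?thesis using A0 by simp
  next
    case False
    then have vl: "ll T * (T / 4) \<le> (\<Sum>i\<in>?C. val i)" using inv valC by auto
    have dich: "(\<forall>i\<in>set cls. ty T i = 5 \<longrightarrow> y i = 0) \<or> (\<forall>i\<in>set cls. ty T i = 3 \<or> ty T i = 4 \<longrightarrow> y i = D T i)"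
      using inv False by auto
    have y0: "i \<in> ?C ==> 0 \<le> y i" for i using y_bounds(1) by auto
    from dich show ?thesis
    proof
      assume a: "\<forall>i\<in>set cls. ty T i = 5 \<longrightarrow> y i = 0"
      have "(\<Sum>i\<in>?C. ovol i) \<le> (\<Sum>i\<in>?C. L i - val i)"
      proof (rule sum_mono)
        fix i assume i: "i \<in> ?C"
        show "ovol i \<le> L i - val i"
          using a i cls(2) y0[OF i] Pp[OF i] y_bounds(2)[of i] ty_le6[of T i] by (auto simp: ovol_def val_def L_def)
      qed
      then show ?thesis using A1 V vl by (simp add: sum_subtractf)
    next
      assume a: "\<forall>i\<in>set cls. ty T i = 3 \<or> ty T i = 4 \<longrightarrow> y i = D T i"
      have "(\<Sum>i\<in>?C. 2 * ovol i) \<le> (\<Sum>i\<in>?C. 2 * L i - v i - val i)"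
      proof (rule sum_mono)
        fix i assume i: "i \<in> ?C"
        have "ty T i = 3 \<or> ty T i = 4 \<or> ty T i = 5 \<or> ty T i = 6" using i ty_le6[of T i] by auto
        then show "2 * ovol i \<le> 2 * L i - v i - val i"
          using a i cls(2) y0[OF i] Pp[OF i] y_bounds(2)[of i] D_3[of i] by (auto simp: ovol_def val_def L_def v_def)
      qed
      then show ?thesis using A2 V vl by (simp add: sum_subtractf sum_distrib_left[symmetric])
    qed
  qed
qed

end

section \<open>Capacity of the main track\<close>

context ordered
begin

definition os :: "nat list" where "os = concat (map blk cls)"

lemma os_distinct: "distinct os" and os_set: "set os = {..<n}"
proof -
  have "distinct (concat (map blk cs))" if "distinct cs" "set cs \<subseteq> {..<c}" for cs
    using that
  proof (induction cs)
    case (Cons i cs)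
    have "set (blk i) \<inter> set (blk k) = {}" if "k \<in> set cs" for k
      using blk[of i] blk[of k] that Cons.prems by (auto simp: J_def)
    then show ?case using Cons blk[of i] by auto
  qed simp
  then show "distinct os" using cls by (simp add: os_def)
  show "set os = {..<n}" using cls(2) blk cl_less by (auto simp: os_def J_def)
qed

definition rr :: "nat \<Rightarrow> real" where
  "rr j = t j - pl (foldl nx (cs0 T) (takeWhile (\<lambda>k. k \<noteq> j) os)) j"

lemma rr_eq: "os = pre @ j # post ==> rr j = t j - pl (foldl nx (cs0 T) pre) j"
proof -
  assume e: "os = pre @ j # post"
  then have "j \<notin> set pre" using os_distinct by auto
  then have "takeWhile (\<lambda>k. k \<noteq> j) (pre @ j # post) = pre" by (induction pre) auto
  then show ?thesis unfolding rr_def e by simp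
qed

lemma nx_bounds: "set js \<subseteq> {..<n} ==> \<exists>k x r. foldl nx (cs0 T) js = (k, x, T / 2, r) \<and> AA T \<le> k \<and> 0 \<le> x \<and> x \<le> T / 2"
proof (induction js rule: rev_induct)
  case Nil then show ?case using T_pos by (auto simp: cs0_def)
next
  case (snoc j js)
  then obtain k x r where st: "foldl nx (cs0 T) js = (k, x, T / 2, r)" "AA T \<le> k" "0 \<le> x" "x \<le> T / 2" by auto
  from sl_bounds[OF st(2-4), of j r] snoc.prems
  obtain k' x' r' where "nx (k, x, T / 2, r) j = (k', x', T / 2, r')" "AA T \<le> k'" "0 \<le> x'" "x' \<le> T / 2" by auto
  then show ?case using st(1) by simp
qed

lemma rr_bounds: assumes "j < n" shows "0 \<le> rr j" "rr j \<le> t j" "ty T (cl j) \<le> 2 ==> rr j = t j"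
proof -
  obtain pre post where e: "os = pre @ j # post" using assms os_set by (metis lessThan_iff split_list)
  have "set pre \<subseteq> {..<n}" using os_set e by auto
  from nx_bounds[OF this] obtain k x r where st: "foldl nx (cs0 T) pre = (k, x, T / 2, r)" "AA T \<le> k" "0 \<le> x" "x \<le> T / 2" by blast
  have "0 \<le> pl (k, x, T / 2, r) j" "pl (k, x, T / 2, r) j \<le> am T j" using sl_bounds[OF st(2-4) assms, of r] by auto
  then show "0 \<le> rr j" "rr j \<le> t j" "ty T (cl j) \<le> 2 ==> rr j = t j"
    unfolding rr_eq[OF e] st(1) using am_le[OF assms] by (auto simp: am_def)
qed

lemma rr_sum: "os = A @ js @ B ==> sum_list (map rr js) = sum_list (map t js) - sum_list (ps (foldl nx (cs0 T) A) js)"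
proof (induction js arbitrary: A)
  case (Cons j js)
  have "rr j = t j - pl (foldl nx (cs0 T) A) j" using Cons.prems by (intro rr_eq) simp
  moreover have "sum_list (map rr js) = sum_list (map t js) - sum_list (ps (foldl nx (cs0 T) (A @ [j])) js)"
    using Cons.prems by (intro Cons.IH) simp
  ultimately show ?case by simp
qed simp

lemma rr_class: "i < c ==> (\<Sum>j\<in>J i. rr j) = P i - y i"
proof -
  assume i: "i < c"
  then obtain cp cq where e: "cls = cp @ i # cq" using cls(2) by (metis lessThan_iff split_list)
  have "sum_list (map rr (blk i)) = sum_list (map t (blk i)) - sum_list (ps (bef i) (blk i))"
    unfolding bef_eq[OF e] by (rule rr_sum[of _ _ "concat (map blk cq)"]) (unfold os_def, simp add: e)
  moreover have "sum_list (map f (blk i)) = (\<Sum>j\<in>J i. f j)" for f :: "nat \<Rightarrow> real"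
    using blk[OF i] by (simp add: sum_list_distinct_conv_sum_set)
  ultimately show ?thesis by (simp add: y_def P_def)
qed

definition mst :: "cursor \<Rightarrow> nat \<Rightarrow> cursor" where "mst c0 j = fst (mp T c0 j (rr j))"
fun okl :: "cursor \<Rightarrow> nat list \<Rightarrow> bool" where
  "okl c0 [] = True"
| "okl c0 (j # js) = (okm T c0 j (rr j) \<and> okl (mst c0 j) js)"

lemma okl_append: "okl c0 (xs @ ys) \<longleftrightarrow> okl c0 xs \<and> okl (foldl mst c0 xs) ys"
  by (induction xs arbitrary: c0) auto

lemma okl_fits:
  assumes "\<And>j. j \<in> set js ==> j < n \<and> cl j = i" "ty T i \<le> 2" "0 \<le> k" "k < int m" "T / 2 \<le> x" "b \<le> 3 / 2 * T"
    "x + sum_list (map t js) \<le> b"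
  shows "okl (k, x, b, int i) js \<and> foldl mst (k, x, b, int i) js = (k, x + sum_list (map t js), b, int i)"
  using assms
proof (induction js arbitrary: x)
  case (Cons j js)
  have j: "j < n" "cl j = i" using Cons.prems(1) by auto
  have r: "rr j = t j" "0 < t j" using rr_bounds(3)[OF j(1)] j(2) Cons.prems(2) t_pos[OF j(1)] by auto
  have "0 \<le> sum_list (map t js)" using Cons.prems(1) t_pos by (intro sum_list_nonneg) (auto intro: less_imp_le)
  then have xt: "x + t j \<le> b" using Cons.prems(7) by simp
  have "okl (k, x + t j, b, int i) js \<and> foldl mst (k, x + t j, b, int i) js = (k, x + t j + sum_list (map t js), b, int i)"
    using Cons.prems r by (intro Cons.IH) auto
  moreover have "mst (k, x, b, int i) j = (k, x + t j, b, int i)"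
    using xt r j Cons.prems(4) by (simp add: mst_def mp_def put_def opn_def pce_def)
  moreover have "okm T (k, x, b, int i) j (rr j)" using Cons.prems r xt j by (auto simp: okm_def opn_def Let_def)
  ultimately show ?case by (simp add: algebra_simps)
qed auto

text \<open>A class of type 0: the current machine ends at \<open>b\<close>, each of
  \<open>q\<close> further ones at \<open>T\<close>. Since the load equals this capacity exactly,
  the class ends precisely at the end of the last machine and leaves no rest. A wrapped part starts
  after a setup longer than \<open>T / 2\<close>, as \<open>okm\<close> demands.\<close>

lemma okl_plus:
  assumes "\<And>j. j \<in> set js ==> j < n \<and> cl j = i" "i < c" "ty T i = 0" "0 \<le> k" "k + q < AA T" "0 \<le> q" "s i \<le> x" "x \<le> b"
    "T \<le> b" "b \<le> 3 / 2 * T" "sum_list (map t js) = (b - x) + real_of_int q * (T - s i)"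
  shows "okl (k, x, b, int i) js \<and> (\<exists>b'. foldl mst (k, x, b, int i) js = (k + q, b', b', int i) \<and> T \<le> b' \<and> b' \<le> 3 / 2 * T)"
  using assms
proof (induction js arbitrary: k q x b)
  case Nil
  have "0 < T - s i" using s_less Nil by simp
  have "0 \<le> real_of_int q * (T - s i)" using Nil.prems(6) \<open>0 < T - s i\<close> by simp
  moreover have "b - x + real_of_int q * (T - s i) = 0" using Nil.prems(11) by simp
  ultimately have bx: "b = x" "real_of_int q * (T - s i) = 0" using Nil.prems(8) by linarith+
  then have "q = 0" using \<open>0 < T - s i\<close> by simp
  then show ?case using Nil.prems bx by auto
next
  case (Cons j js)
  have j: "j < n" "cl j = i" using Cons.prems(1) by auto
  have r: "rr j = t j" "0 < t j" using rr_bounds(3)[OF j(1)] j(2) Cons.prems(3) t_pos[OF j(1)] by auto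
  have sT: "s i < T" "T < 2 * s i" "s i + t j \<le> T"
    using s_less[OF Cons.prems(2)] Cons.prems(3) job_le[OF j(1)] j by (auto simp: ty_def split: if_splits)
  have nn: "0 \<le> sum_list (map t js)" using Cons.prems(1) t_pos by (intro sum_list_nonneg) (auto intro: less_imp_le)
  have Am: "AA T \<le> int m" using Al by simp
  show ?case
  proof (cases "x + t j \<le> b")
    case True
    have "okl (k, x + t j, b, int i) js \<and> (\<exists>b'. foldl mst (k, x + t j, b, int i) js = (k + q, b', b', int i) \<and> T \<le> b' \<and> b' \<le> 3 / 2 * T)"
      using Cons.prems True r by (intro Cons.IH) auto
    moreover have "mst (k, x, b, int i) j = (k, x + t j, b, int i)"
      using True r j Cons.prems Am by (simp add: mst_def mp_def put_def opn_def pce_def)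
    moreover have "okm T (k, x, b, int i) j (rr j)" using Cons.prems r True j sT Am by (auto simp: okm_def opn_def Let_def)
    ultimately show ?thesis by simp
  next
    case False
    have q1: "1 \<le> q"
    proof (rule ccontr)
      assume "\<not> 1 \<le> q"
      then have "q = 0" using Cons.prems(6) by simp
      then show False using Cons.prems(11) False nn by simp
    qed
    let ?x = "s i + (t j - (b - x))"
    have "okl (k + 1, ?x, T, int i) js \<and> (\<exists>b'. foldl mst (k + 1, ?x, T, int i) js = (k + 1 + (q - 1), b', b', int i) \<and> T \<le> b' \<and> b' \<le> 3 / 2 * T)"
      using Cons.prems False r q1 sT T_pos by (intro Cons.IH) (auto simp: algebra_simps)
    moreover have "mst (k, x, b, int i) j = (k + 1, ?x, T, int i)"
      using False r j q1 Cons.prems Am by (simp add: mst_def mp_def put_def opn_def pce_def p0_def bc_def)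
    moreover have "okm T (k, x, b, int i) j (rr j)"
      using Cons.prems r False j sT Am q1 by (auto simp: okm_def opn_def Let_def p0_def)
    ultimately show ?thesis by simp
  qed
qed

lemma okl_new:
  assumes "js \<noteq> []" "\<And>j. j \<in> set js ==> j < n \<and> cl j = i" "0 < rr (hd js)" "r \<noteq> int i" "b < x + s i"
    "0 \<le> k + 1" "k + 1 < int m" "AA T \<le> k + 1 ==> k + 1 < AA T + ll T ==> T / 2 \<le> p0 T i"
    "okl (k + 1, p0 T i + s i, bo T i, int i) js"
  shows "okl (k, x, b, r) js \<and> foldl mst (k, x, b, r) js = foldl mst (k + 1, p0 T i + s i, bo T i, int i) js"
proof -
  obtain j js' where jj: "js = j # js'" using assms(1) by (cases js) auto
  have j: "cl j = i" "0 < rr j" using assms(2,3) jj by auto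
  have "mst (k, x, b, r) j = mst (k + 1, p0 T i + s i, bo T i, int i) j"
    using assms(4,5) j by (simp add: mst_def mp_def put_def opn_def split: prod.splits)
  moreover have "okm T (k, x, b, r) j (rr j)"
    using assms(4-9) j unfolding jj by (auto simp: okm_def opn_def Let_def)
  ultimately show ?thesis using assms(9) unfolding jj by simp
qed

lemma okl_old:
  assumes "js \<noteq> []" "\<And>j. j \<in> set js ==> j < n \<and> cl j = i" "0 < rr (hd js)" "r \<noteq> int i" "x + s i \<le> b"
    "0 \<le> k" "k < int m" "T / 2 \<le> x" "okl (k, x + s i, b, int i) js"
  shows "okl (k, x, b, r) js \<and> foldl mst (k, x, b, r) js = foldl mst (k, x + s i, b, int i) js"
proof -
  obtain j js' where jj: "js = j # js'" using assms(1) by (cases js) auto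
  have j: "cl j = i" "0 < rr j" using assms(2,3) jj by auto
  have "mst (k, x, b, r) j = mst (k, x + s i, b, int i) j"
    using assms(4-7) j by (simp add: mst_def mp_def put_def opn_def split: prod.splits)
  moreover have "okm T (k, x, b, r) j (rr j)"
    using assms(4-9) j unfolding jj by (auto simp: okm_def opn_def Let_def)
  ultimately show ?thesis using assms(9) unfolding jj by simp
qed

definition cnt :: "nat \<Rightarrow> nat list \<Rightarrow> int" where
  "cnt v pre = (\<Sum>i\<leftarrow>pre. if ty T i = v then mc T i else 0)"

lemma cnt_total: "cnt 0 cls = AA T" "cnt 1 cls = ll T" "cnt 0 cls + cnt 1 cls + cnt 2 cls \<le> int m"
proof -
  have *: "cnt v cls = (\<Sum>i\<in>{i. i < c \<and> ty T i = v}. mc T i)" for v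
  proof -
    have "cnt v cls = (\<Sum>i\<in>{..<c}. if ty T i = v then mc T i else 0)"
      unfolding cnt_def using cls(1,2) by (simp add: sum_list_distinct_conv_sum_set)
    also have "\<dots> = (\<Sum>i\<in>{i. i < c \<and> ty T i = v}. mc T i)" by (rule sum.mono_neutral_cong_right) auto
    finally show ?thesis .
  qed
  show 0: "cnt 0 cls = AA T" unfolding * AA_def by (rule sum.cong) (auto simp: mc_def)
  have "cnt 1 cls = (\<Sum>i\<in>{i. i < c \<and> ty T i = 1}. 1)" unfolding * by (rule sum.cong) (auto simp: mc_def)
  then show 1: "cnt 1 cls = ll T" by (simp add: ll_def)
  have "cnt 2 cls = (\<Sum>i\<in>{i. i < c \<and> ty T i = 2}. 1)" unfolding * by (rule sum.cong) (auto simp: mc_def)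
  then show "cnt 0 cls + cnt 1 cls + cnt 2 cls \<le> int m" using 0 1 mc_le by simp
qed

lemma cnt_snoc: "cnt v (pre @ [i]) = cnt v pre + (if ty T i = v then mc T i else 0)" by (simp add: cnt_def)

lemma cnt_nonneg: "set pre \<subseteq> {..<c} ==> 0 \<le> cnt v pre"
  unfolding cnt_def using mc_nonneg by (intro sum_list_nonneg) auto
lemma cnt_append: "cnt v (pre @ post) = cnt v pre + cnt v post" by (simp add: cnt_def)
lemma cnt_none: "(\<And>i. i \<in> set pre ==> ty T i \<noteq> v) ==> cnt v pre = 0"
  unfolding cnt_def by (induction pre) auto

text \<open>Free capacity is counted as \<open>T\<close> per untouched machine plus the rest of the
  current one, and it covers \<open>m * T\<close> minus the charges. For types 0 and 1 every machine
  is finished and equality holds. For type 2, whose loads lie between \<open>T / 2\<close> and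
  \<open>3 / 4 * T\<close>, the rest of a machine is either at least \<open>3 / 4 * T\<close>, room
  for a whole further class, or at most \<open>T / 2\<close>, too short for an expensive
  setup.\<close>

definition einv :: "nat list \<Rightarrow> bool" where
  "einv pre \<longleftrightarrow> (case foldl mst (cm0 T) (concat (map blk pre)) of (k, x, b, r) \<Rightarrow>
    okl (cm0 T) (concat (map blk pre)) \<and> (r = - 1 \<or> r \<in> int ` set pre) \<and> T / 2 \<le> x \<and> x \<le> b \<and> b \<le> 3 / 2 * T \<and>
    cnt 0 pre + cnt 1 pre \<le> k + 1 \<and> k + 1 \<le> cnt 0 pre + cnt 1 pre + cnt 2 pre \<and> (x < b \<longrightarrow> b = 3 / 2 * T \<and> 0 \<le> k) \<and>
    (cnt 2 pre = 0 \<longrightarrow> x = b \<and> (int m - 1 - k) * T = m * T - (\<Sum>i\<in>set pre. eo i)) \<and>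
    (b - x \<le> T / 2 \<or> 3 / 4 * T \<le> b - x) \<and>
    m * T - (\<Sum>i\<in>set pre. eo i) \<le> (int m - 1 - k) * T + (b - x))"

lemma einv_all: "cls = pre @ post ==> (\<And>i. i \<in> set pre ==> ty T i \<le> 2) ==> einv pre"
proof (induction pre arbitrary: post rule: rev_induct)
  case Nil
  show ?case using T_pos by (simp add: einv_def cm0_def cnt_def algebra_simps)
next
  case (snoc i pre)
  have cl: "cls = pre @ i # post" using snoc.prems by simp
  have IH: "einv pre" using snoc.IH[of "i # post"] snoc.prems by simp
  have ic: "i < c" "i \<notin> set pre" using cls cl by auto
  have subc: "set pre \<subseteq> {..<c}" "set post \<subseteq> {..<c}" using cls(2) cl by auto
  have ty2: "ty T i \<le> 2" using snoc.prems by simp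
  obtain k x b r where st: "foldl mst (cm0 T) (concat (map blk pre)) = (k, x, b, r)" by (metis prod_cases4)
  have Iv: "okl (cm0 T) (concat (map blk pre))" "r = - 1 \<or> r \<in> int ` set pre" "T / 2 \<le> x" "x \<le> b" "b \<le> 3 / 2 * T"
    "cnt 0 pre + cnt 1 pre \<le> k + 1" "k + 1 \<le> cnt 0 pre + cnt 1 pre + cnt 2 pre" "x < b \<longrightarrow> b = 3 / 2 * T \<and> 0 \<le> k"
    "cnt 2 pre = 0 \<longrightarrow> x = b \<and> (int m - 1 - k) * T = m * T - (\<Sum>i\<in>set pre. eo i)"
    "b - x \<le> T / 2 \<or> 3 / 4 * T \<le> b - x" "m * T - (\<Sum>i\<in>set pre. eo i) \<le> (int m - 1 - k) * T + (b - x)"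
    using IH unfolding einv_def st by simp_all
  have ri: "r \<noteq> int i" using Iv(2) ic by auto
  have sum: "(\<Sum>i\<in>set (pre @ [i]). eo i) = (\<Sum>i\<in>set pre. eo i) + eo i" using ic by simp
  have bj: "j < n \<and> cl j = i" if "j \<in> set (blk i)" for j using that blk[OF ic(1)] by (auto simp: J_def)
  have hd: "0 < rr (hd (blk i))"
    using bj[of "hd (blk i)"] rr_bounds(3)[of "hd (blk i)"] t_pos[of "hd (blk i)"] ty2 blk_ne[OF ic(1)] by simp
  have srt: "ty T a \<le> ty T i" if "a \<in> set pre" for a using cls(3) that unfolding cl by (auto simp: sorted_append)
  have srt2: "ty T i \<le> ty T a" if "a \<in> set post" for a using cls(3) that unfolding cl by (auto simp: sorted_append)
  have Pt: "sum_list (map t (blk i)) = P i" using blk[OF ic(1)] by (simp add: P_def sum_list_distinct_conv_sum_set)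
  have sT: "s i < T" "T < 2 * s i" "0 < s i" using s_less[OF ic(1)] ty2 s_pos[OF ic(1)] by (auto simp: ty_def split: if_splits)
  have cp: "0 \<le> cnt v pre" "0 \<le> cnt v post" for v using cnt_nonneg subc by auto
  have tot: "cnt v cls = cnt v pre + (if ty T i = v then mc T i else 0) + cnt v post" for v
    using cnt_append[of v "pre @ [i]" post] unfolding cl by (simp add: cnt_snoc)
  have new: "foldl mst (cm0 T) (concat (map blk (pre @ [i]))) = foldl mst (k, x, b, r) (blk i)"
    "okl (cm0 T) (concat (map blk (pre @ [i]))) \<longleftrightarrow> okl (k, x, b, r) (blk i)"
    using st Iv(1) by (simp_all add: okl_append)
  have k0: "0 \<le> k + 1" using Iv(6) cp(1)[of 0] cp(1)[of 1] by linarith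
  consider (0) "ty T i = 0" | (1) "ty T i = 1" | (2) "ty T i = 2" using ty2 by linarith
  then show ?case
  proof cases
    case 0
    have c0: "cnt 1 pre = 0" "cnt 2 pre = 0" using srt 0 by (auto intro!: cnt_none)
    have kA: "k + 1 = cnt 0 pre" "x = b" "(int m - 1 - k) * T = m * T - (\<Sum>i\<in>set pre. eo i)" using Iv(6,7,9) c0 by auto
    have mci: "mc T i = al T i" "1 \<le> al T i" using 0 al1[OF ic(1)] by (auto simp: mc_def)
    have kal: "k + 1 + (al T i - 1) < AA T"
      using tot[of 0] cnt_total(1) 0 mci kA cp[of 0] by simp
    have AAm: "AA T \<le> int m" using Al by simp
    have bnd: "T \<le> bo T i" "bo T i \<le> 3 / 2 * T"
      using al_bounds[OF sT(1)] sT 0 by (auto simp: bo_def L_def algebra_simps)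
    have P0: "p0 T i = 0" using 0 by (simp add: p0_def)
    have "sum_list (map t (blk i)) = (bo T i - s i) + real_of_int (al T i - 1) * (T - s i)"
      unfolding Pt using 0 by (simp add: bo_def L_def)
    from okl_plus[OF bj ic(1) 0 k0 kal _ order_refl _ bnd this] mci sT bnd
    obtain b' where A: "okl (k + 1, s i, bo T i, int i) (blk i)" "T \<le> b'" "b' \<le> 3 / 2 * T"
      "foldl mst (k + 1, s i, bo T i, int i) (blk i) = (k + 1 + (al T i - 1), b', b', int i)" by auto
    have "okl (k, x, b, r) (blk i) \<and> foldl mst (k, x, b, r) (blk i) = foldl mst (k + 1, p0 T i + s i, bo T i, int i) (blk i)"
      by (rule okl_new[OF blk_ne[OF ic(1)] bj hd ri]) (use k0 kal mci kA sT AAm A P0 in auto)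
    then have B: "okl (k, x, b, r) (blk i)" "foldl mst (k, x, b, r) (blk i) = (k + al T i, b', b', int i)"
      using A(4) P0 by auto
    have "(int m - 1 - (k + al T i)) * T = m * T - ((\<Sum>i\<in>set pre. eo i) + eo i)"
      using kA(3) 0 by (simp add: eo_def algebra_simps)
    then show ?thesis unfolding einv_def new B(2) sum
      using B(1) A(2,3) T_pos kA c0 mci 0 by (simp add: cnt_snoc)
  next
    case 1
    have c0: "cnt 2 pre = 0" using srt 1 by (force intro!: cnt_none)
    have kA: "k + 1 = cnt 0 pre + cnt 1 pre" "x = b" "(int m - 1 - k) * T = m * T - (\<Sum>i\<in>set pre. eo i)" using Iv(6,7,9) c0 by auto
    have mci: "mc T i = 1" using 1 by (simp add: mc_def)
    have km: "k + 1 < int m" using tot[of 0] tot[of 1] tot[of 2] cnt_total(3) 1 mci kA cp[of 0] cp[of 1] cp[of 2] by simp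
    have P0: "p0 T i = 3 / 2 * T - L i" "bo T i = 3 / 2 * T" "T / 2 \<le> p0 T i"
      using 1 by (auto simp: p0_def bo_def ty_def split: if_splits)
    have A: "okl (k + 1, p0 T i + s i, bo T i, int i) (blk i) \<and>
      foldl mst (k + 1, p0 T i + s i, bo T i, int i) (blk i) = (k + 1, p0 T i + s i + sum_list (map t (blk i)), bo T i, int i)"
      by (rule okl_fits[OF bj ty2]) (use k0 km P0 sT in \<open>auto simp: Pt L_def\<close>)
    have "okl (k, x, b, r) (blk i) \<and> foldl mst (k, x, b, r) (blk i) = foldl mst (k + 1, p0 T i + s i, bo T i, int i) (blk i)"
      by (rule okl_new[OF blk_ne[OF ic(1)] bj hd ri]) (use k0 km P0 sT kA A in auto)
    then have B: "okl (k, x, b, r) (blk i)" "foldl mst (k, x, b, r) (blk i) = (k + 1, 3 / 2 * T, 3 / 2 * T, int i)"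
      using A P0 by (auto simp: Pt L_def)
    have "(int m - 1 - (k + 1)) * T = m * T - ((\<Sum>i\<in>set pre. eo i) + eo i)"
      using kA(3) 1 by (simp add: eo_def algebra_simps)
    then show ?thesis unfolding einv_def new B(2) sum
      using B(1) T_pos kA c0 mci 1 by (simp add: cnt_snoc)
  next
    case 2
    have mci: "mc T i = 1" using 2 by (simp add: mc_def)
    have L2: "4 * L i \<le> 3 * T" "s i < L i" "eo i = L i" using 2 P_pos[OF ic(1)] by (auto simp: ty_def L_def eo_def split: if_splits)
    have P0: "p0 T i = 0" "bo T i = 3 / 2 * T" using 2 by (auto simp: p0_def bo_def)
    have post0: "cnt 0 post = 0" "cnt 1 post = 0" using srt2 2 by (force intro!: cnt_none)+
    have kA: "AA T + ll T \<le> k + 1" using tot[of 0] tot[of 1] post0 cnt_total(1,2) Iv(6) 2 by simp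
    have c2: "cnt 2 (pre @ [i]) \<noteq> 0" using mci 2 cp(1)[of 2] by (simp add: cnt_snoc)
    have km: "k + 1 < int m" using tot[of 0] tot[of 1] tot[of 2] cnt_total(3) 2 mci Iv(7) cp[of 0] cp[of 1] cp[of 2] by simp
    show ?thesis
    proof (cases "b - x \<le> T / 2")
      case True
      have A: "okl (k + 1, s i, bo T i, int i) (blk i) \<and>
        foldl mst (k + 1, s i, bo T i, int i) (blk i) = (k + 1, s i + sum_list (map t (blk i)), bo T i, int i)"
        by (rule okl_fits[OF bj ty2]) (use k0 km P0 sT L2 in \<open>auto simp: Pt L_def\<close>)
      have "okl (k, x, b, r) (blk i) \<and> foldl mst (k, x, b, r) (blk i) = foldl mst (k + 1, p0 T i + s i, bo T i, int i) (blk i)"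
        by (rule okl_new[OF blk_ne[OF ic(1)] bj hd ri]) (use k0 km P0 sT kA A True in auto)
      then have B: "okl (k, x, b, r) (blk i)" "foldl mst (k, x, b, r) (blk i) = (k + 1, L i, 3 / 2 * T, int i)"
        using A P0 by (auto simp: Pt L_def)
      \<comment> \<open>The abandoned rest of at most \<open>T / 2\<close> is made up for by the
        fresh machine, which counted as \<open>T\<close> and offers
        \<open>3 / 2 * T\<close>.\<close>
      have "m * T - ((\<Sum>i\<in>set pre. eo i) + eo i) \<le> (int m - 1 - (k + 1)) * T + (3 / 2 * T - L i)"
        using Iv(11) True L2 by (simp add: algebra_simps)
      then show ?thesis unfolding einv_def new B(2) sum
        using B(1) sT L2 T_pos Iv(6,7) k0 mci 2 c2 by (simp add: cnt_snoc)
    next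
      case False
      then have F: "3 / 4 * T \<le> b - x" "b = 3 / 2 * T" "0 \<le> k" using Iv(8,10) T_pos by auto
      have A: "okl (k, x + s i, b, int i) (blk i) \<and>
        foldl mst (k, x + s i, b, int i) (blk i) = (k, x + s i + sum_list (map t (blk i)), b, int i)"
        by (rule okl_fits[OF bj ty2]) (use km F sT L2 Iv in \<open>auto simp: Pt L_def\<close>)
      have "okl (k, x, b, r) (blk i) \<and> foldl mst (k, x, b, r) (blk i) = foldl mst (k, x + s i, b, int i) (blk i)"
        by (rule okl_old[OF blk_ne[OF ic(1)] bj hd ri]) (use km F sT L2 Iv A in auto)
      then have B: "okl (k, x, b, r) (blk i)" "foldl mst (k, x, b, r) (blk i) = (k, x + L i, b, int i)"
        using A by (auto simp: Pt L_def)
      have "m * T - ((\<Sum>i\<in>set pre. eo i) + eo i) \<le> (int m - 1 - k) * T + (b - (x + L i))"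
        using Iv(11) L2(3) by linarith
      moreover have bb: "x + L i < b \<longrightarrow> b = 3 / 2 * T \<and> 0 \<le> k" using F by simp
      moreover have "b - (x + L i) \<le> T / 2" "T / 2 \<le> x + L i" "x + L i \<le> b" using sT L2(1,2) T_pos Iv(3) F by linarith+
      ultimately show ?thesis unfolding einv_def new B(2) sum
        using B(1) Iv(5-7) bb mci 2 c2 by (simp add: cnt_snoc)
    qed
  qed
qed

text \<open>Demand of a set of jobs on the main track: the remaining loads and one setup for each
  class with a remainder. A setup repeated at a wrap ends at \<open>T / 2\<close>, below the time
  \<open>T\<close> that is counted for a machine, so it costs nothing.\<close>

definition vol :: "nat set \<Rightarrow> real" where
  "vol W = (\<Sum>j\<in>W. rr j) + (\<Sum>i\<in>cl ` {j \<in> W. 0 < rr j}. s i)"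

definition CJ :: "nat set" where "CJ = {j. j < n \<and> 3 \<le> ty T (cl j)}"

lemma vol_mono: "W \<subseteq> W' ==> W' \<subseteq> {..<n} ==> vol W \<le> vol W'"
proof -
  assume W: "W \<subseteq> W'" "W' \<subseteq> {..<n}"
  have fin: "finite W'" by (rule finite_subset[OF W(2)]) simp
  have "(\<Sum>j\<in>W. rr j) \<le> (\<Sum>j\<in>W'. rr j)"
    by (rule sum_mono2[OF fin W(1)]) (use W(2) rr_bounds(1) in blast)
  moreover have "(\<Sum>i\<in>cl ` {j \<in> W. 0 < rr j}. s i) \<le> (\<Sum>i\<in>cl ` {j \<in> W'. 0 < rr j}. s i)"
  proof (rule sum_mono2)
    fix i assume "i \<in> cl ` {j \<in> W'. 0 < rr j} - cl ` {j \<in> W. 0 < rr j}"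
    then obtain j where "j \<in> W'" "i = cl j" by blast
    then have "0 < s i" using W(2) cl_less s_pos by blast
    then show "0 \<le> s i" by simp
  qed (use fin W(1) in auto)
  ultimately show ?thesis by (simp add: vol_def)
qed

lemma vol_insert:
  assumes "j \<notin> W" "finite W" "0 < rr j"
  shows "vol (insert j W) = vol W + rr j + (if cl j \<in> cl ` {j \<in> W. 0 < rr j} then 0 else s (cl j))"
proof -
  have "{k \<in> insert j W. 0 < rr k} = insert j {k \<in> W. 0 < rr k}" using assms(3) by auto
  then show ?thesis using assms unfolding vol_def by (auto simp: sum.insert_if)
qed

lemma vol_CJ: "vol CJ \<le> RR"
proof -
  let ?C = "{i. i < c \<and> 3 \<le> ty T i}"
  have "(\<Sum>j\<in>CJ. rr j) = (\<Sum>i\<in>?C. \<Sum>j\<in>J i. rr j)"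
  proof -
    have "CJ = (\<Union>i\<in>?C. J i)" using cl_less by (auto simp: CJ_def J_def)
    then show ?thesis by (simp add: sum.UNION_disjoint J_def disjoint_iff)
  qed
  also have "\<dots> = (\<Sum>i\<in>?C. P i - y i)" by (rule sum.cong) (auto simp: rr_class)
  finally have 1: "(\<Sum>j\<in>CJ. rr j) = (\<Sum>i\<in>?C. P i - y i)" .
  have "(\<Sum>i\<in>cl ` {j \<in> CJ. 0 < rr j}. s i) \<le> (\<Sum>i\<in>{i \<in> ?C. y i \<noteq> P i}. s i)"
  proof (rule sum_mono2)
    show "cl ` {j \<in> CJ. 0 < rr j} \<subseteq> {i \<in> ?C. y i \<noteq> P i}"
    proof
      fix i assume "i \<in> cl ` {j \<in> CJ. 0 < rr j}"
      then obtain j where j: "j < n" "3 \<le> ty T (cl j)" "0 < rr j" "i = cl j" by (auto simp: CJ_def)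
      have "0 < (\<Sum>k\<in>J i. rr k)" by (rule sum_pos2[of _ j]) (use j rr_bounds(1) in \<open>auto simp: J_def\<close>)
      then show "i \<in> {i \<in> ?C. y i \<noteq> P i}" using j cl_less rr_class[of i] by auto
    qed
  qed (use s_pos in \<open>auto intro: less_imp_le\<close>)
  also have "\<dots> = (\<Sum>i\<in>?C. if y i = P i then 0 else s i)" by (rule sum.mono_neutral_cong_left) auto
  finally have "vol CJ \<le> (\<Sum>i\<in>?C. P i - y i) + (\<Sum>i\<in>?C. if y i = P i then 0 else s i)" unfolding vol_def 1 by simp
  also have "\<dots> = (\<Sum>i\<in>?C. ovol i)" unfolding sum.distrib[symmetric] by (rule sum.cong) (auto simp: ovol_def)
  finally show ?thesis using ovol_le by simp
qed

definition cinv :: "nat \<Rightarrow> cursor \<Rightarrow> nat set \<Rightarrow> bool" where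
  "cinv i c0 W \<longleftrightarrow> (case c0 of (k, x, b, r) \<Rightarrow> AA T + ll T \<le> k + 1 \<and> k < int m \<and> T / 2 \<le> x \<and> x \<le> b \<and> b \<le> 3 / 2 * T \<and>
     (x < b \<or> r = int i \<longrightarrow> b = 3 / 2 * T \<and> 0 \<le> k) \<and> (r = int i \<longleftrightarrow> i \<in> cl ` {j \<in> W. 0 < rr j}) \<and>
     RR - vol W \<le> (int m - 1 - k) * T + (b - x))"

text \<open>Opening a class either uses \<open>s i\<close> of the current rest or abandons a rest
  shorter than \<open>s i\<close>; both are covered by the one setup charged in \<open>vol\<close>.
  Wrapping loses nothing. If no machine were left when one is required, the demand would exceed
  \<open>RR\<close>, contrary to \<open>vol_CJ\<close>.\<close>

lemma cheap_step:
  assumes c: "cinv i (k, x, b, r) W" and j: "j < n" "cl j = i" "3 \<le> ty T i" "j \<notin> W" "W \<subseteq> CJ"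
  shows "okm T (k, x, b, r) j (rr j)" "cinv i (mst (k, x, b, r) j) (insert j W)"
    "snd (snd (snd (mst (k, x, b, r) j))) \<in> {r, int i}"
proof -
  have cv: "AA T + ll T \<le> k + 1" "k < int m" "T / 2 \<le> x" "x \<le> b" "b \<le> 3 / 2 * T"
    "x < b \<or> r = int i \<longrightarrow> b = 3 / 2 * T \<and> 0 \<le> k" "r = int i \<longleftrightarrow> i \<in> cl ` {j \<in> W. 0 < rr j}"
    "RR - vol W \<le> (int m - 1 - k) * T + (b - x)" using c by (simp_all add: cinv_def)
  have "okm T (k, x, b, r) j (rr j) \<and> cinv i (mst (k, x, b, r) j) (insert j W) \<and>
    snd (snd (snd (mst (k, x, b, r) j))) \<in> {r, int i}"
  proof (cases "0 < rr j")
    case False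
    then have r0: "rr j = 0" using rr_bounds(1)[OF j(1)] by simp
    have "finite W" using finite_subset[OF j(5)] by (simp add: CJ_def)
    then have "vol (insert j W) = vol W" "{k \<in> insert j W. 0 < rr k} = {k \<in> W. 0 < rr k}"
      using r0 j(4) by (auto simp: vol_def intro!: arg_cong[of _ _ "sum s"])
    then show ?thesis using c r0 by (simp add: okm_def mst_def mp_def put_def cinv_def)
  next
    case True
    have ic: "i < c" using cl_less j by blast
    have st: "0 < s i" "2 * s i \<le> T" using s_pos[OF ic] j(3) by (auto simp: ty_cheap)
    have a: "rr j \<le> T" "0 < rr j" using True rr_bounds(2)[OF j(1)] job_le[OF j(1)] j(2) st by auto
    have ps: "p0 T i = T / 2 - s i" "bo T i = 3 / 2 * T" "bc T i = 3 / 2 * T"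
      using j(3) by (auto simp: p0_def bo_def bc_def)
    have finW: "finite W" using finite_subset[OF j(5)] by (simp add: CJ_def)
    have V: "vol (insert j W) = vol W + rr j + (if r = int i then 0 else s i)"
      using vol_insert[OF j(4) finW True] cv(7) j(2) by simp
    have "insert j W \<subseteq> CJ" using j by (auto simp: CJ_def)
    then have "vol (insert j W) \<le> RR" using vol_mono[of "insert j W" CJ] vol_CJ by (force simp: CJ_def)
    then have Vle: "vol W + rr j + (if r = int i then 0 else s i) \<le> RR" using V by simp
    have neg: "(int m - 1 - k) * T = 0" if "int m - 1 - k = 0" for k using that by simp
    obtain k1 x1 b1 r1 E where op: "opn (int m) (s i) (p0 T i) (bo T i) i (k, x, b, r) = ((k1, x1, b1, r1), E)"
      by (metis prod_cases4 surj_pair)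
    have o: "r \<noteq> int i \<longrightarrow> (if k < int m \<and> x + s i \<le> b then 0 \<le> k \<and> T / 2 \<le> x else
        0 \<le> k + 1 \<and> k + 1 < int m \<and> \<not> (AA T \<le> k + 1 \<and> k + 1 < AA T + ll T))"
      "0 \<le> k1" "k1 < int m" "T / 2 \<le> x1" "x1 \<le> b1" "b1 = 3 / 2 * T" "r1 = int i" "AA T + ll T \<le> k1 + 1"
      "RR - (vol W + (if r = int i then 0 else s i)) \<le> (int m - 1 - k1) * T + (b1 - x1)"
    proof -
      have new: "k + 1 < int m" if "r \<noteq> int i" "b < x + s i"
      proof (rule ccontr)
        assume "\<not> k + 1 < int m"
        then have "int m - 1 - k = 0" using cv(2) by simp
        from neg[OF this] show False using cv(8) Vle that a by simp
      qed
      have k0: "0 \<le> k + 1" using cv(1) Al by simp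
      show "r \<noteq> int i \<longrightarrow> (if k < int m \<and> x + s i \<le> b then 0 \<le> k \<and> T / 2 \<le> x else
        0 \<le> k + 1 \<and> k + 1 < int m \<and> \<not> (AA T \<le> k + 1 \<and> k + 1 < AA T + ll T))"
        using cv k0 st new by auto
      show "0 \<le> k1" "k1 < int m" "T / 2 \<le> x1" "x1 \<le> b1" "b1 = 3 / 2 * T" "r1 = int i" "AA T + ll T \<le> k1 + 1"
        using op cv k0 st new ps T_pos by (auto simp: opn_def split: if_splits)
      show "RR - (vol W + (if r = int i then 0 else s i)) \<le> (int m - 1 - k1) * T + (b1 - x1)"
        using op cv st ps by (auto simp: opn_def algebra_simps split: if_splits)
    qed
    have cut: "k1 + 1 < int m" if "\<not> x1 + rr j \<le> b1"
    proof (rule ccontr)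
      assume "\<not> k1 + 1 < int m"
      then have k1: "k1 = int m - 1" using o(3) by simp
      show False using o(9) Vle that unfolding k1 by simp
    qed
    have ok: "okm T (k, x, b, r) j (rr j)"
    proof -
      have new: "0 \<le> k1 + 1 \<and> k1 + 1 < int m \<and> (AA T \<le> k1 + 1 \<and> k1 + 1 < AA T + ll T \<longrightarrow> T / 2 \<le> p0 T i) \<and>
        T / 2 \<le> p0 T i + s i \<and> p0 T i + s i + rr j \<le> b1" if "\<not> x1 + rr j \<le> b1"
        using cut[OF that] o(2,6,8) a ps by auto
      have old: "r \<noteq> int i \<longrightarrow> (if k < int m \<and> x + s i \<le> b then 0 \<le> k \<and> T / 2 \<le> x else
        0 \<le> k + 1 \<and> k + 1 < int m \<and> (AA T \<le> k + 1 \<and> k + 1 < AA T + ll T \<longrightarrow> T / 2 \<le> p0 T i))"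
        using o(1) by auto
      have "b1 \<le> 3 / 2 * T" using o(6) by simp
      then show ?thesis unfolding okm_def Let_def j(2) op prod.case using new old o(2-5) by blast
    qed
    have ms: "mst (k, x, b, r) j = (if x1 + rr j \<le> b1 then (k1, x1 + rr j, b1, int i)
        else (k1 + 1, T / 2 + (rr j - (b1 - x1)), 3 / 2 * T, int i))"
    proof -
      have "mst (k, x, b, r) j = fst (pce (int m) (s i) (p0 T i) (bc T i) i j (rr j) (k1, x1, b1, r1))"
        using True op by (simp add: mst_def mp_def put_def j(2) split: prod.splits)
      then show ?thesis using cut o(3,7) by (auto simp: pce_def ps)
    qed
    have img: "i \<in> cl ` {k \<in> insert j W. 0 < rr k}" using True j(2) by auto
    have "cinv i (mst (k, x, b, r) j) (insert j W)"
    proof (cases "x1 + rr j \<le> b1")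
      case T: True
      then show ?thesis unfolding ms cinv_def V using o a img by (auto simp: algebra_simps)
    next
      case F: False
      then show ?thesis unfolding ms cinv_def V using o a img cut[OF F] T_pos by (auto simp: algebra_simps)
    qed
    then show ?thesis using ok ms by auto
  qed
  then show "okm T (k, x, b, r) j (rr j)" "cinv i (mst (k, x, b, r) j) (insert j W)"
    "snd (snd (snd (mst (k, x, b, r) j))) \<in> {r, int i}" by auto
qed

lemma cheap_block:
  assumes "cinv i (k, x, b, r) W" "W \<subseteq> CJ" "3 \<le> ty T i" "distinct js" "\<And>j. j \<in> set js ==> j < n \<and> cl j = i" "set js \<inter> W = {}"
  shows "okl (k, x, b, r) js \<and> cinv i (foldl mst (k, x, b, r) js) (set js \<union> W) \<and>
    snd (snd (snd (foldl mst (k, x, b, r) js))) \<in> {r, int i}"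
  using assms
proof (induction js arbitrary: k x b r W)
  case (Cons j js)
  have j: "j < n" "cl j = i" "j \<notin> W" using Cons.prems by auto
  note cs = cheap_step[OF Cons.prems(1) j(1,2) Cons.prems(3) j(3) Cons.prems(2)]
  obtain k1 x1 b1 r1 where ev: "mst (k, x, b, r) j = (k1, x1, b1, r1)" by (metis prod_cases4)
  have "okl (k1, x1, b1, r1) js \<and> cinv i (foldl mst (k1, x1, b1, r1) js) (set js \<union> insert j W) \<and>
    snd (snd (snd (foldl mst (k1, x1, b1, r1) js))) \<in> {r1, int i}"
    by (rule Cons.IH) (use Cons.prems cs ev j in \<open>auto simp: CJ_def\<close>)
  then show ?case using cs ev by auto
qed auto

lemma cheap_classes:
  assumes "cls = cp @ cq" "\<And>i. i \<in> set cp ==> ty T i \<le> 2" "\<And>i. i \<in> set cq ==> 3 \<le> ty T i"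
    "cq = q1 @ q2"
  shows "okl (cm0 T) (concat (map blk (cp @ q1))) \<and> (case foldl mst (cm0 T) (concat (map blk (cp @ q1))) of (k, x, b, r) \<Rightarrow>
     (r = - 1 \<or> r \<in> int ` set (cp @ q1)) \<and> AA T + ll T \<le> k + 1 \<and> k < int m \<and> T / 2 \<le> x \<and> x \<le> b \<and> b \<le> 3 / 2 * T \<and>
     (x < b \<longrightarrow> b = 3 / 2 * T \<and> 0 \<le> k) \<and> RR - vol (\<Union>i\<in>set q1. set (blk i)) \<le> (int m - 1 - k) * T + (b - x))"
  using assms(4)
proof (induction q1 arbitrary: q2 rule: rev_induct)
  case Nil
  obtain k x b r where st: "foldl mst (cm0 T) (concat (map blk cp)) = (k, x, b, r)" by (metis prod_cases4)
  have ev: "einv cp" using einv_all assms by blast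
  have E: "(\<Sum>i\<in>set cp. eo i) = (\<Sum>i\<in>{i. i < c \<and> ty T i \<le> 2}. eo i)"
    using assms cls(2) by (intro sum.cong) (auto, force)
  have q0: "cnt 0 cq = 0" "cnt 1 cq = 0" "cnt 2 cq = 0" using assms(3) by (force intro!: cnt_none)+
  have "cnt 0 cp = AA T" "cnt 1 cp = ll T" "cnt 0 cp + cnt 1 cp + cnt 2 cp \<le> int m"
  proof -
    have *: "cnt v cls = cnt v cp + cnt v cq" for v unfolding assms(1) by (rule cnt_append)
    show "cnt 0 cp = AA T" using cnt_total(1) *[of 0] q0 by simp
    show "cnt 1 cp = ll T" using cnt_total(2) *[of 1] q0 by simp
    show "cnt 0 cp + cnt 1 cp + cnt 2 cp \<le> int m" using cnt_total(3) *[of 0] *[of 1] *[of 2] q0 by simp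
  qed
  moreover have "okl (cm0 T) (concat (map blk cp)) \<and> (r = - 1 \<or> r \<in> int ` set cp) \<and> T / 2 \<le> x \<and> x \<le> b \<and> b \<le> 3 / 2 * T \<and>
    cnt 0 cp + cnt 1 cp \<le> k + 1 \<and> k + 1 \<le> cnt 0 cp + cnt 1 cp + cnt 2 cp \<and> (x < b \<longrightarrow> b = 3 / 2 * T \<and> 0 \<le> k) \<and>
    RR \<le> (int m - 1 - k) * T + (b - x)"
    using ev unfolding einv_def st RR_def E[symmetric] by blast
  moreover have "vol (\<Union>i\<in>set []. set (blk i)) = 0" by (simp add: vol_def)
  ultimately show ?case using st by simp
next
  case (snoc i q1)
  obtain k x b r where st: "foldl mst (cm0 T) (concat (map blk (cp @ q1))) = (k, x, b, r)" by (metis prod_cases4)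
  have cl': "cls = cp @ q1 @ i # q2" using assms(1) snoc.prems by simp
  have ic: "i < c" "i \<notin> set (cp @ q1)" using cls cl' by auto
  have qc: "set q1 \<subseteq> {..<c}" using cls(2) cl' by auto
  have I: "okl (cm0 T) (concat (map blk (cp @ q1)))" "r = - 1 \<or> r \<in> int ` set (cp @ q1)" "AA T + ll T \<le> k + 1" "k < int m"
    "T / 2 \<le> x" "x \<le> b" "b \<le> 3 / 2 * T" "x < b \<longrightarrow> b = 3 / 2 * T \<and> 0 \<le> k"
    "RR - vol (\<Union>i\<in>set q1. set (blk i)) \<le> (int m - 1 - k) * T + (b - x)"
    using snoc.IH[of "i # q2"] snoc.prems st by simp_all
  let ?W = "\<Union>i\<in>set q1. set (blk i)"
  have ri: "r \<noteq> int i" using I(2) ic by auto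
  have Wi: "cl j \<noteq> i" if "j \<in> ?W" for j using that ic(2) qc blk by (auto simp: J_def)
  have ci: "cinv i (k, x, b, r) ?W" using I ri Wi by (auto simp: cinv_def)
  have WC: "?W \<subseteq> CJ" using blk qc assms(3) snoc.prems by (auto simp: CJ_def J_def)
  have bi: "distinct (blk i)" "\<And>j. j \<in> set (blk i) ==> j < n \<and> cl j = i" "set (blk i) \<inter> ?W = {}"
    using blk[OF ic(1)] Wi by (auto simp: J_def)
  have ti: "3 \<le> ty T i" using assms(3) snoc.prems by simp
  note cb = cheap_block[OF ci WC ti bi]
  obtain k1 x1 b1 r1 where ev: "foldl mst (k, x, b, r) (blk i) = (k1, x1, b1, r1)" by (metis prod_cases4)
  have U: "(\<Union>i\<in>set (q1 @ [i]). set (blk i)) = set (blk i) \<union> ?W" by auto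
  have f: "foldl mst (cm0 T) (concat (map blk (cp @ q1 @ [i]))) = (k1, x1, b1, r1)" using st ev by simp
  have g: "okl (cm0 T) (concat (map blk (cp @ q1 @ [i])))" using I(1) cb st okl_append[of "cm0 T" "concat (map blk (cp @ q1))" "blk i"] by simp
  have "r1 = - 1 \<or> r1 \<in> int ` set (cp @ q1 @ [i])" using cb I(2) unfolding ev by auto
  moreover have "AA T + ll T \<le> k1 + 1 \<and> k1 < int m \<and> T / 2 \<le> x1 \<and> x1 \<le> b1 \<and> b1 \<le> 3 / 2 * T \<and>
     (x1 < b1 \<longrightarrow> b1 = 3 / 2 * T \<and> 0 \<le> k1) \<and> RR - vol (set (blk i) \<union> ?W) \<le> (int m - 1 - k1) * T + (b1 - x1)"
    using cb unfolding ev cinv_def by blast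
  ultimately show ?case unfolding f U using g by simp
qed

theorem okl_os: "okl (cm0 T) os"
proof -
  define cp where "cp = takeWhile (\<lambda>i. ty T i \<le> 2) cls"
  define cq where "cq = dropWhile (\<lambda>i. ty T i \<le> 2) cls"
  have e: "cls = cp @ cq" by (simp add: cp_def cq_def)
  have p: "\<And>i. i \<in> set cp ==> ty T i \<le> 2" by (auto simp: cp_def dest: set_takeWhileD)
  have q: "3 \<le> ty T i" if "i \<in> set cq" for i
  proof -
    have ne: "cq \<noteq> []" using that by auto
    have "\<not> ty T (hd cq) \<le> 2" using ne unfolding cq_def by (rule hd_dropWhile)
    moreover have "sorted (map (ty T) cq)" using cls(3) unfolding e by (simp add: sorted_append)
    then have "ty T (hd cq) \<le> ty T i" using that ne by (cases cq) auto
    ultimately show ?thesis by simp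
  qed
  have "os = concat (map blk (cp @ cq))" by (unfold os_def, simp only: e)
  then show ?thesis using cheap_classes[OF e p q, of cq "[]"] by simp
qed

lemma fst_step: "fst (step T st j) = nx (fst st) j"
  "fst (snd (step T st j)) = fst (mp T (fst (snd st)) j (t j - pl (fst st) j))"
  by (auto simp: step_def nx_def pl_def split: prod.splits)

theorem construction:
  "feasible_pmtn I (snd (snd (foldl (step T) (cs0 T, cm0 T, []) os)))"
  "\<forall>e\<in>set (snd (snd (foldl (step T) (cs0 T, cm0 T, []) os))). finish_of e \<le> 3 / 2 * T"
proof -
  have run: "fst (foldl (step T) (cs0 T, cm0 T, []) pre) = foldl nx (cs0 T) pre \<and>
    fst (snd (foldl (step T) (cs0 T, cm0 T, []) pre)) = foldl mst (cm0 T) pre" if "os = pre @ post" for pre post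
    using that
  proof (induction pre arbitrary: post rule: rev_induct)
    case (snoc j pre)
    have r: "rr j = t j - pl (foldl nx (cs0 T) pre) j" by (rule rr_eq) (use snoc.prems in simp)
    have "fst (foldl (step T) (cs0 T, cm0 T, []) pre) = foldl nx (cs0 T) pre \<and>
      fst (snd (foldl (step T) (cs0 T, cm0 T, []) pre)) = foldl mst (cm0 T) pre"
      using snoc.IH[of "j # post"] snoc.prems by simp
    then show ?case using r by (simp add: fst_step mst_def[of _ j])
  qed simp
  have "inv (foldl (step T) (cs0 T, cm0 T, []) os) (set os)"
  proof (rule run_inv[OF os_distinct])
    fix pre j post st
    assume *: "os = pre @ j # post" "st = foldl (step T) (cs0 T, cm0 T, []) pre"
    have "okl (foldl mst (cm0 T) pre) (j # post)" using okl_os unfolding *(1) okl_append by simp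
    then show "okm T (fst (snd st)) j (t j - pl (fst st) j)"
      using run[OF *(1)] rr_eq[OF *(1)] *(2) by simp
  qed (simp add: os_set)
  then have "fz (snd (snd (foldl (step T) (cs0 T, cm0 T, []) os)))"
    "\<forall>j<n. tot (snd (snd (foldl (step T) (cs0 T, cm0 T, []) os))) j = t j"
    by (auto simp: inv_def os_set split: prod.splits)
  then show "feasible_pmtn I (snd (snd (foldl (step T) (cs0 T, cm0 T, []) os)))"
    "\<forall>e\<in>set (snd (snd (foldl (step T) (cs0 T, cm0 T, []) os))). finish_of e \<le> 3 / 2 * T"
    by (auto intro!: fz_feasible simp: fz_def)
qed

end

section \<open>Job order, breakpoints and the choice of the makespan\<close>

lemma sorted_filter_concat:
  assumes "sorted (map f xs)" "\<And>x. x \<in> set xs ==> f x < (k::nat)"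
  shows "concat (map (\<lambda>i. filter (\<lambda>x. f x = i) xs) [0..<k]) = xs"
  using assms
proof (induction k arbitrary: xs)
  case 0
  then show ?case by (cases xs) auto
next
  case (Suc k)
  define A where "A = takeWhile (\<lambda>x. f x < k) xs"
  define B where "B = dropWhile (\<lambda>x. f x < k) xs"
  have e: "xs = A @ B" by (simp add: A_def B_def)
  have A: "\<And>x. x \<in> set A ==> f x < k" by (auto simp: A_def dest: set_takeWhileD)
  have B: "f x = k" if "x \<in> set B" for x
  proof -
    have ne: "B \<noteq> []" using that by auto
    have "\<not> f (hd B) < k" using ne unfolding B_def by (rule hd_dropWhile)
    moreover have "sorted (map f B)" using Suc.prems(1) unfolding e by (simp add: sorted_append)
    then have "f (hd B) \<le> f x" using that ne by (cases B) auto
    moreover have "f x < Suc k" using Suc.prems(2)[of x] that e by auto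
    ultimately show ?thesis by simp
  qed
  have fA: "filter (\<lambda>x. f x = i) xs = filter (\<lambda>x. f x = i) A" if "i < k" for i
    unfolding e using B that by (auto simp: filter_empty_conv)
  have "filter (\<lambda>x. f x = k) xs = B" unfolding e using A B by (auto simp: filter_empty_conv filter_id_conv)
  moreover have "concat (map (\<lambda>i. filter (\<lambda>x. f x = i) xs) [0..<k]) = concat (map (\<lambda>i. filter (\<lambda>x. f x = i) A) [0..<k])"
    using fA by (intro arg_cong[of _ _ concat] map_cong) auto
  moreover have "\<dots> = A" using A Suc.prems(1) unfolding e by (intro Suc.IH) (auto simp: sorted_append)
  ultimately show ?case using e by simp
qed

context inst
begin

definition Tm :: real where "Tm = Max ((\<lambda>j. s (cl j) + t j) ` {..<n})"
text \<open>The jumps of \<open>ty\<close>, \<open>bg\<close>, \<open>ok0\<close> and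
  \<open>al\<close>. The last jumps at \<open>s i + P i / k\<close>, and only \<open>k\<close> up to
  the number of jobs of the class matters: if every job fits with its setup, then \<open>P i\<close>
  is at most that number times \<open>T - s i\<close>. This keeps the set linear in
  \<open>n\<close>; \<open>k = 1\<close> yields \<open>L i\<close>.\<close>

definition BP :: "real set" where
  "BP = insert Tm (\<Union>j<n. {2 * s (cl j), 4 * s (cl j), 8 * s (cl j), 4 / 3 * L (cl j), 2 * (s (cl j) + t j)} \<union>
     (\<lambda>k. s (cl j) + P (cl j) / real k) ` {1..card (J (cl j))})"

lemma BP_class:
  assumes "i < c"
  shows "2 * s i \<in> BP" "4 * s i \<in> BP" "8 * s i \<in> BP" "4 / 3 * L i \<in> BP"
    "k \<in> {1..card (J i)} ==> s i + P i / real k \<in> BP" "j \<in> J i ==> 2 * (s i + t j) \<in> BP" "L i \<in> BP"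
proof -
  obtain j0 where j: "j0 < n" "cl j0 = i" using J_ne[OF assms] by (auto simp: J_def)
  then show "2 * s i \<in> BP" "4 * s i \<in> BP" "8 * s i \<in> BP" "4 / 3 * L i \<in> BP" unfolding BP_def by auto
  show k: "k \<in> {1..card (J i)} ==> s i + P i / real k \<in> BP" for k using j unfolding BP_def by blast
  have "1 \<in> {1..card (J i)}" using J_ne[OF assms] by (simp add: Suc_le_eq card_gt_0_iff)
  from k[OF this] show "L i \<in> BP" by (simp add: L_def)
  show "j \<in> J i ==> 2 * (s i + t j) \<in> BP" unfolding BP_def J_def by auto
qed

lemma fits_all: "0 < n ==> (\<forall>j<n. s (cl j) + t j \<le> T) \<longleftrightarrow> Tm \<le> T"
  unfolding Tm_def by (subst Max_le_iff) auto

text \<open>The slope is at least 2 or 4 times the number of machines that the expensive classes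
  leave over. Hence raising \<open>T\<close> between two breakpoints never violates an
  inequality.\<close>

lemma FB_nonneg: assumes "ok0 T" "q < 3" shows "0 \<le> FB q T"
proof -
  have al: "0 \<le> al T i" if i: "i < c" "ty T i = 0" for i
  proof -
    obtain j where "j < n" "cl j = i" using J_ne[OF i(1)] by (auto simp: J_def)
    then have "s i < T" using assms(1) t_pos[of j] by (auto simp: ok0_def)
    then show ?thesis using al_ge1[of i T] i(2) by (auto simp: ty_def split: if_splits)
  qed
  have q: "q = 0 \<or> q = 1 \<or> q = 2" using assms(2) by auto
  let ?w = "if q = 2 then 4 else 2 :: real"
  have "(\<Sum>i<c. - ?w * mc T i) \<le> (\<Sum>i<c. fb q T i)"
    by (rule sum_mono) (use q al in \<open>auto simp: fb_def mc_def Let_def le_Suc_eq numeral_2_eq_2\<close>)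
  moreover have "(\<Sum>i<c. - ?w * mc T i) = - ?w * real_of_int (\<Sum>i<c. mc T i)"
    by (simp add: sum_distrib_left)
  moreover have "real_of_int (\<Sum>i<c. mc T i) \<le> real m" using assms(1) unfolding ok0_def by linarith
  ultimately show ?thesis unfolding FB_def by auto
qed

lemma al_const:
  assumes "i < c" "lo \<le> T" "\<forall>b\<in>BP. T < b \<longleftrightarrow> lo < b" "\<forall>j<n. s (cl j) + t j \<le> lo"
  shows "al T i = al lo i"
proof -
  obtain j where j: "j < n" "cl j = i" using J_ne[OF assms(1)] by (auto simp: J_def)
  have slo: "s i < lo" using assms(4) j t_pos[OF j(1)] by fastforce
  define k where "k = al lo i"
  have b: "k * (lo - s i) < P i" "P i \<le> (k + 1) * (lo - s i)" unfolding k_def using al_bounds[OF slo] by auto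
  have "(k + 1) * (lo - s i) \<le> (k + 1) * (T - s i)"
  proof (rule mult_left_mono)
    have "0 < (k + 1) * (lo - s i)" using b(2) P_pos[OF assms(1)] by linarith
    then show "0 \<le> real_of_int (k + 1)" using slo by (simp add: zero_less_mult_iff)
  qed (use assms(2) in simp)
  then have up: "P i \<le> (k + 1) * (T - s i)" using b(2) by linarith
  have low: "k * (T - s i) < P i"
  proof (cases "k \<ge> 1")
    case True
    \<comment> \<open>Each job of the class is at most \<open>lo - s i\<close>, so \<open>k\<close>
      stays below the number of jobs and the jump at \<open>s i + P i / k\<close> is among the
      breakpoints.\<close>
    have "P i \<le> (\<Sum>j\<in>J i. lo - s i)" unfolding P_def using assms(4) by (intro sum_mono) (auto simp: J_def)
    then have "k * (lo - s i) < card (J i) * (lo - s i)" using b(1) by simp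
    then have "k < card (J i)" using slo by simp
    then have "s i + P i / real (nat k) \<in> BP" using True by (intro BP_class[OF assms(1)]) auto
    moreover have "lo < s i + P i / real (nat k)" using b(1) True by (simp add: field_simps)
    ultimately have "T < s i + P i / real (nat k)" using assms(3) by blast
    then show ?thesis using True by (simp add: field_simps)
  next
    case False
    then have "real_of_int k * (T - s i) \<le> 0" using slo assms(2) by (intro mult_nonpos_nonneg) auto
    then show ?thesis using P_pos[OF assms(1)] by linarith
  qed
  have pos: "0 < T - s i" using slo assms(2) by simp
  have "\<lceil>P i / (T - s i)\<rceil> = k + 1" using up low pos by (intro ceiling_unique) (auto simp: field_simps)
  then show ?thesis by (simp add: al_def k_def)
qed

lemma interval_const:
  assumes "0 < n" "lo \<le> T" "T < hi" "\<forall>b\<in>BP. \<not> (lo < b \<and> b < hi)"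
  shows "ok0 T = ok0 lo" "ok0 lo ==> FA q T = FA q lo" "ok0 lo ==> FB q T = FB q lo"
proof -
  have lt: "T < b \<longleftrightarrow> lo < b" if "b \<in> BP" for b using assms(2,3) bspec[OF assms(4) that] by linarith
  have lt3: "3 * T < 4 * L i \<longleftrightarrow> 3 * lo < 4 * L i" if "i < c" for i using lt[OF BP_class(4)[OF that]] by auto
  have bgs: "{j \<in> J i. T < 2 * (s i + t j)} = {j \<in> J i. lo < 2 * (s i + t j)}"
    "{j \<in> J i. \<not> T < 2 * (s i + t j)} = {j \<in> J i. \<not> lo < 2 * (s i + t j)}" if "i < c" for i
    using lt BP_class(6)[OF that] by blast+
  have bg: "bg T i = bg lo i" "sm T i = sm lo i" if "i < c" for i
    unfolding bg_def sm_def bgs[OF that] by auto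
  have ty: "ty T i = ty lo i" if "i < c" for i
    unfolding ty_def bg[OF that] using lt3[OF that] lt[OF BP_class(1)[OF that]] lt[OF BP_class(2)[OF that]]
      lt[OF BP_class(3)[OF that]] lt[OF BP_class(7)[OF that]] by simp
  have Tm: "Tm \<le> T \<longleftrightarrow> Tm \<le> lo" using lt[of Tm] by (auto simp: BP_def not_less[symmetric])
  have al: "al T i = al lo i" if "i < c" "Tm \<le> lo" for i
    using al_const[OF that(1) assms(2)] lt that(2) fits_all[OF assms(1)] by blast
  have mc: "(\<Sum>i<c. mc T i) = (\<Sum>i<c. mc lo i)" if "Tm \<le> lo"
    by (rule sum.cong) (auto simp: mc_def ty al that)
  show ok: "ok0 T = ok0 lo" unfolding ok0_def fits_all[OF assms(1)] using Tm mc by auto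
  assume "ok0 lo"
  then have Tl: "Tm \<le> lo" unfolding ok0_def fits_all[OF assms(1)] by simp
  show "FA q T = FA q lo" unfolding FA_def
  proof (rule sum.cong[OF refl])
    fix i assume "i \<in> {..<c}"
    then have i: "i < c" by simp
    show "fa q T i = fa q lo i" unfolding fa_def bg[OF i] ty[OF i] ..
  qed
  show "FB q T = FB q lo" unfolding FB_def
  proof (intro arg_cong2[of _ _ _ _ "(+)"] refl sum.cong)
    fix i assume "i \<in> {..<c}"
    then have i: "i < c" by simp
    show "fb q T i = fb q lo i" unfolding fb_def bg[OF i] ty[OF i] al[OF i Tl] ..
  qed
qed

text \<open>The least value from \<open>x\<close> on that satisfies inequality \<open>q\<close> with
  the coefficients frozen at \<open>lo\<close>; \<open>hi\<close> stands for the absence of a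
  root.\<close>

definition rt :: "real \<Rightarrow> real \<Rightarrow> nat \<Rightarrow> real \<Rightarrow> real" where
  "rt lo hi q x = (if FA q lo + FB q lo * x < 0 then (if 0 < FB q lo then - FA q lo / FB q lo else hi) else x)"
definition Tst :: "real \<Rightarrow> real \<Rightarrow> real" where
  "Tst lo hi = (let x = rt lo hi 2 (rt lo hi 1 (rt lo hi 0 lo)) in if ok0 lo \<and> x < hi then x else hi)"

text \<open>The coefficients are constant up to \<open>hi\<close> and the slopes nonnegative, so
  each inequality holds exactly from its root on. Raising the candidate for one inequality therefore
  preserves the earlier ones, and one round through the three suffices.\<close>

lemma Tst_props:
  assumes "0 < n" "lo < hi" "\<not> acc lo" "acc hi" "\<forall>b\<in>BP. \<not> (lo < b \<and> b < hi)"
  shows "acc (Tst lo hi)" "\<And>T. lo \<le> T ==> T < Tst lo hi ==> \<not> acc T"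
proof -
  note C = interval_const[OF assms(1) _ _ assms(5)]
  have main: "acc (Tst lo hi) \<and> (\<forall>T. lo \<le> T \<and> T < Tst lo hi \<longrightarrow> \<not> acc T)"
  proof (cases "ok0 lo")
    case False
    then have "Tst lo hi = hi" by (simp add: Tst_def Let_def)
    moreover have "\<not> acc T" if "lo \<le> T" "T < hi" for T using C(1)[OF that] False by (simp add: acc_def)
    ultimately show ?thesis using assms(4) by auto
  next
    case True
    \<comment> \<open>The candidate satisfies the inequalities in \<open>Q\<close> unless it has
      reached \<open>hi\<close>, and everything that has been skipped is rejected.\<close>
    define G where "G Q x \<longleftrightarrow> lo \<le> x \<and> (\<forall>q\<in>Q. x < hi \<longrightarrow> 0 \<le> FA q lo + FB q lo * x) \<and>
      (\<forall>T. lo \<le> T \<and> T < hi \<and> T < x \<longrightarrow> \<not> acc T)" for Q x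
    have step: "G (insert q Q) (rt lo hi q x)" if "G Q x" "q < 3" "\<forall>p\<in>Q. p < 3" for Q q x
    proof (cases "FA q lo + FB q lo * x < 0")
      case False
      then show ?thesis using that(1) by (auto simp: G_def rt_def)
    next
      case neg: True
      have sl: "0 \<le> FB p lo" if "p < 3" for p using FB_nonneg[OF True that] .
      define z where "z = rt lo hi q x"
      have z: "z = (if 0 < FB q lo then - FA q lo / FB q lo else hi)" using neg by (simp add: z_def rt_def)
      have xz: "x < z \<or> z = hi"
        using neg z by (auto simp: field_simps)
      have rej: "\<not> acc T" if "lo \<le> T" "T < hi" "T < z" for T
      proof -
        have "FA q lo + FB q lo * T < 0"
        proof (cases "0 < FB q lo")
          case True
          then have "T < - FA q lo / FB q lo" using that(3) z by simp
          then show ?thesis using True by (simp add: field_simps)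
        next
          case False
          then show ?thesis using neg sl[OF \<open>q < 3\<close>] by (simp add: less_eq_real_def)
        qed
        then show ?thesis using C(2,3)[OF that(1,2) True] \<open>q < 3\<close> unfolding acc_def by force
      qed
      have new: "0 \<le> FA p lo + FB p lo * z" if "p \<in> insert q Q" "z < hi" for p
      proof (cases "p = q")
        case True
        then show ?thesis using that z by (auto simp: field_simps split: if_splits)
      next
        case False
        have "x < z" using xz that(2) by simp
        then have "0 \<le> FA p lo + FB p lo * x" using \<open>G Q x\<close> that False by (auto simp: G_def)
        moreover have "FB p lo * x \<le> FB p lo * z" using sl[of p] \<open>\<forall>p\<in>Q. p < 3\<close> that(1) False \<open>x < z\<close>
          by (intro mult_left_mono) auto
        ultimately show ?thesis by linarith
      qed
      have "lo \<le> z" using xz \<open>G Q x\<close> assms(2) by (auto simp: G_def)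
      then show ?thesis unfolding z_def[symmetric] using rej new by (auto simp: G_def)
    qed
    define x where "x = rt lo hi 2 (rt lo hi 1 (rt lo hi 0 lo))"
    have "G {} lo" by (auto simp: G_def)
    from step[OF this, of 0] have "G {0} (rt lo hi 0 lo)" by simp
    from step[OF this, of 1] have "G {1, 0} (rt lo hi 1 (rt lo hi 0 lo))" by simp
    from step[OF this, of 2] have G: "G {2, 1, 0} x" by (simp add: x_def)
    have T: "Tst lo hi = (if x < hi then x else hi)" using True by (simp add: Tst_def Let_def x_def)
    have "acc x" if "x < hi"
    proof -
      have "lo \<le> x" using G by (simp add: G_def)
      note Cx = C[OF this that]
      have "0 \<le> FA q x + FB q x * x" if "q < 3" for q
      proof -
        have "q \<in> {2, 1, 0}" using that by auto
        then show ?thesis using G \<open>x < hi\<close> Cx(2,3)[OF True] by (auto simp: G_def)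
      qed
      then show ?thesis using Cx(1) True by (simp add: acc_def)
    qed
    then show ?thesis using G T assms(4) by (auto simp: G_def)
  qed
  then show "acc (Tst lo hi)" "\<And>T. lo \<le> T ==> T < Tst lo hi ==> \<not> acc T" by auto
qed

lemma acc_makespan: assumes "0 < n" "feasible_pmtn I S" "makespan S \<le> T" shows "acc T"
proof -
  have "finish_of e \<le> T" if "e \<in> set S" for e
    using that assms(3) unfolding makespan_def by (simp add: Max_ge)
  then interpret sched I S T by unfold_locales (use assms(2) in auto)
  show ?thesis by (rule lower_bound[OF assms(1)])
qed

definition jlist :: "real \<Rightarrow> nat list \<Rightarrow> nat list" where
  "jlist T js = concat (map (\<lambda>v. filter (\<lambda>j. ty T (cl j) = v) js) [0..<7])"
definition sched_of :: "real \<Rightarrow> nat list \<Rightarrow> schedule" where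
  "sched_of T js = snd (snd (foldl (step T) (cs0 T, cm0 T, []) (jlist T js)))"

lemma sched_of:
  assumes "0 < n" "acc T" "distinct js" "set js = {..<n}" "sorted (map cl js)"
  shows "feasible_pmtn I (sched_of T js)" "\<forall>e\<in>set (sched_of T js). finish_of e \<le> 3 / 2 * T"
proof -
  define blk where "blk i = filter (\<lambda>j. cl j = i) js" for i
  define cls where "cls = concat (map (\<lambda>v. filter (\<lambda>i. ty T i = v) [0..<c]) [0..<7])"
  have d: "distinct (concat (map (\<lambda>v. filter (\<lambda>i. ty T i = v) [0..<c]) vs))" if "distinct vs" for vs
    using that by (induction vs) auto
  have const: "sorted (map f xs)" if "\<forall>x\<in>set xs. f x = v" for f :: "nat \<Rightarrow> nat" and xs v
    using that by (induction xs) auto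
  have so: "sorted (map (ty T) (concat (map (\<lambda>v. filter (\<lambda>i. ty T i = v) [0..<c]) [0..<k])))" for k
  proof (induction k)
    case (Suc k)
    have "sorted (map (ty T) (filter (\<lambda>i. ty T i = k) [0..<c]))" by (rule const[of _ _ k]) auto
    then show ?case using Suc by (auto simp: sorted_append)
  qed simp
  interpret ordered I T blk cls
  proof
    show "distinct (blk i) \<and> set (blk i) = J i" for i using assms(3,4) by (auto simp: blk_def J_def)
    show "distinct cls" unfolding cls_def by (rule d) simp
    have "ty T i < 7" for i using ty_le6[of T i] by linarith
    then show "set cls = {..<c}" by (auto simp: cls_def)
    show "sorted (map (ty T) cls)" unfolding cls_def by (rule so)
  qed (use assms in auto)
  \<comment> \<open>Filtering the jobs, which are sorted by class, by type lists whole class blocks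
    in the order of \<open>cls\<close>; so the order the program can produce is one to which
    \<open>ordered\<close> applies.\<close>
  have "concat (map blk (filter (\<lambda>i. ty T i = v) [0..<c])) = filter (\<lambda>j. ty T (cl j) = v) js" for v
  proof -
    have "js = concat (map blk [0..<c])" unfolding blk_def
      by (rule sorted_filter_concat[symmetric]) (use assms cl_less in auto)
    then have "filter (\<lambda>j. ty T (cl j) = v) js = filter (\<lambda>j. ty T (cl j) = v) (concat (map blk [0..<c]))" by simp
    also have "\<dots> = concat (map blk (filter (\<lambda>i. ty T i = v) cs))" if "cs = [0..<c]" for cs
      unfolding that[symmetric] by (induction cs) (auto simp: blk_def filter_empty_conv intro!: filter_cong)
    finally show ?thesis by simp
  qed
  moreover have "concat (map blk (concat (map f vs))) = concat (map (\<lambda>v. concat (map blk (f v))) vs)" for f :: "nat \<Rightarrow> nat list" and vs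
    by (induction vs) auto
  ultimately have "concat (map blk cls) = jlist T js" unfolding jlist_def cls_def by simp
  then have "jlist T js = os" unfolding os_def by simp
  then show "feasible_pmtn I (sched_of T js)" "\<forall>e\<in>set (sched_of T js). finish_of e \<le> 3 / 2 * T"
    using construction by (simp_all add: sched_of_def)
qed

lemma makespan_le: "0 \<le> B ==> (\<forall>e\<in>set S. finish_of e \<le> B) ==> makespan S \<le> B"
  unfolding makespan_def by simp

text \<open>A makespan from \<open>lo\<close> up to the chosen value is excluded by
  \<open>Tst_props\<close>. One below \<open>lo\<close> would, read as a bound \<open>lo\<close> on
  the same schedule, make \<open>lo\<close> accepted.\<close>

theorem approx:
  assumes "0 < n" "lo < hi" "\<not> acc lo" "acc hi" "\<forall>b\<in>BP. \<not> (lo < b \<and> b < hi)"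
    "distinct js" "set js = {..<n}" "sorted (map cl js)"
  shows "feasible_pmtn I (sched_of (Tst lo hi) js)" "makespan (sched_of (Tst lo hi) js) \<le> 3 / 2 * OPT_pmtn I"
proof -
  note T = Tst_props[OF assms(1-5)]
  note F = sched_of[OF assms(1) T(1) assms(6-8)]
  show "feasible_pmtn I (sched_of (Tst lo hi) js)" by (rule F(1))
  have "Tst lo hi \<le> OPT_pmtn I" unfolding OPT_pmtn_def
  proof (rule cInf_greatest)
    show "makespan ` {S. feasible_pmtn I S} \<noteq> {}" using F(1) by auto
    fix x assume "x \<in> makespan ` {S. feasible_pmtn I S}"
    then obtain S where S: "feasible_pmtn I S" "x = makespan S" by auto
    show "Tst lo hi \<le> x"
    proof (rule ccontr)
      assume "\<not> Tst lo hi \<le> x"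
      then show False using T(2)[of x] acc_makespan[OF assms(1) S(1), of x] acc_makespan[OF assms(1) S(1), of lo] assms(3) S(2)
        by (cases "lo \<le> x") auto
    qed
  qed
  moreover have "0 \<le> Tst lo hi"
  proof -
    interpret constr I "Tst lo hi" by unfold_locales (use T(1) assms(1) in auto)
    show ?thesis using T_pos by simp
  qed
  ultimately show "makespan (sched_of (Tst lo hi) js) \<le> 3 / 2 * OPT_pmtn I"
    using makespan_le[OF _ F(2)] by auto
qed

lemma not_acc_0: "0 < n ==> \<not> acc 0"
proof
  assume "0 < n" "acc 0"
  then interpret constr I 0 by unfold_locales
  show False using T_pos by simp
qed

text \<open>The accepted upper end for the binary search. At this size every class is of type 3, and
  only the total volume has to be checked.\<close>

lemma acc_big:
  assumes "0 < n" "8 * (\<Sum>i<c. L i) \<le> T" shows "acc T"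
proof -
  have L: "s i + P i = L i" "0 < s i" "0 < P i" "8 * L i \<le> T" if "i < c" for i
  proof -
    have "L i \<le> (\<Sum>i<c. L i)" using that s_pos P_pos by (intro member_le_sum) (auto simp: L_def intro: less_imp_le add_nonneg_nonneg)
    then show "8 * L i \<le> T" "s i + P i = L i" "0 < s i" "0 < P i" using assms(2) that s_pos P_pos by (auto simp: L_def)
  qed
  have tP: "t j \<le> P i" if "j \<in> J i" for i j
    unfolding P_def using that t_pos by (intro member_le_sum) (auto simp: J_def intro: less_imp_le)
  have "bg T i = 0" if i: "i < c" for i
  proof -
    have "\<not> T < 2 * (s i + t j)" if "j \<in> J i" for j using tP[OF that] L[OF i] by simp
    then show ?thesis by (simp add: bg_def)
  qed
  then have ty: "ty T i = 3" if "i < c" for i using that L[OF that] by (simp add: ty_def)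
  have LL: "0 \<le> (\<Sum>i<c. L i)" using L by (intro sum_nonneg) (auto simp: L_def intro: less_imp_le add_nonneg_nonneg)
  have mL: "(\<Sum>i<c. L i) \<le> real m * T"
  proof -
    have "1 * (\<Sum>i<c. L i) \<le> real m * T" using m_pos LL assms(2) by (intro mult_mono) auto
    then show ?thesis by simp
  qed
  have ok: "ok0 T"
    unfolding ok0_def
  proof
    show "\<forall>j<n. s (cl j) + t j \<le> T"
    proof (intro allI impI)
      fix j assume j: "j < n"
      then show "s (cl j) + t j \<le> T" using tP[of j "cl j"] L[OF cl_less[OF j]] by (auto simp: J_def)
    qed
    have "(\<Sum>i<c. mc T i) = (\<Sum>i<c. 0)" by (rule sum.cong) (auto simp: mc_def ty)
    then show "(\<Sum>i<c. mc T i) \<le> int m" by simp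
  qed
  have "0 \<le> FA q T + FB q T * T" if "q < 3" for q
  proof -
    have q: "q = 0 \<or> q = 1 \<or> q = 2" using that by auto
    have "(\<Sum>i<c. fa q T i + fb q T i * T) = (\<Sum>i<c. (if q = 0 then 0 else - 2) * L i)"
      by (rule sum.cong) (use q ty in \<open>auto simp: fa_def fb_def Let_def\<close>)
    also have "\<dots> = (if q = 0 then 0 else - 2) * (\<Sum>i<c. L i)" by (simp add: sum_distrib_left)
    finally have e: "(\<Sum>i<c. fa q T i + fb q T i * T) = (if q = 0 then 0 else - 2) * (\<Sum>i<c. L i)" .
    obtain w where w: "w = real m * T" by blast
    have e1: "(if q = 2 then 4 else 2) * real m * T = (if q = 2 then 4 else 2) * w" unfolding w by simp
    have "(\<Sum>i<c. L i) \<le> w" using mL w by simp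
    then show ?thesis unfolding FF_eq e e1 using LL by (simp add: q)
  qed
  then show ?thesis using ok by (simp add: acc_def)
qed

end

section \<open>Programs without word bound\<close>

inductive big :: "com \<Rightarrow> memory \<Rightarrow> nat \<Rightarrow> memory \<Rightarrow> bool" where
  big_Skip: "big Skip M 1 M"
| big_Write: "big (Write x a b) M (1 + acost a + acost b) (M(x := (M x)(aval a M := aval b M)))"
| big_Seq: "[|big p M t M'; big q M' t' M''|] ==> big (Seq p q) M (t + t') M''"
| big_CondTrue: "[|bval b M; big p M t M'|] ==> big (Cond b p q) M (1 + bcost b + t) M'"
| big_CondFalse: "[|\<not> bval b M; big q M t M'|] ==> big (Cond b p q) M (1 + bcost b + t) M'"
| big_LoopFalse: "\<not> bval b M ==> big (Loop b p) M (1 + bcost b) M"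
| big_LoopTrue: "[|bval b M; big p M t M'; big (Loop b p) M' t' M''|] ==>
    big (Loop b p) M (1 + bcost b + t + t') M''"

text \<open>Degree bounds: a cell of array \<open>x\<close> is bounded by \<open>B ^ G x\<close> times the running time so far, and
  the running time is below \<open>B ^ h\<close>. A write either stores a value of lower degree or adds one to
  a cell, so that no bound on sums has to be proved semantically.\<close>

fun edeg :: "(string \<Rightarrow> nat) \<Rightarrow> nat \<Rightarrow> aexp \<Rightarrow> nat" where
  "edeg G h (Num k) = (if \<bar>k\<bar> \<le> 32 then 5 else nat \<bar>k\<bar>)"
| "edeg G h (Read x a) = max (G x + h) (edeg G h a)"
| "edeg G h (Add a b) = Suc (max (edeg G h a) (edeg G h b))"
| "edeg G h (Sub a b) = Suc (max (edeg G h a) (edeg G h b))"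
| "edeg G h (Mul a b) = edeg G h a + edeg G h b"
| "edeg G h (Quot a b) = max (edeg G h a) (edeg G h b)"

fun bdeg :: "(string \<Rightarrow> nat) \<Rightarrow> nat \<Rightarrow> bexp \<Rightarrow> nat" where
  "bdeg G h (Less a b) = max (edeg G h a) (edeg G h b)"
| "bdeg G h (Neg b) = bdeg G h b"
| "bdeg G h (Conj a b) = max (bdeg G h a) (bdeg G h b)"

fun wdeg :: "(string \<Rightarrow> nat) \<Rightarrow> nat \<Rightarrow> nat \<Rightarrow> aexp \<Rightarrow> bool" where
  "wdeg G h g (Add (Read y a) e) \<longleftrightarrow> edeg G h (Add (Read y a) e) \<le> g \<or> G y \<le> g \<and> edeg G h e \<le> g"
| "wdeg G h g (Sub (Read y a) e) \<longleftrightarrow> edeg G h (Sub (Read y a) e) \<le> g \<or> G y \<le> g \<and> edeg G h e \<le> g"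
| "wdeg G h g (Read y a) \<longleftrightarrow> G y \<le> g"
| "wdeg G h g e \<longleftrightarrow> edeg G h e \<le> g"

text \<open>A write whose value is enclosed by its own guard between two expressions of small
  degree. Variables computed from themselves, such as the doubled width of merge sort and the
  midpoint of the binary search, would otherwise have no finite degree.\<close>

fun gw :: "(string \<Rightarrow> nat) \<Rightarrow> nat \<Rightarrow> nat \<Rightarrow> bexp \<Rightarrow> com \<Rightarrow> bool" where
  "gw G h d (Conj (Less a e) (Less e' u)) (Write x i e'') \<longleftrightarrow> e = e'' \<and> e' = e'' \<and>
     edeg G h a \<le> G x \<and> edeg G h u \<le> G x \<and> edeg G h i \<le> d \<and> edeg G h e \<le> d"
| "gw G h d b p \<longleftrightarrow> False"

fun wt :: "(string \<Rightarrow> nat) \<Rightarrow> nat \<Rightarrow> nat \<Rightarrow> com \<Rightarrow> bool" where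
  "wt G h d Skip \<longleftrightarrow> True"
| "wt G h d (Write x a b) \<longleftrightarrow> edeg G h a \<le> d \<and> edeg G h b \<le> d \<and> wdeg G h (G x) b"
| "wt G h d (Seq p q) \<longleftrightarrow> wt G h d p \<and> wt G h d q"
| "wt G h d (Cond b p q) \<longleftrightarrow> bdeg G h b \<le> d \<and> (gw G h d b p \<or> wt G h d p) \<and> wt G h d q"
| "wt G h d (Loop b p) \<longleftrightarrow> bdeg G h b \<le> d \<and> wt G h d p"

definition bnd :: "int \<Rightarrow> (string \<Rightarrow> nat) \<Rightarrow> nat \<Rightarrow> memory \<Rightarrow> bool" where
  "bnd B G t M \<longleftrightarrow> (\<forall>x z. \<bar>M x z\<bar> \<le> B ^ G x * (1 + int t))"

lemma bnd_mono: "bnd B G t M ==> t \<le> t' ==> 2 \<le> B ==> bnd B G t' M"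
  unfolding bnd_def by (meson order_trans mult_left_mono add_left_mono of_nat_mono zero_le_power order_trans[of 0 2 B] zero_le_numeral)

lemma aval_edeg:
  assumes B: "2 \<le> B" and b: "bnd B G t M" and t: "1 + int t \<le> B ^ h"
  shows "\<bar>aval e M\<bar> \<le> B ^ edeg G h e"
proof (induction e)
  case (Num k)
  \<comment> \<open>Constants up to 32 have degree 5 because the base is at least 2.\<close>
  have "(2::int) ^ 5 \<le> B ^ 5" using B by (intro power_mono) auto
  moreover have "\<bar>k\<bar> \<le> B ^ nat \<bar>k\<bar>"
  proof -
    have "\<bar>k\<bar> \<le> 2 ^ nat \<bar>k\<bar>" using of_nat_less_two_power[of "nat \<bar>k\<bar>", where 'a = int] by linarith
    also have "\<dots> \<le> B ^ nat \<bar>k\<bar>" using B by (intro power_mono) auto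
    finally show ?thesis .
  qed
  ultimately show ?case by auto
next
  case (Read x a)
  have "\<bar>M x (aval a M)\<bar> \<le> B ^ G x * (1 + int t)" using b by (simp add: bnd_def)
  also have "\<dots> \<le> B ^ G x * B ^ h" using t B by (intro mult_left_mono) auto
  also have "\<dots> \<le> B ^ max (G x + h) (edeg G h a)"
    unfolding power_add[symmetric] using B by (intro power_increasing) auto
  finally show ?case by simp
next
  case (Add a b)
  have "B ^ edeg G h a \<le> B ^ max (edeg G h a) (edeg G h b)" "B ^ edeg G h b \<le> B ^ max (edeg G h a) (edeg G h b)"
    using B by (auto intro: power_increasing)
  then have "\<bar>aval a M + aval b M\<bar> \<le> 2 * B ^ max (edeg G h a) (edeg G h b)" using Add by linarith
  also have "\<dots> \<le> B * B ^ max (edeg G h a) (edeg G h b)" using B by (intro mult_right_mono) auto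
  finally show ?case by simp
next
  case (Sub a b)
  have "B ^ edeg G h a \<le> B ^ max (edeg G h a) (edeg G h b)" "B ^ edeg G h b \<le> B ^ max (edeg G h a) (edeg G h b)"
    using B by (auto intro: power_increasing)
  then have "\<bar>aval a M - aval b M\<bar> \<le> 2 * B ^ max (edeg G h a) (edeg G h b)" using Sub by linarith
  also have "\<dots> \<le> B * B ^ max (edeg G h a) (edeg G h b)" using B by (intro mult_right_mono) auto
  finally show ?case by simp
next
  case (Mul a b)
  then show ?case using B by (auto simp: abs_mult power_add intro!: mult_mono)
next
  case (Quot a b)
  have "\<bar>x div y\<bar> \<le> \<bar>x\<bar>" for x y :: int
  proof (cases "y = 0")
    case False
    have *: "\<bar>x div y\<bar> \<le> \<bar>x\<bar>" if "0 < y" for x y :: int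
    proof (cases "0 \<le> x")
      case True
      then have "x div y \<le> x div 1" using that by (intro zdiv_mono2) auto
      then show ?thesis using True that by (simp add: pos_imp_zdiv_nonneg_iff)
    next
      case False
      then have "x div 1 \<le> x div y" using that by (intro zdiv_mono2_neg) auto
      moreover have "x div y < 0" using False that by (simp add: neg_imp_zdiv_neg_iff pos_imp_zdiv_neg_iff)
      ultimately show ?thesis by simp
    qed
    show ?thesis using *[of y x] *[of "- y" "- x"] False by (cases "0 < y") auto
  qed simp
  then have "\<bar>aval a M div aval b M\<bar> \<le> B ^ edeg G h a" using Quot(1) order_trans by blast
  also have "\<dots> \<le> B ^ max (edeg G h a) (edeg G h b)" using B by (intro power_increasing) auto
  finally show ?case by simp
qed

lemma asubs_edeg: "e' \<in> asubs e ==> edeg G h e' \<le> edeg G h e"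
  by (induction e) (auto simp: le_Suc_eq intro: le_SucI)

lemma afits_edeg:
  assumes "2 \<le> B" "bnd B G t M" "1 + int t \<le> B ^ h" "edeg G h e \<le> d"
  shows "afits (B ^ d) e M"
  unfolding afits_def
proof
  fix e' assume "e' \<in> asubs e"
  then have "edeg G h e' \<le> d" using asubs_edeg assms(4) order_trans by blast
  then have "B ^ edeg G h e' \<le> B ^ d" using assms(1) by (intro power_increasing) auto
  then show "\<bar>aval e' M\<bar> \<le> B ^ d" using aval_edeg[OF assms(1-3), of e'] by linarith
qed

lemma bfits_bdeg:
  assumes "2 \<le> B" "bnd B G t M" "1 + int t \<le> B ^ h" "bdeg G h b \<le> d"
  shows "bfits (B ^ d) b M"
  using assms(4) by (induction b) (auto intro: afits_edeg[OF assms(1-3)])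


lemma wdeg_cases:
  assumes "wdeg G h g e"
  shows "edeg G h e \<le> g \<or> (\<exists>y a. e = Read y a \<and> G y \<le> g) \<or>
    (\<exists>y a e'. (e = Add (Read y a) e' \<or> e = Sub (Read y a) e') \<and> G y \<le> g \<and> edeg G h e' \<le> g)"
  using assms by (induction G h g e rule: wdeg.induct) auto

lemma wdeg_bound:
  assumes B: "2 \<le> B" and b: "bnd B G t M" and t: "1 + int t \<le> B ^ h" and w: "wdeg G h g e"
  shows "\<bar>aval e M\<bar> \<le> B ^ g * (2 + int t)"
proof -
  have small: "\<bar>aval e M\<bar> \<le> B ^ g" if "edeg G h e \<le> g" for e
    using aval_edeg[OF B b t, of e] power_increasing[OF that, of B] B by linarith
  have Bg: "0 \<le> B ^ g" using B by simp
  have big: "B ^ g * 1 \<le> B ^ g * (2 + int t)" using Bg by (intro mult_left_mono) auto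
  have rd: "\<bar>M y z\<bar> \<le> B ^ g * (1 + int t)" if "G y \<le> g" for y z
  proof -
    have "\<bar>M y z\<bar> \<le> B ^ G y * (1 + int t)" using b by (simp add: bnd_def)
    also have "\<dots> \<le> B ^ g * (1 + int t)" using that B by (intro mult_right_mono power_increasing) auto
    finally show ?thesis .
  qed
  have e2: "B ^ g * (1 + int t) + B ^ g = B ^ g * (2 + int t)" by (simp add: algebra_simps)
  from wdeg_cases[OF w] show ?thesis
  proof (elim disjE exE conjE)
    assume "edeg G h e \<le> g"
    then show ?thesis using small[of e] big by simp
  next
    fix y a assume "e = Read y a" "G y \<le> g"
    then show ?thesis using rd[of y "aval a M"] e2 Bg by simp
  next
    fix y a e' assume "e = Add (Read y a) e'" "G y \<le> g" "edeg G h e' \<le> g"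
    then show ?thesis using rd[of y "aval a M"] small[of e'] e2 by simp
  next
    fix y a e' assume "e = Sub (Read y a) e'" "G y \<le> g" "edeg G h e' \<le> g"
    then show ?thesis using rd[of y "aval a M"] small[of e'] e2 by simp
  qed
qed

lemma gw_cases:
  assumes "gw G h d b p"
  obtains a e u x i where "b = Conj (Less a e) (Less e u)" "p = Write x i e"
    "edeg G h a \<le> G x" "edeg G h u \<le> G x" "edeg G h i \<le> d" "edeg G h e \<le> d"
proof -
  have "\<exists>a e u x i. b = Conj (Less a e) (Less e u) \<and> p = Write x i e \<and>
    edeg G h a \<le> G x \<and> edeg G h u \<le> G x \<and> edeg G h i \<le> d \<and> edeg G h e \<le> d"
    using assms by (induction G h d b p rule: gw.induct) auto
  then show thesis using that by blast
qed

inductive_cases big_WriteE: "big (Write x i e) M t M'"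

text \<open>The elapsed time \<open>t0\<close> belongs to the invariant: a write that accumulates
  raises the bound of its cell by one more multiple of the power of \<open>B\<close>, and each write
  costs at least one time unit. Verified runs thus carry over to bounded words by checking
  syntax.\<close>

theorem big_exec:
  assumes "big p M t M'" "wt G h d p" "2 \<le> B" "bnd B G t0 M" "1 + int (t0 + t) \<le> B ^ h"
  shows "exec (B ^ d) p M t M' \<and> bnd B G (t0 + t) M'"
  using assms
proof (induction arbitrary: t0 rule: big.induct)
  case (big_Skip M)
  then show ?case using exec.exec_Skip bnd_mono[of B G t0 M "t0 + 1"] by simp
next
  case (big_Write x a b M)
  have t: "1 + int t0 \<le> B ^ h" using big_Write.prems(4) by simp
  have f: "afits (B ^ d) a M" "afits (B ^ d) b M" using big_Write.prems afits_edeg[OF big_Write.prems(2,3) t] by auto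
  have "\<bar>aval b M\<bar> \<le> B ^ G x * (2 + int t0)" using big_Write.prems wdeg_bound[OF big_Write.prems(2,3) t] by auto
  also have "\<dots> \<le> B ^ G x * (1 + int (t0 + (1 + acost a + acost b)))" using big_Write.prems(2) by (intro mult_left_mono) auto
  finally have v: "\<bar>aval b M\<bar> \<le> B ^ G x * (1 + int (t0 + (1 + acost a + acost b)))" .
  have "bnd B G (t0 + (1 + acost a + acost b)) M" by (rule bnd_mono[OF big_Write.prems(3)]) (use big_Write.prems(2) in auto)
  then have "bnd B G (t0 + (1 + acost a + acost b)) (M(x := (M x)(aval a M := aval b M)))"
    using v by (simp add: bnd_def)
  then show ?case using exec.exec_Write[OF f] by blast
next
  case (big_Seq p M t M' q t' M'')
  have 1: "exec (B ^ d) p M t M' \<and> bnd B G (t0 + t) M'" using big_Seq.prems by (intro big_Seq.IH(1)) auto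
  have "exec (B ^ d) q M' t' M'' \<and> bnd B G (t0 + t + t') M''" using big_Seq.prems 1 by (intro big_Seq.IH(2)) (auto simp: add_ac)
  then show ?case using 1 exec.exec_Seq by (metis add.assoc)
next
  case (big_CondTrue b M p t M' q)
  have t: "1 + int t0 \<le> B ^ h" using big_CondTrue.prems(4) by simp
  have f: "bfits (B ^ d) b M" using big_CondTrue.prems bfits_bdeg[OF big_CondTrue.prems(2,3) t] by auto
  have "exec (B ^ d) p M t M' \<and> bnd B G (t0 + t) M'"
  proof (cases "gw G h d b p")
    case False
    then show ?thesis using big_CondTrue.prems by (intro big_CondTrue.IH) auto
  next
    case True
    then obtain a e u x i where p: "b = Conj (Less a e) (Less e u)" "p = Write x i e"
      "edeg G h a \<le> G x" "edeg G h u \<le> G x" "edeg G h i \<le> d" "edeg G h e \<le> d"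
      by (rule gw_cases)
    from big_CondTrue.hyps(2) p(2) have tm: "t = 1 + acost i + acost e" "M' = M(x := (M x)(aval i M := aval e M))"
      by (auto elim: big_WriteE)
    have bd: "\<bar>aval a M\<bar> \<le> B ^ G x" "\<bar>aval u M\<bar> \<le> B ^ G x"
      using aval_edeg[OF big_CondTrue.prems(2,3) t, of a] aval_edeg[OF big_CondTrue.prems(2,3) t, of u]
        power_increasing[OF p(3), of B] power_increasing[OF p(4), of B] big_CondTrue.prems(2) by linarith+
    have "\<bar>aval e M\<bar> \<le> B ^ G x * 1" using big_CondTrue.hyps(1) p(1) bd by auto
    also have "\<dots> \<le> B ^ G x * (1 + int (t0 + t))" using big_CondTrue.prems(2) by (intro mult_left_mono) auto
    finally have v: "\<bar>aval e M\<bar> \<le> B ^ G x * (1 + int (t0 + t))" .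
    have "bnd B G (t0 + t) M" by (rule bnd_mono[OF big_CondTrue.prems(3)]) (use big_CondTrue.prems(2) in auto)
    then have "bnd B G (t0 + t) M'" unfolding tm(2) using v by (simp add: bnd_def)
    moreover have "exec (B ^ d) p M t M'" unfolding p(2) tm
      by (rule exec.exec_Write) (use afits_edeg[OF big_CondTrue.prems(2,3) t] p in auto)
    ultimately show ?thesis by blast
  qed
  then show ?case using exec.exec_CondTrue[OF f big_CondTrue.hyps(1)] bnd_mono[of B G "t0 + t" M' "t0 + (1 + bcost b + t)"] big_CondTrue.prems(2) by simp
next
  case (big_CondFalse b M q t M' p)
  have t: "1 + int t0 \<le> B ^ h" using big_CondFalse.prems(4) by simp
  have f: "bfits (B ^ d) b M" using big_CondFalse.prems bfits_bdeg[OF big_CondFalse.prems(2,3) t] by auto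
  have "exec (B ^ d) q M t M' \<and> bnd B G (t0 + t) M'" using big_CondFalse.prems by (intro big_CondFalse.IH) auto
  then show ?case using exec.exec_CondFalse[OF f big_CondFalse.hyps(1)] bnd_mono[of B G "t0 + t" M' "t0 + (1 + bcost b + t)"] big_CondFalse.prems(2) by simp
next
  case (big_LoopFalse b M p)
  have t: "1 + int t0 \<le> B ^ h" using big_LoopFalse.prems(4) by simp
  have f: "bfits (B ^ d) b M" using big_LoopFalse.prems bfits_bdeg[OF big_LoopFalse.prems(2,3) t] by auto
  then show ?case using exec.exec_LoopFalse[OF f big_LoopFalse.hyps] bnd_mono[of B G t0 M "t0 + (1 + bcost b)"] big_LoopFalse.prems by simp
next
  case (big_LoopTrue b M p t M' t' M'')
  have t: "1 + int t0 \<le> B ^ h" using big_LoopTrue.prems(4) by simp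
  have f: "bfits (B ^ d) b M" using big_LoopTrue.prems bfits_bdeg[OF big_LoopTrue.prems(2,3) t] by auto
  have 1: "exec (B ^ d) p M t M' \<and> bnd B G (t0 + t) M'" using big_LoopTrue.prems by (intro big_LoopTrue.IH(1)) auto
  have 2: "exec (B ^ d) (Loop b p) M' t' M'' \<and> bnd B G (t0 + t + t') M''"
    using big_LoopTrue.prems 1 by (intro big_LoopTrue.IH(2)) (auto simp: add_ac)
  have "exec (B ^ d) (Loop b p) M (1 + bcost b + t + t') M''"
    by (rule exec.exec_LoopTrue[OF f big_LoopTrue.hyps(1)]) (use 1 2 in auto)
  moreover have "bnd B G (t0 + (1 + bcost b + t + t')) M''"
    by (rule bnd_mono[of B G "t0 + t + t'"]) (use 2 big_LoopTrue.prems(2) in auto)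
  ultimately show ?case by blast
qed

section \<open>A program logic with running times\<close>

fun wr :: "com \<Rightarrow> string set" where
  "wr Skip = {}"
| "wr (Write x a b) = {x}"
| "wr (Seq p q) = wr p \<union> wr q"
| "wr (Cond b p q) = wr p \<union> wr q"
| "wr (Loop b p) = wr p"

lemma big_frame: "big p M t M' ==> x \<notin> wr p ==> M' x = M x"
  by (induction rule: big.induct) auto

definition ex :: "com \<Rightarrow> nat \<Rightarrow> (memory \<Rightarrow> bool) \<Rightarrow> memory \<Rightarrow> bool" where
  "ex p k Q M \<longleftrightarrow> (\<exists>t M'. big p M t M' \<and> t \<le> k \<and> Q M')"

text \<open>Loop-free programs are executed by simplification: \<open>run\<close> is the result and
  \<open>cc\<close> the cost in the longest branch. The clauses for \<open>Loop\<close> are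
  defaults, excluded by \<open>lf\<close>.\<close>

fun run :: "com \<Rightarrow> memory \<Rightarrow> memory" where
  "run Skip M = M"
| "run (Write x a b) M = M(x := (M x)(aval a M := aval b M))"
| "run (Seq p q) M = run q (run p M)"
| "run (Cond b p q) M = (if bval b M then run p M else run q M)"
| "run (Loop b p) M = M"

fun lf :: "com \<Rightarrow> bool" where
  "lf (Seq p q) \<longleftrightarrow> lf p \<and> lf q"
| "lf (Cond b p q) \<longleftrightarrow> lf p \<and> lf q"
| "lf (Loop b p) \<longleftrightarrow> False"
| "lf p \<longleftrightarrow> True"

fun cc :: "com \<Rightarrow> nat" where
  "cc Skip = 1"
| "cc (Write x a b) = 1 + acost a + acost b"
| "cc (Seq p q) = cc p + cc q"
| "cc (Cond b p q) = 1 + bcost b + max (cc p) (cc q)"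
| "cc (Loop b p) = 0"

lemma big_run: "lf p ==> \<exists>t \<le> cc p. big p M t (run p M)"
proof (induction p arbitrary: M)
  case Skip
  show ?case by (rule exI[of _ 1]) (use big_Skip in auto)
next
  case (Write x a b)
  show ?case by (rule exI[of _ "1 + acost a + acost b"]) (use big_Write in \<open>simp add: fun_upd_def\<close>)
next
  case (Seq p q)
  obtain t where t: "t \<le> cc p" "big p M t (run p M)" using Seq by fastforce
  obtain t' where "t' \<le> cc q" "big q (run p M) t' (run q (run p M))" using Seq by fastforce
  then show ?case using t big_Seq[of p M t "run p M" q t'] by (auto intro!: exI[of _ "t + t'"])
next
  case (Cond b p q)
  show ?case
  proof (cases "bval b M")
    case True
    obtain t where "t \<le> cc p" "big p M t (run p M)" using Cond by fastforce
    then show ?thesis using True big_CondTrue[of b M p t "run p M" q] by (auto intro!: exI[of _ "1 + bcost b + t"])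
  next
    case False
    obtain t where "t \<le> cc q" "big q M t (run q M)" using Cond by fastforce
    then show ?thesis using False big_CondFalse[of b M q t "run q M" p] by (auto intro!: exI[of _ "1 + bcost b + t"])
  qed
qed auto

lemma run_frame: "x \<notin> wr p ==> run p M x = M x"
  by (induction p arbitrary: M) auto

lemma ex_lf: "lf p ==> cc p \<le> k ==> Q (run p M) ==> ex p k Q M"
  using big_run[of p M] unfolding ex_def by (meson order_trans)

lemma ex_conseq: "ex p k Q M ==> k \<le> k' ==> (\<And>M'. Q M' ==> (\<And>x. x \<notin> wr p ==> M' x = M x) ==> Q' M') ==> ex p k' Q' M"
  unfolding ex_def using big_frame by (meson order_trans)

lemma ex_seq:
  assumes "ex p k1 Q M" "\<And>M'. Q M' ==> (\<And>x. x \<notin> wr p ==> M' x = M x) ==> ex q k2 R M'"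
  shows "ex (Seq p q) (k1 + k2) R M"
proof -
  obtain t M' where 1: "big p M t M'" "t \<le> k1" "Q M'" using assms(1) by (auto simp: ex_def)
  have "ex q k2 R M'" by (rule assms(2)[OF 1(3)]) (rule big_frame[OF 1(1)])
  then obtain t' M'' where "big q M' t' M''" "t' \<le> k2" "R M''" by (auto simp: ex_def)
  then show ?thesis using 1 big_Seq unfolding ex_def by (meson add_mono)
qed

text \<open>The index of \<open>Inv\<close> bounds the number of iterations still to come.\<close>

lemma ex_loop:
  assumes "Inv N M" "\<And>k M'. Inv k M' ==> (\<And>x. x \<notin> wr p ==> M' x = M x) ==> bval b M' ==> 0 < k \<and> ex p K (Inv (k - 1)) M'"
  shows "ex (Loop b p) (N * (K + bcost b + 1) + bcost b + 1) (\<lambda>M'. (\<exists>k. Inv k M') \<and> \<not> bval b M') M"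
proof -
  have "ex (Loop b p) (k * (K + bcost b + 1) + bcost b + 1) (\<lambda>M'. (\<exists>k. Inv k M') \<and> \<not> bval b M') M'"
    if "Inv k M'" "\<And>x. x \<notin> wr p ==> M' x = M x" for k M'
    using that
  proof (induction k arbitrary: M')
    case 0
    then have "\<not> bval b M'" using assms(2)[OF 0(1)] by auto
    then show ?case using 0 big_LoopFalse[of b M' p] unfolding ex_def by auto
  next
    case (Suc k)
    show ?case
    proof (cases "bval b M'")
      case False
      then show ?thesis using Suc.prems big_LoopFalse[of b M' p] unfolding ex_def
        by (intro exI[of _ "1 + bcost b"] exI[of _ M']) auto
    next
      case True
      have "ex p K (Inv k) M'" using assms(2)[OF Suc.prems(1,2) True] by simp
      then obtain t M1 where 1: "big p M' t M1" "t \<le> K" "Inv k M1" by (auto simp: ex_def)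
      have "ex (Loop b p) (k * (K + bcost b + 1) + bcost b + 1) (\<lambda>M'. (\<exists>k. Inv k M') \<and> \<not> bval b M') M1"
        using Suc.prems big_frame[OF 1(1)] 1(3) by (intro Suc.IH) auto
      then obtain t' M2 where 2: "big (Loop b p) M1 t' M2" "t' \<le> k * (K + bcost b + 1) + bcost b + 1"
        "\<exists>k. Inv k M2" "\<not> bval b M2" by (auto simp: ex_def)
      have "1 + bcost b + t + t' \<le> Suc k * (K + bcost b + 1) + bcost b + 1" using 1(2) 2(2) by simp
      then show ?thesis using big_LoopTrue[OF True 1(1) 2(1)] 2(3,4) unfolding ex_def by blast
    qed
  qed
  then show ?thesis using assms(1) by blast
qed

abbreviation V :: "string \<Rightarrow> aexp" where "V x \<equiv> Read x (Num 0)"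
abbreviation Set :: "string \<Rightarrow> aexp \<Rightarrow> com" where "Set x e \<equiv> Write x (Num 0) e"

definition For :: "string \<Rightarrow> aexp \<Rightarrow> com \<Rightarrow> com" where
  "For v e p = Seq (Set v (Num 0)) (Loop (Less (V v) e) (Seq p (Set v (Add (V v) (Num 1)))))"

lemma wr_For[simp]: "wr (For v e p) = insert v (wr p)" by (auto simp: For_def)

lemma ex_for:
  assumes init: "Inv 0 (M(v := (M v)(0 := 0)))"
    and step: "\<And>i M'. i < N ==> Inv i M' ==> M' v 0 = int i ==> (\<And>x. x \<notin> insert v (wr p) ==> M' x = M x) ==>
       ex p K (\<lambda>M''. M'' v 0 = int i \<and> Inv (Suc i) (M''(v := (M'' v)(0 := int (Suc i))))) M'"
    and e: "\<And>i M'. i \<le> N ==> Inv i M' ==> (\<And>x. x \<notin> insert v (wr p) ==> M' x = M x) ==> aval e M' = int N"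
  shows "ex (For v e p) (N * (K + acost e + 10) + acost e + 7) (Inv N) M"
proof -
  let ?b = "Less (V v) e" and ?q = "Seq p (Set v (Add (V v) (Num 1)))"
  define J where "J k M' \<longleftrightarrow> (\<exists>i. i + k = N \<and> Inv i M' \<and> M' v 0 = int i \<and> (\<forall>x. x \<notin> insert v (wr p) \<longrightarrow> M' x = M x))" for k M'
  let ?M0 = "M(v := (M v)(0 := 0))"
  have 1: "ex (Set v (Num 0)) 3 (\<lambda>M'. M' = ?M0) M" by (rule ex_lf) auto
  have 2: "ex (Loop ?b ?q) (N * ((K + 6) + bcost ?b + 1) + bcost ?b + 1) (\<lambda>M'. (\<exists>k. J k M') \<and> \<not> bval ?b M') ?M0"
  proof (rule ex_loop)
    show "J N ?M0" using init by (auto simp: J_def)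
    fix k M' assume I: "J k M'" and b: "bval ?b M'"
    then obtain i where i: "i + k = N" "Inv i M'" "M' v 0 = int i" "\<And>x. x \<notin> insert v (wr p) ==> M' x = M x" unfolding J_def by blast
    have "aval e M' = int N" by (rule e) (use i in auto)
    then have iN: "i < N" using b i(3) by simp
    have "ex ?q (K + 6) (J (k - 1)) M'"
    proof (rule ex_seq)
      show "ex p K (\<lambda>M''. M'' v 0 = int i \<and> Inv (Suc i) (M''(v := (M'' v)(0 := int (Suc i))))) M'"
        by (rule step[OF iN i(2-4)])
      fix M'' assume M2: "M'' v 0 = int i \<and> Inv (Suc i) (M''(v := (M'' v)(0 := int (Suc i))))"
        "\<And>x. x \<notin> wr p ==> M'' x = M' x"
      have "J (k - 1) (M''(v := (M'' v)(0 := int (Suc i))))"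
        unfolding J_def by (rule exI[of _ "Suc i"]) (use M2 i iN in auto)
      then show "ex (Set v (Add (V v) (Num 1))) 6 (J (k - 1)) M''"
        using M2(1) by (intro ex_lf) (auto simp: add.commute)
    qed
    then show "0 < k \<and> ex ?q (K + 6) (J (k - 1)) M'" using i(1) iN by simp
  qed
  have "ex (For v e p) (3 + (N * ((K + 6) + bcost ?b + 1) + bcost ?b + 1)) (Inv N) M"
    unfolding For_def
  proof (rule ex_seq[OF 1])
    fix M' assume M': "M' = ?M0"
    show "ex (Loop ?b ?q) (N * ((K + 6) + bcost ?b + 1) + bcost ?b + 1) (Inv N) M'"
      unfolding M'
    proof (rule ex_conseq[OF 2 order_refl])
      fix M2 assume "(\<exists>k. J k M2) \<and> \<not> bval ?b M2"
      then obtain k i where i: "i + k = N" "Inv i M2" "M2 v 0 = int i" "\<forall>x. x \<notin> insert v (wr p) \<longrightarrow> M2 x = M x" "\<not> bval ?b M2"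
        unfolding J_def by blast
      have "aval e M2 = int N" by (rule e) (use i in auto)
      then have "i = N" using i by simp
      then show "Inv N M2" using i by simp
    qed
  qed
  then show ?thesis by (simp add: algebra_simps)
qed

section \<open>Merge sort\<close>

definition merge_cond :: bexp where
  "merge_cond = Conj (Less (V ''a'') (Add (V ''lo'') (V ''w''))) (Conj (Less (V ''a'') (V ''N''))
     (Neg (Conj (Less (V ''b'') (Add (V ''lo'') (Mul (Num 2) (V ''w'')))) (Conj (Less (V ''b'') (V ''N''))
       (Less (Mul (Read ''KN'' (V ''b'')) (Read ''KD'' (V ''a''))) (Mul (Read ''KN'' (V ''a'')) (Read ''KD'' (V ''b''))))))))"

definition merge_take :: "string \<Rightarrow> com" where
  "merge_take v = Seq (Write ''LN'' (V ''k'') (Read ''KN'' (V v))) (Seq (Write ''LD'' (V ''k'') (Read ''KD'' (V v)))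
     (Set v (Add (V v) (Num 1))))"

text \<open>A single loop over the output index serves all pairs of runs of a pass: when
  \<open>k\<close> reaches the end of a pair, the two heads are reset to the next one.\<close>

definition merge_body :: com where
  "merge_body = Seq
     (Cond (Neg (Less (V ''k'') (Add (V ''lo'') (Mul (Num 2) (V ''w'')))))
       (Seq (Set ''lo'' (V ''k'')) (Seq (Set ''a'' (V ''k'')) (Set ''b'' (Add (V ''k'') (V ''w''))))) Skip)
     (Cond merge_cond (merge_take ''a'') (merge_take ''b''))"

definition copy_body :: com where
  "copy_body = Seq (Write ''KN'' (V ''k'') (Read ''LN'' (V ''k''))) (Write ''KD'' (V ''k'') (Read ''LD'' (V ''k'')))"

text \<open>The final guard holds for every width with \<open>w < N\<close>. It bounds the doubled
  width by \<open>N + N\<close> in the form that \<open>gw\<close> recognises.\<close>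

definition sort_pass :: com where
  "sort_pass = Seq (Set ''lo'' (Num 0)) (Seq (Set ''a'' (Num 0)) (Seq (Set ''b'' (V ''w''))
     (Seq (For ''k'' (V ''N'') merge_body) (Seq (For ''k'' (V ''N'') copy_body)
       (Cond (Conj (Less (Num (-1)) (Add (V ''w'') (V ''w''))) (Less (Add (V ''w'') (V ''w'')) (Add (V ''N'') (V ''N''))))
         (Set ''w'' (Add (V ''w'') (V ''w''))) Skip)))))"

definition sort_prog :: com where
  "sort_prog = Seq (Set ''w'' (Num 1)) (Loop (Less (V ''w'') (V ''N'')) sort_pass)"

definition pk :: "memory \<Rightarrow> nat \<Rightarrow> int \<times> int" where "pk M p = (M ''KN'' (int p), M ''KD'' (int p))"
definition pL :: "memory \<Rightarrow> nat \<Rightarrow> int \<times> int" where "pL M p = (M ''LN'' (int p), M ''LD'' (int p))"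
definition vl :: "int \<times> int \<Rightarrow> real" where "vl x = real_of_int (fst x) / real_of_int (snd x)"

definition bsorted :: "nat \<Rightarrow> nat \<Rightarrow> (nat \<Rightarrow> int \<times> int) \<Rightarrow> bool" where
  "bsorted w N f \<longleftrightarrow> (\<forall>p q. p < q \<and> q < N \<and> p div w = q div w \<longrightarrow> vl (f p) \<le> vl (f q))"

lemma vl_less: "0 < snd x ==> 0 < snd y ==> fst x * snd y < fst y * snd x \<longleftrightarrow> vl x < vl y"
  unfolding vl_def by (simp add: divide_less_eq pos_less_divide_eq field_simps flip: of_int_mult)

text \<open>\<open>a\<close> and \<open>b\<close> are the heads of the runs starting at
  \<open>lo\<close> and \<open>lo + w\<close>. The right run may begin beyond \<open>N\<close>, and
  then it is empty; hence \<open>b\<close> is bounded by \<open>N\<close> only once something has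
  been taken from it. Only the set of keys is tracked, which is enough for breakpoints as well as
  for the pairwise distinct job keys.\<close>

definition minv :: "nat \<Rightarrow> nat \<Rightarrow> (nat \<Rightarrow> int \<times> int) \<Rightarrow> nat \<Rightarrow> nat \<Rightarrow> nat \<Rightarrow> nat \<Rightarrow> (nat \<Rightarrow> int \<times> int) \<Rightarrow> bool" where
  "minv w N f k lo a b g \<longleftrightarrow> lo \<le> k \<and> k \<le> lo + 2 * w \<and> k \<le> N \<and> 2 * w dvd lo \<and> lo \<le> a \<and> a \<le> lo + w \<and> lo + w \<le> b \<and> b \<le> lo + 2 * w \<and>
     k + w = a + b - lo \<and> a \<le> N \<and> (lo + w < b \<longrightarrow> b \<le> N) \<and> g ` {..<k} = f ` ({..<a} \<union> {lo + w..<b}) \<and>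
     (\<forall>p<k. lo \<le> p \<longrightarrow> (a < lo + w \<and> a < N \<longrightarrow> vl (g p) \<le> vl (f a)) \<and> (b < lo + 2 * w \<and> b < N \<longrightarrow> vl (g p) \<le> vl (f b))) \<and>
     bsorted (2 * w) k g"

lemma minv_block: "minv w N f k lo a b g ==> 0 < w ==> k < N ==> lo + 2 * w \<le> k ==> minv w N f k k k (k + w) g"
proof -
  assume m: "minv w N f k lo a b g" and w: "0 < w" "k < N" "lo + 2 * w \<le> k"
  then have e: "k = lo + 2 * w" "a = lo + w" "b = lo + 2 * w" by (auto simp: minv_def)
  have "{..<a} \<union> {lo + w..<b} = {..<k}" using e by auto
  then show ?thesis using m w unfolding minv_def e by auto
qed

lemma bsorted_snoc:
  assumes "bsorted (2 * w) k g" "2 * w dvd lo" "lo \<le> k" "k < lo + 2 * w" "\<And>p. p < k ==> lo \<le> p ==> vl (g p) \<le> vl v"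
  shows "bsorted (2 * w) (Suc k) (g(k := v))"
proof -
  have "lo \<le> p" if "p < k" "p div (2 * w) = k div (2 * w)" for p
  proof -
    have "lo div (2 * w) \<le> k div (2 * w)" using assms(3) by (rule div_le_mono)
    then have "lo div (2 * w) \<le> p div (2 * w)" using that by simp
    then have "lo div (2 * w) * (2 * w) \<le> p" by (meson div_times_less_eq_dividend le_trans mult_le_mono1)
    then show ?thesis using assms(2) by simp
  qed
  then show ?thesis using assms(1,5) by (auto simp: bsorted_def less_Suc_eq)
qed

lemma minv_step:
  assumes m: "minv w N f k lo a b g" and k: "k < N" "k < lo + 2 * w" and w: "0 < w" and f: "bsorted w N f"
    and pos: "\<And>p. p < N ==> 0 < snd (f p)"
  shows "a < lo + w \<and> a < N \<and> \<not> (b < lo + 2 * w \<and> b < N \<and> fst (f b) * snd (f a) < fst (f a) * snd (f b)) ==>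
      minv w N f (Suc k) lo (Suc a) b (g(k := f a))"
    "\<not> (a < lo + w \<and> a < N \<and> \<not> (b < lo + 2 * w \<and> b < N \<and> fst (f b) * snd (f a) < fst (f a) * snd (f b))) ==>
      minv w N f (Suc k) lo a (Suc b) (g(k := f b))"
proof -
  have M: "lo \<le> k" "2 * w dvd lo" "lo \<le> a" "a \<le> lo + w" "lo + w \<le> b" "b \<le> lo + 2 * w"
     "k + w = a + b - lo" "a \<le> N" "lo + w < b \<longrightarrow> b \<le> N" "g ` {..<k} = f ` ({..<a} \<union> {lo + w..<b})"
     "\<And>p. p < k ==> lo \<le> p ==> a < lo + w ==> a < N ==> vl (g p) \<le> vl (f a)"
     "\<And>p. p < k ==> lo \<le> p ==> b < lo + 2 * w ==> b < N ==> vl (g p) \<le> vl (f b)"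
     "bsorted (2 * w) k g" using m by (auto simp: minv_def)
  have img: "(g(k := v)) ` {..<Suc k} = insert v (g ` {..<k})" for v by (auto simp: lessThan_Suc)
  have wl: "w dvd lo" using M(2) by (meson dvd_mult_right)
  have blk: "x div w = lo div w" if "lo \<le> x" "x < lo + w" for x
  proof -
    obtain z where "lo = w * z" using wl by (auto simp: dvd_def)
    then show ?thesis using that w by (simp add: div_nat_eqI)
  qed
  have blk2: "x div w = lo div w + 1" if "lo + w \<le> x" "x < lo + 2 * w" for x
  proof -
    obtain z where "lo = w * z" using wl by (auto simp: dvd_def)
    then show ?thesis using that w by (simp add: div_nat_eqI)
  qed
  show "minv w N f (Suc k) lo (Suc a) b (g(k := f a))"
    if c: "a < lo + w \<and> a < N \<and> \<not> (b < lo + 2 * w \<and> b < N \<and> fst (f b) * snd (f a) < fst (f a) * snd (f b))"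
  proof -
    have nb: "vl (f a) \<le> vl (f b)" if "b < lo + 2 * w" "b < N"
      using c that vl_less[of "f b" "f a"] pos by auto
    have na: "vl (f a) \<le> vl (f (Suc a))" if "Suc a < lo + w" "Suc a < N"
      using f that blk[of a] blk[of "Suc a"] M(3) by (auto simp: bsorted_def)
    have s: "bsorted (2 * w) (Suc k) (g(k := f a))"
      by (rule bsorted_snoc[OF M(13,2,1) k(2)]) (use M(11) c in auto)
    have i: "insert (f a) (f ` ({..<a} \<union> {lo + w..<b})) = f ` ({..<Suc a} \<union> {lo + w..<b})" by (auto simp: lessThan_Suc)
    have o: "vl ((g(k := f a)) p) \<le> vl (f a)" if "p < Suc k" "lo \<le> p" for p
      using M(11)[of p] that c by (auto simp: less_Suc_eq)
    have ar: "lo \<le> Suc k \<and> Suc k \<le> lo + 2 * w \<and> Suc k \<le> N \<and> 2 * w dvd lo \<and> lo \<le> Suc a \<and> Suc a \<le> lo + w \<and>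
      lo + w \<le> b \<and> b \<le> lo + 2 * w \<and> Suc k + w = Suc a + b - lo \<and> Suc a \<le> N \<and> (lo + w < b \<longrightarrow> b \<le> N)"
      using M(1-9) k c by (intro conjI) (blast | linarith)+
    have pp: "\<forall>p<Suc k. lo \<le> p \<longrightarrow> (Suc a < lo + w \<and> Suc a < N \<longrightarrow> vl ((g(k := f a)) p) \<le> vl (f (Suc a))) \<and>
      (b < lo + 2 * w \<and> b < N \<longrightarrow> vl ((g(k := f a)) p) \<le> vl (f b))" using o na nb order_trans by blast
    show ?thesis unfolding minv_def img M(10) i using ar pp s by blast
  qed
  show "minv w N f (Suc k) lo a (Suc b) (g(k := f b))"
    if c: "\<not> (a < lo + w \<and> a < N \<and> \<not> (b < lo + 2 * w \<and> b < N \<and> fst (f b) * snd (f a) < fst (f a) * snd (f b)))"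
  proof -
    have bv: "b < lo + 2 * w" "b < N"
    proof -
      have "b < lo + 2 * w \<and> b < N"
      proof (cases "a < lo + w \<and> a < N")
        case False
        then show ?thesis using M(3-9) k by auto
      qed (use c in auto)
      then show "b < lo + 2 * w" "b < N" by auto
    qed
    have na: "vl (f b) \<le> vl (f a)" if "a < lo + w" "a < N"
    proof -
      have "fst (f b) * snd (f a) < fst (f a) * snd (f b)" using c that by blast
      then show ?thesis using vl_less[of "f b" "f a"] pos[OF bv(2)] pos[OF that(2)] by simp
    qed
    have nb: "vl (f b) \<le> vl (f (Suc b))" if "Suc b < lo + 2 * w" "Suc b < N"
      using f that blk2[of b] blk2[of "Suc b"] M(5) by (auto simp: bsorted_def)
    have s: "bsorted (2 * w) (Suc k) (g(k := f b))"
      by (rule bsorted_snoc[OF M(13,2,1) k(2)]) (use M(12) bv in auto)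
    have i: "insert (f b) (f ` ({..<a} \<union> {lo + w..<b})) = f ` ({..<a} \<union> {lo + w..<Suc b})"
      using M(5) by (auto simp: atLeastLessThanSuc)
    have o: "vl ((g(k := f b)) p) \<le> vl (f b)" if "p < Suc k" "lo \<le> p" for p
      using M(12)[of p] that bv by (auto simp: less_Suc_eq)
    have ar: "lo \<le> Suc k \<and> Suc k \<le> lo + 2 * w \<and> Suc k \<le> N \<and> 2 * w dvd lo \<and> lo \<le> a \<and> a \<le> lo + w \<and>
      lo + w \<le> Suc b \<and> Suc b \<le> lo + 2 * w \<and> Suc k + w = a + Suc b - lo \<and> a \<le> N \<and> (lo + w < Suc b \<longrightarrow> Suc b \<le> N)"
      using M(1-9) k bv by (intro conjI) (blast | linarith)+
    have pp: "\<forall>p<Suc k. lo \<le> p \<longrightarrow> (a < lo + w \<and> a < N \<longrightarrow> vl ((g(k := f b)) p) \<le> vl (f a)) \<and>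
      (Suc b < lo + 2 * w \<and> Suc b < N \<longrightarrow> vl ((g(k := f b)) p) \<le> vl (f (Suc b)))" using o na nb order_trans by blast
    show ?thesis unfolding minv_def img M(10) i using ar pp s by blast
  qed
qed

lemma minv_end:
  assumes "minv w N f N lo a b g" "0 < w"
  shows "g ` {..<N} = f ` {..<N}" "bsorted (2 * w) N g"
proof -
  have "{..<a} \<union> {lo + w..<b} \<subseteq> {..<N}" using assms by (auto simp: minv_def)
  moreover have "card ({..<a} \<union> {lo + w..<b}) = N"
  proof -
    have "{..<a} \<inter> {lo + w..<b} = {}" "N + w = a + b - lo" "lo + w \<le> b" using assms by (auto simp: minv_def)
    then show ?thesis by (simp add: card_Un_disjoint)
  qed
  ultimately have "{..<a} \<union> {lo + w..<b} = {..<N}" by (intro card_subset_eq) auto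
  then show "g ` {..<N} = f ` {..<N}" "bsorted (2 * w) N g" using assms(1) by (auto simp: minv_def)
qed

lemma merge_ok:
  assumes M: "M ''N'' 0 = int N" "M ''w'' 0 = int w" "0 < w" "M ''lo'' 0 = 0" "M ''a'' 0 = 0" "M ''b'' 0 = int w"
    and f: "bsorted w N (pk M)" "\<And>p. p < N ==> 0 < M ''KD'' (int p)"
  shows "ex (For ''k'' (V ''N'') merge_body) (N * 120 + 9) (\<lambda>M'. pL M' ` {..<N} = pk M ` {..<N} \<and> bsorted (2 * w) N (pL M')) M"
proof -
  define Inv where "Inv k M' \<longleftrightarrow> (\<exists>lo a b. M' ''lo'' 0 = int lo \<and> M' ''a'' 0 = int a \<and> M' ''b'' 0 = int b \<and>
    minv w N (pk M) k lo a b (pL M'))" for k M'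
  have pos: "\<And>p. p < N ==> 0 < snd (pk M p)" using f(2) by (simp add: pk_def)
  have "ex (For ''k'' (V ''N'') merge_body) (N * (108 + acost (V ''N'') + 10) + acost (V ''N'') + 7) (Inv N) M"
  proof (rule ex_for)
    show "Inv 0 (M(''k'' := (M ''k'')(0 := 0)))"
      unfolding Inv_def using M by (intro exI[of _ 0] exI[of _ w]) (auto simp: minv_def bsorted_def)
    show "\<And>i M'. Inv i M' ==> (\<And>x. x \<notin> insert ''k'' (wr merge_body) ==> M' x = M x) ==> aval (V ''N'') M' = int N"
      using M by (simp add: merge_body_def merge_take_def)
    fix k M' assume k: "k < N" "Inv k M'" "M' ''k'' 0 = int k" and fr: "\<And>x. x \<notin> insert ''k'' (wr merge_body) ==> M' x = M x"
    have F: "M' ''N'' = M ''N''" "M' ''w'' = M ''w''" "M' ''KN'' = M ''KN''" "M' ''KD'' = M ''KD''"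
      by (rule fr; simp add: merge_body_def merge_take_def)+
    obtain lo a b where I: "M' ''lo'' 0 = int lo" "M' ''a'' 0 = int a" "M' ''b'' 0 = int b" "minv w N (pk M) k lo a b (pL M')"
      using k(2) by (auto simp: Inv_def)
    define lo' where "lo' = (if k < lo + 2 * w then lo else k)"
    define a' where "a' = (if k < lo + 2 * w then a else k)"
    define b' where "b' = (if k < lo + 2 * w then b else k + w)"
    have m: "minv w N (pk M) k lo' a' b' (pL M')" "k < lo' + 2 * w"
      using I(4) minv_block[OF I(4) M(3) k(1)] M(3) by (auto simp: lo'_def a'_def b'_def)
    have cnd: "int k < int lo + 2 * int w \<longleftrightarrow> k < lo + 2 * w" by linarith
    let ?c = "a' < lo' + w \<and> a' < N \<and> \<not> (b' < lo' + 2 * w \<and> b' < N \<and>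
      fst (pk M b') * snd (pk M a') < fst (pk M a') * snd (pk M b'))"
    define src where "src = (if ?c then a' else b')"
    have cast: "int x < int y + 2 * int w \<longleftrightarrow> x < y + 2 * w" "int x < int y + int w \<longleftrightarrow> x < y + w" for x y by linarith+
    obtain C1 C2 where mb: "merge_body = Seq C1 C2" and C1: "C1 = Cond (Neg (Less (V ''k'') (Add (V ''lo'') (Mul (Num 2) (V ''w'')))))
       (Seq (Set ''lo'' (V ''k'')) (Seq (Set ''a'' (V ''k'')) (Set ''b'' (Add (V ''k'') (V ''w''))))) Skip"
      and C2: "C2 = Cond merge_cond (merge_take ''a'') (merge_take ''b'')" by (simp add: merge_body_def)
    define M1 where "M1 = run C1 M'"
    have M1: "M1 ''lo'' 0 = int lo'" "M1 ''a'' 0 = int a'" "M1 ''b'' 0 = int b'"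
      unfolding M1_def C1 lo'_def a'_def b'_def using I(1-3) k(3) F(2) M(2) by (simp_all add: cast)
    have fr1: "M1 x = M' x" if "x \<notin> {''lo'', ''a'', ''b''}" for x
      unfolding M1_def by (rule run_frame) (use that in \<open>simp add: C1\<close>)
    have M1': "M1 ''k'' = M' ''k''" "M1 ''N'' 0 = int N" "M1 ''w'' 0 = int w" "M1 ''KN'' = M ''KN''" "M1 ''KD'' = M ''KD''" "pL M1 = pL M'"
      using F M(1,2) by (simp_all add: fr1 pL_def fun_eq_iff)
    have cnd: "bval merge_cond M1 \<longleftrightarrow> ?c" by (simp add: merge_cond_def M1 M1' cast pk_def)
    have res: "(let R = run merge_body M' in R ''k'' 0 = int k \<and> R ''lo'' 0 = int lo' \<and> R ''a'' 0 = int (if ?c then Suc a' else a') \<and>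
       R ''b'' 0 = int (if ?c then b' else Suc b') \<and> pL R = (pL M')(k := pk M (if ?c then a' else b')))"
    proof (cases ?c)
      case True
      have nb: "bval merge_cond M1 = True" using True cnd by blast
      have R: "run merge_body M' = run (merge_take ''a'') M1" by (simp only: mb C2 run.simps M1_def[symmetric] nb if_True)
      show ?thesis unfolding R Let_def if_P[OF True] M1'(6)[symmetric] using M1 M1' k(3)
        by (auto simp: merge_take_def pL_def pk_def fun_eq_iff)
    next
      case False
      have nb: "bval merge_cond M1 = False" using False cnd by blast
      have R: "run merge_body M' = run (merge_take ''b'') M1" by (simp only: mb C2 run.simps M1_def[symmetric] nb if_False)
      show ?thesis unfolding R Let_def if_not_P[OF False] M1'(6)[symmetric] using M1 M1' k(3)
        by (auto simp: merge_take_def pL_def pk_def fun_eq_iff)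
    qed
    have mm: "minv w N (pk M) (Suc k) lo' (if ?c then Suc a' else a') (if ?c then b' else Suc b') ((pL M')(k := pk M (if ?c then a' else b')))"
    proof (cases ?c)
      case True
      show ?thesis unfolding if_P[OF True] by (rule minv_step(1)[OF m(1) k(1) m(2) M(3) f(1) pos True])
    next
      case False
      show ?thesis unfolding if_not_P[OF False] by (rule minv_step(2)[OF m(1) k(1) m(2) M(3) f(1) pos False])
    qed
    have pLk: "pL (R(''k'' := z)) = pL R" for R z by (simp add: pL_def fun_eq_iff)
    have "run merge_body M' ''k'' 0 = int k \<and> Inv (Suc k) ((run merge_body M')(''k'' := (run merge_body M' ''k'')(0 := int (Suc k))))"
      unfolding Inv_def pLk using res mm unfolding Let_def by auto
    then show "ex merge_body 108 (\<lambda>M''. M'' ''k'' 0 = int k \<and> Inv (Suc k) (M''(''k'' := (M'' ''k'')(0 := int (Suc k))))) M'"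
      by (intro ex_lf) (auto simp: merge_body_def merge_take_def merge_cond_def)
  qed
  then show ?thesis
  proof (rule ex_conseq)
    fix M' assume "Inv N M'"
    then show "pL M' ` {..<N} = pk M ` {..<N} \<and> bsorted (2 * w) N (pL M')"
      unfolding Inv_def using minv_end[OF _ M(3), where f = "pk M" and g = "pL M'" and N = N] by blast
  qed simp
qed

lemma copy_ok:
  assumes "M ''N'' 0 = int N"
  shows "ex (For ''k'' (V ''N'') copy_body) (N * 40 + 9) (\<lambda>M'. \<forall>p<N. pk M' p = pL M p) M"
proof -
  have "ex (For ''k'' (V ''N'') copy_body) (N * (20 + acost (V ''N'') + 10) + acost (V ''N'') + 7) (\<lambda>M'. \<forall>p<N. pk M' p = pL M p) M"
  proof (rule ex_for)
    fix k M' assume k: "k < N" "\<forall>p<k. pk M' p = pL M p" "M' ''k'' 0 = int k" and fr: "\<And>x. x \<notin> insert ''k'' (wr copy_body) ==> M' x = M x"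
    have F: "M' ''LN'' = M ''LN''" "M' ''LD'' = M ''LD''" by (rule fr; simp add: copy_body_def)+
    show "ex copy_body 20 (\<lambda>M''. M'' ''k'' 0 = int k \<and> (\<forall>p<Suc k. pk (M''(''k'' := (M'' ''k'')(0 := int (Suc k)))) p = pL M p)) M'"
      by (rule ex_lf) (use k F in \<open>auto simp: copy_body_def pk_def pL_def less_Suc_eq\<close>)
  qed (use assms in \<open>auto simp: copy_body_def\<close>)
  then show ?thesis by (rule ex_conseq) auto
qed

lemma bsorted_cong: "(\<And>p. p < N ==> f p = g p) ==> bsorted w N f = bsorted w N g"
  unfolding bsorted_def by (intro all_cong1 imp_cong refl) simp

lemma wr_sort: "wr merge_body = {''lo'', ''a'', ''b'', ''LN'', ''LD''}" "wr copy_body = {''KN'', ''KD''}"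
  "wr sort_pass = {''lo'', ''a'', ''b'', ''LN'', ''LD'', ''KN'', ''KD'', ''k'', ''w''}"
  "wr sort_prog = {''lo'', ''a'', ''b'', ''LN'', ''LD'', ''KN'', ''KD'', ''k'', ''w''}"
  by (auto simp: merge_body_def merge_take_def copy_body_def sort_pass_def sort_prog_def)

lemma pass_ok:
  assumes M: "M ''N'' 0 = int N" "M ''w'' 0 = int w" "0 < w" "w < N"
    and f: "bsorted w N (pk M)" "\<And>p. p < N ==> 0 < M ''KD'' (int p)"
  shows "ex sort_pass (N * 160 + 60) (\<lambda>M'. M' ''w'' 0 = int (2 * w) \<and> pk M' ` {..<N} = pk M ` {..<N} \<and> bsorted (2 * w) N (pk M')) M"
proof -
  let ?M1 = "M(''lo'' := (M ''lo'')(0 := 0), ''a'' := (M ''a'')(0 := 0), ''b'' := (M ''b'')(0 := int w))"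
  let ?fin = "Cond (Conj (Less (Num (-1)) (Add (V ''w'') (V ''w''))) (Less (Add (V ''w'') (V ''w'')) (Add (V ''N'') (V ''N''))))
         (Set ''w'' (Add (V ''w'') (V ''w''))) Skip"
  have pkM: "pk ?M1 = pk M" by (auto simp: pk_def)
  have m: "ex (For ''k'' (V ''N'') merge_body) (N * 120 + 9) (\<lambda>M'. pL M' ` {..<N} = pk ?M1 ` {..<N} \<and> bsorted (2 * w) N (pL M')) ?M1"
    by (rule merge_ok) (use M f pkM in auto)
  have rest: "ex (Seq (For ''k'' (V ''N'') merge_body) (Seq (For ''k'' (V ''N'') copy_body) ?fin)) ((N * 120 + 9) + ((N * 40 + 9) + 30))
     (\<lambda>M'. M' ''w'' 0 = int (2 * w) \<and> pk M' ` {..<N} = pk M ` {..<N} \<and> bsorted (2 * w) N (pk M')) ?M1"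
  proof (rule ex_seq[OF m])
    fix M2 assume m2: "pL M2 ` {..<N} = pk ?M1 ` {..<N} \<and> bsorted (2 * w) N (pL M2)"
      and fr: "\<And>x. x \<notin> wr (For ''k'' (V ''N'') merge_body) ==> M2 x = ?M1 x"
    have F2: "M2 ''N'' 0 = int N" "M2 ''w'' 0 = int w" using fr[of "''N''"] fr[of "''w''"] M by (auto simp: wr_sort)
    show "ex (Seq (For ''k'' (V ''N'') copy_body) ?fin) ((N * 40 + 9) + 30)
     (\<lambda>M'. M' ''w'' 0 = int (2 * w) \<and> pk M' ` {..<N} = pk M ` {..<N} \<and> bsorted (2 * w) N (pk M')) M2"
    proof (rule ex_seq[OF copy_ok[of M2 N]])
      show "M2 ''N'' 0 = int N" by (rule F2(1))
    next
      fix M3 assume m3: "\<forall>p<N. pk M3 p = pL M2 p" and fr3: "\<And>x. x \<notin> wr (For ''k'' (V ''N'') copy_body) ==> M3 x = M2 x"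
      have F3: "M3 ''N'' 0 = int N" "M3 ''w'' 0 = int w" using fr3[of "''N''"] fr3[of "''w''"] F2 by (auto simp: wr_sort)
      have img: "pk M3 ` {..<N} = pk M ` {..<N}" using m3 m2 pkM by (auto intro!: image_cong)
      have so: "bsorted (2 * w) N (pk M3)" using bsorted_cong[of N "pk M3" "pL M2"] m3 m2 by auto
      let ?M4 = "M3(''w'' := (M3 ''w'')(0 := int w + int w))"
      have r4: "run ?fin M3 = ?M4" using F3 M(4) by simp
      have p4: "pk ?M4 = pk M3" by (simp add: pk_def fun_eq_iff)
      show "ex ?fin 30 (\<lambda>M'. M' ''w'' 0 = int (2 * w) \<and> pk M' ` {..<N} = pk M ` {..<N} \<and> bsorted (2 * w) N (pk M')) M3"
      proof (rule ex_lf)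
        show "run ?fin M3 ''w'' 0 = int (2 * w) \<and> pk (run ?fin M3) ` {..<N} = pk M ` {..<N} \<and> bsorted (2 * w) N (pk (run ?fin M3))"
          unfolding r4 p4 using img so by simp
      qed simp_all
    qed
  qed
  have s: "ex (Set x e) (2 + acost e) (\<lambda>M'. M' = M(x := (M x)(0 := aval e M))) M" for x e M by (rule ex_lf) auto
  have "ex sort_pass (3 + (3 + (4 + ((N * 120 + 9) + ((N * 40 + 9) + 30)))))
     (\<lambda>M'. M' ''w'' 0 = int (2 * w) \<and> pk M' ` {..<N} = pk M ` {..<N} \<and> bsorted (2 * w) N (pk M')) M"
    unfolding sort_pass_def
    by (rule ex_seq, rule ex_conseq[OF s], simp, assumption, rule ex_seq, rule ex_conseq[OF s], simp, assumption,
        rule ex_seq, rule ex_conseq[OF s], simp, assumption) (use rest M in simp)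
  then show ?thesis by (rule ex_conseq) auto
qed

theorem sort_ok:
  assumes M: "M ''N'' 0 = int N" "N \<le> 2 ^ L" and f: "\<And>p. p < N ==> 0 < M ''KD'' (int p)"
  shows "ex sort_prog (L * (N * 160 + 80) + 20)
    (\<lambda>M'. pk M' ` {..<N} = pk M ` {..<N} \<and> (\<forall>p q. p \<le> q \<and> q < N \<longrightarrow> vl (pk M' p) \<le> vl (pk M' q))) M"
proof -
  define Inv where "Inv k M' \<longleftrightarrow> (\<exists>i. i + k = L \<and> M' ''w'' 0 = int (2 ^ i) \<and> pk M' ` {..<N} = pk M ` {..<N} \<and> bsorted (2 ^ i) N (pk M'))" for k M'
  let ?M1 = "M(''w'' := (M ''w'')(0 := 1))"
  have 1: "ex (Set ''w'' (Num 1)) 3 (\<lambda>M'. M' = ?M1) M" by (rule ex_lf) auto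
  have pkM: "pk ?M1 = pk M" by (auto simp: pk_def)
  have 2: "ex (Loop (Less (V ''w'') (V ''N'')) sort_pass) (L * ((N * 160 + 60) + bcost (Less (V ''w'') (V ''N'')) + 1) + bcost (Less (V ''w'') (V ''N'')) + 1)
     (\<lambda>M'. (\<exists>k. Inv k M') \<and> \<not> bval (Less (V ''w'') (V ''N'')) M') ?M1"
  proof (rule ex_loop)
    show "Inv L ?M1" unfolding Inv_def using pkM by (auto simp: bsorted_def)
    fix k M' assume I: "Inv k M'" and fr: "\<And>x. x \<notin> wr sort_pass ==> M' x = ?M1 x" and b: "bval (Less (V ''w'') (V ''N'')) M'"
    obtain i where i: "i + k = L" "M' ''w'' 0 = int (2 ^ i)" "pk M' ` {..<N} = pk M ` {..<N}" "bsorted (2 ^ i) N (pk M')"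
      using I by (auto simp: Inv_def)
    have N: "M' ''N'' 0 = int N" using fr[of "''N''"] M by (simp add: wr_sort)
    have lt: "2 ^ i < N" using b i(2) N by simp
    then have "i < L" using M(2) by (meson le_less_trans linorder_not_less nat_power_less_imp_less not_less numeral_2_eq_2 zero_less_Suc power_increasing one_le_numeral order_less_le_trans)
    then have k: "0 < k" using i(1) by simp
    have pos: "0 < M' ''KD'' (int p)" if "p < N" for p
    proof -
      have "pk M' p \<in> pk M ` {..<N}" using i(3) that by blast
      then show ?thesis using f by (auto simp: pk_def)
    qed
    have "ex sort_pass (N * 160 + 60) (Inv (k - 1)) M'"
      by (rule ex_conseq[OF pass_ok[OF N i(2) _ lt i(4) pos]])
        (use i k in \<open>auto simp: Inv_def intro!: exI[of _ "Suc i"]\<close>)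
    then show "0 < k \<and> ex sort_pass (N * 160 + 60) (Inv (k - 1)) M'" using k by simp
  qed
  have "ex sort_prog (3 + (L * ((N * 160 + 60) + bcost (Less (V ''w'') (V ''N'')) + 1) + bcost (Less (V ''w'') (V ''N'')) + 1))
    (\<lambda>M'. pk M' ` {..<N} = pk M ` {..<N} \<and> (\<forall>p q. p \<le> q \<and> q < N \<longrightarrow> vl (pk M' p) \<le> vl (pk M' q))) M"
    unfolding sort_prog_def
  proof (rule ex_seq[OF 1])
    fix M2 assume M2: "M2 = ?M1"
    show "ex (Loop (Less (V ''w'') (V ''N'')) sort_pass) (L * ((N * 160 + 60) + bcost (Less (V ''w'') (V ''N'')) + 1) + bcost (Less (V ''w'') (V ''N'')) + 1)
      (\<lambda>M'. pk M' ` {..<N} = pk M ` {..<N} \<and> (\<forall>p q. p \<le> q \<and> q < N \<longrightarrow> vl (pk M' p) \<le> vl (pk M' q))) M2"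
      unfolding M2
    proof (rule ex_conseq[OF 2 order_refl])
      fix M' assume I: "(\<exists>k. Inv k M') \<and> \<not> bval (Less (V ''w'') (V ''N'')) M'"
        and fr: "\<And>x. x \<notin> wr (Loop (Less (V ''w'') (V ''N'')) sort_pass) ==> M' x = ?M1 x"
      then obtain i where i: "M' ''w'' 0 = int (2 ^ i)" "pk M' ` {..<N} = pk M ` {..<N}" "bsorted (2 ^ i) N (pk M')" by (auto simp: Inv_def)
      have "M' ''N'' 0 = int N" using fr[of "''N''"] M by (simp add: wr_sort)
      then have NN: "N \<le> 2 ^ i" using I i(1) by simp
      have "vl (pk M' p) \<le> vl (pk M' q)" if "p \<le> q" "q < N" for p q
      proof (cases "p = q")
        case False
        then have "p < q" "p div 2 ^ i = q div 2 ^ i" using that NN by simp_all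
        then show ?thesis using i(3) that unfolding bsorted_def by blast
      qed simp
      then show "pk M' ` {..<N} = pk M ` {..<N} \<and> (\<forall>p q. p \<le> q \<and> q < N \<longrightarrow> vl (pk M' p) \<le> vl (pk M' q))" using i(2) by blast
    qed
  qed
  then show ?thesis by (rule ex_conseq) (auto simp: algebra_simps)
qed

section \<open>Testing a makespan\<close>

fun sq :: "com list \<Rightarrow> com" where
  "sq [] = Skip"
| "sq (p # ps) = Seq p (sq ps)"

text \<open>Knowledge about the memory as a list of array names with predicates. A command discards
  the facts about the arrays that it writes, which \<open>hs_Cons\<close> expresses by a
  \<open>filter\<close> on names that the simplifier evaluates.\<close>

definition st :: "(string \<times> ((int \<Rightarrow> int) \<Rightarrow> bool)) list \<Rightarrow> memory \<Rightarrow> bool" where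
  "st G M \<longleftrightarrow> (\<forall>(x, Q)\<in>set G. Q (M x))"

lemma st_simps: "st [] M" "st ((x, Q) # G) M \<longleftrightarrow> Q (M x) \<and> st G M"
  by (auto simp: st_def)

lemma st_filter: "st G M ==> (\<And>y. y \<notin> A ==> M' y = M y) ==> st (filter (\<lambda>yQ. fst yQ \<notin> A) G) M'"
  by (auto simp: st_def)

definition hs :: "nat \<Rightarrow> (string \<times> ((int \<Rightarrow> int) \<Rightarrow> bool)) list \<Rightarrow> com list \<Rightarrow> (memory \<Rightarrow> bool) \<Rightarrow> bool" where
  "hs U G ps Q \<longleftrightarrow> (\<forall>M. st G M \<longrightarrow> ex (sq ps) (length ps * U + 1) Q M)"

lemma hs_Nil: "(\<And>M. st G M ==> Q M) ==> hs U G [] Q"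
  unfolding hs_def by (auto intro!: ex_lf)

lemma hs_Cons:
  assumes "\<And>M. st G M ==> ex p U (\<lambda>M'. Q (M' x)) M" "hs U ((x, Q) # filter (\<lambda>yQ. fst yQ \<notin> wr p) G) ps R"
  shows "hs U G (p # ps) R"
  unfolding hs_def
proof (intro allI impI)
  fix M assume M: "st G M"
  have "ex (Seq p (sq ps)) (U + (length ps * U + 1)) R M"
  proof (rule ex_seq[OF assms(1)[OF M]])
    fix M' assume "Q (M' x)" "\<And>y. y \<notin> wr p ==> M' y = M y"
    then have "st ((x, Q) # filter (\<lambda>yQ. fst yQ \<notin> wr p) G) M'"
      unfolding st_simps using st_filter[OF M] by blast
    then show "ex (sq ps) (length ps * U + 1) R M'" using assms(2) by (simp add: hs_def)
  qed
  then show "ex (sq (p # ps)) (length (p # ps) * U + 1) R M" by (simp add: add.assoc)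
qed

lemma for_acc:
  assumes "lf p" "wr p \<subseteq> {x}" "v \<noteq> x"
    and "\<And>i M'. i < N ==> M' v 0 = int i ==> (\<And>y. y \<notin> {v, x} ==> M' y = M y) ==>
      run p M' x = (M' x)(ix i := M' x (ix i) + ev i)"
    and e: "\<And>M'. (\<And>y. y \<notin> {v, x} ==> M' y = M y) ==> aval e M' = int N"
    and U: "N * (cc p + acost e + 10) + acost e + 7 \<le> U"
    and Q: "\<And>f. (\<And>z. f z = M x z + (\<Sum>i<N. if ix i = z then ev i else 0)) ==> Q f"
  shows "ex (For v e p) U (\<lambda>M'. Q (M' x)) M"
proof -
  define Inv where "Inv k M' \<longleftrightarrow> (\<forall>z. M' x z = M x z + (\<Sum>i<k. if ix i = z then ev i else 0))" for k and M' :: memory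
  have "ex (For v e p) (N * (cc p + acost e + 10) + acost e + 7) (Inv N) M"
  proof (rule ex_for)
    show "Inv 0 (M(v := (M v)(0 := 0)))" using assms(3) by (simp add: Inv_def)
    fix i M' assume i: "i < N" "Inv i M'" "M' v 0 = int i" and fr: "\<And>y. y \<notin> insert v (wr p) ==> M' y = M y"
    have fr': "M' y = M y" if "y \<notin> {v, x}" for y using fr[of y] that assms(2) by auto
    have r: "run p M' x = (M' x)(ix i := M' x (ix i) + ev i)" by (rule assms(4)[OF i(1,3) fr'])
    have v: "run p M' v = M' v" by (rule run_frame) (use assms(2,3) in auto)
    show "ex p (cc p) (\<lambda>M''. M'' v 0 = int i \<and> Inv (Suc i) (M''(v := (M'' v)(0 := int (Suc i))))) M'"
      by (rule ex_lf) (use assms(1,3) i r v in \<open>auto simp: Inv_def\<close>)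
  next
    fix M' assume fr: "\<And>y. y \<notin> insert v (wr p) ==> M' y = M y"
    show "aval e M' = int N" by (rule e, rule fr) (use assms(2) in auto)
  qed
  then show ?thesis
  proof (rule ex_conseq[OF _ U])
    fix M' assume "Inv N M'"
    then show "Q (M' x)" unfolding Inv_def by (intro Q) auto
  qed
qed

lemma for_set:
  assumes "lf p" "wr p \<subseteq> {x}" "v \<noteq> x"
    and "\<And>i M'. i < N ==> M' v 0 = int i ==> (\<And>y. y \<notin> {v, x} ==> M' y = M y) ==>
      run p M' x = (M' x)(off + int i := ev i)"
    and e: "\<And>M'. (\<And>y. y \<notin> {v, x} ==> M' y = M y) ==> aval e M' = int N"
    and U: "N * (cc p + acost e + 10) + acost e + 7 \<le> U"
    and Q: "\<And>f. (\<And>i. i < N ==> f (off + int i) = ev i) ==> (\<And>z. z < off \<or> off + int N \<le> z ==> f z = M x z) ==> Q f"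
  shows "ex (For v e p) U (\<lambda>M'. Q (M' x)) M"
proof -
  define Inv where "Inv k M' \<longleftrightarrow> (\<forall>i<k. M' x (off + int i) = ev i) \<and> (\<forall>z. z < off \<or> off + int k \<le> z \<longrightarrow> M' x z = M x z)" for k and M' :: memory
  have "ex (For v e p) (N * (cc p + acost e + 10) + acost e + 7) (Inv N) M"
  proof (rule ex_for)
    show "Inv 0 (M(v := (M v)(0 := 0)))" using assms(3) by (simp add: Inv_def)
    fix i M' assume i: "i < N" "Inv i M'" "M' v 0 = int i" and fr: "\<And>y. y \<notin> insert v (wr p) ==> M' y = M y"
    have fr': "M' y = M y" if "y \<notin> {v, x}" for y using fr[of y] that assms(2) by auto
    have r: "run p M' x = (M' x)(off + int i := ev i)" by (rule assms(4)[OF i(1,3) fr'])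
    have v: "run p M' v = M' v" by (rule run_frame) (use assms(2,3) in auto)
    show "ex p (cc p) (\<lambda>M''. M'' v 0 = int i \<and> Inv (Suc i) (M''(v := (M'' v)(0 := int (Suc i))))) M'"
      by (rule ex_lf) (use assms(1,3) i r v in \<open>auto simp: Inv_def less_Suc_eq\<close>)
  next
    fix M' assume fr: "\<And>y. y \<notin> insert v (wr p) ==> M' y = M y"
    show "aval e M' = int N" by (rule e, rule fr) (use assms(2) in auto)
  qed
  then show ?thesis
  proof (rule ex_conseq[OF _ U])
    fix M' assume "Inv N M'"
    then show "Q (M' x)" unfolding Inv_def by (intro Q) auto
  qed
qed

lemma cd_set:
  assumes "lf p" "wr p \<subseteq> {x}" "cc p \<le> U" "Q (run p M x)"
  shows "ex p U (\<lambda>M'. Q (M' x)) M"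
  by (rule ex_lf) (use assms in auto)

abbreviation jc :: aexp where "jc \<equiv> Read ''job_class'' (V ''j'')"
abbreviation sj :: aexp where "sj \<equiv> Read ''setup_times'' jc"
abbreviation tj :: aexp where "tj \<equiv> Read ''job_times'' (V ''j'')"
abbreviation sc :: aexp where "sc \<equiv> Read ''setup_times'' (V ''i'')"
abbreviation pc :: aexp where "pc \<equiv> Read ''P'' (V ''i'')"
abbreviation tyi :: aexp where "tyi \<equiv> Read ''ty'' (V ''i'')"

definition inc :: "string \<Rightarrow> aexp \<Rightarrow> aexp \<Rightarrow> com" where
  "inc x a e = Write x a (Add (Read x a) e)"

definition classify :: com where
  "classify = (let w = (\<lambda>v. Write ''ty'' (V ''i'') (Num v)); sD = Mul sc (V ''TD''); lD = Mul (Add sc pc) (V ''TD'') in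
    Cond (Less (V ''TN'') (Mul (Num 2) sD))
      (Cond (Less (V ''TN'') lD) (w 0) (Cond (Less (Mul (Num 3) (V ''TN'')) (Mul (Num 4) lD)) (w 1) (w 2)))
      (Cond (Less (V ''TN'') (Mul (Num 4) sD)) (w 6) (Cond (Less (Num 0) (Read ''bg'' (V ''i'')))
        (Cond (Less (V ''TN'') (Mul (Num 8) sD)) (w 5) (w 4)) (w 3))))"

abbreviation rd :: "string \<Rightarrow> int \<Rightarrow> aexp" where "rd x k \<equiv> Read x (Num k)"

text \<open>Class data are summed separately for each type, in arrays with seven cells; the
  coefficients are then fixed linear combinations of these sums. \<open>nj\<close> counts the jobs
  too long for \<open>T\<close>; with any of them the quotients stored in \<open>al\<close> carry no
  meaning.\<close>

definition test :: "com list" where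
  "test = [
    For ''i'' (V ''c'') (Write ''bg'' (V ''i'') (Num 0)),
    For ''i'' (V ''c'') (Write ''sm'' (V ''i'') (Num 0)),
    For ''i'' (Num 7) (Write ''SL'' (V ''i'') (Num 0)),
    For ''i'' (Num 7) (Write ''SA'' (V ''i'') (Num 0)),
    For ''i'' (Num 7) (Write ''SC'' (V ''i'') (Num 0)),
    For ''i'' (Num 7) (Write ''SD'' (V ''i'') (Num 0)),
    For ''i'' (Num 7) (Write ''SK'' (V ''i'') (Num 0)),
    Set ''nj'' (Num 0),
    For ''j'' (V ''n'') (Cond (Less (V ''TN'') (Mul (Add sj tj) (V ''TD''))) (inc ''nj'' (Num 0) (Num 1)) Skip),
    For ''j'' (V ''n'') (Cond (Less (V ''TN'') (Mul (Num 2) (Mul (Add sj tj) (V ''TD'')))) (inc ''bg'' jc (Num 1)) Skip),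
    For ''j'' (V ''n'') (Cond (Less (V ''TN'') (Mul (Num 2) (Mul (Add sj tj) (V ''TD'')))) Skip (inc ''sm'' jc tj)),
    For ''i'' (V ''c'') classify,
    For ''i'' (V ''c'') (Write ''al'' (V ''i'') (Quot (Sub (Mul pc (V ''TD'')) (Num 1)) (Sub (V ''TN'') (Mul sc (V ''TD''))))),
    For ''i'' (V ''c'') (inc ''SL'' tyi (Add sc pc)),
    For ''i'' (V ''c'') (inc ''SA'' tyi (Read ''al'' (V ''i''))),
    For ''i'' (V ''c'') (inc ''SC'' tyi (Num 1)),
    For ''i'' (V ''c'') (inc ''SD'' tyi (Sub (Read ''sm'' (V ''i'')) (Mul (Read ''bg'' (V ''i'')) sc))),
    For ''i'' (V ''c'') (inc ''SK'' tyi (Read ''bg'' (V ''i''))),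
    Set ''A0'' (Mul (Num 2) (Sub (Add (rd ''SD'' 4) (rd ''SD'' 5)) (Add (rd ''SL'' 2) (Add (rd ''SL'' 4) (Add (rd ''SL'' 5) (rd ''SL'' 6)))))),
    Set ''A1'' (Mul (Num (-2)) (Add (rd ''SL'' 1) (Add (rd ''SL'' 2) (Add (rd ''SL'' 3) (Add (rd ''SL'' 4) (Add (rd ''SL'' 5) (rd ''SL'' 6))))))),
    Set ''A2'' (Mul (Num 2) (Sub (Sub (rd ''SD'' 4) (Add (rd ''SL'' 1) (rd ''SL'' 3)))
      (Mul (Num 2) (Add (rd ''SL'' 2) (Add (rd ''SL'' 4) (Add (rd ''SL'' 5) (rd ''SL'' 6))))))),
    Set ''B0'' (Sub (Add (Mul (Num 2) (V ''m'')) (Add (rd ''SK'' 4) (rd ''SK'' 5))) (Mul (Num 2) (Add (rd ''SA'' 0) (rd ''SC'' 1)))),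
    Set ''B1'' (Mul (Num 2) (Sub (V ''m'') (rd ''SA'' 0))),
    Set ''B2'' (Sub (Add (Mul (Num 4) (V ''m'')) (rd ''SK'' 4)) (Add (Mul (Num 4) (rd ''SA'' 0)) (Mul (Num 2) (rd ''SC'' 1)))),
    Cond (Conj (Neg (Less (Num 0) (V ''nj''))) (Neg (Less (V ''m'') (Add (rd ''SA'' 0) (Add (rd ''SC'' 1) (rd ''SC'' 2))))))
      (Set ''o0'' (Num 1)) (Set ''o0'' (Num 0))]"

lemma frac_less:
  fixes T :: real assumes "T = real_of_int N / real_of_int D" "0 < D"
  shows "N < k * D \<longleftrightarrow> T < real_of_int k" "3 * N < k * D \<longleftrightarrow> 3 * T < real_of_int k"
    "N < q * (k * D) \<longleftrightarrow> T < real_of_int q * real_of_int k" "3 * N < q * (k * D) \<longleftrightarrow> 3 * T < real_of_int q * real_of_int k"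
proof -
  have D: "0 < real_of_int D" using assms(2) by simp
  have a: "N < k * D \<longleftrightarrow> T < real_of_int k" for k
  proof -
    have "N < k * D \<longleftrightarrow> real_of_int N < real_of_int k * real_of_int D" by (metis of_int_less_iff of_int_mult)
    then show ?thesis unfolding assms(1) using D by (simp add: pos_divide_less_eq)
  qed
  have b: "3 * N < k * D \<longleftrightarrow> 3 * T < real_of_int k" for k
  proof -
    have "3 * N < k * D \<longleftrightarrow> 3 * real_of_int N < real_of_int k * real_of_int D"
      by (metis of_int_less_iff of_int_mult of_int_numeral)
    then show ?thesis unfolding assms(1) using D by (simp add: pos_divide_less_eq)
  qed
  show "N < k * D \<longleftrightarrow> T < real_of_int k" "3 * N < k * D \<longleftrightarrow> 3 * T < real_of_int k" by (rule a, rule b)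
  show "N < q * (k * D) \<longleftrightarrow> T < real_of_int q * real_of_int k" "3 * N < q * (k * D) \<longleftrightarrow> 3 * T < real_of_int q * real_of_int k"
    using a[of "q * k"] b[of "q * k"] by (simp_all add: mult.assoc)
qed

context inst
begin

definition si :: "nat \<Rightarrow> int" where "si i = int (setup_times I ! i)"
definition ti :: "nat \<Rightarrow> int" where "ti j = int (job_times I ! j)"
definition Pi :: "nat \<Rightarrow> int" where "Pi i = (\<Sum>j<n. if int (cl j) = int i then ti j else 0)"

lemma real_si: "real_of_int (si i) = s i" by (simp add: si_def s_def)
lemma real_ti: "real_of_int (ti j) = t j" by (simp add: ti_def t_def)

lemma sum_J: "(\<Sum>j<n. if cl j = i \<and> B j then f j else 0) = (\<Sum>j\<in>{j \<in> J i. B j}. f j)"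
  for f :: "nat \<Rightarrow> 'b::comm_monoid_add"
proof -
  have "{j \<in> J i. B j} = {j \<in> {..<n}. cl j = i \<and> B j}" by (auto simp: J_def)
  then show ?thesis using sum.inter_filter[of "{..<n}" f "\<lambda>j. cl j = i \<and> B j"] by simp
qed

lemma real_Pi: "real_of_int (Pi i) = P i"
proof -
  have "Pi i = (\<Sum>j\<in>J i. ti j)" unfolding Pi_def using sum_J[of i "\<lambda>_. True" ti] by simp
  then show ?thesis by (simp add: P_def real_ti)
qed

definition env :: "(string \<times> ((int \<Rightarrow> int) \<Rightarrow> bool)) list" where
  "env = [(''m'', \<lambda>f. f 0 = int m), (''n'', \<lambda>f. f 0 = int n), (''c'', \<lambda>f. f 0 = int c),
     (''setup_times'', \<lambda>f. \<forall>i<c. f (int i) = si i), (''job_times'', \<lambda>f. \<forall>j<n. f (int j) = ti j),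
     (''job_class'', \<lambda>f. \<forall>j<n. f (int j) = int (cl j)), (''P'', \<lambda>f. \<forall>i<c. f (int i) = Pi i)]"

lemma c_le_n: "c \<le> n"
proof -
  have "{..<c} \<subseteq> cl ` {..<n}" using J_ne by (fastforce simp: J_def)
  from card_mono[OF _ this] card_image_le[of "{..<n}" cl] show ?thesis by simp
qed

text \<open>The integer form of \<open>al\<close>: for positive \<open>y\<close>, the ceiling of
  \<open>x / y\<close> minus 1 is \<open>(x - 1) div y\<close>.\<close>

definition alv :: "int \<Rightarrow> int \<Rightarrow> nat \<Rightarrow> int" where "alv N Dn i = (Pi i * Dn - 1) div (N - si i * Dn)"

lemma alv:
  fixes T :: real assumes "T = real_of_int N / real_of_int Dn" "0 < Dn" "s i < T"
  shows "alv N Dn i = al T i"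
proof -
  have Dn: "0 < real_of_int Dn" using assms(2) by simp
  have T: "real_of_int N = T * real_of_int Dn" unfolding assms(1) using Dn by simp
  have "s i * real_of_int Dn < real_of_int N" using assms(3) Dn unfolding T by simp
  then have "real_of_int (si i * Dn) < real_of_int N" by (simp add: real_si)
  then have pos: "0 < N - si i * Dn" by (simp only: of_int_less_iff)
  have "P i / (T - s i) = (P i * real_of_int Dn) / ((T - s i) * real_of_int Dn)" using Dn by simp
  also have "(T - s i) * real_of_int Dn = real_of_int (N - si i * Dn)" by (simp add: T real_si algebra_simps)
  also have "P i * real_of_int Dn = real_of_int (Pi i * Dn)" by (simp add: real_Pi)
  finally have e: "P i / (T - s i) = real_of_int (Pi i * Dn) / real_of_int (N - si i * Dn)" .
  have "\<lceil>real_of_int x / real_of_int y\<rceil> - 1 = (x - 1) div y" if "0 < y" for x y :: int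
  proof -
    have "\<lceil>real_of_int x / real_of_int y\<rceil> = (x - 1) div y + 1"
    proof (rule ceiling_unique)
      have y: "0 < real_of_int y" using that by simp
      have "(x - 1) div y * y \<le> x - 1" using that by (metis div_mult_mod_eq le_add_same_cancel1 pos_mod_sign)
      then have "real_of_int ((x - 1) div y) * real_of_int y < real_of_int x"
        by (metis of_int_less_iff of_int_mult zle_diff1_eq)
      then show "real_of_int ((x - 1) div y + 1) - 1 < real_of_int x / real_of_int y" using y by (simp add: pos_less_divide_eq)
      have "x - 1 < ((x - 1) div y + 1) * y" using that by (metis add.commute int_distrib(1) div_mult_mod_eq mult_1 add_strict_left_mono pos_mod_bound)
      then have "x \<le> ((x - 1) div y + 1) * y" by simp
      then have "real_of_int x \<le> real_of_int ((x - 1) div y + 1) * real_of_int y" by (metis of_int_le_iff of_int_mult)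
      then show "real_of_int x / real_of_int y \<le> real_of_int ((x - 1) div y + 1)" using y by (simp add: pos_divide_le_eq)
    qed
    then show ?thesis by simp
  qed
  from this[OF pos, of "Pi i * Dn"] show ?thesis unfolding alv_def al_def e by simp
qed

definition TS :: "real \<Rightarrow> (nat \<Rightarrow> 'b::comm_monoid_add) \<Rightarrow> nat \<Rightarrow> 'b" where
  "TS T f v = (\<Sum>i<c. if ty T i = v then f i else 0)"

lemma ty_split:
  obtains "ty T i = 0" | "ty T i = 1" | "ty T i = 2" | "ty T i = 3" | "ty T i = 4" | "ty T i = 5" | "ty T i = 6"
  using ty_le6[of T i] by linarith

lemma FA_S:
  fixes T :: real
  defines "l \<equiv> L" and "d \<equiv> (\<lambda>i. sm T i - real (bg T i) * s i)"
  shows "FA 0 T = 2 * ((TS T d 4 + TS T d 5) - (TS T l 2 + (TS T l 4 + (TS T l 5 + TS T l 6))))"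
    "FA 1 T = - 2 * (TS T l 1 + (TS T l 2 + (TS T l 3 + (TS T l 4 + (TS T l 5 + TS T l 6)))))"
    "FA 2 T = 2 * ((TS T d 4 - (TS T l 1 + TS T l 3)) - 2 * (TS T l 2 + (TS T l 4 + (TS T l 5 + TS T l 6))))"
  unfolding FA_def TS_def sum.distrib[symmetric] sum_distrib_left sum_subtractf[symmetric]
  subgoal by (rule sum.cong[OF refl], rule_tac T = T and i = x in ty_split, simp_all add: fa_def Let_def l_def d_def)
  subgoal by (rule sum.cong[OF refl], rule_tac T = T and i = x in ty_split, simp_all add: fa_def Let_def l_def d_def)
  subgoal by (rule sum.cong[OF refl], rule_tac T = T and i = x in ty_split, simp_all add: fa_def Let_def l_def d_def)
  done

lemma FB_S:
  fixes T :: real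
  defines "a \<equiv> (\<lambda>i. real_of_int (al T i))" and "k \<equiv> (\<lambda>i. real (bg T i))"
  shows "FB 0 T = (2 * real m + (TS T k 4 + TS T k 5)) - 2 * (TS T a 0 + TS T (\<lambda>_. 1) 1)"
    "FB 1 T = 2 * (real m - TS T a 0)"
    "FB 2 T = (4 * real m + TS T k 4) - (4 * TS T a 0 + 2 * TS T (\<lambda>_. 1) 1)"
proof -
  have "(\<Sum>i<c. fb 0 T i) = (TS T k 4 + TS T k 5) - 2 * (TS T a 0 + TS T (\<lambda>_. 1) 1)"
    "(\<Sum>i<c. fb 1 T i) = - 2 * TS T a 0"
    "(\<Sum>i<c. fb 2 T i) = TS T k 4 - (4 * TS T a 0 + 2 * TS T (\<lambda>_. 1) 1)"
    unfolding TS_def sum.distrib[symmetric] sum_distrib_left sum_subtractf[symmetric]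
    subgoal by (rule sum.cong[OF refl], rule_tac T = T and i = x in ty_split, simp_all add: fb_def Let_def a_def k_def)
    subgoal by (rule sum.cong[OF refl], rule_tac T = T and i = x in ty_split, simp_all add: fb_def Let_def a_def k_def)
    subgoal by (rule sum.cong[OF refl], rule_tac T = T and i = x in ty_split, simp_all add: fb_def Let_def a_def k_def)
    done
  then show "FB 0 T = (2 * real m + (TS T k 4 + TS T k 5)) - 2 * (TS T a 0 + TS T (\<lambda>_. 1) 1)"
    "FB 1 T = 2 * (real m - TS T a 0)"
    "FB 2 T = (4 * real m + TS T k 4) - (4 * TS T a 0 + 2 * TS T (\<lambda>_. 1) 1)"
    by (simp_all add: FB_def)
qed

lemma mc_S: "(\<Sum>i<c. mc T i) = TS T (al T) 0 + (TS T (\<lambda>_. 1) 1 + TS T (\<lambda>_. 1) 2)"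
  unfolding TS_def sum.distrib[symmetric] by (rule sum.cong[OF refl], rule_tac T = T and i = x in ty_split, simp_all add: mc_def)

lemma AA_S: "AA T = TS T (al T) 0" "ll T = TS T (\<lambda>_. 1) 1"
proof -
  have "{i. i < c \<and> ty T i = v} = {i \<in> {..<c}. ty T i = v}" for v by auto
  then show "AA T = TS T (al T) 0" "ll T = TS T (\<lambda>_. 1) 1"
    unfolding TS_def AA_def ll_def by (simp_all add: sum.inter_filter[symmetric])
qed

lemma real_TS: "real_of_int (TS T f v) = TS T (\<lambda>i. real_of_int (f i)) v"
  unfolding TS_def of_int_sum by (rule sum.cong) auto

lemma TS_cong: "(\<And>i. i < c ==> ty T i = v ==> f i = g i) ==> TS T f v = TS T g v"
  unfolding TS_def by (rule sum.cong) auto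

end

lemma wr_inc: "wr (inc x a e) = {x}" by (simp add: inc_def)
lemma wr_classify: "wr classify = {''ty''}" by (auto simp: classify_def Let_def)
lemma lf_classify: "lf classify" by (simp add: classify_def Let_def)
lemma cc_classify: "cc classify = 48" by (simp add: classify_def Let_def)

lemma filter_TF: "Q a ==> filter Q (a # xs) = a # filter Q xs" "\<not> Q a ==> filter Q (a # xs) = filter Q xs"
  "filter Q [] = []" by auto

lemmas hs_simps = append.simps filter_TF fst_conv wr.simps wr_For wr_inc wr_classify Un_iff insert_iff empty_iff simp_thms if_True if_False
  list.inject list.distinct char.inject list.simps(3) list.simps(2)

context inst
begin

definition U :: nat where "U = 200 * n + 400"

text \<open>The values beyond \<open>o0\<close> and \<open>ty\<close> are claimed only if
  \<open>ok0\<close> holds, since the divisor in \<open>al\<close> is positive only when every setup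
  is shorter than \<open>T\<close>.\<close>

definition tested :: "real \<Rightarrow> memory \<Rightarrow> bool" where
  "tested T M \<longleftrightarrow> M ''o0'' 0 = (if ok0 T then 1 else 0) \<and> (\<forall>i<c. M ''ty'' (int i) = int (ty T i)) \<and>
    (ok0 T \<longrightarrow> (\<forall>i<c. M ''al'' (int i) = al T i) \<and> M ''SA'' 0 = AA T \<and> M ''SC'' 1 = ll T \<and> real_of_int (M ''A0'' 0) = FA 0 T \<and> real_of_int (M ''A1'' 0) = FA 1 T \<and>
      real_of_int (M ''A2'' 0) = FA 2 T \<and> real_of_int (M ''B0'' 0) = FB 0 T \<and> real_of_int (M ''B1'' 0) = FB 1 T \<and>
      real_of_int (M ''B2'' 0) = FB 2 T)"

context
  fixes N Dn :: int and T :: real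
  assumes TT: "T = real_of_int N / real_of_int Dn" and Dp: "0 < Dn"
begin

definition smi :: "nat \<Rightarrow> int" where
  "smi i = (\<Sum>j<n. if cl j = i then if N < 2 * ((si (cl j) + ti j) * Dn) then 0 else ti j else 0)"

abbreviation fits :: bool where "fits \<equiv> \<forall>j<n. s (cl j) + t j \<le> T"

lemma big_I: "N < 2 * ((si i + ti j) * Dn) \<longleftrightarrow> T < 2 * (s i + t j)"
  using frac_less(3)[OF TT Dp, of 2 "si i + ti j"] by (simp add: real_si real_ti)

lemma nj_I: "0 < (\<Sum>j<n. if N < (si (cl j) + ti j) * Dn then 1 else (0::int)) \<longleftrightarrow> \<not> fits"
proof -
  have e: "N < (si (cl j) + ti j) * Dn \<longleftrightarrow> T < s (cl j) + t j" for j
    using frac_less(1)[OF TT Dp, of "si (cl j) + ti j"] by (simp add: real_si real_ti)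
  have "(\<Sum>j<n. if T < s (cl j) + t j then 1 else (0::int)) = int (card {j \<in> {..<n}. T < s (cl j) + t j})"
    by (simp add: sum.inter_filter[symmetric])
  then show ?thesis unfolding e by (auto simp: card_gt_0_iff not_le)
qed

lemma bg_I: "(\<Sum>j<n. if cl j = i then if N < 2 * ((si (cl j) + ti j) * Dn) then 1 else 0 else 0) = int (bg T i)"
proof -
  have "(\<Sum>j<n. if cl j = i then if N < 2 * ((si (cl j) + ti j) * Dn) then 1 else 0 else 0) =
     (\<Sum>j<n. if cl j = i \<and> T < 2 * (s i + t j) then 1 else (0::int))"
    unfolding big_I by (rule sum.cong) auto
  also have "\<dots> = int (bg T i)" unfolding sum_J bg_def by simp
  finally show ?thesis .
qed

lemma real_smi: "real_of_int (smi i) = sm T i"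
proof -
  have "smi i = (\<Sum>j<n. if cl j = i \<and> \<not> T < 2 * (s i + t j) then ti j else (0::int))"
    unfolding smi_def big_I by (rule sum.cong) auto
  also have "\<dots> = (\<Sum>j\<in>{j \<in> J i. \<not> T < 2 * (s i + t j)}. ti j)" unfolding sum_J by simp
  finally show ?thesis by (simp add: sm_def real_ti)
qed

lemma classify_run:
  assumes "M ''TN'' 0 = N" "M ''TD'' 0 = Dn" "M ''i'' 0 = int i" "M ''setup_times'' (int i) = si i"
    "M ''P'' (int i) = Pi i" "M ''bg'' (int i) = int (bg T i)"
  shows "run classify M ''ty'' = (M ''ty'')(int i := int (ty T i))"
proof -
  note f = frac_less[OF TT Dp]
  have "N < 2 * (si i * Dn) \<longleftrightarrow> T < 2 * s i" "N < 4 * (si i * Dn) \<longleftrightarrow> T < 4 * s i" "N < 8 * (si i * Dn) \<longleftrightarrow> T < 8 * s i"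
    "N < (si i + Pi i) * Dn \<longleftrightarrow> T < L i" "3 * N < 4 * ((si i + Pi i) * Dn) \<longleftrightarrow> 3 * T < 4 * L i"
    using f(3)[of 2 "si i"] f(3)[of 4 "si i"] f(3)[of 8 "si i"] f(1)[of "si i + Pi i"] f(4)[of 4 "si i + Pi i"]
    by (simp_all add: real_si real_Pi L_def)
  then show ?thesis unfolding classify_def Let_def using assms by (simp add: ty_def)
qed

lemma acc7:
  assumes "\<And>z. f z = M0 z + (\<Sum>i<c. if int (ty T i) = z then g i else 0)" "\<And>i. i < 7 ==> M0 (int i) = 0"
  shows "\<forall>k. 0 \<le> k \<and> k < 7 \<longrightarrow> f k = TS T g (nat k)"
proof (intro allI impI)
  fix k :: int assume k: "0 \<le> k \<and> k < 7"
  then obtain v where v: "k = int v" "v < 7" by (metis nonneg_int_cases of_nat_less_iff of_nat_numeral)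
  show "f k = TS T g (nat k)" using assms(1)[of k] assms(2) v by (simp add: TS_def)
qed

lemma ty_loop:
  assumes M: "M ''c'' 0 = int c" "\<forall>i<c. M ''ty'' (int i) = int (ty T i)" "\<forall>i<7. M x (int i) = 0"
    and x: "x \<notin> {''i'', ''c'', ''ty''}"
    and e: "\<And>i M'. i < c ==> M' ''i'' 0 = int i ==> (\<And>y. y \<noteq> ''i'' ==> y \<noteq> x ==> M' y = M y) ==> aval e M' = g i"
    and a: "acost e \<le> 50"
  shows "ex (For ''i'' (V ''c'') (inc x tyi e)) (200 * n + 400) (\<lambda>M'. \<forall>k. 0 \<le> k \<and> k < 7 \<longrightarrow> M' x k = TS T g (nat k)) M"
proof -
  have "c * (cc (inc x tyi e) + acost (V ''c'') + 10) \<le> n * 200" by (rule mult_le_mono[OF c_le_n]) (use a in \<open>simp add: inc_def\<close>)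
  then show ?thesis
    by (intro for_acc[where N = c and ix = "\<lambda>i. int (ty T i)" and ev = g and Q = "\<lambda>f. \<forall>k. 0 \<le> k \<and> k < 7 \<longrightarrow> f k = TS T g (nat k)"] acc7[of _ "M x"])
      (use x M e in \<open>auto simp: inc_def\<close>)
qed

lemma L_I: "L = (\<lambda>i. real_of_int (si i + Pi i))" by (simp add: fun_eq_iff L_def real_si real_Pi)
lemma d_I: "(\<lambda>i. sm T i - real (bg T i) * s i) = (\<lambda>i. real_of_int (smi i - int (bg T i) * si i))"
  by (simp add: fun_eq_iff real_smi real_si)

lemma FA_I:
  defines "l \<equiv> \<lambda>i. si i + Pi i" and "d \<equiv> \<lambda>i. smi i - int (bg T i) * si i"
  shows "FA 0 T = real_of_int (2 * ((TS T d 4 + TS T d 5) - (TS T l 2 + (TS T l 4 + (TS T l 5 + TS T l 6)))))"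
    "FA (Suc 0) T = real_of_int (- 2 * (TS T l 1 + (TS T l 2 + (TS T l 3 + (TS T l 4 + (TS T l 5 + TS T l 6))))))"
    "FA 2 T = real_of_int (2 * ((TS T d 4 - (TS T l 1 + TS T l 3)) - 2 * (TS T l 2 + (TS T l 4 + (TS T l 5 + TS T l 6)))))"
  using FA_S[of T] unfolding l_def d_def L_I d_I by (simp_all add: real_TS)

lemma alv_al: assumes fits "i < c" shows "alv N Dn i = al T i"
proof -
  obtain j where "j < n" "cl j = i" using J_ne[OF assms(2)] by (auto simp: J_def)
  then have "s i < T" using assms(1) t_pos[of j] by fastforce
  then show ?thesis by (rule alv[OF TT Dp])
qed

lemma FB_I:
  defines "k \<equiv> \<lambda>i. int (bg T i)"
  assumes fits
  shows "FB 0 T = real_of_int ((2 * int m + (TS T k 4 + TS T k 5)) - 2 * (TS T (alv N Dn) 0 + TS T (\<lambda>_. 1) 1))"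
    "FB (Suc 0) T = real_of_int (2 * (int m - TS T (alv N Dn) 0))"
    "FB 2 T = real_of_int ((4 * int m + TS T k 4) - (4 * TS T (alv N Dn) 0 + 2 * TS T (\<lambda>_. 1) 1))"
proof -
  have "TS T (\<lambda>i. real_of_int (al T i)) v = real_of_int (TS T (alv N Dn) v)" for v
    unfolding real_TS by (rule TS_cong) (simp add: alv_al[OF assms(2)])
  moreover have "TS T (\<lambda>_. 1) v = real_of_int (TS T (\<lambda>_. 1) v)" for v by (simp add: real_TS)
  moreover have "TS T (\<lambda>i. real (bg T i)) v = real_of_int (TS T k v)" for v by (simp add: real_TS k_def)
  ultimately show "FB 0 T = real_of_int ((2 * int m + (TS T k 4 + TS T k 5)) - 2 * (TS T (alv N Dn) 0 + TS T (\<lambda>_. 1) 1))"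
    "FB (Suc 0) T = real_of_int (2 * (int m - TS T (alv N Dn) 0))"
    "FB 2 T = real_of_int ((4 * int m + TS T k 4) - (4 * TS T (alv N Dn) 0 + 2 * TS T (\<lambda>_. 1) 1))"
    using FB_S[of T] by simp_all
qed

lemma TS_alv: "fits ==> TS T (alv N Dn) v = TS T (al T) v"
  by (rule TS_cong) (simp add: alv_al)

lemma ok0_I: "ok0 T \<longleftrightarrow> fits \<and> \<not> int m < TS T (alv N Dn) 0 + (TS T (\<lambda>_. 1) 1 + TS T (\<lambda>_. 1) 2)"
proof (cases fits)
  case True
  show ?thesis unfolding ok0_def mc_S TS_alv[OF True] using True by (simp add: not_less)
qed (auto simp: ok0_def)

lemma test_hs: "hs U (env @ [(''TN'', \<lambda>f. f 0 = N), (''TD'', \<lambda>f. f 0 = Dn)]) test (tested T)"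
  unfolding env_def test_def U_def
  apply (simp only: hs_simps)
  apply (rule hs_Cons[where x = "''bg''" and Q = "\<lambda>f. \<forall>i<c. f (int i) = 0"])
  subgoal premises pr for M
    apply (rule for_set[where N = "c" and off = "0" and ev = "\<lambda>_. 0"])
    using pr c_le_n by (simp_all add: inc_def cl_less st_simps)
  apply (simp only: hs_simps)
  apply (rule hs_Cons[where x = "''sm''" and Q = "\<lambda>f. \<forall>i<c. f (int i) = 0"])
  subgoal premises pr for M
    apply (rule for_set[where N = "c" and off = "0" and ev = "\<lambda>_. 0"])
    using pr c_le_n by (simp_all add: inc_def cl_less st_simps)
  apply (simp only: hs_simps)
  apply (rule hs_Cons[where x = "''SL''" and Q = "\<lambda>f. \<forall>i<7. f (int i) = 0"])
  subgoal premises pr for M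
    apply (rule for_set[where N = "7" and off = "0" and ev = "\<lambda>_. 0"])
    using pr c_le_n by (simp_all add: inc_def cl_less st_simps)
  apply (simp only: hs_simps)
  apply (rule hs_Cons[where x = "''SA''" and Q = "\<lambda>f. \<forall>i<7. f (int i) = 0"])
  subgoal premises pr for M
    apply (rule for_set[where N = "7" and off = "0" and ev = "\<lambda>_. 0"])
    using pr c_le_n by (simp_all add: inc_def cl_less st_simps)
  apply (simp only: hs_simps)
  apply (rule hs_Cons[where x = "''SC''" and Q = "\<lambda>f. \<forall>i<7. f (int i) = 0"])
  subgoal premises pr for M
    apply (rule for_set[where N = "7" and off = "0" and ev = "\<lambda>_. 0"])
    using pr c_le_n by (simp_all add: inc_def cl_less st_simps)
  apply (simp only: hs_simps)
  apply (rule hs_Cons[where x = "''SD''" and Q = "\<lambda>f. \<forall>i<7. f (int i) = 0"])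
  subgoal premises pr for M
    apply (rule for_set[where N = "7" and off = "0" and ev = "\<lambda>_. 0"])
    using pr c_le_n by (simp_all add: inc_def cl_less st_simps)
  apply (simp only: hs_simps)
  apply (rule hs_Cons[where x = "''SK''" and Q = "\<lambda>f. \<forall>i<7. f (int i) = 0"])
  subgoal premises pr for M
    apply (rule for_set[where N = "7" and off = "0" and ev = "\<lambda>_. 0"])
    using pr c_le_n by (simp_all add: inc_def cl_less st_simps)
  apply (simp only: hs_simps)
  apply (rule hs_Cons[where x = "''nj''" and Q = "\<lambda>f. f 0 = 0"])
  subgoal premises pr for M
    apply (rule cd_set)
    using pr c_le_n by (simp_all add: inc_def cl_less st_simps)
  apply (simp only: hs_simps)
  apply (rule hs_Cons[where x = "''nj''" and Q = "\<lambda>f. 0 < f 0 \<longleftrightarrow> \<not> fits"])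
  subgoal premises pr for M
    apply (rule for_acc[where N = "n" and ix = "\<lambda>j. 0" and ev = "\<lambda>j. if N < (si (cl j) + ti j) * Dn then 1 else 0"])
    using pr c_le_n by (simp_all add: inc_def cl_less st_simps nj_I)
  apply (simp only: hs_simps)
  apply (rule hs_Cons[where x = "''bg''" and Q = "\<lambda>f. \<forall>i<c. f (int i) = int (bg T i)"])
  subgoal premises pr for M
    apply (rule for_acc[where N = "n" and ix = "\<lambda>j. int (cl j)" and ev = "\<lambda>j. if N < 2 * ((si (cl j) + ti j) * Dn) then 1 else 0"])
    using pr c_le_n by (simp_all add: inc_def cl_less st_simps bg_I)
  apply (simp only: hs_simps)
  apply (rule hs_Cons[where x = "''sm''" and Q = "\<lambda>f. \<forall>i<c. f (int i) = smi i"])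
  subgoal premises pr for M
    apply (rule for_acc[where N = "n" and ix = "\<lambda>j. int (cl j)" and ev = "\<lambda>j. if N < 2 * ((si (cl j) + ti j) * Dn) then 0 else ti j"])
    using pr c_le_n by (simp_all add: inc_def cl_less st_simps smi_def)
  apply (simp only: hs_simps)
  apply (rule hs_Cons[where x = "''ty''" and Q = "\<lambda>f. \<forall>i<c. f (int i) = int (ty T i)"])
  subgoal premises pr for M
    apply (rule for_set[where N = "c" and off = "0" and ev = "\<lambda>i. int (ty T i)"])
    using pr c_le_n by (simp_all add: inc_def cl_less st_simps classify_run lf_classify cc_classify wr_classify)
  apply (simp only: hs_simps)
  apply (rule hs_Cons[where x = "''al''" and Q = "\<lambda>f. \<forall>i<c. f (int i) = alv N Dn i"])
  subgoal premises pr for M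
    apply (rule for_set[where N = "c" and off = "0" and ev = "alv N Dn"])
    using pr c_le_n by (simp_all add: inc_def cl_less st_simps alv_def)
  apply (simp only: hs_simps)
  apply (rule hs_Cons[where x = "''SL''" and Q = "\<lambda>f. \<forall>k. 0 \<le> k \<and> k < 7 \<longrightarrow> f k = TS T (\<lambda>i. si i + Pi i) (nat k)"])
  subgoal premises pr for M
    apply (rule ty_loop[where g = "\<lambda>i. si i + Pi i"])
    using pr c_le_n by (simp_all add: inc_def cl_less st_simps)
  apply (simp only: hs_simps)
  apply (rule hs_Cons[where x = "''SA''" and Q = "\<lambda>f. \<forall>k. 0 \<le> k \<and> k < 7 \<longrightarrow> f k = TS T (alv N Dn) (nat k)"])
  subgoal premises pr for M
    apply (rule ty_loop[where g = "alv N Dn"])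
    using pr c_le_n by (simp_all add: inc_def cl_less st_simps)
  apply (simp only: hs_simps)
  apply (rule hs_Cons[where x = "''SC''" and Q = "\<lambda>f. \<forall>k. 0 \<le> k \<and> k < 7 \<longrightarrow> f k = TS T (\<lambda>i. 1) (nat k)"])
  subgoal premises pr for M
    apply (rule ty_loop[where g = "\<lambda>i. 1"])
    using pr c_le_n by (simp_all add: inc_def cl_less st_simps)
  apply (simp only: hs_simps)
  apply (rule hs_Cons[where x = "''SD''" and Q = "\<lambda>f. \<forall>k. 0 \<le> k \<and> k < 7 \<longrightarrow> f k = TS T (\<lambda>i. smi i - int (bg T i) * si i) (nat k)"])
  subgoal premises pr for M
    apply (rule ty_loop[where g = "\<lambda>i. smi i - int (bg T i) * si i"])
    using pr c_le_n by (simp_all add: inc_def cl_less st_simps)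
  apply (simp only: hs_simps)
  apply (rule hs_Cons[where x = "''SK''" and Q = "\<lambda>f. \<forall>k. 0 \<le> k \<and> k < 7 \<longrightarrow> f k = TS T (\<lambda>i. int (bg T i)) (nat k)"])
  subgoal premises pr for M
    apply (rule ty_loop[where g = "\<lambda>i. int (bg T i)"])
    using pr c_le_n by (simp_all add: inc_def cl_less st_simps)
  apply (simp only: hs_simps)
  apply (rule hs_Cons[where x = "''A0''" and Q = "\<lambda>f. real_of_int (f 0) = FA 0 T"])
  subgoal premises pr for M
    apply (rule cd_set)
    using pr c_le_n by (simp_all add: inc_def cl_less st_simps FA_I)
  apply (simp only: hs_simps)
  apply (rule hs_Cons[where x = "''A1''" and Q = "\<lambda>f. real_of_int (f 0) = FA 1 T"])
  subgoal premises pr for M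
    apply (rule cd_set)
    using pr c_le_n by (simp_all add: inc_def cl_less st_simps FA_I)
  apply (simp only: hs_simps)
  apply (rule hs_Cons[where x = "''A2''" and Q = "\<lambda>f. real_of_int (f 0) = FA 2 T"])
  subgoal premises pr for M
    apply (rule cd_set)
    using pr c_le_n by (simp_all add: inc_def cl_less st_simps FA_I)
  apply (simp only: hs_simps)
  apply (rule hs_Cons[where x = "''B0''" and Q = "\<lambda>f. fits \<longrightarrow> real_of_int (f 0) = FB 0 T"])
  subgoal premises pr for M
    apply (rule cd_set)
    using pr c_le_n by (simp_all add: inc_def cl_less st_simps FB_I)
  apply (simp only: hs_simps)
  apply (rule hs_Cons[where x = "''B1''" and Q = "\<lambda>f. fits \<longrightarrow> real_of_int (f 0) = FB 1 T"])
  subgoal premises pr for M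
    apply (rule cd_set)
    using pr c_le_n by (simp_all add: inc_def cl_less st_simps FB_I)
  apply (simp only: hs_simps)
  apply (rule hs_Cons[where x = "''B2''" and Q = "\<lambda>f. fits \<longrightarrow> real_of_int (f 0) = FB 2 T"])
  subgoal premises pr for M
    apply (rule cd_set)
    using pr c_le_n by (simp_all add: inc_def cl_less st_simps FB_I)
  apply (simp only: hs_simps)
  apply (rule hs_Cons[where x = "''o0''" and Q = "\<lambda>f. f 0 = (if ok0 T then 1 else 0)"])
  subgoal premises pr for M
    apply (rule cd_set)
    using pr c_le_n by (simp_all add: inc_def cl_less st_simps ok0_I)
  apply (simp only: hs_simps)
  apply (rule hs_Nil)
  subgoal premises pr for M
    using pr unfolding tested_def by (auto simp: st_simps AA_S TS_alv ok0_def alv_al)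
  done

end
end

text \<open>A variant for commands whose result is known only up to existence, namely sorting. The
  witness \<open>w\<close> is shared by two arrays, so numerators and denominators of the sorted
  keys stay paired.\<close>

lemma hs_ConsE:
  assumes "\<And>M. st G M ==> ex p U (\<lambda>M'. \<exists>w. W w \<and> Q w (M' x) \<and> Q' w (M' y)) M"
    and "\<And>w. W w ==> hs U ((x, Q w) # (y, Q' w) # filter (\<lambda>yQ. fst yQ \<notin> wr p) G) ps R"
  shows "hs U G (p # ps) R"
  unfolding hs_def
proof (intro allI impI)
  fix M assume M: "st G M"
  have "ex (Seq p (sq ps)) (U + (length ps * U + 1)) R M"
  proof (rule ex_seq[OF assms(1)[OF M]])
    fix M' assume "\<exists>w. W w \<and> Q w (M' x) \<and> Q' w (M' y)" and fr: "\<And>y. y \<notin> wr p ==> M' y = M y"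
    then obtain w where w: "W w" "Q w (M' x)" "Q' w (M' y)" by blast
    then have "st ((x, Q w) # (y, Q' w) # filter (\<lambda>yQ. fst yQ \<notin> wr p) G) M'"
      unfolding st_simps using st_filter[OF M fr] by blast
    then show "ex (sq ps) (length ps * U + 1) R M'" using assms(2)[OF w(1)] by (simp add: hs_def)
  qed
  then show "ex (sq (p # ps)) (length (p # ps) * U + 1) R M" by (simp add: add.assoc)
qed

section \<open>Sorted jobs and sorted breakpoints\<close>

lemma wr_sort_prog: "wr sort_prog = {''lo'', ''a'', ''b'', ''LN'', ''LD'', ''KN'', ''KD'', ''k'', ''w''}" by (rule wr_sort)

definition loopK :: "nat \<Rightarrow> aexp \<Rightarrow> com" where
  "loopK e x = For ''j'' (V ''n'') (Write ''KN'' (Add (Mul (Num (int e)) (V ''n'')) (V ''j'')) x)"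

lemma wr_loopK: "wr (loopK e x) = {''j'', ''KN''}" by (auto simp: loopK_def)

text \<open>Numbers the jobs inside each class. These numbers are the \<open>k\<close> of the
  breakpoints \<open>s i + P i / k\<close>, so every job contributes exactly one of them.\<close>

definition rank_loop :: com where
  "rank_loop = For ''j'' (V ''n'') (Seq (inc ''cn'' jc (Num 1)) (Write ''rk'' (V ''j'') (Read ''cn'' jc)))"

lemma wr_rank: "wr rank_loop = {''j'', ''cn'', ''rk''}" by (auto simp: rank_loop_def inc_def)

text \<open>Ordering the jobs by class becomes sorting the integers \<open>cl j * n + j\<close>:
  they are distinct, and the job is the residue modulo \<open>n\<close>.\<close>

definition prep1 :: "com list" where
  "prep1 = [
    For ''j'' (V ''n'') (inc ''P'' jc tj),
    For ''j'' (V ''n'') (inc ''sa'' (Num 0) (Add sj tj)),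
    rank_loop,
    For ''j'' (V ''n'') (Write ''KN'' (V ''j'') (Add (Mul jc (V ''n'')) (V ''j''))),
    For ''j'' (V ''n'') (Write ''KD'' (V ''j'') (Num 1)),
    Set ''N'' (V ''n''),
    sort_prog]"

text \<open>Seven blocks of \<open>n\<close> cells hold the breakpoints as fractions, with
  denominator 3 in block 3 and the rank in block 5. Two sentinels follow: 0, which is rejected, and
  \<open>8 * sa\<close>, which is accepted.\<close>

definition prep2 :: "com list" where
  "prep2 = [
    For ''j'' (V ''n'') (Write ''od'' (V ''j'') (Sub (Read ''KN'' (V ''j'')) (Mul (Quot (Read ''KN'' (V ''j'')) (V ''n'')) (V ''n'')))),
    loopK 0 (Mul (Num 2) sj),
    loopK 1 (Mul (Num 4) sj),
    loopK 2 (Mul (Num 8) sj),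
    loopK 3 (Mul (Num 4) (Add sj (Read ''P'' jc))),
    loopK 4 (Mul (Num 2) (Add sj tj)),
    loopK 5 (Add (Mul sj (Read ''rk'' (V ''j''))) (Read ''P'' jc)),
    loopK 6 (Add sj tj),
    Write ''KN'' (Mul (Num 7) (V ''n'')) (Num 0),
    Write ''KN'' (Add (Mul (Num 7) (V ''n'')) (Num 1)) (Mul (Num 8) (V ''sa'')),
    For ''j'' (Add (Mul (Num 7) (V ''n'')) (Num 2)) (Write ''KD'' (V ''j'') (Num 1)),
    For ''j'' (V ''n'') (Write ''KD'' (Add (Mul (Num 3) (V ''n'')) (V ''j'')) (Num 3)),
    For ''j'' (V ''n'') (Write ''KD'' (Add (Mul (Num 5) (V ''n'')) (V ''j'')) (Read ''rk'' (V ''j''))),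
    Set ''N'' (Add (Mul (Num 7) (V ''n'')) (Num 2)),
    sort_prog]"

lemmas hs_simps' = hs_simps wr_sort_prog wr_loopK wr_rank

context inst
begin

definition rank :: "nat \<Rightarrow> nat" where "rank j = card {j'. j' \<le> j \<and> cl j' = cl j}"

definition cv :: "nat \<Rightarrow> nat \<Rightarrow> int" where
  "cv e j = (let i = cl j in [2 * si i, 4 * si i, 8 * si i, 4 * (si i + Pi i), 2 * (si i + ti j), si i * int (rank j) + Pi i, si i + ti j] ! e)"

definition dv :: "nat \<Rightarrow> nat \<Rightarrow> int" where
  "dv e j = (if e = 3 then 3 else if e = 5 then int (rank j) else 1)"

definition NN :: nat where "NN = 7 * n + 2"
definition sI :: int where "sI = (\<Sum>j<n. si (cl j) + ti j)"

definition keys :: "(nat \<Rightarrow> int \<times> int) \<Rightarrow> bool" where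
  "keys F \<longleftrightarrow> (\<forall>p<NN. 0 < snd (F p)) \<and> (\<forall>p q. p \<le> q \<and> q < NN \<longrightarrow> vl (F p) \<le> vl (F q)) \<and>
     (\<forall>b\<in>BP. \<exists>p<NN. vl (F p) = b) \<and> \<not> acc (vl (F 0)) \<and> acc (vl (F (NN - 1)))"

definition jobs_list :: "nat list \<Rightarrow> bool" where
  "jobs_list js \<longleftrightarrow> distinct js \<and> set js = {..<n} \<and> sorted (map cl js) \<and> length js = n"

lemma rank_pos: "0 < rank j"
proof -
  have "{j'. j' \<le> j \<and> cl j' = cl j} \<noteq> {}" by auto
  moreover have "finite {j'. j' \<le> j \<and> cl j' = cl j}" by (rule finite_subset[of _ "{..j}"]) auto
  ultimately show ?thesis unfolding rank_def by (simp add: card_gt_0_iff)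
qed

text \<open>The rank increases strictly within a class and never exceeds its size; an injection
  between finite sets of equal size is onto.\<close>

lemma rank_image: "rank ` J i = {1..card (J i)}"
proof -
  have fin: "finite {j'. j' \<le> j \<and> cl j' = i}" for j by (rule finite_subset[of _ "{..j}"]) auto
  have "inj_on rank (J i)"
  proof (rule linorder_inj_onI)
    fix x y assume xy: "x < y" "x \<in> J i" "y \<in> J i"
    have "y \<notin> {j'. j' \<le> x \<and> cl j' = i}" "y \<in> {j'. j' \<le> y \<and> cl j' = i}" using xy by (auto simp: J_def)
    moreover have "{j'. j' \<le> x \<and> cl j' = i} \<subseteq> {j'. j' \<le> y \<and> cl j' = i}" using xy by auto
    ultimately have "{j'. j' \<le> x \<and> cl j' = i} \<subset> {j'. j' \<le> y \<and> cl j' = i}" by blast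
    from psubset_card_mono[OF fin this] show "rank x \<noteq> rank y" using xy by (simp add: rank_def J_def)
  qed auto
  then have "card (rank ` J i) = card {1..card (J i)}" by (simp add: card_image)
  moreover have "rank ` J i \<subseteq> {1..card (J i)}"
  proof
    fix k assume "k \<in> rank ` J i"
    then obtain j where j: "j \<in> J i" "k = rank j" by blast
    have "{j'. j' \<le> j \<and> cl j' = cl j} \<subseteq> J i" using j by (auto simp: J_def)
    then have "rank j \<le> card (J i)" unfolding rank_def by (intro card_mono) auto
    then show "k \<in> {1..card (J i)}" using rank_pos[of j] j by simp
  qed
  ultimately show ?thesis by (intro card_subset_eq) auto
qed

lemma keysI:
  assumes n: "0 < n" and G: "\<And>e j. e < 7 ==> j < n ==> G (e * n + j) = (cv e j, dv e j)" "G (7 * n) = (0, 1)" "G (7 * n + 1) = (8 * sI, 1)"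
    and F: "F ` {..<NN} = G ` {..<NN}" "\<And>p q. p \<le> q ==> q < NN ==> vl (F p) \<le> vl (F q)"
  shows "keys F"
proof -
  have si0: "0 \<le> si i" "0 \<le> ti j" for i j by (auto simp: si_def ti_def)
  have Pi0: "0 \<le> Pi i" for i unfolding Pi_def by (rule sum_nonneg) (auto simp: si0)
  have cv0: "0 \<le> cv e j" if "e < 7" for e j
  proof -
    have "e = 0 \<or> e = 1 \<or> e = 2 \<or> e = 3 \<or> e = 4 \<or> e = 5 \<or> e = 6" using that by arith
    then show ?thesis unfolding cv_def Let_def using si0 Pi0 by (elim disjE) simp_all
  qed
  have sI0: "0 \<le> sI" unfolding sI_def by (rule sum_nonneg) (simp add: si0)
  have dv0: "0 < dv e j" for e j using rank_pos by (auto simp: dv_def)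
  have Gc: "0 < snd (G p) \<and> 0 \<le> fst (G p)" if "p < NN" for p
  proof -
    have "p < 7 * n \<or> p = 7 * n \<or> p = 7 * n + 1" using that unfolding NN_def by linarith
    then consider "p < 7 * n" | "p = 7 * n" | "p = 7 * n + 1" by blast
    then show ?thesis
    proof cases
      case 1
      then have "p div n < 7" "p mod n < n" using n by (simp_all add: div_less_iff_less_mult)
      then have "G p = (cv (p div n) (p mod n), dv (p div n) (p mod n))" using G(1)[of "p div n" "p mod n"] by simp
      then show ?thesis using cv0[OF \<open>p div n < 7\<close>] dv0 by simp
    qed (use G sI0 in auto)
  qed
  have Fc: "0 < snd (F p) \<and> 0 \<le> fst (F p)" if p: "p < NN" for p
  proof -
    have "F p \<in> G ` {..<NN}" using F(1) p by blast
    then show ?thesis using Gc by auto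
  qed
  have GF: "\<exists>p<NN. vl (F p) = vl (G q)" if q: "q < NN" for q
  proof -
    have "G q \<in> F ` {..<NN}" using F(1) q by blast
    then show ?thesis by auto
  qed
  have eq: "e * n + j < NN" if "e < 7" "j < n" for e j
  proof -
    have "e * n + j < Suc e * n" using that by simp
    also have "\<dots> \<le> 7 * n" using that by (intro mult_right_mono) auto
    finally show ?thesis by (simp add: NN_def)
  qed
  have val: "\<exists>p<NN. vl (F p) = real_of_int (cv e j) / real_of_int (dv e j)" if "e < 7" "j < n" for e j
    using GF[OF eq[OF that]] G(1)[OF that] by (simp add: vl_def)
  have NN0: "0 < NN" "NN - 1 < NN" "7 * n < NN" "7 * n + 1 < NN" by (simp_all add: NN_def)
  have bp: "\<exists>p<NN. vl (F p) = b" if b: "b \<in> BP" for b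
  proof -
    have j: "\<exists>p<NN. vl (F p) = 2 * s (cl j)" "\<exists>p<NN. vl (F p) = 4 * s (cl j)" "\<exists>p<NN. vl (F p) = 8 * s (cl j)"
      "\<exists>p<NN. vl (F p) = 4 / 3 * L (cl j)" "\<exists>p<NN. vl (F p) = 2 * (s (cl j) + t j)" "\<exists>p<NN. vl (F p) = s (cl j) + t j"
      "\<exists>p<NN. vl (F p) = s (cl j) + P (cl j) / real (rank j)" if "j < n" for j
    proof -
      have q: "real_of_int (cv 0 j) / real_of_int (dv 0 j) = 2 * s (cl j)" "real_of_int (cv 1 j) / real_of_int (dv 1 j) = 4 * s (cl j)"
        "real_of_int (cv 2 j) / real_of_int (dv 2 j) = 8 * s (cl j)" "real_of_int (cv 3 j) / real_of_int (dv 3 j) = 4 / 3 * L (cl j)"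
        "real_of_int (cv 4 j) / real_of_int (dv 4 j) = 2 * (s (cl j) + t j)" "real_of_int (cv 6 j) / real_of_int (dv 6 j) = s (cl j) + t j"
        "real_of_int (cv 5 j) / real_of_int (dv 5 j) = s (cl j) + P (cl j) / real (rank j)"
        using rank_pos[of j] by (simp_all add: cv_def dv_def Let_def real_si real_ti real_Pi L_def field_simps)
      show "\<exists>p<NN. vl (F p) = 2 * s (cl j)" "\<exists>p<NN. vl (F p) = 4 * s (cl j)" "\<exists>p<NN. vl (F p) = 8 * s (cl j)"
        "\<exists>p<NN. vl (F p) = 4 / 3 * L (cl j)" "\<exists>p<NN. vl (F p) = 2 * (s (cl j) + t j)" "\<exists>p<NN. vl (F p) = s (cl j) + t j"
        "\<exists>p<NN. vl (F p) = s (cl j) + P (cl j) / real (rank j)"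
        using val[of 0 j, unfolded q] val[of 1 j, unfolded q] val[of 2 j, unfolded q] val[of 3 j, unfolded q]
          val[of 4 j, unfolded q] val[of 5 j, unfolded q] val[of 6 j, unfolded q] that by simp_all
    qed
    have "b = Tm \<or> (\<exists>j<n. b \<in> {2 * s (cl j), 4 * s (cl j), 8 * s (cl j), 4 / 3 * L (cl j), 2 * (s (cl j) + t j)}) \<or>
       (\<exists>j<n. b \<in> (\<lambda>k. s (cl j) + P (cl j) / real k) ` {1..card (J (cl j))})"
      using b unfolding BP_def by blast
    then consider "b = Tm" | j where "j < n" "b \<in> {2 * s (cl j), 4 * s (cl j), 8 * s (cl j), 4 / 3 * L (cl j), 2 * (s (cl j) + t j)}"
      | j where "j < n" "b \<in> (\<lambda>k. s (cl j) + P (cl j) / real k) ` {1..card (J (cl j))}" by blast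
    then show ?thesis
    proof cases
      case 1
      have "Tm \<in> (\<lambda>j. s (cl j) + t j) ` {..<n}" unfolding Tm_def using n by (intro Max_in) auto
      then show ?thesis using j(6) 1 by auto
    next
      case 2
      from 2(2) show ?thesis using j(1-5)[OF 2(1)] by blast
    next
      case 3
      then obtain k where k: "k \<in> {1..card (J (cl j))}" "b = s (cl j) + P (cl j) / real k" by blast
      then have "k \<in> rank ` J (cl j)" by (simp add: rank_image)
      then obtain j' where "j' \<in> J (cl j)" "k = rank j'" by blast
      then show ?thesis using j(7)[of j'] k by (simp add: J_def)
    qed
  qed
  have "vl (F 0) = 0"
  proof (rule antisym)
    obtain p where p: "p < NN" "vl (F p) = 0" using GF[OF NN0(3)] G(2) by (auto simp: vl_def)
    then show "vl (F 0) \<le> 0" using F(2)[of 0 p] by simp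
    show "0 \<le> vl (F 0)" using Fc[OF NN0(1)] by (simp add: vl_def)
  qed
  then have a0: "\<not> acc (vl (F 0))" using not_acc_0[OF n] by simp
  \<comment> \<open>Every class has a job, so adding the setup once per job gives at least the sum
    of all class loads.\<close>
  have "(\<Sum>i<c. L i) \<le> real_of_int sI"
  proof -
    have "real_of_int sI = (\<Sum>j<n. s (cl j) + t j)" by (simp add: sI_def real_si real_ti)
    also have "\<dots> = (\<Sum>i<c. \<Sum>j\<in>J i. s (cl j) + t j)"
      using sum.group[of "{..<n}" "{..<c}" cl "\<lambda>j. s (cl j) + t j"] cl_less by (auto simp: J_def image_subset_iff)
    also have "\<dots> \<ge> (\<Sum>i<c. L i)"
    proof (rule sum_mono)
      fix i assume i: "i \<in> {..<c}"
      have "(\<Sum>j\<in>J i. s (cl j) + t j) = (\<Sum>j\<in>J i. s i + t j)" by (rule sum.cong) (auto simp: J_def)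
      also have "\<dots> = real (card (J i)) * s i + P i" by (simp add: sum.distrib P_def)
      also have "\<dots> \<ge> L i"
      proof -
        have "1 \<le> card (J i)" using J_ne i by (simp add: Suc_le_eq card_gt_0_iff)
        then have "1 * s i \<le> real (card (J i)) * s i" using s_pos[of i] i by (intro mult_right_mono) auto
        then show ?thesis by (simp add: L_def)
      qed
      finally show "L i \<le> (\<Sum>j\<in>J i. s (cl j) + t j)" .
    qed
    finally show ?thesis .
  qed
  moreover have "8 * real_of_int sI \<le> vl (F (NN - 1))"
  proof -
    obtain p where p: "p < NN" "vl (F p) = 8 * real_of_int sI" using GF[OF NN0(4)] G(3) by (auto simp: vl_def)
    then show ?thesis using F(2)[of p "NN - 1"] NN0 by simp
  qed
  ultimately have "acc (vl (F (NN - 1)))" by (intro acc_big[OF n]) simp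
  then show ?thesis unfolding keys_def using Fc F(2) bp a0 by blast
qed

lemma jobs_listI:
  assumes n: "0 < n" and K: "K ` {..<n} = (\<lambda>j. int (cl j) * int n + int j) ` {..<n}" "\<And>p q. p \<le> q ==> q < n ==> K p \<le> K q"
  shows "\<exists>js. jobs_list js \<and> (\<forall>p<n. K p = int (cl (js ! p)) * int n + int (js ! p))"
proof -
  let ?k = "\<lambda>j. int (cl j) * int n + int j"
  have md: "?k j mod int n = int j" "?k j div int n = int (cl j)" if "j < n" for j using that by auto
  have "\<forall>p<n. \<exists>j<n. K p = ?k j"
  proof (intro allI impI)
    fix p assume "p < n"
    then have "K p \<in> ?k ` {..<n}" using K(1) by blast
    then show "\<exists>j<n. K p = ?k j" by auto
  qed
  then obtain g where g: "\<And>p. p < n ==> g p < n \<and> K p = ?k (g p)" by metis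
  define js where "js = map g [0..<n]"
  have "g ` {..<n} = {..<n}"
  proof
    show "g ` {..<n} \<subseteq> {..<n}" using g by auto
    show "{..<n} \<subseteq> g ` {..<n}"
    proof
      fix j assume j: "j \<in> {..<n}"
      then have "?k j \<in> K ` {..<n}" unfolding K(1) by blast
      then obtain p where p: "p < n" "K p = ?k j" by auto
      then have "?k (g p) mod int n = ?k j mod int n" using g by simp
      then have "g p = j" using md g[OF p(1)] j by simp
      then show "j \<in> g ` {..<n}" using p(1) by blast
    qed
  qed
  then have st: "set js = {..<n}" by (auto simp: js_def lessThan_atLeast0)
  have len: "length js = n" by (simp add: js_def)
  have "distinct js" by (rule card_distinct) (simp add: st len)
  moreover have "sorted (map cl js)"
    unfolding sorted_iff_nth_mono
  proof (intro allI impI)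
    fix p q assume pq: "p \<le> q" "q < length (map cl js)"
    then have q: "p < n" "q < n" by (simp_all add: len)
    have "K p div int n \<le> K q div int n" using K(2)[OF pq(1) q(2)] n by (intro zdiv_mono1) auto
    then have "cl (g p) \<le> cl (g q)" using g q md by simp
    then show "map cl js ! p \<le> map cl js ! q" using q by (simp add: js_def)
  qed
  ultimately show ?thesis using st len g by (intro exI[of _ js]) (simp add: jobs_list_def js_def)
qed

definition U2 :: "nat \<Rightarrow> nat" where "U2 l = l * ((7 * n + 2) * 160 + 80) + 500 * n + 1000"

lemma cand_loop:
  assumes M: "M ''n'' 0 = int n" "\<forall>e'<e. \<forall>j<n. M ''KN'' (int (e' * n + j)) = cv e' j"
    and x: "\<And>j M'. j < n ==> M' ''j'' 0 = int j ==> (\<And>y. y \<noteq> ''j'' ==> y \<noteq> ''KN'' ==> M' y = M y) ==> aval x M' = cv e j"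
    and a: "acost x \<le> 30"
  shows "ex (loopK e x) (U2 l) (\<lambda>M'. (\<forall>e'<Suc e. \<forall>j<n. M' ''KN'' (int (e' * n + j)) = cv e' j)) M"
  unfolding loopK_def
proof (rule for_set[where N = n and off = "int (e * n)" and ev = "cv e" and Q = "\<lambda>f. \<forall>e'<Suc e. \<forall>j<n. f (int (e' * n + j)) = cv e' j"])
  let ?p = "Write ''KN'' (Add (Mul (Num (int e)) (V ''n'')) (V ''j'')) x"
  have "n * (cc ?p + acost (V ''n'') + 10) \<le> n * 500" using a by (intro mult_left_mono) auto
  then show "n * (cc ?p + acost (V ''n'') + 10) + acost (V ''n'') + 7 \<le> U2 l"
    unfolding U2_def acost.simps by linarith
next
  fix f assume f: "\<And>i. i < n ==> f (int (e * n) + int i) = cv e i"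
    "\<And>z. z < int (e * n) \<or> int (e * n) + int n \<le> z ==> f z = M ''KN'' z"
  show "\<forall>e'<Suc e. \<forall>j<n. f (int (e' * n + j)) = cv e' j"
  proof (intro allI impI)
    fix e' j assume j: "e' < Suc e" "j < n"
    show "f (int (e' * n + j)) = cv e' j"
    proof (cases "e' = e")
      case True
      then show ?thesis using f(1)[OF j(2)] by simp
    next
      case False
      then have "Suc e' \<le> e" using j(1) by simp
      then have "Suc e' * n \<le> e * n" by (rule mult_right_mono) simp
      then have "e' * n + j < e * n" using j(2) by simp
      then have "f (int (e' * n + j)) = M ''KN'' (int (e' * n + j))" by (intro f(2) disjI1) (simp only: of_nat_less_iff)
      then show ?thesis using M(2) False j by simp
    qed
  qed
qed (use M x in auto)

lemma rank_ok:
  assumes M: "M ''n'' 0 = int n" "\<forall>z. M ''cn'' z = 0" "\<forall>j<n. M ''job_class'' (int j) = int (cl j)"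
  shows "ex rank_loop (U2 l) (\<lambda>M'. (\<forall>j<n. M' ''rk'' (int j) = int (rank j))) M"
proof -
  define cnt where "cnt k z = card {j. j < k \<and> cl j = z}" for k z
  have cnt0: "cnt 0 z = 0" for z by (simp add: cnt_def)
  have c1: "cnt (Suc i) z = (if z = cl i then Suc (cnt i z) else cnt i z)" for i z
  proof -
    have e1: "{j. j < Suc i \<and> cl j = z} = (if z = cl i then insert i {j. j < i \<and> cl j = z} else {j. j < i \<and> cl j = z})"
      by (auto simp: less_Suc_eq)
    show ?thesis unfolding cnt_def e1 by simp
  qed
  have r: "rank i = Suc (cnt i (cl i))" for i
    using c1[of i "cl i"] by (simp add: rank_def cnt_def less_Suc_eq_le)
  define Inv where "Inv k M' \<longleftrightarrow> (\<forall>z. M' ''cn'' (int z) = int (cnt k z)) \<and> (\<forall>j<k. M' ''rk'' (int j) = int (rank j))" for k and M' :: memory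
  let ?p = "Seq (inc ''cn'' jc (Num 1)) (Write ''rk'' (V ''j'') (Read ''cn'' jc))"
  have "ex rank_loop (n * (40 + acost (V ''n'') + 10) + acost (V ''n'') + 7) (Inv n) M"
    unfolding rank_loop_def
  proof (rule ex_for)
    show "Inv 0 (M(''j'' := (M ''j'')(0 := 0)))" using M by (simp add: Inv_def cnt0)
    fix i M' assume i: "i < n" "Inv i M'" "M' ''j'' 0 = int i" and fr: "\<And>y. y \<notin> insert ''j'' (wr ?p) ==> M' y = M y"
    have jc: "M' ''job_class'' (int i) = int (cl i)" using fr[of "''job_class''"] M(3) i(1) by (simp add: inc_def)
    show "ex ?p 40 (\<lambda>M''. M'' ''j'' 0 = int i \<and> Inv (Suc i) (M''(''j'' := (M'' ''j'')(0 := int (Suc i))))) M'"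
      by (rule ex_lf) (use i jc in \<open>auto simp: inc_def Inv_def c1 r less_Suc_eq\<close>)
  next
    fix M' assume fr: "\<And>y. y \<notin> insert ''j'' (wr ?p) ==> M' y = M y"
    show "aval (V ''n'') M' = int n" using fr[of "''n''"] M by (simp add: inc_def)
  qed
  then show ?thesis by (rule ex_conseq) (auto simp: U2_def Inv_def)
qed

lemma hs_post: "hs u G ps R ==> (\<And>M. R M ==> R' M) ==> hs u G ps R'"
  unfolding hs_def ex_def by meson

lemma hs_weak: "hs u G ps R ==> (\<And>M. st G' M ==> st G M) ==> hs u G' ps R"
  by (simp add: hs_def)

definition env1 :: "nat list \<Rightarrow> (string \<times> ((int \<Rightarrow> int) \<Rightarrow> bool)) list" where
  "env1 js = env @ [(''od'', \<lambda>f. \<forall>p<n. f (int p) = int (js ! p))]"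

definition env2 :: "nat list \<Rightarrow> (nat \<Rightarrow> int \<times> int) \<Rightarrow> (string \<times> ((int \<Rightarrow> int) \<Rightarrow> bool)) list" where
  "env2 js F = env1 js @ [(''N'', \<lambda>f. f 0 = int NN), (''KN'', \<lambda>f. \<forall>p<NN. f (int p) = fst (F p)),
     (''KD'', \<lambda>f. \<forall>p<NN. f (int p) = snd (F p))]"

lemma nth_js: "jobs_list js ==> p < n ==> js ! p < n"
  by (metis jobs_list_def lessThan_iff nth_mem)

context
  fixes js :: "nat list" and l :: nat
  assumes js: "jobs_list js" and n0: "0 < n" and l: "NN \<le> 2 ^ l"
begin

lemma set_KD:
  assumes "\<forall>p<NN. M ''KD'' (int p) = (if 3 * n \<le> p \<and> p < 4 * n then 3 else 1)"
    and "\<And>i. i < n ==> f (5 * int n + int i) = int (rank i)"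
    and "\<And>z. z < 5 * int n \<or> 5 * int n + int n \<le> z ==> f z = M ''KD'' z"
  shows "\<forall>e<7. \<forall>j<n. f (int (e * n + j)) = dv e j" "f (7 * int n) = 1" "f (7 * int n + 1) = 1" "\<forall>p<NN. 0 < f (int p)"
proof -
  have a: "f (int p) = (if 5 * n \<le> p \<and> p < 6 * n then int (rank (p - 5 * n)) else if 3 * n \<le> p \<and> p < 4 * n then 3 else 1)" if p: "p < NN" for p
  proof (cases "5 * n \<le> p \<and> p < 6 * n")
    case True
    then have "int p = 5 * int n + int (p - 5 * n)" "p - 5 * n < n" by auto
    then show ?thesis using assms(2)[of "p - 5 * n"] True by simp
  next
    case False
    then show ?thesis using assms(3)[of "int p"] assms(1) p by auto
  qed
  show "\<forall>p<NN. 0 < f (int p)" using a rank_pos by simp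
  have p7: "7 * n < NN" "7 * n + 1 < NN" by (simp_all add: NN_def)
  show "f (7 * int n) = 1" "f (7 * int n + 1) = 1" using a[OF p7(1)] a[OF p7(2)] n0 by (simp_all add: add.commute)
  show "\<forall>e<7. \<forall>j<n. f (int (e * n + j)) = dv e j"
  proof (intro allI impI)
    fix e j assume e: "e < (7::nat)" and j: "j < n"
    have "e = 0 \<or> e = 1 \<or> e = 2 \<or> e = 3 \<or> e = 4 \<or> e = 5 \<or> e = 6" using e by arith
    then have "e * n + j < NN \<and> (5 * n \<le> e * n + j \<and> e * n + j < 6 * n \<longleftrightarrow> e = 5) \<and> (3 * n \<le> e * n + j \<and> e * n + j < 4 * n \<longleftrightarrow> e = 3)"
      using j by (elim disjE) (simp_all add: NN_def)
    then show "f (int (e * n + j)) = dv e j" using a[of "e * n + j"] by (auto simp: dv_def)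
  qed
qed

lemma set_KD3:
  assumes "\<forall>p<NN. M ''KD'' (int p) = 1" "\<And>i. i < n ==> f (3 * int n + int i) = 3"
    and "\<And>z. z < 3 * int n \<or> 3 * int n + int n \<le> z ==> f z = M ''KD'' z"
  shows "\<forall>p<NN. f (int p) = (if 3 * n \<le> p \<and> p < 4 * n then 3 else 1)"
proof (intro allI impI)
  fix p assume p: "p < NN"
  show "f (int p) = (if 3 * n \<le> p \<and> p < 4 * n then 3 else 1)"
  proof (cases "3 * n \<le> p \<and> p < 4 * n")
    case True
    then have "int p = 3 * int n + int (p - 3 * n)" "p - 3 * n < n" by auto
    then show ?thesis using assms(2)[of "p - 3 * n"] True by simp
  next
    case False
    then show ?thesis using assms(3)[of "int p"] assms(1) p by auto
  qed
qed

lemma KN_upd: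
  assumes "\<forall>e<7. \<forall>j<n. g (int (e * n + j)) = cv e j" "7 * int n \<le> z"
  shows "\<forall>e<7. \<forall>j<n. (g(z := v)) (int (e * n + j)) = cv e j"
proof (intro allI impI)
  fix e j assume e: "e < (7::nat)" and j: "j < n"
  have "e * n + j < Suc e * n" using j by simp
  also have "\<dots> \<le> 7 * n" using e by (intro mult_right_mono) auto
  finally have "int (e * n + j) \<noteq> z" using assms(2) by linarith
  then show "(g(z := v)) (int (e * n + j)) = cv e j" using assms(1) e j by simp
qed

lemma sort2:
  assumes M: "M ''N'' 0 = int NN" "\<forall>e<7. \<forall>j<n. M ''KN'' (int (e * n + j)) = cv e j" "M ''KN'' (7 * int n) = 0" "M ''KN'' (7 * int n + 1) = 8 * sI"
    "\<forall>e<7. \<forall>j<n. M ''KD'' (int (e * n + j)) = dv e j" "M ''KD'' (7 * int n) = 1" "M ''KD'' (7 * int n + 1) = 1" "\<forall>p<NN. 0 < M ''KD'' (int p)"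
  shows "ex sort_prog (U2 l) (\<lambda>M'. \<exists>F. keys F \<and> (\<forall>p<NN. M' ''KN'' (int p) = fst (F p)) \<and> (\<forall>p<NN. M' ''KD'' (int p) = snd (F p))) M"
proof (rule ex_conseq[OF sort_ok[of M NN l, OF M(1) l]])
  show "0 < M ''KD'' (int p)" if "p < NN" for p using M(8) that by simp
  show "l * (NN * 160 + 80) + 20 \<le> U2 l" by (simp add: U2_def NN_def)
  fix M' assume M': "pk M' ` {..<NN} = pk M ` {..<NN} \<and> (\<forall>p q. p \<le> q \<and> q < NN \<longrightarrow> vl (pk M' p) \<le> vl (pk M' q))"
  have "keys (pk M')"
  proof (rule keysI[OF n0, of "pk M"])
    show "pk M (e * n + j) = (cv e j, dv e j)" if "e < 7" "j < n" for e j using M(2,5) that unfolding pk_def by blast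
    show "pk M (7 * n) = (0, 1)" "pk M (7 * n + 1) = (8 * sI, 1)" using M(3,4,6,7) by (simp_all add: pk_def add.commute)
  qed (use M' in blast)+
  then show "\<exists>F. keys F \<and> (\<forall>p<NN. M' ''KN'' (int p) = fst (F p)) \<and> (\<forall>p<NN. M' ''KD'' (int p) = snd (F p))"
    by (intro exI[of _ "pk M'"]) (simp add: pk_def)
qed

lemma prep2_hs: "hs (U2 l) (env @ [(''KN'', \<lambda>f. \<forall>p<n. f (int p) = int (cl (js ! p)) * int n + int (js ! p)),
    (''sa'', \<lambda>f. f 0 = sI), (''rk'', \<lambda>f. \<forall>j<n. f (int j) = int (rank j))]) prep2 (\<lambda>M. \<exists>F. keys F \<and> st (env2 js F) M)"
  unfolding env_def prep2_def
  apply (simp only: hs_simps')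
  apply (rule hs_Cons[where x = "''od''" and Q = "\<lambda>f. \<forall>p<n. f (int p) = int (js ! p)"])
  subgoal premises pr for M
    apply (rule for_set[where N = "n" and off = "0" and ev = "\<lambda>p. int (js ! p)"])
    using pr c_le_n by (simp_all add: inc_def cl_less st_simps nth_js[OF js] U2_def)
  apply (simp only: hs_simps')
  apply (rule hs_Cons[where x = "''KN''" and Q = "\<lambda>f. \<forall>e'<Suc 0. \<forall>j<n. f (int (e' * n + j)) = cv e' j"])
  subgoal premises pr for M
    apply (rule cand_loop)
    using pr c_le_n by (simp_all add: inc_def cl_less st_simps cv_def Let_def)
  apply (simp only: hs_simps')
  apply (rule hs_Cons[where x = "''KN''" and Q = "\<lambda>f. \<forall>e'<Suc 1. \<forall>j<n. f (int (e' * n + j)) = cv e' j"])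
  subgoal premises pr for M
    apply (rule cand_loop)
    using pr c_le_n by (simp_all add: inc_def cl_less st_simps cv_def Let_def)
  apply (simp only: hs_simps')
  apply (rule hs_Cons[where x = "''KN''" and Q = "\<lambda>f. \<forall>e'<Suc 2. \<forall>j<n. f (int (e' * n + j)) = cv e' j"])
  subgoal premises pr for M
    apply (rule cand_loop)
    using pr c_le_n by (simp_all add: inc_def cl_less st_simps cv_def Let_def)
  apply (simp only: hs_simps')
  apply (rule hs_Cons[where x = "''KN''" and Q = "\<lambda>f. \<forall>e'<Suc 3. \<forall>j<n. f (int (e' * n + j)) = cv e' j"])
  subgoal premises pr for M
    apply (rule cand_loop)
    using pr c_le_n by (simp_all add: inc_def cl_less st_simps cv_def Let_def)
  apply (simp only: hs_simps')
  apply (rule hs_Cons[where x = "''KN''" and Q = "\<lambda>f. \<forall>e'<Suc 4. \<forall>j<n. f (int (e' * n + j)) = cv e' j"])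
  subgoal premises pr for M
    apply (rule cand_loop)
    using pr c_le_n by (simp_all add: inc_def cl_less st_simps cv_def Let_def)
  apply (simp only: hs_simps')
  apply (rule hs_Cons[where x = "''KN''" and Q = "\<lambda>f. \<forall>e'<Suc 5. \<forall>j<n. f (int (e' * n + j)) = cv e' j"])
  subgoal premises pr for M
    apply (rule cand_loop)
    using pr c_le_n by (simp_all add: inc_def cl_less st_simps cv_def Let_def)
  apply (simp only: hs_simps')
  apply (rule hs_Cons[where x = "''KN''" and Q = "\<lambda>f. \<forall>e'<Suc 6. \<forall>j<n. f (int (e' * n + j)) = cv e' j"])
  subgoal premises pr for M
    apply (rule cand_loop)
    using pr c_le_n by (simp_all add: inc_def cl_less st_simps cv_def Let_def)
  apply (simp only: hs_simps')
  apply (simp only: Suc_numeral Suc_1 numeral_eq_Suc[symmetric] semiring_norm)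
  apply (rule hs_Cons[where x = "''KN''" and Q = "\<lambda>f. (\<forall>e<7. \<forall>j<n. f (int (e * n + j)) = cv e j) \<and> f (7 * int n) = 0"])
  subgoal premises pr for M
    apply (rule cd_set)
    subgoal by simp
    subgoal by simp
    subgoal by (simp add: U2_def)
    subgoal using pr KN_upd[of "M ''KN''" "7 * int n" 0] by (simp add: st_simps)
    done
  apply (simp only: hs_simps')
  apply (rule hs_Cons[where x = "''KN''" and Q = "\<lambda>f. (\<forall>e<7. \<forall>j<n. f (int (e * n + j)) = cv e j) \<and> f (7 * int n) = 0 \<and> f (7 * int n + 1) = 8 * sI"])
  subgoal premises pr for M
    apply (rule cd_set)
    subgoal by simp
    subgoal by simp
    subgoal by (simp add: U2_def)
    subgoal using pr KN_upd[of "M ''KN''" "7 * int n + 1" "8 * sI"] by (simp add: st_simps)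
    done
  apply (simp only: hs_simps')
  apply (rule hs_Cons[where x = "''KD''" and Q = "\<lambda>f. \<forall>p<NN. f (int p) = 1"])
  subgoal premises pr for M
    apply (rule for_set[where N = "NN" and off = "0" and ev = "\<lambda>p. 1"])
    using pr c_le_n by (simp_all add: inc_def cl_less st_simps U2_def NN_def)
  apply (simp only: hs_simps')
  apply (rule hs_Cons[where x = "''KD''" and Q = "\<lambda>f. \<forall>p<NN. f (int p) = (if 3 * n \<le> p \<and> p < 4 * n then 3 else 1)"])
  subgoal premises pr for M
    apply (rule for_set[where N = "n" and off = "3 * int n" and ev = "\<lambda>p. 3"])
    apply (rule_tac [7] set_KD3[of M])
    using pr c_le_n by (simp_all add: st_simps U2_def)
  apply (simp only: hs_simps')
  apply (rule hs_Cons[where x = "''KD''" and Q = "\<lambda>f. (\<forall>e<7. \<forall>j<n. f (int (e * n + j)) = dv e j) \<and> f (7 * int n) = 1 \<and> f (7 * int n + 1) = 1 \<and> (\<forall>p<NN. 0 < f (int p))"])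
  subgoal premises pr for M
    apply (rule for_set[where N = "n" and off = "5 * int n" and ev = "\<lambda>p. int (rank p)"])
    subgoal by simp
    subgoal by simp
    subgoal by simp
    subgoal using pr by (simp add: st_simps)
    subgoal using pr by (simp add: st_simps)
    subgoal by (simp add: U2_def)
    subgoal for f using pr set_KD[of M f] by (simp add: st_simps)
    done
  apply (simp only: hs_simps')
  apply (rule hs_Cons[where x = "''N''" and Q = "\<lambda>f. f 0 = int NN"])
  subgoal premises pr for M
    apply (rule cd_set)
    using pr c_le_n by (simp_all add: inc_def cl_less st_simps U2_def NN_def)
  apply (simp only: hs_simps')
  apply (rule hs_ConsE[where x = "''KN''" and y = "''KD''" and W = keys and Q = "\<lambda>F f. \<forall>p<NN. f (int p) = fst (F p)" and Q' = "\<lambda>F f. \<forall>p<NN. f (int p) = snd (F p)"])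
  subgoal premises pr for M
    apply (rule sort2)
    using pr by (simp_all add: st_simps)
  apply (simp only: hs_simps')
  apply (rule hs_Nil)
  subgoal premises pr for F M
    apply (rule exI[of _ F])
    using pr by (simp add: st_simps env2_def env1_def env_def)
  done

end

definition init :: "(string \<times> ((int \<Rightarrow> int) \<Rightarrow> bool)) list" where
  "init = [(''m'', \<lambda>f. f 0 = int m), (''n'', \<lambda>f. f 0 = int n), (''c'', \<lambda>f. f 0 = int c),
     (''setup_times'', \<lambda>f. \<forall>i<c. f (int i) = si i), (''job_times'', \<lambda>f. \<forall>j<n. f (int j) = ti j),
     (''job_class'', \<lambda>f. \<forall>j<n. f (int j) = int (cl j)), (''P'', \<lambda>f. \<forall>z. f z = 0), (''sa'', \<lambda>f. \<forall>z. f z = 0), (''cn'', \<lambda>f. \<forall>z. f z = 0)]"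

lemma sort1:
  assumes n0: "0 < n" and l: "NN \<le> 2 ^ l" and M: "M ''N'' 0 = int n" "\<forall>j<n. M ''KN'' (int j) = int (cl j) * int n + int j" "\<forall>j<n. M ''KD'' (int j) = 1"
  shows "ex sort_prog (U2 l) (\<lambda>M'. \<exists>js. jobs_list js \<and> (\<forall>p<n. M' ''KN'' (int p) = int (cl (js ! p)) * int n + int (js ! p)) \<and> True) M"
proof -
  have nl: "n \<le> 2 ^ l" using l by (simp add: NN_def)
  show ?thesis
  proof (rule ex_conseq[OF sort_ok[of M n l, OF M(1) nl]])
    show "0 < M ''KD'' (int p)" if "p < n" for p using M(3) that by simp
    show "l * (n * 160 + 80) + 20 \<le> U2 l" by (simp add: U2_def algebra_simps)
    fix M' assume M': "pk M' ` {..<n} = pk M ` {..<n} \<and> (\<forall>p q. p \<le> q \<and> q < n \<longrightarrow> vl (pk M' p) \<le> vl (pk M' q))"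
    have d: "snd (pk M' p) = 1" if "p < n" for p
    proof -
      have "pk M' p \<in> pk M ` {..<n}" using M' that by blast
      then show ?thesis using M(3) by (auto simp: pk_def)
    qed
    have "(\<lambda>p. fst (pk M' p)) ` {..<n} = (\<lambda>p. fst (pk M p)) ` {..<n}" using M' by (metis image_image)
    also have "\<dots> = (\<lambda>j. int (cl j) * int n + int j) ` {..<n}" using M(2) by (intro image_cong) (auto simp: pk_def)
    finally have img: "(\<lambda>p. fst (pk M' p)) ` {..<n} = (\<lambda>j. int (cl j) * int n + int j) ` {..<n}" .
    have mono: "fst (pk M' p) \<le> fst (pk M' q)" if "p \<le> q" "q < n" for p q
    proof -
      have "vl (pk M' p) \<le> vl (pk M' q)" using M' that by blast
      then show ?thesis using d[of p] d[of q] that by (simp add: vl_def)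
    qed
    show "\<exists>js. jobs_list js \<and> (\<forall>p<n. M' ''KN'' (int p) = int (cl (js ! p)) * int n + int (js ! p)) \<and> True"
      using jobs_listI[OF n0 img mono] by (simp add: pk_def)
  qed
qed

lemma prep1_hs:
  assumes n0: "0 < n" and l: "NN \<le> 2 ^ l"
  shows "hs (U2 l) init (prep1 @ prep2) (\<lambda>M. \<exists>js F. jobs_list js \<and> keys F \<and> st (env2 js F) M)"
  unfolding init_def prep1_def
  apply (simp only: hs_simps')
  apply (rule hs_Cons[where x = "''P''" and Q = "\<lambda>f. \<forall>i<c. f (int i) = Pi i"])
  subgoal premises pr for M
    apply (rule for_acc[where N = "n" and ix = "\<lambda>j. int (cl j)" and ev = ti])
    using pr c_le_n by (simp_all add: inc_def cl_less st_simps U2_def Pi_def)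
  apply (simp only: hs_simps')
  apply (rule hs_Cons[where x = "''sa''" and Q = "\<lambda>f. f 0 = sI"])
  subgoal premises pr for M
    apply (rule for_acc[where N = "n" and ix = "\<lambda>j. 0" and ev = "\<lambda>j. si (cl j) + ti j"])
    using pr c_le_n by (simp_all add: inc_def cl_less st_simps U2_def sI_def)
  apply (simp only: hs_simps')
  apply (rule hs_Cons[where x = "''rk''" and Q = "\<lambda>f. \<forall>j<n. f (int j) = int (rank j)"])
  subgoal premises pr for M
    apply (rule rank_ok)
    using pr c_le_n by (simp_all add: inc_def cl_less st_simps)
  apply (simp only: hs_simps')
  apply (rule hs_Cons[where x = "''KN''" and Q = "\<lambda>f. \<forall>j<n. f (int j) = int (cl j) * int n + int j"])
  subgoal premises pr for M
    apply (rule for_set[where N = "n" and off = 0 and ev = "\<lambda>j. int (cl j) * int n + int j"])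
    using pr c_le_n by (simp_all add: inc_def cl_less st_simps U2_def)
  apply (simp only: hs_simps')
  apply (rule hs_Cons[where x = "''KD''" and Q = "\<lambda>f. \<forall>j<n. f (int j) = 1"])
  subgoal premises pr for M
    apply (rule for_set[where N = "n" and off = 0 and ev = "\<lambda>j. 1"])
    using pr c_le_n by (simp_all add: inc_def cl_less st_simps U2_def)
  apply (simp only: hs_simps')
  apply (rule hs_Cons[where x = "''N''" and Q = "\<lambda>f. f 0 = int n"])
  subgoal premises pr for M
    apply (rule cd_set)
    using pr c_le_n by (simp_all add: inc_def cl_less st_simps U2_def)
  apply (simp only: hs_simps')
  apply (rule hs_ConsE[where x = "''KN''" and y = "''KD''" and W = jobs_list and Q = "\<lambda>js f. \<forall>p<n. f (int p) = int (cl (js ! p)) * int n + int (js ! p)" and Q' = "\<lambda>F f. True"])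
  subgoal premises pr for M
    apply (rule sort1[OF n0 l])
    using pr by (simp_all add: st_simps)
  apply (simp only: hs_simps')
  subgoal premises pr for js
  proof (rule hs_weak)
    show "hs (U2 l) (env @ [(''KN'', \<lambda>f. \<forall>p<n. f (int p) = int (cl (js ! p)) * int n + int (js ! p)),
      (''sa'', \<lambda>f. f 0 = sI), (''rk'', \<lambda>f. \<forall>j<n. f (int j) = int (rank j))]) prep2 (\<lambda>M. \<exists>js F. jobs_list js \<and> keys F \<and> st (env2 js F) M)"
      using prep2_hs[OF pr n0 l] by (rule hs_post) (use pr in blast)
  qed (use pr in \<open>auto simp: st_simps env_def\<close>)
  done

end

section \<open>Binary search and the root of the test\<close>

abbreviation Aq :: "string \<Rightarrow> string \<Rightarrow> bexp" where
  "Aq a b \<equiv> Neg (Less (Add (Mul (V a) (V ''TD'')) (Mul (V b) (V ''TN''))) (Num 0))"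
definition acb :: bexp where
  "acb = Conj (Less (Num 0) (V ''o0'')) (Conj (Aq ''A0'' ''B0'') (Conj (Aq ''A1'' ''B1'') (Aq ''A2'' ''B2'')))"

definition get :: "string \<Rightarrow> string \<Rightarrow> string \<Rightarrow> com" where
  "get x y v = Seq (Set x (Read ''KN'' (V v))) (Set y (Read ''KD'' (V v)))"

definition set_mid :: com where
  "set_mid = (let e = Quot (Add (V ''lb'') (V ''ub'')) (Num 2) in
     Cond (Conj (Less (Num (-1)) e) (Less e (V ''N''))) (Set ''md'' e) Skip)"

definition sbody :: com where
  "sbody = Seq (Seq set_mid (get ''TN'' ''TD'' ''md''))
     (Seq (sq test) (Cond acb (Set ''ub'' (V ''md'')) (Set ''lb'' (V ''md''))))"

definition search :: com where
  "search = Seq (Seq (Set ''lb'' (Num 0)) (Set ''ub'' (Sub (V ''N'') (Num 1)))) (Loop (Less (Add (V ''lb'') (Num 1)) (V ''ub'')) sbody)"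

text \<open>Computes \<open>rt\<close> on fractions. The root \<open>- A / B\<close> is taken only
  when \<open>B\<close> is positive, so the new denominator is positive again.\<close>

definition root1 :: "string \<Rightarrow> string \<Rightarrow> com" where
  "root1 a b = Cond (Less (Add (Mul (V a) (V ''RD'')) (Mul (V b) (V ''RN''))) (Num 0))
     (Cond (Less (Num 0) (V b)) (Seq (Set ''RN'' (Sub (Num 0) (V a))) (Set ''RD'' (V b))) (get ''RN'' ''RD'' ''ub'')) Skip"

definition root :: com where
  "root = Seq (get ''RN'' ''RD'' ''lb'') (Seq (root1 ''A0'' ''B0'') (Seq (root1 ''A1'' ''B1'') (Seq (root1 ''A2'' ''B2'')
     (Cond (Conj (Less (Num 0) (V ''o0'')) (Less (Mul (V ''RN'') (Read ''KD'' (V ''ub''))) (Mul (Read ''KN'' (V ''ub'')) (V ''RD''))))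
       Skip (get ''RN'' ''RD'' ''ub'')))))"

definition find :: com where
  "find = Seq search (Seq (get ''TN'' ''TD'' ''lb'') (Seq (sq test) root))"

lemma st_frame: "st G M ==> (\<forall>y\<in>fst ` set G. M' y = M y) ==> st G M'"
  by (fastforce simp: st_def)

lemma wr_test: "wr (sq test) = {''i'', ''j'', ''bg'', ''sm'', ''SL'', ''SA'', ''SC'', ''SD'', ''SK'', ''nj'', ''ty'', ''al'',
   ''A0'', ''A1'', ''A2'', ''B0'', ''B1'', ''B2'', ''o0''}"
  by (rule subset_antisym; simp add: test_def wr_inc wr_classify)

lemma wr_sbody: "wr sbody = insert ''md'' (insert ''TN'' (insert ''TD'' (insert ''lb'' (insert ''ub'' (wr (sq test))))))"
  unfolding sbody_def set_mid_def get_def Let_def by (simp only: wr.simps) blast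

lemma frac_sum: "0 < d ==> a * d + b * k < 0 \<longleftrightarrow> real_of_int a + real_of_int b * (real_of_int k / real_of_int d) < 0"
  for a b k d :: int
proof -
  assume d: "0 < d"
  have "a * d + b * k < 0 \<longleftrightarrow> real_of_int (a * d + b * k) < 0" by (simp only: of_int_less_0_iff)
  also have "\<dots> \<longleftrightarrow> real_of_int a + real_of_int b * (real_of_int k / real_of_int d) < 0"
    using d by (simp add: field_simps)
  finally show ?thesis .
qed

context inst
begin

lemma acb_ok:
  assumes T: "tested (vl (k, d)) M" and M: "M ''TN'' 0 = k" "M ''TD'' 0 = d" "0 < d"
  shows "bval acb M \<longleftrightarrow> acc (vl (k, d))"
proof (cases "ok0 (vl (k, d))")
  case True
  have q: "(\<forall>q<3. P q) \<longleftrightarrow> P 0 \<and> P 1 \<and> P 2" for P :: "nat \<Rightarrow> bool"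
    by (auto simp: numeral_3_eq_3 numeral_2_eq_2 less_Suc_eq)
  have F: "real_of_int (M ''A0'' 0) = FA 0 (vl (k, d))" "real_of_int (M ''A1'' 0) = FA 1 (vl (k, d))" "real_of_int (M ''A2'' 0) = FA 2 (vl (k, d))"
    "real_of_int (M ''B0'' 0) = FB 0 (vl (k, d))" "real_of_int (M ''B1'' 0) = FB 1 (vl (k, d))" "real_of_int (M ''B2'' 0) = FB 2 (vl (k, d))"
    "M ''o0'' 0 = 1" using T True unfolding tested_def by simp_all
  have v: "vl (k, d) = real_of_int k / real_of_int d" by (simp add: vl_def)
  have f: "M a 0 * d + M b 0 * k < 0 \<longleftrightarrow> real_of_int (M a 0) + real_of_int (M b 0) * vl (k, d) < 0" for a b
    unfolding v by (rule frac_sum[OF M(3)])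
  have "bval acb M \<longleftrightarrow> \<not> FA 0 (vl (k, d)) + FB 0 (vl (k, d)) * vl (k, d) < 0 \<and> \<not> FA 1 (vl (k, d)) + FB 1 (vl (k, d)) * vl (k, d) < 0 \<and>
    \<not> FA 2 (vl (k, d)) + FB 2 (vl (k, d)) * vl (k, d) < 0"
    unfolding acb_def bval.simps aval.simps M(1,2) f F by simp
  then show ?thesis unfolding acc_def q using True by (simp add: not_less)
next
  case False
  then show ?thesis using T by (simp add: acb_def acc_def tested_def)
qed

lemma test_ok:
  assumes "st env M" "M ''TN'' 0 = k" "M ''TD'' 0 = d" "0 < d"
  shows "ex (sq test) (25 * U + 1) (tested (vl (k, d))) M"
proof -
  have v: "vl (k, d) = real_of_int k / real_of_int d" by (simp add: vl_def)
  have "st (env @ [(''TN'', \<lambda>f. f 0 = k), (''TD'', \<lambda>f. f 0 = d)]) M" using assms by (auto simp: st_def)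
  moreover have "length test = 25" by (simp add: test_def)
  ultimately show ?thesis using test_hs[OF v assms(4)] by (simp add: hs_def)
qed

lemma fst_env: "fst ` set env = {''m'', ''n'', ''c'', ''setup_times'', ''job_times'', ''job_class'', ''P''}"
  "fst ` set (env2 js F) = {''m'', ''n'', ''c'', ''setup_times'', ''job_times'', ''job_class'', ''P'', ''od'', ''N'', ''KN'', ''KD''}"
  by (auto simp: env_def env2_def env1_def)

lemma env2_env: "st (env2 js F) M ==> st env M" by (auto simp: env2_def env1_def st_def)

lemma env2_frame: "st (env2 js F) M ==> (\<And>y. y \<notin> wr sbody ==> M' y = M y) ==> st (env2 js F) M'"
  by (rule st_frame, assumption) (simp add: fst_env wr_sbody wr_test)

lemma env2D: assumes "st (env2 js F) M" shows "M ''N'' 0 = int NN" "p < NN ==> M ''KN'' (int p) = fst (F p)" "p < NN ==> M ''KD'' (int p) = snd (F p)"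
  using assms by (auto simp: env2_def st_def)

text \<open>The invariant asks for a rejected lower and an accepted upper end only, which every
  outcome at the midpoint restores; the bound \<open>2 ^ k\<close> on their distance limits the
  number of rounds.\<close>

lemma find_search:
  assumes n: "0 < n" and l: "NN \<le> 2 ^ l" and F: "keys F" and M: "st (env2 js F) M"
  shows "ex search (l * (25 * U + 200) + 50) (\<lambda>M'. \<exists>lo. M' ''lb'' 0 = int lo \<and> M' ''ub'' 0 = int (Suc lo) \<and> Suc lo < NN \<and>
     \<not> acc (vl (F lo)) \<and> acc (vl (F (Suc lo)))) M"
proof -
  define Inv where "Inv k M' \<longleftrightarrow> (\<exists>lo hi. M' ''lb'' 0 = int lo \<and> M' ''ub'' 0 = int hi \<and> lo < hi \<and> hi < NN \<and> hi \<le> lo + 2 ^ k \<and>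
     \<not> acc (vl (F lo)) \<and> acc (vl (F hi)))" for k and M' :: memory
  let ?b = "Less (Add (V ''lb'') (Num 1)) (V ''ub'')"
  let ?s = "Seq (Set ''lb'' (Num 0)) (Set ''ub'' (Sub (V ''N'') (Num 1)))"
  let ?M1 = "run ?s M"
  have fr1: "y \<notin> {''lb'', ''ub''} ==> ?M1 y = M y" for y by simp
  have M1: "st (env2 js F) ?M1" by (rule env2_frame[OF M]) (rule fr1, auto simp: wr_sbody)
  have i1: "ex ?s 10 (\<lambda>M'. M' = ?M1) M" by (rule ex_lf) simp_all
  have start: "Inv l ?M1"
    unfolding Inv_def using F env2D[OF M] l n by (intro exI[of _ 0] exI[of _ "NN - 1"]) (auto simp: keys_def NN_def)
  have 2: "ex (Loop ?b sbody) (l * ((25 * U + 150) + bcost ?b + 1) + bcost ?b + 1) (\<lambda>M'. (\<exists>k. Inv k M') \<and> \<not> bval ?b M') ?M1"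
  proof (rule ex_loop[where Inv = Inv, OF start])
    fix k M' assume I: "Inv k M'" and fr: "\<And>x. x \<notin> wr sbody ==> M' x = ?M1 x" and b: "bval ?b M'"
    from I obtain lo hi where I: "M' ''lb'' 0 = int lo" "M' ''ub'' 0 = int hi" "lo < hi" "hi < NN" "hi \<le> lo + 2 ^ k"
      "\<not> acc (vl (F lo))" "acc (vl (F hi))" unfolding Inv_def by blast
    have b': "lo + 1 < hi" using b I(1,2) by simp
    then have k: "0 < k" using I(5) by (cases k) auto
    have k2: "(2::nat) ^ k = 2 * 2 ^ (k - 1)" using k by (cases k) auto
    define md where "md = (lo + hi) div 2"
    have md: "lo < md" "md < hi" "md \<le> lo + 2 ^ (k - 1)" "hi \<le> md + 2 ^ (k - 1)" "md < NN"
      using b' I(4,5) unfolding md_def k2 by linarith+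
    have M': "st (env2 js F) M'" by (rule env2_frame[OF M1 fr])
    note D = env2D[OF M'] and D2 = env2D(2,3)[OF M' md(5)]
    let ?p = "Seq set_mid (get ''TN'' ''TD'' ''md'')"
    have im: "(int lo + int hi) div 2 = int md" by (simp add: md_def)
    have mdl: "- 1 < int md" "int md < int NN" using md(5) by simp_all
    have r: "run ?p M' ''TN'' 0 = fst (F md)" "run ?p M' ''TD'' 0 = snd (F md)" "run ?p M' ''md'' 0 = int md"
      unfolding set_mid_def get_def Let_def using D2 by (simp_all add: I(1,2) D(1) im mdl md(5))
    have p: "ex ?p 60 (\<lambda>M''. M'' ''TN'' 0 = fst (F md) \<and> M'' ''TD'' 0 = snd (F md) \<and> M'' ''md'' 0 = int md) M'"
      by (rule ex_lf) (use r in \<open>simp_all add: set_mid_def get_def Let_def\<close>)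
    have wp: "wr ?p = {''md'', ''TN'', ''TD''}" by (auto simp: set_mid_def get_def Let_def)
    have "ex sbody (60 + ((25 * U + 1) + 89)) (Inv (k - 1)) M'"
      unfolding sbody_def
    proof (rule ex_seq[OF p])
      fix M2 assume m2: "M2 ''TN'' 0 = fst (F md) \<and> M2 ''TD'' 0 = snd (F md) \<and> M2 ''md'' 0 = int md"
        and fr2: "\<And>x. x \<notin> wr ?p ==> M2 x = M' x"
      note fr2 = fr2[unfolded wp]
      have M2: "st (env2 js F) M2" by (rule env2_frame[OF M']) (rule fr2, auto simp: wr_sbody)
      have d: "0 < snd (F md)" using F md(5) by (simp add: keys_def)
      have lu2: "M2 ''lb'' 0 = int lo" "M2 ''ub'' 0 = int hi" using fr2[of "''lb''"] fr2[of "''ub''"] I(1,2) by simp_all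
      have t: "ex (sq test) (25 * U + 1) (tested (vl (fst (F md), snd (F md)))) M2"
        by (rule test_ok[OF env2_env[OF M2]]) (use m2 d in auto)
      show "ex (Seq (sq test) (Cond acb (Set ''ub'' (V ''md'')) (Set ''lb'' (V ''md'')))) ((25 * U + 1) + 89) (Inv (k - 1)) M2"
      proof (rule ex_seq[OF t])
        fix M3 assume m3: "tested (vl (fst (F md), snd (F md))) M3" and fr3: "\<And>x. x \<notin> wr (sq test) ==> M3 x = M2 x"
        have e3: "M3 ''TN'' 0 = fst (F md)" "M3 ''TD'' 0 = snd (F md)" "M3 ''md'' 0 = int md" "M3 ''lb'' 0 = int lo" "M3 ''ub'' 0 = int hi"
          using fr3[of "''TN''"] fr3[of "''TD''"] fr3[of "''md''"] fr3[of "''lb''"] fr3[of "''ub''"] m2 lu2 by (simp_all add: wr_test)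
        have ac: "bval acb M3 \<longleftrightarrow> acc (vl (F md))" using acb_ok[OF m3 e3(1,2) d] by simp
        have "bcost acb + 10 \<le> 89" by (simp add: acb_def)
        moreover have "Inv (k - 1) (run (Cond acb (Set ''ub'' (V ''md'')) (Set ''lb'' (V ''md''))) M3)"
        proof (cases "acc (vl (F md))")
          case True
          then show ?thesis unfolding Inv_def using ac e3 md I by (intro exI[of _ lo] exI[of _ md]) simp
        next
          case False
          then show ?thesis unfolding Inv_def using ac e3 md I by (intro exI[of _ md] exI[of _ hi]) simp
        qed
        ultimately show "ex (Cond acb (Set ''ub'' (V ''md'')) (Set ''lb'' (V ''md''))) 89 (Inv (k - 1)) M3"
          by (intro ex_lf) simp_all
      qed
    qed
    then show "0 < k \<and> ex sbody (25 * U + 150) (Inv (k - 1)) M'" using k by (simp add: add.commute)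
  qed
  have "ex search (10 + (l * ((25 * U + 150) + bcost ?b + 1) + bcost ?b + 1)) (\<lambda>M'. (\<exists>k. Inv k M') \<and> \<not> bval ?b M') M"
    unfolding search_def by (rule ex_seq[OF i1]) (use 2 in simp)
  then show ?thesis
  proof (rule ex_conseq)
    show "10 + (l * ((25 * U + 150) + bcost ?b + 1) + bcost ?b + 1) \<le> l * (25 * U + 200) + 50" by (simp add: algebra_simps)
    fix M' assume "(\<exists>k. Inv k M') \<and> \<not> bval ?b M'"
    then obtain lo hi where I: "M' ''lb'' 0 = int lo" "M' ''ub'' 0 = int hi" "lo < hi" "hi < NN"
      "\<not> acc (vl (F lo))" "acc (vl (F hi))" "\<not> bval ?b M'" unfolding Inv_def by blast
    then have "hi = Suc lo" by simp
    then show "\<exists>lo. M' ''lb'' 0 = int lo \<and> M' ''ub'' 0 = int (Suc lo) \<and> Suc lo < NN \<and> \<not> acc (vl (F lo)) \<and> acc (vl (F (Suc lo)))"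
      using I by blast
  qed
qed

lemma root1_ok:
  assumes M: "real_of_int (M a 0) = FA q lo" "real_of_int (M b 0) = FB q lo" "M ''RN'' 0 = k" "M ''RD'' 0 = d" "0 < d"
    "M ''ub'' 0 = u" "M ''KN'' u = kh" "M ''KD'' u = dh" "0 < dh" and ab: "a \<notin> {''RN'', ''RD''}" "b \<notin> {''RN'', ''RD''}"
  shows "\<exists>k' d'. run (root1 a b) M ''RN'' 0 = k' \<and> run (root1 a b) M ''RD'' 0 = d' \<and> 0 < d' \<and> vl (k', d') = rt lo (vl (kh, dh)) q (vl (k, d))"
proof -
  have c1: "M a 0 * d + M b 0 * k < 0 \<longleftrightarrow> FA q lo + FB q lo * vl (k, d) < 0"
    unfolding frac_sum[OF M(5)] M(1,2) by (simp add: vl_def)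
  have c2: "0 < M b 0 \<longleftrightarrow> 0 < FB q lo" unfolding M(2)[symmetric] by simp
  have v: "vl (- M a 0, M b 0) = - FA q lo / FB q lo" by (simp add: vl_def M(1,2))
  show ?thesis
  proof (cases "FA q lo + FB q lo * vl (k, d) < 0")
    case False
    then show ?thesis unfolding root1_def rt_def using M c1 by simp
  next
    case True
    then show ?thesis
    proof (cases "0 < FB q lo")
      case True
      have "run (root1 a b) M ''RN'' 0 = - M a 0" "run (root1 a b) M ''RD'' 0 = M b 0"
        unfolding root1_def using \<open>FA q lo + FB q lo * vl (k, d) < 0\<close> True M c1 c2 ab by simp_all
      then show ?thesis using \<open>FA q lo + FB q lo * vl (k, d) < 0\<close> True c2 v by (simp add: rt_def)
    next
      case False
      have "run (root1 a b) M ''RN'' 0 = kh" "run (root1 a b) M ''RD'' 0 = dh"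
        unfolding root1_def get_def using \<open>FA q lo + FB q lo * vl (k, d) < 0\<close> False M c1 c2 by simp_all
      then show ?thesis using \<open>FA q lo + FB q lo * vl (k, d) < 0\<close> False M(9) by (simp add: rt_def)
    qed
  qed
qed

lemma wr_root1: "wr (root1 a b) = {''RN'', ''RD''}" by (auto simp: root1_def get_def)

lemma root_ok:
  assumes T: "tested lo M" and lo: "lo = vl (k, d)" "0 < d" and hi: "hi = vl (kh, dh)" "0 < dh"
    and M: "M ''lb'' 0 = b" "M ''KN'' b = k" "M ''KD'' b = d" "M ''ub'' 0 = u" "M ''KN'' u = kh" "M ''KD'' u = dh"
  shows "ex root 400 (\<lambda>M'. 0 < M' ''RD'' 0 \<and> vl (M' ''RN'' 0, M' ''RD'' 0) = Tst lo hi) M"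
proof -
  define M0 where "M0 = run (get ''RN'' ''RD'' ''lb'') M"
  define M1 where "M1 = run (root1 ''A0'' ''B0'') M0"
  define M2 where "M2 = run (root1 ''A1'' ''B1'') M1"
  define M3 where "M3 = run (root1 ''A2'' ''B2'') M2"
  define fin where "fin = (Cond (Conj (Less (Num 0) (V ''o0'')) (Less (Mul (V ''RN'') (Read ''KD'' (V ''ub''))) (Mul (Read ''KN'' (V ''ub'')) (V ''RD''))))
       Skip (get ''RN'' ''RD'' ''ub''))"
  have rr: "run root M = run fin M3" unfolding root_def fin_def M3_def M2_def M1_def M0_def run.simps ..
  have f0: "y \<noteq> ''RN'' ==> y \<noteq> ''RD'' ==> M0 y = M y" for y unfolding M0_def get_def by simp
  have f1: "y \<noteq> ''RN'' ==> y \<noteq> ''RD'' ==> M1 y = M y" for y unfolding M1_def using run_frame[of y "root1 ''A0'' ''B0''" M0] f0 by (simp add: wr_root1)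
  have f2: "y \<noteq> ''RN'' ==> y \<noteq> ''RD'' ==> M2 y = M y" for y unfolding M2_def using run_frame[of y "root1 ''A1'' ''B1''" M1] f1 by (simp add: wr_root1)
  have f3: "y \<noteq> ''RN'' ==> y \<noteq> ''RD'' ==> M3 y = M y" for y unfolding M3_def using run_frame[of y "root1 ''A2'' ''B2''" M2] f2 by (simp add: wr_root1)
  have "0 < (run fin M3) ''RD'' 0 \<and> vl ((run fin M3) ''RN'' 0, (run fin M3) ''RD'' 0) = Tst lo hi"
  proof (cases "ok0 lo")
    case False
    then have "M3 ''o0'' 0 = 0" using T f3[of "''o0''"] by (simp add: tested_def)
    then have "run fin M3 ''RN'' 0 = kh" "run fin M3 ''RD'' 0 = dh" unfolding fin_def get_def using M f3 by simp_all
    then show ?thesis using False hi by (simp add: Tst_def Let_def)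
  next
    case True
    have F: "real_of_int (M ''A0'' 0) = FA 0 lo" "real_of_int (M ''A1'' 0) = FA 1 lo" "real_of_int (M ''A2'' 0) = FA 2 lo"
      "real_of_int (M ''B0'' 0) = FB 0 lo" "real_of_int (M ''B1'' 0) = FB 1 lo" "real_of_int (M ''B2'' 0) = FB 2 lo"
      and o: "M ''o0'' 0 = 1" using T True unfolding tested_def by simp_all
    have m0: "M0 ''RN'' 0 = k" "M0 ''RD'' 0 = d" unfolding M0_def get_def using M by simp_all
    obtain k1 d1 where m1: "M1 ''RN'' 0 = k1" "M1 ''RD'' 0 = d1" "0 < d1" "vl (k1, d1) = rt lo hi 0 lo"
      using root1_ok[of M0 "''A0''" 0 lo "''B0''" k d u kh dh] F m0 lo hi M f0 unfolding M1_def by auto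
    obtain k2 d2 where m2: "M2 ''RN'' 0 = k2" "M2 ''RD'' 0 = d2" "0 < d2" "vl (k2, d2) = rt lo hi 1 (rt lo hi 0 lo)"
      using root1_ok[of M1 "''A1''" 1 lo "''B1''" k1 d1 u kh dh] F m1 lo hi M f1 unfolding M2_def by auto
    obtain k3 d3 where m3: "M3 ''RN'' 0 = k3" "M3 ''RD'' 0 = d3" "0 < d3" "vl (k3, d3) = rt lo hi 2 (rt lo hi 1 (rt lo hi 0 lo))"
      using root1_ok[of M2 "''A2''" 2 lo "''B2''" k2 d2 u kh dh] F m2 lo hi M f2 unfolding M3_def by auto
    have cmp: "k3 * dh < kh * d3 \<longleftrightarrow> vl (k3, d3) < hi" using vl_less[of "(k3, d3)" "(kh, dh)"] m3(3) hi by simp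
    have m3': "M3 ''o0'' 0 = 1" "M3 ''ub'' 0 = u" "M3 ''KN'' u = kh" "M3 ''KD'' u = dh" using f3 M o by simp_all
    show ?thesis
    proof (cases "vl (k3, d3) < hi")
      case T1: True
      have "run fin M3 = M3" unfolding fin_def using m3 m3' cmp T1 by simp
      then show ?thesis using True T1 m3 by (simp add: Tst_def Let_def)
    next
      case F1: False
      have "run fin M3 ''RN'' 0 = kh" "run fin M3 ''RD'' 0 = dh" unfolding fin_def get_def using m3 m3' cmp F1 by simp_all
      then show ?thesis using F1 m3(4) hi by (simp add: Tst_def Let_def)
    qed
  qed
  then show ?thesis unfolding rr[symmetric] by (intro ex_lf) (simp_all add: root_def root1_def get_def)
qed

text \<open>The hypotheses that \<open>approx\<close> places on the two ends, with the ends
  themselves forgotten.\<close>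

definition good :: "real \<Rightarrow> bool" where
  "good T \<longleftrightarrow> (\<exists>lo hi. lo < hi \<and> \<not> acc lo \<and> acc hi \<and> (\<forall>b\<in>BP. \<not> (lo < b \<and> b < hi)) \<and> T = Tst lo hi)"

lemma find_ok:
  assumes n: "0 < n" and l: "NN \<le> 2 ^ l" and F: "keys F" and M: "st (env2 js F) M"
  shows "ex find (l * (25 * U + 200) + 25 * U + 500) (\<lambda>M'. st (env1 js) M' \<and> 0 < M' ''RD'' 0 \<and> good (vl (M' ''RN'' 0, M' ''RD'' 0))) M"
proof -
  have "ex find ((l * (25 * U + 200) + 50) + (10 + ((25 * U + 1) + 400))) (\<lambda>M'. 0 < M' ''RD'' 0 \<and> good (vl (M' ''RN'' 0, M' ''RD'' 0))) M"
    unfolding find_def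
  proof (rule ex_seq[OF find_search[OF n l F M]], elim exE conjE)
    fix M1 lo assume m1: "M1 ''lb'' 0 = int lo" "M1 ''ub'' 0 = int (Suc lo)" "Suc lo < NN" "\<not> acc (vl (F lo))" "acc (vl (F (Suc lo)))"
      and fr1: "\<And>x. x \<notin> wr search ==> M1 x = M x"
    have ws: "wr search = wr sbody" by (auto simp: search_def wr_sbody)
    have M1: "st (env2 js F) M1" by (rule env2_frame[OF M]) (rule fr1, simp add: ws)
    have lo: "lo < NN" using m1(3) by simp
    have d: "0 < snd (F lo)" "0 < snd (F (Suc lo))" using F lo m1(3) by (simp_all add: keys_def)
    note D = env2D(2,3)[OF M1 lo] env2D(2,3)[OF M1 m1(3)]
    have g: "ex (get ''TN'' ''TD'' ''lb'') 10 (\<lambda>M'. M' ''TN'' 0 = fst (F lo) \<and> M' ''TD'' 0 = snd (F lo)) M1"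
      by (rule ex_lf) (use D m1(1) in \<open>simp_all add: get_def\<close>)
    show "ex (Seq (get ''TN'' ''TD'' ''lb'') (Seq (sq test) root)) (10 + ((25 * U + 1) + 400)) (\<lambda>M'. 0 < M' ''RD'' 0 \<and> good (vl (M' ''RN'' 0, M' ''RD'' 0))) M1"
    proof (rule ex_seq[OF g], elim conjE)
      fix M2 assume m2: "M2 ''TN'' 0 = fst (F lo)" "M2 ''TD'' 0 = snd (F lo)" and fr2: "\<And>x. x \<notin> wr (get ''TN'' ''TD'' ''lb'') ==> M2 x = M1 x"
      have M2: "st (env2 js F) M2" by (rule env2_frame[OF M1]) (rule fr2, auto simp: wr_sbody get_def)
      have lb2: "M2 ''lb'' 0 = int lo" "M2 ''ub'' 0 = int (Suc lo)" using fr2[of "''lb''"] fr2[of "''ub''"] m1 by (simp_all add: get_def)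
      have t: "ex (sq test) (25 * U + 1) (tested (vl (fst (F lo), snd (F lo)))) M2"
        by (rule test_ok[OF env2_env[OF M2] m2 d(1)])
      show "ex (Seq (sq test) root) ((25 * U + 1) + 400) (\<lambda>M'. 0 < M' ''RD'' 0 \<and> good (vl (M' ''RN'' 0, M' ''RD'' 0))) M2"
      proof (rule ex_seq[OF t])
        fix M3 assume m3: "tested (vl (fst (F lo), snd (F lo))) M3" and fr3: "\<And>x. x \<notin> wr (sq test) ==> M3 x = M2 x"
        have M3: "st (env2 js F) M3" by (rule env2_frame[OF M2]) (rule fr3, auto simp: wr_sbody)
        have lb3: "M3 ''lb'' 0 = int lo" "M3 ''ub'' 0 = int (Suc lo)" using fr3[of "''lb''"] fr3[of "''ub''"] lb2 by (simp_all add: wr_test)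
        have v: "vl (F lo) = vl (fst (F lo), snd (F lo))" "vl (F (Suc lo)) = vl (fst (F (Suc lo)), snd (F (Suc lo)))" by simp_all
        have rt: "ex root 400 (\<lambda>M'. 0 < M' ''RD'' 0 \<and> vl (M' ''RN'' 0, M' ''RD'' 0) = Tst (vl (F lo)) (vl (F (Suc lo)))) M3"
          by (rule root_ok[of "vl (F lo)" M3 "fst (F lo)" "snd (F lo)" "vl (F (Suc lo))" "fst (F (Suc lo))" "snd (F (Suc lo))" "int lo" "int (Suc lo)"])
            (use m3 d lb3 env2D(2,3)[OF M3 lo] env2D(2,3)[OF M3 m1(3)] in simp_all)
        have le: "vl (F lo) \<le> vl (F (Suc lo))" using conjunct1[OF conjunct2[OF F[unfolded keys_def]], rule_format, of lo "Suc lo"] m1(3) by simp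
        have bp: "\<not> (vl (F lo) < b \<and> b < vl (F (Suc lo)))" if bb: "b \<in> BP" for b
        proof -
          obtain p where p: "p < NN" "vl (F p) = b"
            using bspec[OF conjunct1[OF conjunct2[OF conjunct2[OF F[unfolded keys_def]]]] bb] by auto
          have so: "p \<le> q ==> q < NN ==> vl (F p) \<le> vl (F q)" for p q
            using conjunct1[OF conjunct2[OF F[unfolded keys_def]], rule_format, of p q] by simp
          show ?thesis
          proof (cases "p \<le> lo")
            case True
            then show ?thesis using so[OF True lo] p by simp
          next
            case False
            then show ?thesis using so[of "Suc lo" p] p by simp
          qed
        qed
        \<comment> \<open>One value is rejected and the other accepted, so sorted neighbours must
          differ strictly.\<close>
        have "vl (F lo) \<noteq> vl (F (Suc lo))" using m1(4,5) by metis
        then have lt: "vl (F lo) < vl (F (Suc lo))" using le by simp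
        have "good (Tst (vl (F lo)) (vl (F (Suc lo))))"
          unfolding good_def by (rule exI[of _ "vl (F lo)"], rule exI[of _ "vl (F (Suc lo))"])
            (intro conjI ballI lt m1(4,5) bp refl)
        then show "ex root 400 (\<lambda>M'. 0 < M' ''RD'' 0 \<and> good (vl (M' ''RN'' 0, M' ''RD'' 0))) M3"
          by (intro ex_conseq[OF rt]) auto
      qed
    qed
  qed
  then show ?thesis
  proof (rule ex_conseq)
    fix M' assume g: "0 < M' ''RD'' 0 \<and> good (vl (M' ''RN'' 0, M' ''RD'' 0))" and fr: "\<And>x. x \<notin> wr find ==> M' x = M x"
    have w: "wr find = insert ''RN'' (insert ''RD'' (wr sbody))" by (auto simp: find_def search_def wr_sbody root_def wr_root1 get_def)
    have "st (env1 js) M" using M by (auto simp: env2_def st_def)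
    then have "st (env1 js) M'" by (rule st_frame) (use fr in \<open>auto simp: w wr_sbody wr_test env1_def env_def\<close>)
    then show "st (env1 js) M' \<and> 0 < M' ''RD'' 0 \<and> good (vl (M' ''RN'' 0, M' ''RD'' 0))" using g by blast
  qed simp
qed

end

section \<open>Writing the schedule\<close>

fun rds :: "aexp \<Rightarrow> string set" where
  "rds (Num k) = {}"
| "rds (Read x a) = insert x (rds a)"
| "rds (Add a b) = rds a \<union> rds b"
| "rds (Sub a b) = rds a \<union> rds b"
| "rds (Mul a b) = rds a \<union> rds b"
| "rds (Quot a b) = rds a \<union> rds b"

lemma aval_upd: "x \<notin> rds e ==> aval e (M(x := h)) = aval e M"
  by (induction e) auto

definition OUT :: "string set" where
  "OUT = {''out_kind'', ''out_index'', ''out_machine'', ''out_start_num'', ''out_start_den'', ''out_finish_num'', ''out_finish_den'', ''out_length''}"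

text \<open>All times share the denominator \<open>la\<close>. The conditional on \<open>k\<close>
  imitates \<open>nat\<close> in \<open>mk\<close>, so correctness does not depend on the sign of
  the machine number.\<close>

definition emit :: "int \<Rightarrow> aexp \<Rightarrow> aexp \<Rightarrow> aexp \<Rightarrow> aexp \<Rightarrow> com" where
  "emit kd ix k f g = Seq (Write ''out_kind'' (V ''out_length'') (Num kd)) (Seq (Write ''out_index'' (V ''out_length'') ix)
     (Seq (Cond (Less k (Num 0)) (Write ''out_machine'' (V ''out_length'') (Num 0)) (Write ''out_machine'' (V ''out_length'') k))
     (Seq (Write ''out_start_num'' (V ''out_length'') f) (Seq (Write ''out_start_den'' (V ''out_length'') (V ''la''))
     (Seq (Write ''out_finish_num'' (V ''out_length'') g) (Seq (Write ''out_finish_den'' (V ''out_length'') (V ''la''))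
       (Set ''out_length'' (Add (V ''out_length'') (Num 1)))))))))"

lemma wr_emit: "wr (emit kd ix k f g) = OUT" by (auto simp: emit_def OUT_def)
lemma lf_emit: "lf (emit kd ix k f g)" by (simp add: emit_def)
lemma emit_frame: "y \<notin> OUT ==> run (emit kd ix k f g) M y = M y" by (rule run_frame) (simp add: wr_emit)

lemma outputs_cong:
  assumes "\<And>y. y \<in> OUT ==> M' y = M y"
  shows "outputs M' S = outputs M S"
proof -
  have e: "M' ''out_kind'' = M ''out_kind''" "M' ''out_index'' = M ''out_index''" "M' ''out_machine'' = M ''out_machine''"
    "M' ''out_start_num'' = M ''out_start_num''" "M' ''out_start_den'' = M ''out_start_den''" "M' ''out_finish_num'' = M ''out_finish_num''"
    "M' ''out_finish_den'' = M ''out_finish_den''" "M' ''out_length'' = M ''out_length''"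
    by (rule assms, simp add: OUT_def)+
  show ?thesis by (simp only: outputs_def output_item_def output_time_def e)
qed

lemma outputs_upd: "y \<notin> OUT ==> outputs (M(y := h)) S = outputs M S"
  by (rule outputs_cong) auto

lemma emit_ok:
  assumes o: "outputs M S" and la: "M ''la'' 0 = la" "0 < la"
    and r: "rds ix \<inter> OUT = {}" "rds k \<inter> OUT = {}" "rds f \<inter> OUT = {}" "rds g \<inter> OUT = {}"
    and v: "real_of_int (aval f M) = real_of_int la * a" "real_of_int (aval g M) = real_of_int la * b" "aval k M = kk"
    and it: "(it = Setup i \<and> kd = 0) \<or> (it = Piece i \<and> kd = 1)" "aval ix M = int i"
  shows "outputs (run (emit kd ix k f g) M) (S @ [mk it kk a b])"
proof -
  define R where "R = run (emit kd ix k f g) M"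
  let ?l = "int (length S)"
  have nr: "y \<in> OUT ==> y \<notin> rds ix" "y \<in> OUT ==> y \<notin> rds k" "y \<in> OUT ==> y \<notin> rds f" "y \<in> OUT ==> y \<notin> rds g" for y
    using r by auto
  have O: "''out_kind'' \<in> OUT" "''out_index'' \<in> OUT" "''out_machine'' \<in> OUT" "''out_start_num'' \<in> OUT"
    "''out_start_den'' \<in> OUT" "''out_finish_num'' \<in> OUT" "''out_finish_den'' \<in> OUT" by (simp_all add: OUT_def)
  have ln: "M ''out_length'' 0 = ?l" using o by (simp add: outputs_def)
  have A: "R ''out_kind'' = (M ''out_kind'')(?l := kd)" "R ''out_index'' = (M ''out_index'')(?l := int i)"
    "R ''out_machine'' = (M ''out_machine'')(?l := int (nat kk))" "R ''out_start_num'' = (M ''out_start_num'')(?l := aval f M)"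
    "R ''out_start_den'' = (M ''out_start_den'')(?l := la)" "R ''out_finish_num'' = (M ''out_finish_num'')(?l := aval g M)"
    "R ''out_finish_den'' = (M ''out_finish_den'')(?l := la)" "R ''out_length'' 0 = ?l + 1"
  proof -
    define M1 where "M1 = M(''out_kind'' := (M ''out_kind'')(?l := kd))"
    define M2 where "M2 = M1(''out_index'' := (M1 ''out_index'')(?l := int i))"
    define M3 where "M3 = M2(''out_machine'' := (M2 ''out_machine'')(?l := int (nat kk)))"
    define M4 where "M4 = M3(''out_start_num'' := (M3 ''out_start_num'')(?l := aval f M))"
    define M5 where "M5 = M4(''out_start_den'' := (M4 ''out_start_den'')(?l := la))"
    define M6 where "M6 = M5(''out_finish_num'' := (M5 ''out_finish_num'')(?l := aval g M))"
    define M7 where "M7 = M6(''out_finish_den'' := (M6 ''out_finish_den'')(?l := la))"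
    have av: "aval e M1 = aval e M" "aval e M2 = aval e M" "aval e M3 = aval e M" "aval e M4 = aval e M" "aval e M5 = aval e M"
      if "\<And>y. y \<in> OUT ==> y \<notin> rds e" for e
      unfolding M5_def M4_def M3_def M2_def M1_def by (simp_all only: aval_upd that O not_False_eq_True)
    have h1: "M1 ''out_kind'' = (M ''out_kind'')(?l := kd)" by (simp add: M1_def)
    have r1: "y \<noteq> ''out_kind'' ==> M1 y = M y" for y by (simp add: M1_def)
    have h2: "M2 ''out_index'' = (M1 ''out_index'')(?l := int i)" by (simp add: M2_def)
    have r2: "y \<noteq> ''out_index'' ==> M2 y = M1 y" for y by (simp add: M2_def)
    have h3: "M3 ''out_machine'' = (M2 ''out_machine'')(?l := int (nat kk))" by (simp add: M3_def)
    have r3: "y \<noteq> ''out_machine'' ==> M3 y = M2 y" for y by (simp add: M3_def)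
    have h4: "M4 ''out_start_num'' = (M3 ''out_start_num'')(?l := aval f M)" by (simp add: M4_def)
    have r4: "y \<noteq> ''out_start_num'' ==> M4 y = M3 y" for y by (simp add: M4_def)
    have h5: "M5 ''out_start_den'' = (M4 ''out_start_den'')(?l := la)" by (simp add: M5_def)
    have r5: "y \<noteq> ''out_start_den'' ==> M5 y = M4 y" for y by (simp add: M5_def)
    have h6: "M6 ''out_finish_num'' = (M5 ''out_finish_num'')(?l := aval g M)" by (simp add: M6_def)
    have r6: "y \<noteq> ''out_finish_num'' ==> M6 y = M5 y" for y by (simp add: M6_def)
    have h7: "M7 ''out_finish_den'' = (M6 ''out_finish_den'')(?l := la)" by (simp add: M7_def)
    have r7: "y \<noteq> ''out_finish_den'' ==> M7 y = M6 y" for y by (simp add: M7_def)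
    have l: "M1 ''out_length'' 0 = ?l" "M2 ''out_length'' 0 = ?l" "M3 ''out_length'' 0 = ?l" "M4 ''out_length'' 0 = ?l" "M5 ''out_length'' 0 = ?l"
      "M6 ''out_length'' 0 = ?l" "M7 ''out_length'' 0 = ?l" "M4 ''la'' 0 = la" "M6 ''la'' 0 = la"
      using ln la(1) by (simp_all add: r1 r2 r3 r4 r5 r6 r7)
    have R: "R = M7(''out_length'' := (M7 ''out_length'')(0 := ?l + 1))"
    proof -
      have 1: "run (Write ''out_kind'' (V ''out_length'') (Num kd)) M = M1" using ln by (simp add: M1_def)
      have 2: "run (Write ''out_index'' (V ''out_length'') ix) M1 = M2" using l av(1)[OF nr(1)] it(2) by (simp add: M2_def)
      have 3: "run (Cond (Less k (Num 0)) (Write ''out_machine'' (V ''out_length'') (Num 0)) (Write ''out_machine'' (V ''out_length'') k)) M2 = M3"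
        using l av(2)[OF nr(2)] v(3) by (simp add: M3_def)
      have 4: "run (Write ''out_start_num'' (V ''out_length'') f) M3 = M4" using l av(3)[OF nr(3)] by (simp add: M4_def)
      have 5: "run (Write ''out_start_den'' (V ''out_length'') (V ''la'')) M4 = M5" using l by (simp add: M5_def)
      have 6: "run (Write ''out_finish_num'' (V ''out_length'') g) M5 = M6" using l av(5)[OF nr(4)] by (simp add: M6_def)
      have 7: "run (Write ''out_finish_den'' (V ''out_length'') (V ''la'')) M6 = M7" using l by (simp add: M7_def)
      have "R = run (Set ''out_length'' (Add (V ''out_length'') (Num 1))) M7"
        unfolding R_def emit_def run.simps(3) 1 2 3 4 5 6 7 ..
      then show ?thesis using l by simp
    qed
    show "R ''out_kind'' = (M ''out_kind'')(?l := kd)" "R ''out_index'' = (M ''out_index'')(?l := int i)"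
      "R ''out_machine'' = (M ''out_machine'')(?l := int (nat kk))" "R ''out_start_num'' = (M ''out_start_num'')(?l := aval f M)"
      "R ''out_start_den'' = (M ''out_start_den'')(?l := la)" "R ''out_finish_num'' = (M ''out_finish_num'')(?l := aval g M)"
      "R ''out_finish_den'' = (M ''out_finish_den'')(?l := la)" "R ''out_length'' 0 = ?l + 1"
      unfolding R by (simp_all add: h1 h2 h3 h4 h5 h6 h7 r1 r2 r3 r4 r5 r6 r7)
  qed
  have q: "output_item R (int p) (item_of e) \<longleftrightarrow> output_item M (int p) (item_of e)" if "p < length S" for p and e :: entry
    unfolding output_item_def A using that by (cases "item_of e") simp_all
  show ?thesis
    unfolding R_def[symmetric] outputs_def
  proof (intro conjI allI impI)
    show "R ''out_length'' 0 = int (length (S @ [mk it kk a b]))" using A by simp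
    fix p assume "p < length (S @ [mk it kk a b])"
    then have "p < length S \<or> p = length S" by auto
    then have "output_item R (int p) (item_of ((S @ [mk it kk a b]) ! p)) \<and> R ''out_machine'' (int p) = int (machine_of ((S @ [mk it kk a b]) ! p)) \<and>
       output_time R ''out_start_num'' ''out_start_den'' (int p) (start_of ((S @ [mk it kk a b]) ! p)) \<and>
       output_time R ''out_finish_num'' ''out_finish_den'' (int p) (finish_of ((S @ [mk it kk a b]) ! p))"
    proof
      assume p: "p < length S"
      then show ?thesis using o q[OF p] unfolding outputs_def output_time_def A by (simp add: nth_append)
    next
      assume p: "p = length S"
      have "output_item R ?l it" using it(1) unfolding output_item_def A by auto
      moreover have "a = real_of_int (aval f M) / real_of_int la" "b = real_of_int (aval g M) / real_of_int la" unfolding v using la(2) by simp_all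
      ultimately show ?thesis unfolding p output_time_def A using la(2) by simp
    qed
    then show "output_item R (int p) (item_of ((S @ [mk it kk a b]) ! p))" "R ''out_machine'' (int p) = int (machine_of ((S @ [mk it kk a b]) ! p))"
       "output_time R ''out_start_num'' ''out_start_den'' (int p) (start_of ((S @ [mk it kk a b]) ! p))"
       "output_time R ''out_finish_num'' ''out_finish_den'' (int p) (finish_of ((S @ [mk it kk a b]) ! p))" by blast+
  qed
qed

text \<open>The variables of the two cursors differ in the first character of their names only.\<close>

abbreviation W :: "char \<Rightarrow> string \<Rightarrow> aexp" where "W c x \<equiv> V (c # x)"

definition opn_c :: "char \<Rightarrow> com" where
  "opn_c c = Cond (Conj (Neg (Less (W c ''r'') (V ''ci''))) (Neg (Less (V ''ci'') (W c ''r'')))) Skip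
    (Cond (Conj (Less (W c ''k'') (W c ''lm'')) (Neg (Less (W c ''b'') (Add (W c ''x'') (V ''s4'')))))
      (Seq (emit 0 (V ''ci'') (W c ''k'') (W c ''x'') (Add (W c ''x'') (V ''s4'')))
        (Seq (Set (c # ''x'') (Add (W c ''x'') (V ''s4''))) (Set (c # ''r'') (V ''ci''))))
      (Seq (Set (c # ''k'') (Add (W c ''k'') (Num 1))) (Seq (Set (c # ''x'') (Add (W c ''pp'') (V ''s4'')))
        (Seq (Set (c # ''b'') (W c ''oo'')) (Seq (Set (c # ''r'') (V ''ci''))
          (Cond (Less (W c ''k'') (W c ''lm'')) (emit 0 (V ''ci'') (W c ''k'') (W c ''pp'') (W c ''x'')) Skip))))))"

text \<open>The new time is written as the old one plus a change. In this form \<open>wdeg\<close>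
  treats the assignment as an increment of the cell, and the degree of the time stays
  finite.\<close>

abbreviation wrap :: "char \<Rightarrow> aexp" where
  "wrap c \<equiv> Add (W c ''x'') (Sub (Add (W c ''pp'') (Add (V ''s4'') (W c ''am''))) (W c ''b''))"

definition pce_c :: "char \<Rightarrow> com" where
  "pce_c c = Cond (Less (W c ''k'') (W c ''lm''))
    (Cond (Neg (Less (W c ''b'') (Add (W c ''x'') (W c ''am''))))
      (Seq (emit 1 (V ''jj'') (W c ''k'') (W c ''x'') (Add (W c ''x'') (W c ''am'')))
        (Seq (Set (c # ''x'') (Add (W c ''x'') (W c ''am''))) (Set (c # ''dd'') (W c ''am''))))
      (Seq (Cond (Less (W c ''x'') (W c ''b'')) (emit 1 (V ''jj'') (W c ''k'') (W c ''x'') (W c ''b'')) Skip)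
        (Seq (Set (c # ''dd'') (Sub (W c ''b'') (W c ''x''))) (Seq (Set (c # ''k'') (Add (W c ''k'') (Num 1)))
          (Seq (Cond (Less (W c ''k'') (W c ''lm''))
             (Seq (emit 0 (V ''ci'') (W c ''k'') (W c ''pp'') (Add (W c ''pp'') (V ''s4'')))
               (Seq (emit 1 (V ''jj'') (W c ''k'') (Add (W c ''pp'') (V ''s4'')) (wrap c))
                 (Seq (Set (c # ''x'') (wrap c)) (Set (c # ''dd'') (W c ''am'')))))
             (Set (c # ''x'') (Add (W c ''pp'') (V ''s4''))))
            (Set (c # ''b'') (W c ''ee'')))))))
    (Set (c # ''dd'') (Num 0))"

definition put_c :: "char \<Rightarrow> com" where
  "put_c c = Cond (Less (Num 0) (W c ''am'')) (Seq (opn_c c) (pce_c c)) (Set (c # ''dd'') (Num 0))"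

text \<open>The times of a cursor are stored multiplied by \<open>la\<close>, which makes them
  integers without rounding.\<close>

definition rel :: "char \<Rightarrow> int \<Rightarrow> cursor \<Rightarrow> memory \<Rightarrow> bool" where
  "rel c la cu M \<longleftrightarrow> (case cu of (k, x, b, r) \<Rightarrow> M (c # ''k'') 0 = k \<and> real_of_int (M (c # ''x'') 0) = real_of_int la * x \<and>
     real_of_int (M (c # ''b'') 0) = real_of_int la * b \<and> M (c # ''r'') 0 = r)"

definition par :: "char \<Rightarrow> int \<Rightarrow> int \<Rightarrow> real \<Rightarrow> real \<Rightarrow> real \<Rightarrow> real \<Rightarrow> nat \<Rightarrow> nat \<Rightarrow> real \<Rightarrow> memory \<Rightarrow> bool" where
  "par c la lm s p b0 b1 i j a M \<longleftrightarrow> M ''la'' 0 = la \<and> 0 < la \<and> M (c # ''lm'') 0 = lm \<and> real_of_int (M ''s4'' 0) = real_of_int la * s \<and>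
     real_of_int (M (c # ''pp'') 0) = real_of_int la * p \<and> real_of_int (M (c # ''oo'') 0) = real_of_int la * b0 \<and>
     real_of_int (M (c # ''ee'') 0) = real_of_int la * b1 \<and> M ''ci'' 0 = int i \<and> M ''jj'' 0 = int j \<and>
     real_of_int (M (c # ''am'') 0) = real_of_int la * a"

lemma la_less: "0 < la ==> real_of_int u = real_of_int la * a ==> real_of_int v = real_of_int la * b ==> u < v \<longleftrightarrow> a < b"
  by (metis mult_less_cancel_left_pos of_int_0_less_iff of_int_less_iff)

lemma wr_opn: "wr (opn_c c) \<subseteq> OUT \<union> {c # ''k'', c # ''x'', c # ''b'', c # ''r''}"
  by (auto simp: opn_c_def wr_emit)
lemma wr_pce: "wr (pce_c c) \<subseteq> OUT \<union> {c # ''k'', c # ''x'', c # ''b'', c # ''dd''}"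
  by (auto simp: pce_c_def wr_emit)
lemma wr_put: "wr (put_c c) \<subseteq> OUT \<union> {c # ''k'', c # ''x'', c # ''b'', c # ''r'', c # ''dd''}"
  unfolding put_c_def using wr_opn[of c] wr_pce[of c] by auto

lemma opn_ok:
  assumes P: "par c la lm s p b0 b1 i j a M" and C: "rel c la (k, x, b, r) M" and o: "outputs M S"
    and e: "opn lm s p b0 i (k, x, b, r) = (cu, E)"
  shows "rel c la cu (run (opn_c c) M) \<and> outputs (run (opn_c c) M) (S @ E)"
proof -
  note p = P[unfolded par_def] and q = C[unfolded rel_def prod.case]
  have ls: "0 < la" using p by blast
  have sum: "real_of_int (u + v) = real_of_int la * (y + z)" if "real_of_int u = real_of_int la * y" "real_of_int v = real_of_int la * z" for u v y z
    using that by (simp add: ring_distribs)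
  have xs: "real_of_int (M (c # ''x'') 0 + M ''s4'' 0) = real_of_int la * (x + s)" by (rule sum) (use p q in auto)
  have ps: "real_of_int (M (c # ''pp'') 0 + M ''s4'' 0) = real_of_int la * (p + s)" by (rule sum) (use p in auto)
  have c1: "M (c # ''b'') 0 < M (c # ''x'') 0 + M ''s4'' 0 \<longleftrightarrow> b < x + s" by (rule la_less[OF ls _ xs]) (use q in auto)
  consider "r = int i" | "r \<noteq> int i" "k < lm \<and> x + s \<le> b" | "r \<noteq> int i" "\<not> (k < lm \<and> x + s \<le> b)" by blast
  then show ?thesis
  proof cases
    case 1
    then have "run (opn_c c) M = M" unfolding opn_c_def using p q by simp
    then show ?thesis using 1 e C o by (auto simp: opn_def)
  next
    case 2
    let ?M = "run (emit 0 (V ''ci'') (W c ''k'') (W c ''x'') (Add (W c ''x'') (V ''s4''))) M"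
    have "outputs ?M (S @ [mk (Setup i) k x (x + s)])"
      by (rule emit_ok[OF o, where la = la and i = i]) (use p q xs in \<open>simp_all add: OUT_def\<close>)
    moreover have "run (opn_c c) M = run (Seq (Set (c # ''x'') (Add (W c ''x'') (V ''s4''))) (Set (c # ''r'') (V ''ci''))) ?M"
      unfolding opn_c_def using 2 p q c1 by auto
    moreover have "cu = (k, x + s, b, int i)" "E = [mk (Setup i) k x (x + s)]" using e 2 by (auto simp: opn_def)
    ultimately show ?thesis using p q xs by (simp add: outputs_upd rel_def emit_frame OUT_def)
  next
    case 3
    let ?M = "run (Seq (Set (c # ''k'') (Add (W c ''k'') (Num 1))) (Seq (Set (c # ''x'') (Add (W c ''pp'') (V ''s4'')))
        (Seq (Set (c # ''b'') (W c ''oo'')) (Set (c # ''r'') (V ''ci''))))) M"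
    have o2: "outputs ?M S" using o by (simp add: outputs_upd OUT_def)
    have cu: "cu = (k + 1, p + s, b0, int i)" "E = (if k + 1 < lm then [mk (Setup i) (k + 1) p (p + s)] else [])" using e 3 by (auto simp: opn_def)
    have R: "run (opn_c c) M = run (Cond (Less (W c ''k'') (W c ''lm'')) (emit 0 (V ''ci'') (W c ''k'') (W c ''pp'') (W c ''x'')) Skip) ?M"
      unfolding opn_c_def using 3 p q c1 by auto
    have m: "?M (c # ''k'') 0 = k + 1" "real_of_int (?M (c # ''x'') 0) = real_of_int la * (p + s)" "real_of_int (?M (c # ''b'') 0) = real_of_int la * b0"
      "?M (c # ''r'') 0 = int i" "?M (c # ''lm'') 0 = lm" "real_of_int (?M (c # ''pp'') 0) = real_of_int la * p" "?M ''ci'' 0 = int i" "?M ''la'' 0 = la"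
      using p q ps by simp_all
    define M2 where "M2 = ?M"
    note m = m[folded M2_def] and o2 = o2[folded M2_def] and R = R[folded M2_def]
    show ?thesis
    proof (cases "k + 1 < lm")
      case True
      have "outputs (run (emit 0 (V ''ci'') (W c ''k'') (W c ''pp'') (W c ''x'')) M2) (S @ [mk (Setup i) (k + 1) p (p + s)])"
        by (rule emit_ok[OF o2, where la = la and i = i]) (use m ls in \<open>simp_all add: OUT_def\<close>)
      then show ?thesis unfolding R cu using True m by (simp add: rel_def emit_frame OUT_def)
    next
      case False
      then show ?thesis unfolding R cu using m o2 by (simp add: rel_def)
    qed
  qed
qed

lemma pce_ok:
  assumes P: "par c la lm s p b0 b1 i j a M" and C: "rel c la (k, x, b, r) M" and o: "outputs M S"
    and e: "pce lm s p b1 i j a (k, x, b, r) = (cu, E, d)"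
  shows "rel c la cu (run (pce_c c) M) \<and> outputs (run (pce_c c) M) (S @ E) \<and> real_of_int (run (pce_c c) M (c # ''dd'') 0) = real_of_int la * d"
proof -
  note p = P[unfolded par_def] and q = C[unfolded rel_def prod.case]
  have ls: "0 < la" using p by blast
  have sum: "real_of_int (u + v) = real_of_int la * (y + z)" "real_of_int (u - v) = real_of_int la * (y - z)"
    if "real_of_int u = real_of_int la * y" "real_of_int v = real_of_int la * z" for u v y z
    using that by (simp_all add: ring_distribs right_diff_distrib)
  have xa: "real_of_int (M (c # ''x'') 0 + M (c # ''am'') 0) = real_of_int la * (x + a)" by (rule sum) (use p q in auto)
  have bx: "real_of_int (M (c # ''b'') 0 - M (c # ''x'') 0) = real_of_int la * (b - x)" by (rule sum) (use p q in auto)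
  have c1: "M (c # ''b'') 0 < M (c # ''x'') 0 + M (c # ''am'') 0 \<longleftrightarrow> b < x + a" by (rule la_less[OF ls _ xa]) (use q in auto)
  have c2: "M (c # ''x'') 0 < M (c # ''b'') 0 \<longleftrightarrow> x < b" by (rule la_less[OF ls]) (use q in auto)
  consider "lm \<le> k" | "\<not> lm \<le> k" "x + a \<le> b" | "\<not> lm \<le> k" "\<not> x + a \<le> b" by blast
  then show ?thesis
  proof cases
    case 1
    then have "run (pce_c c) M = run (Set (c # ''dd'') (Num 0)) M" unfolding pce_c_def using p q by simp
    then show ?thesis using 1 e C o by (auto simp: pce_def rel_def outputs_upd OUT_def)
  next
    case 2
    let ?M = "run (emit 1 (V ''jj'') (W c ''k'') (W c ''x'') (Add (W c ''x'') (W c ''am''))) M"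
    have "outputs ?M (S @ [mk (Piece j) k x (x + a)])"
      by (rule emit_ok[OF o, where la = la and i = j]) (use p q xa in \<open>simp_all add: OUT_def\<close>)
    moreover have "run (pce_c c) M = run (Seq (Set (c # ''x'') (Add (W c ''x'') (W c ''am''))) (Set (c # ''dd'') (W c ''am''))) ?M"
      unfolding pce_c_def using 2 p q c1 by auto
    moreover have "cu = (k, x + a, b, r)" "E = [mk (Piece j) k x (x + a)]" "d = a" using e 2 by (auto simp: pce_def)
    ultimately show ?thesis using p q xa by (simp add: outputs_upd rel_def emit_frame OUT_def)
  next
    case 3
    define E1 where "E1 = (if x < b then [mk (Piece j) k x b] else [])"
    define M1 where "M1 = run (Cond (Less (W c ''x'') (W c ''b'')) (emit 1 (V ''jj'') (W c ''k'') (W c ''x'') (W c ''b'')) Skip) M"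
    have o1: "outputs M1 (S @ E1)"
    proof (cases "x < b")
      case True
      have "outputs (run (emit 1 (V ''jj'') (W c ''k'') (W c ''x'') (W c ''b'')) M) (S @ [mk (Piece j) k x b])"
        by (rule emit_ok[OF o, where la = la and i = j]) (use p q in \<open>simp_all add: OUT_def\<close>)
      then show ?thesis unfolding M1_def E1_def using True c2 by simp
    next
      case False
      then show ?thesis unfolding M1_def E1_def using c2 o by simp
    qed
    have f1: "y \<notin> OUT ==> M1 y = M y" for y unfolding M1_def by (rule run_frame) (simp add: wr_emit)
    define M2 where "M2 = run (Seq (Set (c # ''dd'') (Sub (W c ''b'') (W c ''x''))) (Set (c # ''k'') (Add (W c ''k'') (Num 1)))) M1"
    have o2: "outputs M2 (S @ E1)" unfolding M2_def using o1 by (simp add: outputs_upd OUT_def)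
    have m2: "M2 (c # ''k'') 0 = k + 1" "real_of_int (M2 (c # ''x'') 0) = real_of_int la * x" "real_of_int (M2 (c # ''b'') 0) = real_of_int la * b"
      "M2 (c # ''r'') 0 = r" "M2 (c # ''lm'') 0 = lm" "real_of_int (M2 (c # ''pp'') 0) = real_of_int la * p" "M2 ''ci'' 0 = int i" "M2 ''la'' 0 = la"
      "M2 ''jj'' 0 = int j" "real_of_int (M2 ''s4'' 0) = real_of_int la * s" "real_of_int (M2 (c # ''am'') 0) = real_of_int la * a"
      "real_of_int (M2 (c # ''ee'') 0) = real_of_int la * b1" "real_of_int (M2 (c # ''dd'') 0) = real_of_int la * (b - x)"
      unfolding M2_def using p q bx by (simp_all add: f1 OUT_def)
    have ps: "real_of_int (M2 (c # ''pp'') 0 + M2 ''s4'' 0) = real_of_int la * (p + s)" by (rule sum) (use m2 in auto)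
    have wp: "real_of_int (aval (wrap c) M2) = real_of_int la * (p + s + (a - (b - x)))"
      using m2 by (simp add: ring_distribs right_diff_distrib)
    define B1 where "B1 = Seq (emit 0 (V ''ci'') (W c ''k'') (W c ''pp'') (Add (W c ''pp'') (V ''s4'')))
               (Seq (emit 1 (V ''jj'') (W c ''k'') (Add (W c ''pp'') (V ''s4'')) (wrap c))
                 (Seq (Set (c # ''x'') (wrap c)) (Set (c # ''dd'') (W c ''am''))))"
    define fin where "fin = Seq (Cond (Less (W c ''k'') (W c ''lm'')) B1 (Set (c # ''x'') (Add (W c ''pp'') (V ''s4'')))) (Set (c # ''b'') (W c ''ee''))"
    have R: "run (pce_c c) M = run fin M2"
      unfolding pce_c_def M2_def M1_def fin_def B1_def using 3 p q c1 by simp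
    show ?thesis
    proof (cases "k + 1 < lm")
      case True
      let ?A = "mk (Setup i) (k + 1) p (p + s)" and ?B = "mk (Piece j) (k + 1) (p + s) (p + s + (a - (b - x)))"
      define M3 where "M3 = run (emit 0 (V ''ci'') (W c ''k'') (W c ''pp'') (Add (W c ''pp'') (V ''s4''))) M2"
      have o3: "outputs M3 ((S @ E1) @ [?A])" unfolding M3_def
        by (rule emit_ok[OF o2, where la = la and i = i]) (use m2 ps ls in \<open>simp_all add: OUT_def\<close>)
      have f3: "y \<notin> OUT ==> M3 y = M2 y" for y unfolding M3_def by (rule emit_frame)
      have w3: "aval (wrap c) M3 = aval (wrap c) M2" by (simp add: f3 OUT_def)
      define M4 where "M4 = run (emit 1 (V ''jj'') (W c ''k'') (Add (W c ''pp'') (V ''s4'')) (wrap c)) M3"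
      have o4: "outputs M4 (((S @ E1) @ [?A]) @ [?B])" unfolding M4_def
        by (rule emit_ok[OF o3, where la = la and i = j])
          (use m2 ps ls wp in \<open>simp_all only: w3 aval.simps f3, simp_all add: OUT_def f3\<close>)
      have f4: "y \<notin> OUT ==> M4 y = M2 y" for y unfolding M4_def using emit_frame f3 by simp
      have w4: "aval (wrap c) M4 = aval (wrap c) M2" by (simp add: f4 OUT_def)
      have R2: "run fin M2 = run (Seq (Seq (Set (c # ''x'') (wrap c)) (Set (c # ''dd'') (W c ''am''))) (Set (c # ''b'') (W c ''ee''))) M4"
        unfolding fin_def B1_def M4_def M3_def using True m2 by simp
      have cu: "cu = (k + 1, p + s + (a - (b - x)), b1, r)" "E = E1 @ [?A, ?B]" "d = a" using e 3 True by (auto simp: pce_def E1_def)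
      have "outputs (run fin M2) (S @ E)" unfolding R2 cu using o4 by (simp add: outputs_upd OUT_def)
      moreover have "real_of_int (run fin M2 (c # ''x'') 0) = real_of_int la * (p + s + (a - (b - x)))"
        unfolding R2 wp[symmetric] w4[symmetric] by simp
      moreover have "run fin M2 (c # ''k'') 0 = k + 1" "run fin M2 (c # ''r'') 0 = r" "real_of_int (run fin M2 (c # ''b'') 0) = real_of_int la * b1"
        "real_of_int (run fin M2 (c # ''dd'') 0) = real_of_int la * a"
        unfolding R2 using m2 by (simp_all add: f4 OUT_def)
      ultimately show ?thesis unfolding R cu rel_def by simp
    next
      case False
      have R2: "run fin M2 = run (Seq (Set (c # ''x'') (Add (W c ''pp'') (V ''s4''))) (Set (c # ''b'') (W c ''ee''))) M2"
        unfolding fin_def using False m2 by simp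
      have cu: "cu = (k + 1, p + s, b1, r)" "E = E1" "d = b - x" using e 3 False by (auto simp: pce_def E1_def)
      show ?thesis unfolding R R2 cu rel_def using m2 ps o2 by (simp add: outputs_upd OUT_def)
    qed
  qed
qed

lemma put_ok:
  assumes P: "par c la lm s p b0 b1 i j a M" and C: "rel c la cu M" and o: "outputs M S"
    and e: "put lm s p b0 b1 i j a cu = (cu', E, d)"
  shows "rel c la cu' (run (put_c c) M) \<and> outputs (run (put_c c) M) (S @ E) \<and> real_of_int (run (put_c c) M (c # ''dd'') 0) = real_of_int la * d"
proof -
  have ls: "0 < la" using P by (simp add: par_def)
  have c0: "0 < M (c # ''am'') 0 \<longleftrightarrow> 0 < a" by (rule la_less[OF ls]) (use P in \<open>auto simp: par_def\<close>)
  obtain k x b r where cu: "cu = (k, x, b, r)" by (cases cu) auto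
  show ?thesis
  proof (cases "0 < a")
    case False
    then have "run (put_c c) M = run (Set (c # ''dd'') (Num 0)) M" unfolding put_c_def using c0 by simp
    then show ?thesis using False e C o by (auto simp: put_def rel_def outputs_upd OUT_def split: prod.splits)
  next
    case True
    obtain k1 x1 b1' r1 E1 where e1: "opn lm s p b0 i (k, x, b, r) = ((k1, x1, b1', r1), E1)" by (metis surj_pair)
    obtain cu2 E2 d2 where e2: "pce lm s p b1 i j a (k1, x1, b1', r1) = (cu2, E2, d2)" by (metis surj_pair)
    have r: "cu' = cu2" "E = E1 @ E2" "d = d2" using e True e1 e2 unfolding put_def cu by auto
    have 1: "rel c la (k1, x1, b1', r1) (run (opn_c c) M) \<and> outputs (run (opn_c c) M) (S @ E1)"
      by (rule opn_ok[OF P C[unfolded cu] o e1])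
    have fr: "y \<notin> OUT ==> y \<notin> {c # ''k'', c # ''x'', c # ''b'', c # ''r''} ==> run (opn_c c) M y = M y" for y
      by (rule run_frame) (use wr_opn[of c] in auto)
    have P2: "par c la lm s p b0 b1 i j a (run (opn_c c) M)" using P unfolding par_def by (simp add: fr OUT_def)
    have 2: "rel c la cu2 (run (pce_c c) (run (opn_c c) M)) \<and> outputs (run (pce_c c) (run (opn_c c) M)) ((S @ E1) @ E2) \<and>
      real_of_int (run (pce_c c) (run (opn_c c) M) (c # ''dd'') 0) = real_of_int la * d2"
      by (rule pce_ok[OF P2 _ _ e2]) (use 1 in auto)
    have "run (put_c c) M = run (pce_c c) (run (opn_c c) M)" unfolding put_c_def using True c0 by simp
    then show ?thesis using 2 r by simp
  qed
qed

lemma lf_put: "lf (put_c c)" by (simp add: put_c_def opn_c_def pce_c_def lf_emit)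
lemma cc_put: "cc (put_c c) \<le> 500" by (simp add: put_c_def opn_c_def pce_c_def emit_def)

abbreviation tyc :: aexp where "tyc \<equiv> Read ''ty'' (V ''ci'')"
abbreviation l4 :: aexp where "l4 \<equiv> Mul (Mul (Num 4) (V ''TD'')) (Add (Read ''setup_times'' (V ''ci'')) (Read ''P'' (V ''ci'')))"
abbreviation half4 :: aexp where "half4 \<equiv> Sub (Mul (Num 2) (V ''TN'')) (V ''s4'')"

definition job1 :: com where
  "job1 = Seq (Set ''s4'' (Mul (Mul (Num 4) (V ''TD'')) (Read ''setup_times'' (V ''ci''))))
    (Seq (Set ''t4'' (Mul (Mul (Num 4) (V ''TD'')) (Read ''job_times'' (V ''jj''))))
      (Cond (Conj (Less (Num 2) tyc) (Less tyc (Num 6))) (Cond (Less (V ''t4'') half4) (Set ''1am'' (V ''t4'')) (Set ''1am'' half4)) (Set ''1am'' (Num 0))))"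

definition job2 :: com where
  "job2 = Seq (Set ''0am'' (Sub (V ''t4'') (V ''1dd'')))
    (Seq (Cond (Less tyc (Num 1)) (Set ''0pp'' (Num 0)) (Cond (Less tyc (Num 2)) (Set ''0pp'' (Sub (Mul (Num 6) (V ''TN'')) l4))
        (Cond (Less tyc (Num 3)) (Set ''0pp'' (Num 0)) (Set ''0pp'' half4))))
      (Cond (Less tyc (Num 1))
        (Seq (Set ''0oo'' (Sub l4 (Mul (Sub (Read ''al'' (V ''ci'')) (Num 1)) (Sub (Mul (Num 4) (V ''TN'')) (V ''s4''))))) (Set ''0ee'' (Mul (Num 4) (V ''TN''))))
        (Seq (Set ''0oo'' (Mul (Num 6) (V ''TN''))) (Set ''0ee'' (Mul (Num 6) (V ''TN''))))))"

definition job_c :: com where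
  "job_c = Seq job1 (Seq (put_c CHR ''1'') (Seq job2 (put_c CHR ''0'')))"

text \<open>The counter \<open>y\<close> encodes a pair of type and position. One loop of
  \<open>7 * n\<close> rounds thus visits the jobs by type and, within a type, in the order sorted
  by class.\<close>

definition lbody :: com where
  "lbody = Seq (Seq (Set ''v'' (Quot (V ''y'') (V ''n''))) (Seq (Set ''p'' (Sub (V ''y'') (Mul (V ''v'') (V ''n''))))
    (Seq (Set ''jj'' (Read ''od'' (V ''p''))) (Set ''ci'' (Read ''job_class'' (V ''jj''))))))
    (Cond (Conj (Neg (Less tyc (V ''v''))) (Neg (Less (V ''v'') tyc))) job_c Skip)"

text \<open>Scaling by \<open>4 * TD\<close> makes the times of the construction integral:
  \<open>T / 2\<close> becomes \<open>2 * TN\<close> and \<open>3 / 2 * T\<close> becomes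
  \<open>6 * TN\<close>.\<close>

definition cinit :: com where
  "cinit = Seq (Set ''la'' (Mul (Num 4) (V ''TD''))) (Seq (Set ''1lm'' (Add (rd ''SA'' 0) (rd ''SC'' 1))) (Seq (Set ''1pp'' (Num 0))
    (Seq (Set ''1oo'' (Mul (Num 2) (V ''TN''))) (Seq (Set ''1ee'' (Mul (Num 2) (V ''TN''))) (Seq (Set ''0lm'' (V ''m''))
    (Seq (Set ''1k'' (rd ''SA'' 0)) (Seq (Set ''1x'' (Num 0)) (Seq (Set ''1b'' (Mul (Num 2) (V ''TN''))) (Seq (Set ''1r'' (Num (-1)))
    (Seq (Set ''0k'' (Num (-1))) (Seq (Set ''0x'' (Mul (Num 6) (V ''TN''))) (Seq (Set ''0b'' (Mul (Num 6) (V ''TN''))) (Set ''0r'' (Num (-1)))))))))))))))"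

definition construct :: com where
  "construct = Seq cinit (For ''y'' (Mul (Num 7) (V ''n'')) lbody)"

text \<open>The split serves the degree check. The makespan found has a test coefficient as possible
  denominator, and the second test reads it through \<open>TD\<close>; with one table the degrees of
  \<open>TD\<close>, \<open>al\<close> and \<open>B0\<close> would have to exceed each other in a
  circle.\<close>

definition part1 :: com where "part1 = Seq (sq (prep1 @ prep2)) find"
definition part2 :: com where
  "part2 = Seq (Seq (Set ''TN'' (V ''RN'')) (Set ''TD'' (V ''RD''))) (Seq (sq test) construct)"

definition WL :: "string set" where
  "WL = OUT \<union> {''0k'', ''0x'', ''0b'', ''0r'', ''0dd'', ''1k'', ''1x'', ''1b'', ''1r'', ''1dd'', ''s4'', ''t4'', ''1am'', ''0am'', ''0pp'', ''0oo'', ''0ee'',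
     ''v'', ''p'', ''jj'', ''ci'', ''y''}"

lemma wr_job_c: "wr job_c \<subseteq> WL - {''v'', ''p'', ''jj'', ''ci'', ''y''}"
proof -
  have 1: "wr (put_c CHR ''1'') \<subseteq> WL - {''v'', ''p'', ''jj'', ''ci'', ''y''}"
    by (rule subset_trans[OF wr_put]) (simp add: WL_def OUT_def)
  have 0: "wr (put_c CHR ''0'') \<subseteq> WL - {''v'', ''p'', ''jj'', ''ci'', ''y''}"
    by (rule subset_trans[OF wr_put]) (simp add: WL_def OUT_def)
  have "wr job1 \<subseteq> WL - {''v'', ''p'', ''jj'', ''ci'', ''y''}" "wr job2 \<subseteq> WL - {''v'', ''p'', ''jj'', ''ci'', ''y''}"
    by (simp_all add: job1_def job2_def WL_def OUT_def)
  then show ?thesis using 0 1 by (simp add: job_c_def)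
qed

lemma cc_job_c: "cc job_c \<le> 1200" "lf job_c"
  using cc_put[of "CHR ''1''"] cc_put[of "CHR ''0''"] by (simp_all add: job_c_def job1_def job2_def lf_put)

section \<open>Correctness of the written schedule and of the two program parts\<close>

context inst
begin

context
  fixes js :: "nat list" and N Dn :: int and T :: real
  assumes js: "jobs_list js" and Dp: "0 < Dn" and TT: "T = vl (N, Dn)" and aT: "acc T" and n0: "0 < n"
begin

definition K :: "memory \<Rightarrow> bool" where
  "K M \<longleftrightarrow> st (env1 js) M \<and> tested T M \<and> M ''TN'' 0 = N \<and> M ''TD'' 0 = Dn \<and> M ''la'' 0 = 4 * Dn \<and> M ''1lm'' 0 = AA T + ll T \<and>
    M ''1pp'' 0 = 0 \<and> M ''1oo'' 0 = 2 * N \<and> M ''1ee'' 0 = 2 * N \<and> M ''0lm'' 0 = int m"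

lemma K_frame:
  assumes "K M" "\<And>y. y \<notin> WL ==> M' y = M y"
  shows "K M'"
proof -
  have e: "M' ''m'' = M ''m''" "M' ''n'' = M ''n''" "M' ''c'' = M ''c''" "M' ''setup_times'' = M ''setup_times''" "M' ''job_times'' = M ''job_times''" "M' ''job_class'' = M ''job_class''" "M' ''P'' = M ''P''" "M' ''od'' = M ''od''" "M' ''o0'' = M ''o0''" "M' ''ty'' = M ''ty''" "M' ''al'' = M ''al''" "M' ''SA'' = M ''SA''" "M' ''SC'' = M ''SC''" "M' ''A0'' = M ''A0''" "M' ''A1'' = M ''A1''" "M' ''A2'' = M ''A2''" "M' ''B0'' = M ''B0''" "M' ''B1'' = M ''B1''" "M' ''B2'' = M ''B2''" "M' ''TN'' = M ''TN''" "M' ''TD'' = M ''TD''" "M' ''la'' = M ''la''" "M' ''1lm'' = M ''1lm''" "M' ''1pp'' = M ''1pp''" "M' ''1oo'' = M ''1oo''" "M' ''1ee'' = M ''1ee''" "M' ''0lm'' = M ''0lm''"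
    by (rule assms(2), simp add: WL_def OUT_def)+
  have s: "st (env1 js) M" using assms(1) by (simp add: K_def)
  have "st (env1 js) M'" by (rule st_frame[OF s]) (auto simp: env1_def env_def e)
  then show ?thesis using assms(1) unfolding K_def tested_def
    by (simp only: e simp_thms) (elim conjE, intro conjI, assumption+)
qed

lemma KD: assumes "K M"
  shows "i < c ==> M ''ty'' (int i) = int (ty T i)" "i < c ==> M ''al'' (int i) = al T i" "i < c ==> M ''setup_times'' (int i) = si i"
    "i < c ==> M ''P'' (int i) = Pi i" "j < n ==> M ''job_times'' (int j) = ti j" "j < n ==> M ''job_class'' (int j) = int (cl j)"
    "p < n ==> M ''od'' (int p) = int (js ! p)" "M ''n'' 0 = int n" "M ''TN'' 0 = N" "M ''TD'' 0 = Dn"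
  using assms aT unfolding K_def tested_def env1_def env_def acc_def by (simp_all add: st_def)

lemma NT: "real_of_int N = T * real_of_int Dn" using Dp by (simp add: TT vl_def)

lemma job_ok:
  assumes M: "K M" and j: "j < n" "M ''jj'' 0 = int j" "M ''ci'' 0 = int (cl j)"
    and C: "rel CHR ''1'' (4 * Dn) cs M" "rel CHR ''0'' (4 * Dn) cm M" "outputs M S"
    and e: "step T (cs, cm, S) j = (cs', cm', S')"
  shows "rel CHR ''1'' (4 * Dn) cs' (run job_c M) \<and> rel CHR ''0'' (4 * Dn) cm' (run job_c M) \<and> outputs (run job_c M) S'"
proof -
  define i where "i = cl j"
  have i: "i < c" unfolding i_def by (rule cl_less[OF j(1)])
  obtain d E1 where e1: "sl T cs j = (cs', E1, d)" and "\<exists>E2 d2. mp T cm j (t j - d) = (cm', E2, d2) \<and> S' = S @ E1 @ E2"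
    using e unfolding step_def by (auto split: prod.splits)
  then obtain E2 d2 where e2: "mp T cm j (t j - d) = (cm', E2, d2)" and S': "S' = S @ E1 @ E2" by blast
  note k = KD[OF M]
  note kc = M[unfolded K_def]
  have tyi: "M ''ty'' (int i) = int (ty T i)" "M ''al'' (int i) = al T i" "M ''setup_times'' (int i) = si i" "M ''P'' (int i) = Pi i"
    "M ''job_times'' (int j) = ti j" "M ''ci'' 0 = int i" using k i j by (simp_all add: i_def)
  define M1 where "M1 = run job1 M"
  have f1: "y \<notin> {''s4'', ''t4'', ''1am''} ==> M1 y = M y" for y unfolding M1_def by (rule run_frame) (simp add: job1_def)
  have cond: "4 * Dn * ti j < 2 * N - 4 * Dn * si i \<longleftrightarrow> t j < T / 2 - s i"
    by (rule la_less[of "4 * Dn"]) (use Dp in \<open>simp_all add: NT real_si real_ti algebra_simps\<close>)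
  have v1: "M1 ''s4'' 0 = 4 * Dn * si i" "M1 ''t4'' 0 = 4 * Dn * ti j"
    unfolding M1_def job1_def using tyi j(2) k(9,10) by simp_all
  have am1: "real_of_int (M1 ''1am'' 0) = real_of_int (4 * Dn) * am T j"
  proof -
    have "M1 ''1am'' 0 = (if 3 \<le> ty T i \<and> ty T i \<le> 5 then if 4 * Dn * ti j < 2 * N - 4 * Dn * si i then 4 * Dn * ti j else 2 * N - 4 * Dn * si i else 0)"
      unfolding M1_def job1_def using tyi j(2) k(9,10) by auto
    then show ?thesis unfolding cond am_def Let_def i_def[symmetric]
      by (auto simp: NT real_si real_ti algebra_simps min_def)
  qed
  have P1: "par CHR ''1'' (4 * Dn) (AA T + ll T) (s i) 0 (T / 2) (T / 2) i j (am T j) M1"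
    unfolding par_def using kc Dp am1 v1 tyi(6) j(2) by (simp add: f1 NT real_si)
  have C1: "rel CHR ''1'' (4 * Dn) cs M1" "rel CHR ''0'' (4 * Dn) cm M1" using C(1,2) unfolding rel_def by (simp_all add: f1 split: prod.splits)
  have "outputs M1 S = outputs M S" by (rule outputs_cong, rule f1) (auto simp: OUT_def)
  then have o1: "outputs M1 S" using C(3) by simp
  have pu1: "put (AA T + ll T) (s i) 0 (T / 2) (T / 2) i j (am T j) cs = (cs', E1, d)" using e1 unfolding sl_def i_def .
  define M2 where "M2 = run (put_c CHR ''1'') M1"
  have m2: "rel CHR ''1'' (4 * Dn) cs' M2" "outputs M2 (S @ E1)" "real_of_int (M2 ''1dd'' 0) = real_of_int (4 * Dn) * d"
    using put_ok[OF P1 C1(1) o1 pu1] unfolding M2_def by simp_all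
  have f2: "y \<notin> OUT ==> y \<notin> {''1k'', ''1x'', ''1b'', ''1r'', ''1dd''} ==> M2 y = M1 y" for y
    unfolding M2_def by (rule run_frame) (use wr_put[of "CHR ''1''"] in auto)
  have C2: "rel CHR ''0'' (4 * Dn) cm M2" using C1(2) unfolding rel_def by (simp add: f2 OUT_def split: prod.splits)
  define M3 where "M3 = run job2 M2"
  have f3: "y \<notin> {''0am'', ''0pp'', ''0oo'', ''0ee''} ==> M3 y = M2 y" for y unfolding M3_def by (rule run_frame) (simp add: job2_def)
  have g2: "M2 ''ty'' (int i) = int (ty T i)" "M2 ''al'' (int i) = al T i" "M2 ''setup_times'' (int i) = si i" "M2 ''P'' (int i) = Pi i"
    "M2 ''ci'' 0 = int i" "M2 ''TN'' 0 = N" "M2 ''TD'' 0 = Dn" "M2 ''s4'' 0 = 4 * Dn * si i" "M2 ''t4'' 0 = 4 * Dn * ti j"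
    using tyi v1 k(9,10) by (simp_all add: f2 f1 OUT_def)
  have v3: "M3 ''0am'' 0 = 4 * Dn * ti j - M2 ''1dd'' 0"
    "M3 ''0pp'' 0 = (if ty T i = 1 then 6 * N - 4 * Dn * (si i + Pi i) else if ty T i \<le> 2 then 0 else 2 * N - 4 * Dn * si i)"
    "M3 ''0oo'' 0 = (if ty T i = 0 then 4 * Dn * (si i + Pi i) - (al T i - 1) * (4 * N - 4 * Dn * si i) else 6 * N)"
    "M3 ''0ee'' 0 = (if ty T i = 0 then 4 * N else 6 * N)"
    unfolding M3_def job2_def using g2 by auto
  have P3: "par CHR ''0'' (4 * Dn) (int m) (s i) (p0 T i) (bo T i) (bc T i) i j (t j - d) M3"
  proof -
    have "real_of_int (M3 ''0am'' 0) = real_of_int (4 * Dn) * (t j - d)" unfolding v3 using m2(3) by (simp add: real_ti algebra_simps)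
    moreover have "real_of_int (M3 ''0pp'' 0) = real_of_int (4 * Dn) * p0 T i"
      unfolding v3 p0_def by (simp add: NT real_si real_Pi L_def algebra_simps)
    moreover have "real_of_int (M3 ''0oo'' 0) = real_of_int (4 * Dn) * bo T i"
      unfolding v3 bo_def by (simp add: NT real_si real_Pi L_def algebra_simps)
    moreover have "real_of_int (M3 ''0ee'' 0) = real_of_int (4 * Dn) * bc T i" unfolding v3 bc_def by (simp add: NT)
    moreover have "M3 ''la'' 0 = 4 * Dn" "M3 ''0lm'' 0 = int m" "M3 ''ci'' 0 = int i" "M3 ''jj'' 0 = int j" "M3 ''s4'' 0 = 4 * Dn * si i"
      using kc j(2) tyi(6) v1 by (simp_all add: f3 f2 f1 OUT_def)
    ultimately show ?thesis unfolding par_def using Dp by (simp add: real_si)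
  qed
  have C3: "rel CHR ''0'' (4 * Dn) cm M3" "rel CHR ''1'' (4 * Dn) cs' M3" using C2 m2(1) unfolding rel_def by (simp_all add: f3 split: prod.splits)
  have "outputs M3 (S @ E1) = outputs M2 (S @ E1)" by (rule outputs_cong, rule f3) (auto simp: OUT_def)
  then have o3: "outputs M3 (S @ E1)" using m2(2) by simp
  have pu3: "put (int m) (s i) (p0 T i) (bo T i) (bc T i) i j (t j - d) cm = (cm', E2, d2)" using e2 unfolding mp_def i_def .
  define M4 where "M4 = run (put_c CHR ''0'') M3"
  have m4: "rel CHR ''0'' (4 * Dn) cm' M4" "outputs M4 ((S @ E1) @ E2)" using put_ok[OF P3 C3(1) o3 pu3] unfolding M4_def by simp_all
  have f4: "y \<notin> OUT ==> y \<notin> {''0k'', ''0x'', ''0b'', ''0r'', ''0dd''} ==> M4 y = M3 y" for y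
    unfolding M4_def by (rule run_frame) (use wr_put[of "CHR ''0''"] in auto)
  have "rel CHR ''1'' (4 * Dn) cs' M4" using C3(2) unfolding rel_def by (simp add: f4 OUT_def split: prod.splits)
  moreover have "run job_c M = M4" unfolding job_c_def M4_def M3_def M2_def M1_def by simp
  ultimately show ?thesis using m4 S' by simp
qed

definition jl :: "nat \<Rightarrow> nat list" where
  "jl k = concat (map (\<lambda>y. if ty T (cl (js ! (y mod n))) = y div n then [js ! (y mod n)] else []) [0..<k])"

lemma jl_all: "jl (7 * n) = jlist T js"
proof -
  have f: "concat (map (\<lambda>p. if P (xs ! p) then [xs ! p] else []) [0..<length xs]) = filter P xs" for P :: "nat \<Rightarrow> bool" and xs
  proof (induction xs rule: rev_induct)
    case (snoc x xs)
    have "map (\<lambda>p. if P ((xs @ [x]) ! p) then [(xs @ [x]) ! p] else []) [0..<length xs] = map (\<lambda>p. if P (xs ! p) then [xs ! p] else []) [0..<length xs]"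
      by (rule map_cong) (auto simp: nth_append)
    moreover have "[0..<length (xs @ [x])] = [0..<length xs] @ [length xs]" by simp
    ultimately show ?case by (simp only: map_append concat_append snoc) simp
  qed simp
  have len: "length js = n" using js by (simp add: jobs_list_def)
  have "jl (v * n) = concat (map (\<lambda>v. filter (\<lambda>j. ty T (cl j) = v) js) [0..<v])" for v
  proof (induction v)
    case 0
    then show ?case by (simp add: jl_def)
  next
    case (Suc v)
    have up: "[0..<Suc v * n] = [0..<v * n] @ map (\<lambda>p. p + v * n) [0..<n]"
    proof -
      have "[0..<v * n + n] = [0..<v * n] @ [v * n..<v * n + n]" by (rule upt_add_eq_append) simp
      moreover have "map (\<lambda>p. p + v * n) [0..<n] = [v * n..<v * n + n]" by (simp add: map_add_upt add.commute)
      ultimately show ?thesis by (simp add: add.commute)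
    qed
    have "map (\<lambda>y. if ty T (cl (js ! (y mod n))) = y div n then [js ! (y mod n)] else []) (map (\<lambda>p. p + v * n) [0..<n])
      = map (\<lambda>p. if ty T (cl (js ! p)) = v then [js ! p] else []) [0..<length js]"
      unfolding len map_map by (rule map_cong) (use n0 in auto)
    then have "concat (map (\<lambda>y. if ty T (cl (js ! (y mod n))) = y div n then [js ! (y mod n)] else []) (map (\<lambda>p. p + v * n) [0..<n]))
      = filter (\<lambda>j. ty T (cl j) = v) js" using f[of "\<lambda>j. ty T (cl j) = v" js] by simp
    then show ?case using Suc.IH unfolding jl_def up by simp
  qed
  from this[of 7] show ?thesis by (simp add: jlist_def)
qed

lemma construct_ok:
  assumes M: "st (env1 js) M" "tested T M" "M ''TN'' 0 = N" "M ''TD'' 0 = Dn" "M ''out_length'' 0 = 0"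
  shows "ex construct (7 * n * 1300 + 200) (\<lambda>M'. outputs M' (sched_of T js)) M"
proof -
  define M1 where "M1 = run cinit M"
  define Inv where "Inv k M' \<longleftrightarrow> K M' \<and> (case foldl (step T) (cs0 T, cm0 T, []) (jl k) of (cs, cm, S) \<Rightarrow>
    rel CHR ''1'' (4 * Dn) cs M' \<and> rel CHR ''0'' (4 * Dn) cm M' \<and> outputs M' S)" for k and M' :: memory
  have tst: "M ''SA'' 0 = AA T" "M ''SC'' 1 = ll T" using M(2) aT unfolding tested_def acc_def by simp_all
  have mm: "M ''m'' 0 = int m" using M(1) by (simp add: env1_def env_def st_def)
  have f1: "y \<notin> {''la'', ''1lm'', ''1pp'', ''1oo'', ''1ee'', ''0lm'', ''1k'', ''1x'', ''1b'', ''1r'', ''0k'', ''0x'', ''0b'', ''0r''} ==> M1 y = M y" for y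
    unfolding M1_def by (rule run_frame) (simp add: cinit_def)
  have st1: "st (env1 js) M1" by (rule st_frame[OF M(1)]) (auto simp: f1 env1_def env_def)
  have t1: "tested T M1" using M(2) unfolding tested_def by (simp add: f1)
  have v1: "M1 ''la'' 0 = 4 * Dn" "M1 ''1lm'' 0 = AA T + ll T" "M1 ''1pp'' 0 = 0" "M1 ''1oo'' 0 = 2 * N" "M1 ''1ee'' 0 = 2 * N" "M1 ''0lm'' 0 = int m"
    "M1 ''1k'' 0 = AA T" "M1 ''1x'' 0 = 0" "M1 ''1b'' 0 = 2 * N" "M1 ''1r'' 0 = - 1" "M1 ''0k'' 0 = - 1" "M1 ''0x'' 0 = 6 * N" "M1 ''0b'' 0 = 6 * N"
    "M1 ''0r'' 0 = - 1" "M1 ''TN'' 0 = N" "M1 ''TD'' 0 = Dn" "M1 ''out_length'' 0 = 0"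
    unfolding M1_def cinit_def using M tst mm by simp_all
  have K1: "K M1" unfolding K_def using st1 t1 v1 by simp
  have c: "ex cinit 150 (\<lambda>M'. M' = M1) M" by (rule ex_lf) (simp_all add: cinit_def M1_def)
  have "ex (For ''y'' (Mul (Num 7) (V ''n'')) lbody) (7 * n * (1270 + acost (Mul (Num 7) (V ''n'')) + 10) + acost (Mul (Num 7) (V ''n'')) + 7) (Inv (7 * n)) M1"
  proof (rule ex_for)
    let ?M = "M1(''y'' := (M1 ''y'')(0 := 0))"
    have "K ?M" by (rule K_frame[OF K1]) (auto simp: WL_def)
    then show "Inv 0 ?M" unfolding Inv_def jl_def using v1
      by (simp add: rel_def cs0_def cm0_def NT outputs_def)
  next
    fix k M' assume k: "k < 7 * n" "Inv k M'" "M' ''y'' 0 = int k" and fr: "\<And>y. y \<notin> insert ''y'' (wr lbody) ==> M' y = M1 y"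
    obtain cs cm S where fo: "foldl (step T) (cs0 T, cm0 T, []) (jl k) = (cs, cm, S)" by (metis surj_pair)
    have I: "K M'" "rel CHR ''1'' (4 * Dn) cs M'" "rel CHR ''0'' (4 * Dn) cm M'" "outputs M' S" using k(2) unfolding Inv_def fo by simp_all
    define p where "p = k mod n"
    define v where "v = k div n"
    define j where "j = js ! p"
    have p: "p < n" using n0 by (simp add: p_def)
    have j: "j < n" unfolding j_def by (rule nth_js[OF js p])
    have kk: "int k div int n = int v" "int k - int v * int n = int p"
      by (simp_all add: v_def p_def of_nat_div of_nat_mod minus_div_mult_eq_mod)
    let ?pre = "Seq (Set ''v'' (Quot (V ''y'') (V ''n''))) (Seq (Set ''p'' (Sub (V ''y'') (Mul (V ''v'') (V ''n''))))
      (Seq (Set ''jj'' (Read ''od'' (V ''p''))) (Set ''ci'' (Read ''job_class'' (V ''jj'')))))"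
    define M2 where "M2 = run ?pre M'"
    note d = KD[OF I(1)]
    have v2: "M2 ''v'' 0 = int v" "M2 ''jj'' 0 = int j" "M2 ''ci'' 0 = int (cl j)" "M2 ''y'' 0 = int k"
      unfolding M2_def using k(3) d(8) d(7)[OF p] d(6)[OF j] kk by (simp_all add: j_def)
    have f2: "y \<notin> {''v'', ''p'', ''jj'', ''ci''} ==> M2 y = M' y" for y unfolding M2_def by (rule run_frame) simp
    have K2: "K M2" by (rule K_frame[OF I(1)]) (rule f2, auto simp: WL_def)
    have C2: "rel CHR ''1'' (4 * Dn) cs M2" "rel CHR ''0'' (4 * Dn) cm M2" using I(2,3) unfolding rel_def by (simp_all add: f2 split: prod.splits)
    have "outputs M2 S = outputs M' S" by (rule outputs_cong, rule f2) (auto simp: OUT_def)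
    then have o2: "outputs M2 S" using I(4) by simp
    have ty2: "M2 ''ty'' (M2 ''ci'' 0) = int (ty T (cl j))" unfolding v2 by (rule KD(1)[OF K2 cl_less[OF j]])
    have jS: "jl (Suc k) = jl k @ (if ty T (cl j) = v then [j] else [])" by (simp add: jl_def j_def v_def p_def)
    have fin: "M3 ''y'' 0 = int k \<and> Inv (Suc k) (M3(''y'' := (M3 ''y'')(0 := int (Suc k))))"
      if C3: "rel CHR ''1'' (4 * Dn) cs' M3" "rel CHR ''0'' (4 * Dn) cm' M3" "outputs M3 S'"
        and f3: "\<And>y. y \<notin> WL - {''v'', ''p'', ''jj'', ''ci'', ''y''} ==> M3 y = M2 y"
        and fo': "foldl (step T) (cs0 T, cm0 T, []) (jl (Suc k)) = (cs', cm', S')" for M3 cs' cm' S'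
    proof -
      let ?M4 = "M3(''y'' := (M3 ''y'')(0 := int (Suc k)))"
      have "K ?M4" by (rule K_frame[OF K2]) (use f3 in \<open>auto simp: WL_def\<close>)
      moreover have "rel CHR ''1'' (4 * Dn) cs' ?M4" "rel CHR ''0'' (4 * Dn) cm' ?M4" using C3(1,2) unfolding rel_def by (simp_all split: prod.splits)
      moreover have "outputs ?M4 S'" using C3(3) by (simp add: outputs_upd OUT_def)
      ultimately show ?thesis unfolding Inv_def fo' using f3[of "''y''"] v2(4) by simp
    qed
    have "run lbody M' ''y'' 0 = int k \<and> Inv (Suc k) ((run lbody M')(''y'' := (run lbody M' ''y'')(0 := int (Suc k))))"
    proof (cases "ty T (cl j) = v")
      case True
      obtain cs' cm' S' where sp: "step T (cs, cm, S) j = (cs', cm', S')" by (metis surj_pair)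
      have r: "run lbody M' = run job_c M2" unfolding lbody_def M2_def[symmetric] using ty2 v2 True by (simp add: M2_def)
      show ?thesis unfolding r
      proof (rule fin)
        show "y \<notin> WL - {''v'', ''p'', ''jj'', ''ci'', ''y''} ==> run job_c M2 y = M2 y" for y by (rule run_frame) (use wr_job_c in auto)
        show "foldl (step T) (cs0 T, cm0 T, []) (jl (Suc k)) = (cs', cm', S')" unfolding jS using True fo sp by simp
      qed (use job_ok[OF K2 j v2(2,3) C2 o2 sp] in auto)
    next
      case False
      have tv: "M2 ''ty'' (int (cl j)) = int (ty T (cl j))" using ty2 v2(3) by simp
      have "ty T (cl j) < v \<or> v < ty T (cl j)" using False by linarith
      then have nb: "\<not> bval (Conj (Neg (Less tyc (V ''v''))) (Neg (Less (V ''v'') tyc))) M2" by (auto simp: tv v2)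
      have "run lbody M' = run (Cond (Conj (Neg (Less tyc (V ''v''))) (Neg (Less (V ''v'') tyc))) job_c Skip) M2"
        unfolding lbody_def M2_def run.simps(3)[of ?pre] by (rule refl)
      then have r: "run lbody M' = M2" by (simp only: run.simps(4) nb if_False run.simps(1))
      show ?thesis unfolding r
        by (rule fin[OF C2 o2]) (use jS False fo in auto)
    qed
    then show "ex lbody 1270 (\<lambda>M''. M'' ''y'' 0 = int k \<and> Inv (Suc k) (M''(''y'' := (M'' ''y'')(0 := int (Suc k))))) M'"
      by (intro ex_lf) (use cc_job_c in \<open>simp_all add: lbody_def\<close>)
  next
    fix k M' assume "Inv k M'"
    then show "aval (Mul (Num 7) (V ''n'')) M' = int (7 * n)" using KD(8) by (auto simp: Inv_def split: prod.splits)
  qed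
  then have "ex construct (150 + (7 * n * (1270 + acost (Mul (Num 7) (V ''n'')) + 10) + acost (Mul (Num 7) (V ''n'')) + 7)) (Inv (7 * n)) M"
    unfolding construct_def by (intro ex_seq[OF c]) simp
  then show ?thesis
    by (rule ex_conseq) (auto simp: Inv_def jl_all sched_of_def split: prod.splits)
qed

end

lemma good_acc: "0 < n ==> good T ==> acc T" unfolding good_def using Tst_props(1) by blast

theorem part1_ok:
  assumes n: "0 < n" and l: "NN \<le> 2 ^ l"
  shows "ex part1 (22 * U2 l + 1 + (l * (25 * U + 200) + 25 * U + 500)) (\<lambda>M. \<exists>js. jobs_list js \<and> st (env1 js) M \<and>
    0 < M ''RD'' 0 \<and> good (vl (M ''RN'' 0, M ''RD'' 0)) \<and> M ''out_length'' 0 = 0) (input_memory I)"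
proof -
  have len: "length (prep1 @ prep2) = 22" by (simp add: prep1_def prep2_def)
  have v: "length (job_class I) = n" using valid by (simp add: valid_instance_def)
  have "st init (input_memory I)"
    unfolding init_def input_memory_def
    by (simp add: st_simps scalar_array_def list_array_def si_def ti_def cl_def v num_jobs_def[symmetric] num_classes_def[symmetric])
  then have p: "ex (sq (prep1 @ prep2)) (22 * U2 l + 1) (\<lambda>M. \<exists>js F. jobs_list js \<and> keys F \<and> st (env2 js F) M) (input_memory I)"
    using prep1_hs[OF n l] len unfolding hs_def by simp
  have "ex part1 (22 * U2 l + 1 + (l * (25 * U + 200) + 25 * U + 500)) (\<lambda>M. \<exists>js. jobs_list js \<and> st (env1 js) M \<and>
    0 < M ''RD'' 0 \<and> good (vl (M ''RN'' 0, M ''RD'' 0))) (input_memory I)"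
    unfolding part1_def
  proof (rule ex_seq[OF p], elim exE conjE)
    fix M js F assume M: "jobs_list js" "keys F" "st (env2 js F) M"
    show "ex find (l * (25 * U + 200) + 25 * U + 500) (\<lambda>M. \<exists>js. jobs_list js \<and> st (env1 js) M \<and> 0 < M ''RD'' 0 \<and> good (vl (M ''RN'' 0, M ''RD'' 0))) M"
      by (rule ex_conseq[OF find_ok[OF n l M(2,3)]]) (use M(1) in auto)
  qed
  then show ?thesis
  proof (rule ex_conseq[OF _ order_refl])
    fix M' assume a: "\<exists>js. jobs_list js \<and> st (env1 js) M' \<and> 0 < M' ''RD'' 0 \<and> good (vl (M' ''RN'' 0, M' ''RD'' 0))"
      and fr: "\<And>x. x \<notin> wr part1 ==> M' x = input_memory I x"
    have w: "wr find \<subseteq> insert ''RN'' (insert ''RD'' (wr sbody))" by (auto simp: find_def search_def wr_sbody root_def wr_root1 get_def)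
    have "''out_length'' \<notin> wr (sq (prep1 @ prep2))" by (simp add: prep1_def prep2_def wr_inc wr_rank wr_sort_prog wr_loopK)
    moreover have "''out_length'' \<notin> wr find" using w by (auto simp: wr_sbody wr_test)
    ultimately have "M' ''out_length'' = input_memory I ''out_length''" by (intro fr) (simp add: part1_def)
    then have "M' ''out_length'' 0 = 0" by (simp add: input_memory_def)
    then show "\<exists>js. jobs_list js \<and> st (env1 js) M' \<and> 0 < M' ''RD'' 0 \<and> good (vl (M' ''RN'' 0, M' ''RD'' 0)) \<and> M' ''out_length'' 0 = 0" using a by blast
  qed
qed

theorem part2_ok:
  assumes n: "0 < n" and M: "jobs_list js" "st (env1 js) M" "0 < M ''RD'' 0" "good (vl (M ''RN'' 0, M ''RD'' 0))" "M ''out_length'' 0 = 0"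
  shows "ex part2 (10 + ((25 * U + 1) + (7 * n * 1300 + 200))) (\<lambda>M'. \<exists>S. outputs M' S \<and> feasible_pmtn I S \<and> makespan S \<le> 3 / 2 * OPT_pmtn I) M"
proof -
  define N where "N = M ''RN'' 0"
  define Dn where "Dn = M ''RD'' 0"
  define T where "T = vl (N, Dn)"
  have Dp: "0 < Dn" and g: "good T" using M(3,4) by (simp_all add: Dn_def N_def T_def)
  have aT: "acc T" by (rule good_acc[OF n g])
  have fe: "feasible_pmtn I (sched_of T js) \<and> makespan (sched_of T js) \<le> 3 / 2 * OPT_pmtn I"
    using g M(1) approx[OF n] unfolding good_def jobs_list_def by blast
  have 1: "ex (Seq (Set ''TN'' (V ''RN'')) (Set ''TD'' (V ''RD''))) 10 (\<lambda>M'. M' ''TN'' 0 = N \<and> M' ''TD'' 0 = Dn) M"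
    by (rule ex_lf) (simp_all add: N_def Dn_def)
  show ?thesis
    unfolding part2_def
  proof (rule ex_seq[OF 1])
    fix M1 assume m1: "M1 ''TN'' 0 = N \<and> M1 ''TD'' 0 = Dn" and fr1: "\<And>x. x \<notin> wr (Seq (Set ''TN'' (V ''RN'')) (Set ''TD'' (V ''RD''))) ==> M1 x = M x"
    have st1: "st (env1 js) M1" by (rule st_frame[OF M(2)]) (use fr1 in \<open>auto simp: env1_def env_def\<close>)
    have o1: "M1 ''out_length'' 0 = 0" using fr1[of "''out_length''"] M(5) by simp
    have e1: "st env M1" using st1 by (auto simp: env1_def st_def)
    have t: "ex (sq test) (25 * U + 1) (tested T) M1" unfolding T_def by (rule test_ok[OF e1]) (use m1 Dp in auto)
    show "ex (Seq (sq test) construct) ((25 * U + 1) + (7 * n * 1300 + 200)) (\<lambda>M'. \<exists>S. outputs M' S \<and> feasible_pmtn I S \<and> makespan S \<le> 3 / 2 * OPT_pmtn I) M1"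
    proof (rule ex_seq[OF t])
      fix M2 assume t2: "tested T M2" and fr2: "\<And>x. x \<notin> wr (sq test) ==> M2 x = M1 x"
      have st2: "st (env1 js) M2" by (rule st_frame[OF st1]) (use fr2 in \<open>auto simp: env1_def env_def wr_test\<close>)
      have m2: "M2 ''TN'' 0 = N" "M2 ''TD'' 0 = Dn" "M2 ''out_length'' 0 = 0"
        using fr2[of "''TN''"] fr2[of "''TD''"] fr2[of "''out_length''"] m1 o1 by (simp_all add: wr_test)
      have "ex construct (7 * n * 1300 + 200) (\<lambda>M'. outputs M' (sched_of T js)) M2"
        by (rule construct_ok[OF M(1) Dp T_def aT n st2 t2 m2])
      then show "ex construct (7 * n * 1300 + 200) (\<lambda>M'. \<exists>S. outputs M' S \<and> feasible_pmtn I S \<and> makespan S \<le> 3 / 2 * OPT_pmtn I) M2"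
        by (rule ex_conseq) (use fe in auto)
    qed
  qed
qed

end

section \<open>Word length and running time\<close>

text \<open>A solution of the inequalities that \<open>wt\<close> imposes on the first part. The
  input arrays have degree 1, being bounded by the magnitude; arrays that are still zero have degree
  0.\<close>

definition dg1 :: "string \<Rightarrow> nat" where
  "dg1 x = (case map_of [(''A0'', 45), (''A1'', 43), (''A2'', 47), (''B0'', 64), (''B1'', 63), (''B2'', 64), (''KD'', 5), (''KN'', 29), 
    (''LD'', 5), (''LN'', 29), (''N'', 16), (''P'', 14), (''RD'', 64), (''RN'', 57), (''SA'', 48), (''SC'', 5), 
    (''SD'', 29), (''SK'', 14), (''SL'', 24), (''TD'', 5), (''TN'', 29), (''a'', 5), (''al'', 39), (''b'', 35), 
    (''bg'', 5), (''c'', 1), (''cn'', 5), (''i'', 5), (''j'', 5), (''job_class'', 1), (''job_times'', 1), 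
    (''k'', 5), (''lb'', 25), (''lo'', 5), (''m'', 1), (''md'', 25), (''n'', 1), (''nj'', 5), (''o0'', 5), 
    (''od'', 48), (''rk'', 5), (''sa'', 15), (''setup_times'', 1), (''sm'', 14), (''ty'', 5), (''ub'', 25), 
    (''w'', 26)] x of Some k \<Rightarrow> k | None \<Rightarrow> 0)"

text \<open>After the first part a cell may exceed its power in \<open>dg1\<close> by a factor given
  by the running time, which is below the ninth power of the base. Adding 9 absorbs this factor, and
  the clock of the second part starts again at 0.\<close>

definition dg2 :: "string \<Rightarrow> nat" where
  "dg2 x = max (dg1 x + 9) (case map_of [(''0am'', 183), (''0b'', 242), (''0dd'', 261), (''0ee'', 80), (''0lm'', 10), (''0oo'', 242), (''0pp'', 121), 
    (''0r'', 10), (''0x'', 252), (''1am'', 153), (''1b'', 80), (''1dd'', 174), (''1ee'', 80), (''1k'', 124), 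
    (''1lm'', 124), (''1oo'', 80), (''1r'', 10), (''1x'', 165), (''A0'', 63), (''A2'', 63), (''B0'', 140), 
    (''B1'', 139), (''B2'', 140), (''SA'', 124), (''SD'', 47), (''TD'', 73), (''TN'', 66), (''al'', 115), 
    (''ci'', 10), (''jj'', 57), (''la'', 87), (''out_finish_den'', 87), (''out_finish_num'', 252), 
    (''out_index'', 57), (''out_machine'', 124), (''out_start_den'', 87), (''out_start_num'', 252), (''p'', 47), 
    (''s4'', 106), (''t4'', 153), (''v'', 19)] x of Some k \<Rightarrow> k | None \<Rightarrow> 0)"

lemma dg1: "dg1 ''A0'' = 45"
  "dg1 ''A1'' = 43"
  "dg1 ''A2'' = 47"
  "dg1 ''B0'' = 64"
  "dg1 ''B1'' = 63"
  "dg1 ''B2'' = 64"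
  "dg1 ''KD'' = 5"
  "dg1 ''KN'' = 29"
  "dg1 ''LD'' = 5"
  "dg1 ''LN'' = 29"
  "dg1 ''N'' = 16"
  "dg1 ''P'' = 14"
  "dg1 ''RD'' = 64"
  "dg1 ''RN'' = 57"
  "dg1 ''SA'' = 48"
  "dg1 ''SC'' = 5"
  "dg1 ''SD'' = 29"
  "dg1 ''SK'' = 14"
  "dg1 ''SL'' = 24"
  "dg1 ''TD'' = 5"
  "dg1 ''TN'' = 29"
  "dg1 ''a'' = 5"
  "dg1 ''al'' = 39"
  "dg1 ''b'' = 35"
  "dg1 ''bg'' = 5"
  "dg1 ''c'' = 1"
  "dg1 ''cn'' = 5"
  "dg1 ''i'' = 5"
  "dg1 ''j'' = 5"
  "dg1 ''job_class'' = 1"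
  "dg1 ''job_times'' = 1"
  "dg1 ''k'' = 5"
  "dg1 ''lb'' = 25"
  "dg1 ''lo'' = 5"
  "dg1 ''m'' = 1"
  "dg1 ''md'' = 25"
  "dg1 ''n'' = 1"
  "dg1 ''nj'' = 5"
  "dg1 ''o0'' = 5"
  "dg1 ''od'' = 48"
  "dg1 ''rk'' = 5"
  "dg1 ''sa'' = 15"
  "dg1 ''setup_times'' = 1"
  "dg1 ''sm'' = 14"
  "dg1 ''ty'' = 5"
  "dg1 ''ub'' = 25"
  "dg1 ''w'' = 26"
  by (simp_all add: dg1_def)

lemma dg1_0: "dg1 ''0am'' = 0"
  "dg1 ''0b'' = 0"
  "dg1 ''0dd'' = 0"
  "dg1 ''0ee'' = 0"
  "dg1 ''0k'' = 0"
  "dg1 ''0lm'' = 0"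
  "dg1 ''0oo'' = 0"
  "dg1 ''0pp'' = 0"
  "dg1 ''0r'' = 0"
  "dg1 ''0x'' = 0"
  "dg1 ''1am'' = 0"
  "dg1 ''1b'' = 0"
  "dg1 ''1dd'' = 0"
  "dg1 ''1ee'' = 0"
  "dg1 ''1k'' = 0"
  "dg1 ''1lm'' = 0"
  "dg1 ''1oo'' = 0"
  "dg1 ''1pp'' = 0"
  "dg1 ''1r'' = 0"
  "dg1 ''1x'' = 0"
  "dg1 ''ci'' = 0"
  "dg1 ''jj'' = 0"
  "dg1 ''la'' = 0"
  "dg1 ''out_finish_den'' = 0"
  "dg1 ''out_finish_num'' = 0"
  "dg1 ''out_index'' = 0"
  "dg1 ''out_kind'' = 0"
  "dg1 ''out_length'' = 0"
  "dg1 ''out_machine'' = 0"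
  "dg1 ''out_start_den'' = 0"
  "dg1 ''out_start_num'' = 0"
  "dg1 ''p'' = 0"
  "dg1 ''s4'' = 0"
  "dg1 ''t4'' = 0"
  "dg1 ''v'' = 0"
  "dg1 ''y'' = 0"
  by (simp_all add: dg1_def)

lemma dg2: "dg2 ''0am'' = 183"
  "dg2 ''0b'' = 242"
  "dg2 ''0dd'' = 261"
  "dg2 ''0ee'' = 80"
  "dg2 ''0k'' = 9"
  "dg2 ''0lm'' = 10"
  "dg2 ''0oo'' = 242"
  "dg2 ''0pp'' = 121"
  "dg2 ''0r'' = 10"
  "dg2 ''0x'' = 252"
  "dg2 ''1am'' = 153"
  "dg2 ''1b'' = 80"
  "dg2 ''1dd'' = 174"
  "dg2 ''1ee'' = 80"
  "dg2 ''1k'' = 124"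
  "dg2 ''1lm'' = 124"
  "dg2 ''1oo'' = 80"
  "dg2 ''1pp'' = 9"
  "dg2 ''1r'' = 10"
  "dg2 ''1x'' = 165"
  "dg2 ''A0'' = 63"
  "dg2 ''A1'' = 52"
  "dg2 ''A2'' = 63"
  "dg2 ''B0'' = 140"
  "dg2 ''B1'' = 139"
  "dg2 ''B2'' = 140"
  "dg2 ''KD'' = 14"
  "dg2 ''KN'' = 38"
  "dg2 ''LD'' = 14"
  "dg2 ''LN'' = 38"
  "dg2 ''N'' = 25"
  "dg2 ''P'' = 23"
  "dg2 ''RD'' = 73"
  "dg2 ''RN'' = 66"
  "dg2 ''SA'' = 124"
  "dg2 ''SC'' = 14"
  "dg2 ''SD'' = 47"
  "dg2 ''SK'' = 23"
  "dg2 ''SL'' = 33"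
  "dg2 ''TD'' = 73"
  "dg2 ''TN'' = 66"
  "dg2 ''a'' = 14"
  "dg2 ''al'' = 115"
  "dg2 ''b'' = 44"
  "dg2 ''bg'' = 14"
  "dg2 ''c'' = 10"
  "dg2 ''ci'' = 10"
  "dg2 ''cn'' = 14"
  "dg2 ''i'' = 14"
  "dg2 ''j'' = 14"
  "dg2 ''jj'' = 57"
  "dg2 ''job_class'' = 10"
  "dg2 ''job_times'' = 10"
  "dg2 ''k'' = 14"
  "dg2 ''la'' = 87"
  "dg2 ''lb'' = 34"
  "dg2 ''lo'' = 14"
  "dg2 ''m'' = 10"
  "dg2 ''md'' = 34"
  "dg2 ''n'' = 10"
  "dg2 ''nj'' = 14"
  "dg2 ''o0'' = 14"
  "dg2 ''od'' = 57"
  "dg2 ''out_finish_den'' = 87"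
  "dg2 ''out_finish_num'' = 252"
  "dg2 ''out_index'' = 57"
  "dg2 ''out_kind'' = 9"
  "dg2 ''out_length'' = 9"
  "dg2 ''out_machine'' = 124"
  "dg2 ''out_start_den'' = 87"
  "dg2 ''out_start_num'' = 252"
  "dg2 ''p'' = 47"
  "dg2 ''rk'' = 14"
  "dg2 ''s4'' = 106"
  "dg2 ''sa'' = 24"
  "dg2 ''setup_times'' = 10"
  "dg2 ''sm'' = 23"
  "dg2 ''t4'' = 153"
  "dg2 ''ty'' = 14"
  "dg2 ''ub'' = 34"
  "dg2 ''v'' = 19"
  "dg2 ''w'' = 35"
  "dg2 ''y'' = 9"
  by (simp_all add: dg2_def dg1 dg1_0)

text \<open>9 is the exponent of the bound on the running time. 262 bounds the degree of every
  expression in both parts and becomes the exponent of the word bound.\<close>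

lemma wt1: "wt dg1 9 262 part1"
  by (simp add: part1_def prep1_def prep2_def find_def search_def sbody_def set_mid_def get_def root_def root1_def test_def classify_def inc_def For_def
    loopK_def rank_loop_def sort_prog_def sort_pass_def merge_body_def merge_cond_def merge_take_def copy_body_def acb_def Let_def dg1)

lemma wt2: "wt dg2 9 262 part2"
  by (simp add: part2_def test_def classify_def inc_def For_def construct_def cinit_def lbody_def job_c_def job1_def job2_def put_c_def opn_c_def pce_c_def
    emit_def Let_def dg2)

lemma magnitude_bounds:
  assumes "valid_instance I" "0 < num_jobs I"
  shows "num_jobs I + 6 \<le> magnitude I" "\<bar>input_memory I x z\<bar> \<le> int (magnitude I) ^ dg1 x"
proof -
  interpret inst I by unfold_locales (rule assms(1))
  have c0: "0 < c" using cl_less[OF assms(2)] by simp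
  have v: "length (job_class I) = n" "\<And>i. i < c ==> 0 < setup_times I ! i" "\<And>j. j < n ==> 0 < job_times I ! j"
    using assms(1) by (simp_all add: valid_instance_def)
  have ss: "setup_times I ! i \<le> sum_list (setup_times I)" if "i < c" for i
    using that by (intro elem_le_sum_list) (simp add: num_classes_def)
  have st: "job_times I ! j \<le> sum_list (job_times I)" if "j < n" for j
    using that by (intro elem_le_sum_list) (simp add: num_jobs_def)
  show "n + 6 \<le> magnitude I"
    using ss[OF c0] st[OF assms(2)] v(2)[OF c0] v(3)[OF assms(2)] m_pos c0 unfolding magnitude_def by linarith
  have m1: "1 \<le> int (magnitude I)" by (simp add: magnitude_def)
  have la: "\<bar>list_array xs z\<bar> \<le> int (magnitude I)" if "\<And>k. k < length xs ==> xs ! k \<le> magnitude I" for xs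
    using that m1 by (auto simp: list_array_def nat_less_iff)
  have "job_class I ! j \<le> magnitude I" if "j < n" for j using cl_less[OF that] by (simp add: cl_def magnitude_def)
  then have a: "\<bar>list_array (job_class I) z\<bar> \<le> int (magnitude I)" by (intro la) (simp add: v)
  have b: "\<bar>list_array (job_times I) z\<bar> \<le> int (magnitude I)"
    by (rule la) (use st in \<open>fastforce simp: num_jobs_def magnitude_def\<close>)
  have d: "\<bar>list_array (setup_times I) z\<bar> \<le> int (magnitude I)"
    by (rule la) (use ss in \<open>fastforce simp: num_classes_def magnitude_def\<close>)
  have e: "\<bar>scalar_array k z\<bar> \<le> int (magnitude I)" if "k \<le> magnitude I" for k
    unfolding scalar_array_def by (rule la) (use that in simp)
  have f: "m \<le> magnitude I" "n \<le> magnitude I" "c \<le> magnitude I" by (simp_all add: magnitude_def)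
  consider "x = ''m''" | "x = ''n''" | "x = ''c''" | "x = ''setup_times''" | "x = ''job_times''" | "x = ''job_class''"
    | "x \<notin> {''m'', ''n'', ''c'', ''setup_times'', ''job_times'', ''job_class''}" by blast
  then show "\<bar>input_memory I x z\<bar> \<le> int (magnitude I) ^ dg1 x"
  proof cases
    case 7
    then have "input_memory I x z = 0" by (simp add: input_memory_def)
    then show ?thesis by simp
  qed (use a b d e f in \<open>simp_all add: input_memory_def dg1\<close>)
qed

lemma empty_schedule:
  assumes "valid_instance I" "num_jobs I = 0"
  shows "feasible_pmtn I []" "makespan [] \<le> 3 / 2 * OPT_pmtn I"
proof -
  show f: "feasible_pmtn I []" using assms(2) by (simp add: feasible_pmtn_def)
  have "0 \<le> makespan S" for S unfolding makespan_def by (rule Max_ge) auto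
  then have "0 \<le> OPT_pmtn I" unfolding OPT_pmtn_def by (intro cInf_greatest) (use f in auto)
  then show "makespan [] \<le> 3 / 2 * OPT_pmtn I" by (simp add: makespan_def)
qed

text \<open>Without jobs the empty schedule is optimal, and memory filled with zeros already
  describes it as output.\<close>

definition whole :: com where
  "whole = Cond (Less (Num 0) (V ''n'')) (Seq part1 part2) Skip"

text \<open>The summand 6 is the cost of the initial test and \<open>Skip\<close> on an empty
  instance; the other term covers both program parts.\<close>

definition steps :: "nat \<Rightarrow> real" where
  "steps n = 6 + 74000 * real n * (log 2 (18 * real n) + 1)"

lemma steps_bigo: "steps \<in> O(\<lambda>n. real n * ln (real n))"
\<comment> \<open>From 18 on, \<open>ln (18 * n)\<close> is at most \<open>2 * ln n\<close>, and
  \<open>1 \<le> 2 * ln 2\<close> turns this into a bound of \<open>4 * ln n\<close> on the binary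
  logarithm. The constant is \<open>5 * 74000 + 6\<close>.\<close>
proof (rule bigoI[where c = 370006])
  show "\<forall>\<^sub>F n in sequentially. norm (steps n) \<le> 370006 * norm (real n * ln (real n))"
    using eventually_ge_at_top[of 18]
  proof eventually_elim
    fix n :: nat assume n: "18 \<le> n"
    define x where "x = real n"
    define l where "l = ln x"
    have x: "18 \<le> x" using n by (simp add: x_def)
    have "exp 1 \<le> x" using exp_le x by linarith
    then have l1: "1 \<le> l" using x unfolding l_def by (subst ln_ge_iff) auto
    have "1 = ln (exp (1::real))" by simp
    also have "\<dots> \<le> ln 4" using exp_le by (subst ln_le_cancel_iff) auto
    also have "ln (4::real) = 2 * ln 2" using ln_mult[of "2::real" 2] by simp
    finally have l2: "1 \<le> 2 * ln (2::real)" .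
    have "ln (18 * x) \<le> ln (x * x)" using x by (subst ln_le_cancel_iff) (auto intro: mult_right_mono)
    also have "\<dots> = 2 * l" using x ln_mult[of x x] by (simp add: l_def)
    finally have "ln (18 * x) \<le> 2 * l" .
    moreover have "2 * l * 1 \<le> 2 * l * (2 * ln 2)" using l1 l2 by (intro mult_left_mono) auto
    ultimately have "ln (18 * x) \<le> 4 * l * ln 2" by simp
    then have lg: "log 2 (18 * x) \<le> 4 * l" using l2 by (simp add: log_def pos_divide_le_eq)
    have lg0: "0 \<le> log 2 (18 * x)" using x by (subst zero_le_log_cancel_iff) auto
    have "log 2 (18 * x) + 1 \<le> 5 * l" using lg l1 by simp
    then have "74000 * x * (log 2 (18 * x) + 1) \<le> 74000 * x * (5 * l)" using x by (intro mult_left_mono) auto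
    moreover have "74000 * x * (5 * l) = 370000 * (x * l)" by simp
    moreover have "1 * 1 \<le> x * l" using x l1 by (intro mult_mono) auto
    ultimately have "steps n \<le> 370006 * (x * l)" unfolding steps_def x_def[symmetric] by linarith
    moreover have "0 \<le> steps n" unfolding steps_def x_def[symmetric] using x lg0 by simp
    moreover have "0 \<le> x * l" using x l1 by simp
    ultimately show "norm (steps n) \<le> 370006 * norm (real n * ln (real n))" by (simp add: x_def l_def)
  qed
qed

text \<open>The number of rounds is the rounded binary logarithm of \<open>7 * n + 2\<close>;
  rounding doubles the argument to \<open>14 * n + 4\<close>, which is at most
  \<open>18 * n\<close>. The crude bound \<open>n + 4\<close> keeps the running time below a power
  of the magnitude.\<close>

lemma size_log:
  assumes "0 < (n::nat)"
  obtains l :: nat where "7 * n + 2 \<le> 2 ^ l" "l \<le> n + 4" "real l \<le> log 2 (18 * real n)"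
proof -
  define x where "x = 7 * real n + 2"
  define l where "l = nat \<lceil>log 2 x\<rceil>"
  have x: "9 \<le> x" using assms by (simp add: x_def)
  have lp: "0 \<le> log 2 x" using x by (subst zero_le_log_cancel_iff) auto
  have rl: "real l = of_int \<lceil>log 2 x\<rceil>" using lp by (simp add: l_def)
  have "x = 2 powr (log 2 x)" using x by simp
  also have "\<dots> \<le> 2 powr real l" unfolding rl by (intro powr_mono) auto
  also have "\<dots> = 2 ^ l" by (simp add: powr_realpow)
  finally have "real (7 * n + 2) \<le> real (2 ^ l)" by (simp add: x_def)
  then have 1: "7 * n + 2 \<le> 2 ^ l" by (simp only: of_nat_le_iff)
  have "n < 2 ^ n" by (rule less_exp)
  then have "7 * n + 2 \<le> 2 ^ n * 16" using assms by linarith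
  then have "7 * n + 2 \<le> 2 ^ (n + 4)" by (simp add: power_add)
  then have "real (7 * n + 2) \<le> real (2 ^ (n + 4))" by (simp only: of_nat_le_iff)
  then have "x \<le> 2 powr real (n + 4)" unfolding powr_realpow[OF zero_less_numeral] by (simp add: x_def)
  then have "log 2 x \<le> real (n + 4)" using x by (subst log_le_iff) auto
  then have "\<lceil>log 2 x\<rceil> \<le> int (n + 4)" by (subst ceiling_le_iff) simp
  then have 2: "l \<le> n + 4" unfolding l_def by linarith
  have "real l \<le> log 2 x + 1" unfolding rl by linarith
  also have "\<dots> = log 2 (x * 2)" using x by (simp add: log_mult)
  also have "\<dots> \<le> log 2 (18 * real n)" using assms x by (subst log_le_cancel_iff) (auto simp: x_def)
  finally show thesis using that[OF 1 2] by blast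
qed

lemma exec_nonempty:
  assumes I: "valid_instance I" and n: "0 < num_jobs I"
  shows "\<exists>t M S. exec (int (magnitude I ^ 262)) whole (input_memory I) t M \<and> real t \<le> steps (num_jobs I) \<and> outputs M S \<and>
    feasible_pmtn I S \<and> makespan S \<le> 3 / 2 * OPT_pmtn I"
proof -
  interpret inst I by unfold_locales (rule I)
  obtain l where l: "7 * n + 2 \<le> 2 ^ l" "l \<le> n + 4" "real l \<le> log 2 (18 * real n)" using size_log[OF n] by blast
  define k1 where "k1 = 22 * U2 l + 1 + (l * (25 * U + 200) + 25 * U + 500)"
  define k2 where "k2 = 10 + ((25 * U + 1) + (7 * n * 1300 + 200))"
  obtain t1 M1 js where p1: "big part1 (input_memory I) t1 M1" "t1 \<le> k1" "jobs_list js" "st (env1 js) M1" "0 < M1 ''RD'' 0"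
    "good (vl (M1 ''RN'' 0, M1 ''RD'' 0))" "M1 ''out_length'' 0 = 0"
    using part1_ok[OF n, of l] l(1) unfolding ex_def NN_def k1_def[symmetric] by blast
  obtain t2 M2 S where p2: "big part2 M1 t2 M2" "t2 \<le> k2" "outputs M2 S" "feasible_pmtn I S" "makespan S \<le> 3 / 2 * OPT_pmtn I"
    using part2_ok[OF n p1(3-7)] unfolding ex_def k2_def[symmetric] by blast
  define B where "B = int (magnitude I)"
  have Bn: "int n + 6 \<le> B" using magnitude_bounds(1)[OF I n] unfolding B_def by linarith
  have B7: "7 \<le> B" using Bn n by linarith
  have k: "k1 + k2 + 10 \<le> 74000 * (n * (l + 1))"
  proof -
    obtain w where w: "w = l * n" by blast
    have "l \<le> w" using n by (simp add: w)
    moreover have "l * ((7 * n + 2) * 160 + 80) = 1120 * w + 400 * l" "l * (25 * U + 200) = 5000 * w + 10200 * l" "n * (l + 1) = w + n"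
      by (simp_all add: w U_def algebra_simps)
    ultimately show ?thesis using n unfolding k1_def k2_def U2_def by (simp add: U_def)
  qed
  have tot: "1 + int (k1 + k2) \<le> B ^ 9"
  proof -
    have "1 + int (k1 + k2) \<le> int (74000 * (n * (l + 1)))" using k by linarith
    also have "\<dots> = 74000 * (int n * int (l + 1))" by (simp only: of_nat_mult of_nat_numeral)
    also have "\<dots> \<le> B ^ 6 * (B * B)"
    proof (rule mult_mono)
      \<comment> \<open>The base is at least 7 by the bound \<open>num_jobs I + 6\<close> on the
        magnitude, and the sixth power of 7 is 117649.\<close>
      have "(7::int) ^ 6 \<le> B ^ 6" using B7 by (intro power_mono) auto
      then show "74000 \<le> B ^ 6" by simp
      show "int n * int (l + 1) \<le> B * B" using Bn l(2) by (intro mult_mono) auto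
    qed (use B7 in auto)
    also have "\<dots> = B ^ 8" by (simp add: power_numeral_reduce)
    also have "\<dots> \<le> B ^ 9" using B7 by (intro power_increasing) auto
    finally show ?thesis .
  qed
  have b1: "bnd B dg1 0 (input_memory I)" unfolding bnd_def B_def using magnitude_bounds(2)[OF I n] by simp
  have "exec (B ^ 262) part1 (input_memory I) t1 M1 \<and> bnd B dg1 (0 + t1) M1"
    by (rule big_exec[OF p1(1) wt1 _ b1]) (use B7 tot p1(2) in auto)
  then have e1: "exec (B ^ 262) part1 (input_memory I) t1 M1" and b2: "bnd B dg1 t1 M1" by auto
  have b3: "bnd B dg2 0 M1"
    unfolding bnd_def
  proof (intro allI)
    fix x z
    have "\<bar>M1 x z\<bar> \<le> B ^ dg1 x * (1 + int t1)" using b2 by (simp add: bnd_def)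
    also have "\<dots> \<le> B ^ dg1 x * B ^ 9" using B7 tot p1(2) by (intro mult_left_mono) auto
    also have "\<dots> \<le> B ^ dg2 x" unfolding power_add[symmetric] using B7 by (intro power_increasing) (auto simp: dg2_def)
    finally show "\<bar>M1 x z\<bar> \<le> B ^ dg2 x * (1 + int 0)" by simp
  qed
  have e2: "exec (B ^ 262) part2 M1 t2 M2"
    using big_exec[OF p2(1) wt2 _ b3] B7 tot p2(2) by auto
  have nB: "B \<le> B ^ 262" using B7 by (intro self_le_power) auto
  have in0: "input_memory I ''n'' 0 = int n" by (simp add: input_memory_def scalar_array_def list_array_def)
  let ?b = "Less (Num 0) (V ''n'')"
  have "bfits (B ^ 262) ?b (input_memory I)" using in0 Bn nB B7 by (simp add: afits_def)
  then have "exec (B ^ 262) whole (input_memory I) (1 + bcost ?b + (t1 + t2)) M2"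
    unfolding whole_def by (rule exec_CondTrue) (use in0 n exec_Seq[OF e1 e2] in auto)
  then have ex: "exec (int (magnitude I ^ 262)) whole (input_memory I) (1 + bcost ?b + (t1 + t2)) M2" by (simp add: B_def)
  have "1 + bcost ?b + (t1 + t2) \<le> 74000 * (n * (l + 1))" using p1(2) p2(2) k by simp
  then have "real (1 + bcost ?b + (t1 + t2)) \<le> real (74000 * (n * (l + 1)))" by (simp only: of_nat_le_iff)
  also have "\<dots> = 74000 * real n * (real l + 1)" by (simp add: algebra_simps)
  also have "\<dots> \<le> 74000 * real n * (log 2 (18 * real n) + 1)" using l(3) by (intro mult_left_mono) auto
  also have "\<dots> \<le> steps n" by (simp add: steps_def)
  finally show ?thesis using ex p2(3-5) by blast
qed

lemma exec_empty:
  assumes I: "valid_instance I" and n: "num_jobs I = 0"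
  shows "\<exists>t M S. exec (int (magnitude I ^ 262)) whole (input_memory I) t M \<and> real t \<le> steps (num_jobs I) \<and> outputs M S \<and>
    feasible_pmtn I S \<and> makespan S \<le> 3 / 2 * OPT_pmtn I"
proof -
  have in0: "input_memory I ''n'' 0 = 0" by (simp add: input_memory_def scalar_array_def list_array_def n)
  let ?b = "Less (Num 0) (V ''n'')"
  have "bfits (int (magnitude I ^ 262)) ?b (input_memory I)" using in0 by (simp add: afits_def)
  then have "exec (int (magnitude I ^ 262)) whole (input_memory I) (1 + bcost ?b + 1) (input_memory I)"
    unfolding whole_def by (rule exec_CondFalse) (use in0 exec_Skip in auto)
  moreover have "outputs (input_memory I) []" by (simp add: outputs_def input_memory_def)
  moreover have "real (1 + bcost ?b + 1) \<le> steps (num_jobs I)" by (simp add: steps_def n)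
  ultimately show ?thesis using empty_schedule[OF I n] by blast
qed

theorem theorem4p6:
  shows "\<exists>(prog :: com) (d :: nat) (f :: nat \<Rightarrow> real).
    f \<in> O(\<lambda>n. real n * ln (real n)) \<and>
    (\<forall>I. valid_instance I \<longrightarrow>
      (\<exists>t M S. exec (int (magnitude I ^ d)) prog (input_memory I) t M \<and>
         real t \<le> f (num_jobs I) \<and>
         outputs M S \<and>
         feasible_pmtn I S \<and>
         makespan S \<le> 3 / 2 * OPT_pmtn I))"
proof (rule exI[of _ whole], rule exI[of _ 262], rule exI[of _ steps], intro conjI allI impI)
  show "steps \<in> O(\<lambda>n. real n * ln (real n))" by (rule steps_bigo)
  show "\<exists>t M S. exec (int (magnitude I ^ 262)) whole (input_memory I) t M \<and> real t \<le> steps (num_jobs I) \<and> outputs M S \<and>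
    feasible_pmtn I S \<and> makespan S \<le> 3 / 2 * OPT_pmtn I" if "valid_instance I" for I
    using exec_empty[OF that] exec_nonempty[OF that] by (cases "num_jobs I = 0") auto
qed

end
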